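(* Let $(M,g,\nabla)$ be a statistical manifold with divisible cubic form, and let $\sigma\in C^\infty(M)$ be such that $C=\nabla g=\operatorname{sym}(d\sigma\otimes g)$. Assume that $\sigma$ is bounded from below on $M$. Then: (1) if $\nabla$ is complete, then $\nabla$ is geodesically connected; (2) if the Levi-Civita connection $\nabla^g$ of $g$ is complete, then $\nabla$ is geodesically connected.
   Context: All objects are smooth, and $M$ is a connected orientable manifold of dimension $n\ge 2$. A statistical manifold $(M,g,\nabla)$ consists of a Riemannian metric $g$ and a torsion-free affine connection $\nabla$ on $M$ such that the cubic form $C=\nabla g$, $C(X,Y,Z)=(\nabla_X g)(Y,Z)$, is totally symmetric. It has divisible cubic form if there is $\sigma\in C^\infty(M)$ with $C=\operatorname{sym}(d\sigma\otimes g)$, where $\operatorname{sym}(d\sigma\otimes g)(X,Y,Z)=d\sigma(X)g(Y,Z)+d\sigma(Y)g(Z,X)+d\sigma(Z)g(X,Y)$ for all vector fields $X,Y,Z$. An affine connection is complete if every one of its geodesics can be extended to a geodesic with parameter ranging over $(-\infty,\infty)$. An affine connection $\nabla$ on $M$ is geodesically connected if for any $p,q\in M$ there is a geodesic $\gamma:[0,1]\to M$ of $\nabla$ with $\gamma(0)=p$ and $\gamma(1)=q$. *)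

theory Defs
  imports "HOL-Analysis.Analysis"
begin

text \<open>
  The manifold is the whole type \<open>'m\<close> with its (Hausdorff, second countable) topology; its smooth
  structure is given by an atlas \<open>A\<close>, not necessarily maximal, of charts into \<open>real ^ 'n\<close>, so the
  dimension is \<open>CARD('n)\<close>. Tangent vectors are derivations of the algebra of smooth functions.
\<close>

subsection \<open>Smooth maps between open sets of normed spaces\<close>

text \<open>For open \<open>S\<close> in a finite-dimensional space, this is the class of \<open>k\<close> times continuously
  differentiable maps.\<close>

primrec Ck_on :: "nat \<Rightarrow> 'a::real_normed_vector set \<Rightarrow> ('a \<Rightarrow> 'b::real_normed_vector) \<Rightarrow> bool" where
  "Ck_on 0 S f \<longleftrightarrow> continuous_on S f"
| "Ck_on (Suc k) S f \<longleftrightarrow>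
     (\<forall>x\<in>S. f differentiable (at x)) \<and> (\<forall>v. Ck_on k S (\<lambda>x. frechet_derivative f (at x) v))"

definition smooth_on :: "'a::real_normed_vector set \<Rightarrow> ('a \<Rightarrow> 'b::real_normed_vector) \<Rightarrow> bool" where
  "smooth_on S f \<longleftrightarrow> (\<forall>k. Ck_on k S f)"

subsection \<open>Smooth manifolds\<close>

type_synonym ('m, 'n) chart = "'m set \<times> ('m \<Rightarrow> real ^ 'n)"

definition is_chart :: "('m::topological_space, 'n::finite) chart \<Rightarrow> bool" where
  "is_chart = (\<lambda>(U, \<phi>). open U \<and> open (\<phi> ` U) \<and> homeomorphism U (\<phi> ` U) \<phi> (inv_into U \<phi>))"

definition transition :: "('m, 'n::finite) chart \<Rightarrow> ('m, 'n) chart \<Rightarrow> real ^ 'n \<Rightarrow> real ^ 'n" where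
  "transition c d = snd d \<circ> inv_into (fst c) (snd c)"

definition smooth_atlas :: "('m::topological_space, 'n::finite) chart set \<Rightarrow> bool" where
  "smooth_atlas A \<longleftrightarrow>
     (\<forall>c\<in>A. is_chart c) \<and> (\<Union>c\<in>A. fst c) = UNIV \<and>
     (\<forall>c\<in>A. \<forall>d\<in>A. smooth_on (snd c ` (fst c \<inter> fst d)) (transition c d))"

definition orientable :: "('m::topological_space, 'n::finite) chart set \<Rightarrow> bool" where
  "orientable A \<longleftrightarrow>
     (\<exists>B. smooth_atlas B \<and> smooth_atlas (A \<union> B) \<and>
        (\<forall>c\<in>B. \<forall>d\<in>B. \<forall>x \<in> snd c ` (fst c \<inter> fst d). det (jacobian (transition c d) (at x)) > 0))"

definition smooth_fun :: "('m, 'n::finite) chart set \<Rightarrow> ('m \<Rightarrow> real) \<Rightarrow> bool" where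
  "smooth_fun A f \<longleftrightarrow> (\<forall>(U, \<phi>)\<in>A. smooth_on (\<phi> ` U) (f \<circ> inv_into U \<phi>))"

subsection \<open>Tangent vectors and vector fields\<close>

type_synonym 'm tangent = "('m \<Rightarrow> real) \<Rightarrow> real"
type_synonym 'm field = "'m \<Rightarrow> 'm tangent"

text \<open>Derivations at \<open>p\<close> of the smooth functions; they are set to \<open>0\<close> on non-smooth functions so that
  equality in the HOL function type is equality of derivations.\<close>

definition tangent_space :: "('m, 'n::finite) chart set \<Rightarrow> 'm \<Rightarrow> 'm tangent set" where
  "tangent_space A p = {v.
     (\<forall>f h a b. smooth_fun A f \<longrightarrow> smooth_fun A h \<longrightarrow> v (\<lambda>x. a * f x + b * h x) = a * v f + b * v h) \<and>
     (\<forall>f h. smooth_fun A f \<longrightarrow> smooth_fun A h \<longrightarrow> v (\<lambda>x. f x * h x) = v f * h p + f p * v h) \<and>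
     (\<forall>f. \<not> smooth_fun A f \<longrightarrow> v f = 0)}"

text \<open>For a vector field \<open>X\<close>, the function \<open>X f\<close> is \<open>\<lambda>p. X p f\<close>.\<close>

definition vector_fields :: "('m, 'n::finite) chart set \<Rightarrow> 'm field set" where
  "vector_fields A = {X.
     (\<forall>p. X p \<in> tangent_space A p) \<and> (\<forall>f. smooth_fun A f \<longrightarrow> smooth_fun A (\<lambda>p. X p f))}"

definition lie_bracket :: "'m field \<Rightarrow> 'm field \<Rightarrow> 'm field" where
  "lie_bracket X Y = (\<lambda>p f. X p (\<lambda>q. Y q f) - Y p (\<lambda>q. X q f))"

subsection \<open>Metrics and affine connections\<close>

type_synonym 'm metric = "'m \<Rightarrow> 'm tangent \<Rightarrow> 'm tangent \<Rightarrow> real"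
type_synonym 'm connection = "'m field \<Rightarrow> 'm field \<Rightarrow> 'm field"

definition riemannian_metric :: "('m, 'n::finite) chart set \<Rightarrow> 'm metric \<Rightarrow> bool" where
  "riemannian_metric A g \<longleftrightarrow>
     (\<forall>p. \<forall>u\<in>tangent_space A p. \<forall>v\<in>tangent_space A p. \<forall>w\<in>tangent_space A p. \<forall>a b.
        g p (\<lambda>f. a * u f + b * v f) w = a * g p u w + b * g p v w) \<and>
     (\<forall>p. \<forall>u\<in>tangent_space A p. \<forall>v\<in>tangent_space A p. g p u v = g p v u) \<and>
     (\<forall>p. \<forall>u\<in>tangent_space A p. u \<noteq> (\<lambda>f. 0) \<longrightarrow> g p u u > 0) \<and>
     (\<forall>X\<in>vector_fields A. \<forall>Y\<in>vector_fields A. smooth_fun A (\<lambda>p. g p (X p) (Y p)))"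

definition affine_connection :: "('m, 'n::finite) chart set \<Rightarrow> 'm connection \<Rightarrow> bool" where
  "affine_connection A nabla \<longleftrightarrow>
     (\<forall>X\<in>vector_fields A. \<forall>Y\<in>vector_fields A. nabla X Y \<in> vector_fields A) \<and>
     (\<forall>X\<in>vector_fields A. \<forall>Y\<in>vector_fields A. \<forall>Z\<in>vector_fields A. \<forall>h k.
        smooth_fun A h \<longrightarrow> smooth_fun A k \<longrightarrow>
        nabla (\<lambda>p f. h p * X p f + k p * Y p f) Z =
          (\<lambda>p f. h p * nabla X Z p f + k p * nabla Y Z p f)) \<and>
     (\<forall>X\<in>vector_fields A. \<forall>Y\<in>vector_fields A. \<forall>Z\<in>vector_fields A.
        nabla X (\<lambda>p f. Y p f + Z p f) = (\<lambda>p f. nabla X Y p f + nabla X Z p f)) \<and>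
     (\<forall>X\<in>vector_fields A. \<forall>Y\<in>vector_fields A. \<forall>h. smooth_fun A h \<longrightarrow>
        nabla X (\<lambda>p f. h p * Y p f) = (\<lambda>p f. X p h * Y p f + h p * nabla X Y p f))"

definition torsion_free :: "('m, 'n::finite) chart set \<Rightarrow> 'm connection \<Rightarrow> bool" where
  "torsion_free A nabla \<longleftrightarrow>
     (\<forall>X\<in>vector_fields A. \<forall>Y\<in>vector_fields A.
        (\<lambda>p f. nabla X Y p f - nabla Y X p f) = lie_bracket X Y)"

definition cubic_form ::
    "'m metric \<Rightarrow> 'm connection \<Rightarrow> 'm field \<Rightarrow> 'm field \<Rightarrow> 'm field \<Rightarrow> 'm \<Rightarrow> real" where
  "cubic_form g nabla X Y Z p =
     X p (\<lambda>q. g q (Y q) (Z q)) - g p (nabla X Y p) (Z p) - g p (Y p) (nabla X Z p)"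

text \<open>\<open>sym(d\<sigma> \<otimes> g)\<close>, where \<open>d\<sigma>(X) = X \<sigma>\<close>.\<close>

definition sym_dtensor ::
    "('m \<Rightarrow> real) \<Rightarrow> 'm metric \<Rightarrow> 'm field \<Rightarrow> 'm field \<Rightarrow> 'm field \<Rightarrow> 'm \<Rightarrow> real" where
  "sym_dtensor \<sigma> g X Y Z p =
     X p \<sigma> * g p (Y p) (Z p) + Y p \<sigma> * g p (Z p) (X p) + Z p \<sigma> * g p (X p) (Y p)"

definition statistical_manifold ::
    "('m, 'n::finite) chart set \<Rightarrow> 'm metric \<Rightarrow> 'm connection \<Rightarrow> bool" where
  "statistical_manifold A g nabla \<longleftrightarrow>
     riemannian_metric A g \<and> affine_connection A nabla \<and> torsion_free A nabla \<and>
     (\<forall>X\<in>vector_fields A. \<forall>Y\<in>vector_fields A. \<forall>Z\<in>vector_fields A.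
        cubic_form g nabla X Y Z = cubic_form g nabla Y X Z \<and>
        cubic_form g nabla X Y Z = cubic_form g nabla X Z Y)"

text \<open>A relation rather than a function: a connection is only determined on vector fields, so
  its values on other arguments are not unique.\<close>

definition levi_civita ::
    "('m, 'n::finite) chart set \<Rightarrow> 'm metric \<Rightarrow> 'm connection \<Rightarrow> bool" where
  "levi_civita A g nabla \<longleftrightarrow>
     affine_connection A nabla \<and> torsion_free A nabla \<and>
     (\<forall>X\<in>vector_fields A. \<forall>Y\<in>vector_fields A. \<forall>Z\<in>vector_fields A. \<forall>p.
        cubic_form g nabla X Y Z p = 0)"

subsection \<open>Curves and geodesics\<close>

definition smooth_curve_on ::
    "('m::topological_space, 'n::finite) chart set \<Rightarrow> real set \<Rightarrow> (real \<Rightarrow> 'm) \<Rightarrow> bool" where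
  "smooth_curve_on A J \<gamma> \<longleftrightarrow>
     open J \<and> continuous_on J \<gamma> \<and> (\<forall>(U, \<phi>)\<in>A. smooth_on (J \<inter> \<gamma> -` U) (\<phi> \<circ> \<gamma>))"

definition velocity :: "('m, 'n::finite) chart set \<Rightarrow> (real \<Rightarrow> 'm) \<Rightarrow> real \<Rightarrow> 'm tangent" where
  "velocity A \<gamma> t = (\<lambda>f. if smooth_fun A f then deriv (\<lambda>s. f (\<gamma> s)) t else 0)"

definition fields_along ::
    "('m, 'n::finite) chart set \<Rightarrow> real set \<Rightarrow> (real \<Rightarrow> 'm) \<Rightarrow> (real \<Rightarrow> 'm tangent) set" where
  "fields_along A J \<gamma> = {V.
     (\<forall>t\<in>J. V t \<in> tangent_space A (\<gamma> t)) \<and> (\<forall>f. smooth_fun A f \<longrightarrow> smooth_on J (\<lambda>t. V t f))}"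

text \<open>\<open>D\<close> is the covariant derivative \<open>D/dt\<close> along \<open>\<gamma>\<close> induced by \<open>nabla\<close>: the additive operator on
  vector fields along \<open>\<gamma>\<close> that satisfies the Leibniz rule and, on restrictions of vector fields \<open>Y\<close>
  of the manifold, is \<open>nabla\<^bsub>\<gamma>'(t)\<^esub> Y\<close>. It is unique on \<open>J\<close>.\<close>

definition covariant_derivative_along ::
    "('m, 'n::finite) chart set \<Rightarrow> 'm connection \<Rightarrow> real set \<Rightarrow> (real \<Rightarrow> 'm) \<Rightarrow>
      ((real \<Rightarrow> 'm tangent) \<Rightarrow> (real \<Rightarrow> 'm tangent)) \<Rightarrow> bool" where
  "covariant_derivative_along A nabla J \<gamma> D \<longleftrightarrow>
     (\<forall>V\<in>fields_along A J \<gamma>. D V \<in> fields_along A J \<gamma>) \<and>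
     (\<forall>V\<in>fields_along A J \<gamma>. \<forall>W\<in>fields_along A J \<gamma>. \<forall>t\<in>J.
        D (\<lambda>s f. V s f + W s f) t = (\<lambda>f. D V t f + D W t f)) \<and>
     (\<forall>V\<in>fields_along A J \<gamma>. \<forall>h. smooth_on J h \<longrightarrow> (\<forall>t\<in>J.
        D (\<lambda>s f. h s * V s f) t = (\<lambda>f. deriv h t * V t f + h t * D V t f))) \<and>
     (\<forall>X\<in>vector_fields A. \<forall>Y\<in>vector_fields A. \<forall>t\<in>J.
        X (\<gamma> t) = velocity A \<gamma> t \<longrightarrow> D (\<lambda>s. Y (\<gamma> s)) t = nabla X Y (\<gamma> t))"

text \<open>A geodesic on a non-degenerate interval \<open>I\<close>. As usual, if \<open>I\<close> contains an end point, smoothness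
  on \<open>I\<close> means existence of a smooth extension \<open>\<eta>\<close> to a neighbourhood \<open>J\<close> of \<open>I\<close>; the geodesic
  equation \<open>D\<gamma>'/dt = 0\<close> is required on \<open>I\<close> only.\<close>

definition geodesic_on ::
    "('m::topological_space, 'n::finite) chart set \<Rightarrow> 'm connection \<Rightarrow> real set \<Rightarrow> (real \<Rightarrow> 'm) \<Rightarrow> bool"
where
  "geodesic_on A nabla I \<gamma> \<longleftrightarrow>
     is_interval I \<and> interior I \<noteq> {} \<and>
     (\<exists>J \<eta> D. I \<subseteq> J \<and> smooth_curve_on A J \<eta> \<and> (\<forall>t\<in>I. \<eta> t = \<gamma> t) \<and>
        covariant_derivative_along A nabla J \<eta> D \<and> (\<forall>t\<in>I. D (velocity A \<eta>) t = (\<lambda>f. 0)))"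

definition complete_connection ::
    "('m::topological_space, 'n::finite) chart set \<Rightarrow> 'm connection \<Rightarrow> bool" where
  "complete_connection A nabla \<longleftrightarrow>
     (\<forall>I \<gamma>. geodesic_on A nabla I \<gamma> \<longrightarrow>
        (\<exists>\<eta>. geodesic_on A nabla UNIV \<eta> \<and> (\<forall>t\<in>I. \<eta> t = \<gamma> t)))"

definition geodesically_connected ::
    "('m::topological_space, 'n::finite) chart set \<Rightarrow> 'm connection \<Rightarrow> bool" where
  "geodesically_connected A nabla \<longleftrightarrow>
     (\<forall>p q. \<exists>\<gamma>. geodesic_on A nabla {0..1} \<gamma> \<and> \<gamma> 0 = p \<and> \<gamma> 1 = q)"

end

(* By divisibility of the cubic form, the connection obtained from nabla by the projective change
   U V |-> nabla_U V + (U sigma) V + (V sigma) U is the Levi-Civita connection of h = exp(sigma) g. So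
   the geodesics of nabla and of h agree up to parameters s (for h) and t (for nabla) with
   dt/ds = exp(-2 sigma), and it suffices that closed balls of h are compact: then any two points are
   joined by a shortest h-geodesic. By the argument of Hopf, Rinow and Cohn-Vossen, balls are compact
   if every shortest h-ray of finite length has an end point. If nabla is complete, this holds because
   dt/ds is bounded, so that such a ray takes finite time for nabla. If g is complete, its balls are
   compact, and h >= exp(inf sigma) g bounds the distance of h from below by that of g. *)

theory Submission
  imports Defs
begin

section \<open>Calculus of smooth maps\<close>

text \<open>Shortest geodesics are usually obtained from the exponential map and the Gauss lemma,
  hence from smooth dependence of solutions on initial data. The proof avoids both. Nearby points
  are joined by solving the boundary value problem of the geodesic equation with a contraction, and
  a convexity estimate shows that the solution minimises energy. The local distance
  \<open>spd a\<close> is never differentiated: the one-sided estimate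
  \<open>spd_sq_variation\<close> compares it with curves, and equality of distances alone pins a
  metric segment to the solution. Geodesics are expressed through Hessians of functions. On the
  diagonal the projective change subtracts \<open>2 * u \<sigma> * u f\<close>, a multiple of the
  velocity applied to \<open>f\<close>, which a change of parameter absorbs. The Hopf-Rinow argument
  is used in the form with rays because a ray only has to converge: a limit of the reparametrised
  geodesic of nabla is at once a limit of the ray.\<close>

lemma Ck_on_subset: "Ck_on k S f \<Longrightarrow> T \<subseteq> S \<Longrightarrow> Ck_on k T f"
  by (induction k arbitrary: f) (auto intro: continuous_on_subset)

text \<open>The congruence at order \<open>k\<close> is a premise because \<open>Ck_on_cong\<close>
  is proved by an induction whose step is this rule; \<open>Ck_on_SucI'\<close> discharges it
  afterwards.\<close>

lemma Ck_on_SucI: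
  fixes f :: "'a::real_normed_vector \<Rightarrow> 'b::real_normed_vector"
  assumes "open S" "\<And>x. x \<in> S \<Longrightarrow> (f has_derivative f' x) (at x)" "\<And>v. Ck_on k S (\<lambda>x. f' x v)"
    and cong: "\<And>f g :: 'a::real_normed_vector \<Rightarrow> 'b::real_normed_vector. (\<And>x. x \<in> S \<Longrightarrow> f x = g x) \<Longrightarrow> Ck_on k S f \<Longrightarrow> Ck_on k S g"
  shows "Ck_on (Suc k) S f"
proof -
  have "frechet_derivative f (at x) = f' x" if "x \<in> S" for x
    using assms(2)[OF that] frechet_derivative_at by metis
  then have "Ck_on k S (\<lambda>x. frechet_derivative f (at x) v)" for v
    by (intro cong[of "\<lambda>x. f' x v", OF _ assms(3)]) simp
  then show ?thesis
    using assms(2) by (auto simp: differentiable_def)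
qed

lemma Ck_on_cong:
  assumes "open S"
  shows "(\<And>x. x \<in> S \<Longrightarrow> f x = g x) \<Longrightarrow> Ck_on k S f \<Longrightarrow> Ck_on k S g"
proof (induction k arbitrary: f g)
  case 0
  then show ?case by (simp cong: continuous_on_cong)
next
  case (Suc k)
  show ?case
  proof (rule Ck_on_SucI[OF \<open>open S\<close>])
    fix x assume "x \<in> S"
    have "(f has_derivative frechet_derivative f (at x)) (at x)"
      using Suc.prems(2) \<open>x \<in> S\<close> frechet_derivative_works by auto
    then show "(g has_derivative frechet_derivative f (at x)) (at x)"
      using has_derivative_transform_within_open[OF _ \<open>open S\<close> \<open>x \<in> S\<close>] Suc.prems(1) by auto
  next
    show "Ck_on k S (\<lambda>x. frechet_derivative f (at x) v)" for v
      using Suc.prems(2) by simp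
  qed (rule Suc.IH)
qed

lemma Ck_on_SucI':
  assumes "open S" "\<And>x. x \<in> S \<Longrightarrow> (f has_derivative f' x) (at x)" "\<And>v. Ck_on k S (\<lambda>x. f' x v)"
  shows "Ck_on (Suc k) S f"
  by (rule Ck_on_SucI[OF assms]) (assumption, rule Ck_on_cong[OF \<open>open S\<close>])

lemma Ck_on_imp_continuous_on: "Ck_on k S f \<Longrightarrow> continuous_on S f"
  by (cases k) (simp, metis Ck_on.simps(2) continuous_at_imp_continuous_on differentiable_imp_continuous_within)

lemma Ck_on_lower: "Ck_on (Suc k) S f \<Longrightarrow> Ck_on k S f"
proof (induction k arbitrary: f)
  case 0
  then show ?case using Ck_on_imp_continuous_on[OF 0] by simp
next
  case (Suc k)
  then have "\<forall>v. Ck_on k S (\<lambda>x. frechet_derivative f (at x) v)"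
    by (metis Ck_on.simps(2))
  with Suc.prems show ?case by simp
qed

lemma Ck_on_local:
  "(\<And>x. x \<in> S \<Longrightarrow> \<exists>T. open T \<and> x \<in> T \<and> Ck_on k T f) \<Longrightarrow> Ck_on k S f"
proof (induction k arbitrary: f)
  case 0
  then have "\<forall>x\<in>S. isCont f x"
    by (metis Ck_on.simps(1) continuous_on_eq_continuous_at)
  then show ?case using continuous_at_imp_continuous_on by auto
next
  case (Suc k)
  show ?case
    unfolding Ck_on.simps
  proof (intro conjI ballI allI)
    fix x assume "x \<in> S"
    with Suc.prems show "f differentiable at x" by (metis Ck_on.simps(2))
  next
    show "Ck_on k S (\<lambda>x. frechet_derivative f (at x) v)" for v
      by (rule Suc.IH) (metis Ck_on.simps(2) Suc.prems)
  qed
qed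

lemma Ck_on_const: "Ck_on k S (\<lambda>x. c)"
  by (induction k arbitrary: c) auto

lemma Ck_on_bounded_linear: "bounded_linear f \<Longrightarrow> Ck_on k S f"
proof (cases k)
  case 0
  then show "bounded_linear f \<Longrightarrow> Ck_on k S f"
    by (simp add: bounded_linear.linear linear_continuous_on)
next
  case (Suc l)
  assume f: "bounded_linear f"
  then have "frechet_derivative f (at x) = f" for x
    by (metis bounded_linear_imp_has_derivative frechet_derivative_at)
  then show ?thesis
    using f Suc by (auto simp: Ck_on_const bounded_linear_imp_differentiable)
qed

lemma Ck_on_add:
  assumes "open S"
  shows "Ck_on k S f \<Longrightarrow> Ck_on k S g \<Longrightarrow> Ck_on k S (\<lambda>x. f x + g x)"
proof (induction k arbitrary: f g)
  case 0
  then show ?case by (auto intro: continuous_intros)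
next
  case (Suc k)
  show ?case
  proof (rule Ck_on_SucI'[OF assms])
    show "((\<lambda>x. f x + g x) has_derivative
        (\<lambda>v. frechet_derivative f (at x) v + frechet_derivative g (at x) v)) (at x)" if "x \<in> S" for x
      using Suc.prems that by (intro has_derivative_add) (auto simp: frechet_derivative_works[symmetric])
  qed (use Suc in auto)
qed

lemma (in bounded_bilinear) Ck_on:
  assumes "open S"
  shows "Ck_on k S f \<Longrightarrow> Ck_on k S g \<Longrightarrow> Ck_on k S (\<lambda>x. prod (f x) (g x))"
proof (induction k arbitrary: f g)
  case 0
  then show ?case by (auto intro: continuous_on)
next
  case (Suc k)
  show ?case
  proof (rule Ck_on_SucI'[OF assms])
    show "((\<lambda>x. prod (f x) (g x)) has_derivative
        (\<lambda>v. prod (f x) (frechet_derivative g (at x) v) + prod (frechet_derivative f (at x) v) (g x))) (at x)"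
      if "x \<in> S" for x
      using Suc.prems that by (intro FDERIV) (auto simp: frechet_derivative_works[symmetric])
    show "Ck_on k S (\<lambda>x. prod (f x) (frechet_derivative g (at x) v) + prod (frechet_derivative f (at x) v) (g x))" for v
      using Suc.prems Ck_on_lower[OF Suc.prems(1)] Ck_on_lower[OF Suc.prems(2)]
      by (intro Ck_on_add Suc.IH assms) simp_all
  qed
qed

lemma Ck_on_sum:
  assumes "open S"
  shows "(\<And>i. i \<in> I \<Longrightarrow> Ck_on k S (f i)) \<Longrightarrow> Ck_on k S (\<lambda>x. \<Sum>i\<in>I. f i x)"
  by (induction I rule: infinite_finite_induct) (auto intro: Ck_on_const Ck_on_add assms)

lemma linear_euclidean_expansion:
  fixes F :: "'a::euclidean_space \<Rightarrow> 'b::real_vector"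
  assumes "linear F"
  shows "F v = (\<Sum>e\<in>Basis. (v \<bullet> e) *\<^sub>R F e)"
proof -
  have "F v = F (\<Sum>e\<in>Basis. (v \<bullet> e) *\<^sub>R e)" by (simp only: euclidean_representation)
  then show ?thesis by (simp only: linear_sum[OF assms] linear_scale[OF assms] o_def)
qed

lemma Ck_on_compose:
  fixes g :: "'a::real_normed_vector \<Rightarrow> 'b::euclidean_space"
  assumes "open S" "open T" "g ` S \<subseteq> T"
  shows "Ck_on k T f \<Longrightarrow> Ck_on k S g \<Longrightarrow> Ck_on k S (\<lambda>x. f (g x))"
proof (induction k arbitrary: f)
  case 0
  then show ?case using assms continuous_on_compose2 by auto
next
  case (Suc k)
  \<comment> \<open>\<open>Ck_on\<close> only speaks of derivatives in a fixed direction, but the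
    inner direction varies with \<open>x\<close>. Expanding it in the basis leaves sums of products
    of functions of order \<open>k\<close>.\<close>
  define D where "D x v = (\<Sum>b\<in>Basis. (frechet_derivative g (at x) v \<bullet> b) *\<^sub>R frechet_derivative f (at (g x)) b)" for x v
  show ?case
  proof (rule Ck_on_SucI'[OF assms(1)])
    fix x assume x: "x \<in> S"
    then have df: "(f has_derivative frechet_derivative f (at (g x))) (at (g x))"
      using Suc.prems assms(3) by (auto simp: frechet_derivative_works[symmetric])
    have dg: "(g has_derivative frechet_derivative g (at x)) (at x)"
      using Suc.prems x by (auto simp: frechet_derivative_works[symmetric])
    have lin: "linear (frechet_derivative f (at (g x)))"
      using df has_derivative_linear by blast
    have "D x = (\<lambda>v. frechet_derivative f (at (g x)) (frechet_derivative g (at x) v))"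
      unfolding D_def
      by (rule ext) (rule linear_euclidean_expansion[OF lin, symmetric])
    then show "((\<lambda>x. f (g x)) has_derivative D x) (at x)"
      using has_derivative_compose[OF dg df] by simp
  next
    fix v
    have "Ck_on k S (\<lambda>x. frechet_derivative f (at (g x)) b)" for b
      using Suc.prems Ck_on_lower[OF Suc.prems(2)] by (intro Suc.IH) simp_all
    moreover have "Ck_on k S (\<lambda>x. frechet_derivative g (at x) v \<bullet> b)" for b
      using Suc.prems by (intro bounded_bilinear.Ck_on[OF bounded_bilinear_inner] Ck_on_const assms) auto
    ultimately show "Ck_on k S (\<lambda>x. D x v)"
      unfolding D_def
      by (intro Ck_on_sum bounded_bilinear.Ck_on[OF bounded_bilinear_scaleR] assms)
  qed
qed

text \<open>The bootstrap rule: a curve that satisfies a first-order equation gains one order from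
  the regularity of the right-hand side. It serves for geodesics and for inverse parameters.\<close>

lemma Ck_on_Suc_real:
  fixes f :: "real \<Rightarrow> 'a::real_normed_vector"
  assumes "open S" "\<And>t. t \<in> S \<Longrightarrow> (f has_vector_derivative f' t) (at t)" "Ck_on k S f'"
  shows "Ck_on (Suc k) S f"
  by (rule Ck_on_SucI'[OF assms(1) assms(2)[unfolded has_vector_derivative_def]])
    (auto intro!: bounded_bilinear.Ck_on[OF bounded_bilinear_scaleR] Ck_on_const assms)

named_theorems smooth_intros

lemma smooth_on_subset: "smooth_on S f \<Longrightarrow> T \<subseteq> S \<Longrightarrow> smooth_on T f"
  by (auto simp: smooth_on_def intro: Ck_on_subset)

lemma smooth_on_cong: "open S \<Longrightarrow> (\<And>x. x \<in> S \<Longrightarrow> f x = g x) \<Longrightarrow> smooth_on S f \<Longrightarrow> smooth_on S g"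
  unfolding smooth_on_def using Ck_on_cong[of S f g] by simp

lemma smooth_on_local:
  "(\<And>x. x \<in> S \<Longrightarrow> \<exists>T. open T \<and> x \<in> T \<and> smooth_on T f) \<Longrightarrow> smooth_on S f"
  unfolding smooth_on_def using Ck_on_local[of S _ f] by meson

lemma smooth_on_const [smooth_intros]: "smooth_on S (\<lambda>x. c)"
  by (simp add: smooth_on_def Ck_on_const)

lemma smooth_on_bounded_linear: "bounded_linear f \<Longrightarrow> smooth_on S f"
  by (simp add: smooth_on_def Ck_on_bounded_linear)

lemma smooth_on_id [smooth_intros]: "smooth_on S (\<lambda>x. x)"
  by (intro smooth_on_bounded_linear bounded_linear_ident)

lemma smooth_on_add [smooth_intros]:
  "open S \<Longrightarrow> smooth_on S f \<Longrightarrow> smooth_on S g \<Longrightarrow> smooth_on S (\<lambda>x. f x + g x)"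
  by (simp add: smooth_on_def Ck_on_add)

lemma smooth_on_sum [smooth_intros]:
  "open S \<Longrightarrow> (\<And>i. i \<in> I \<Longrightarrow> smooth_on S (f i)) \<Longrightarrow> smooth_on S (\<lambda>x. \<Sum>i\<in>I. f i x)"
  by (simp add: smooth_on_def Ck_on_sum)

lemma smooth_on_scaleR [smooth_intros]:
  "open S \<Longrightarrow> smooth_on S f \<Longrightarrow> smooth_on S g \<Longrightarrow> smooth_on S (\<lambda>x. f x *\<^sub>R g x)"
  by (simp add: smooth_on_def bounded_bilinear.Ck_on[OF bounded_bilinear_scaleR])

lemma smooth_on_mult [smooth_intros]:
  fixes f g :: "_ \<Rightarrow> real"
  shows "open S \<Longrightarrow> smooth_on S f \<Longrightarrow> smooth_on S g \<Longrightarrow> smooth_on S (\<lambda>x. f x * g x)"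
  by (simp add: smooth_on_def bounded_bilinear.Ck_on[OF bounded_bilinear_mult])

lemma smooth_on_inner [smooth_intros]:
  "open S \<Longrightarrow> smooth_on S f \<Longrightarrow> smooth_on S g \<Longrightarrow> smooth_on S (\<lambda>x. f x \<bullet> g x)"
  by (simp add: smooth_on_def bounded_bilinear.Ck_on[OF bounded_bilinear_inner])

lemma smooth_on_minus [smooth_intros]:
  assumes "open S" "smooth_on S f"
  shows "smooth_on S (\<lambda>x. - f x)"
  using smooth_on_scaleR[OF assms(1) smooth_on_const[of S "-1"] assms(2)] by simp

lemma smooth_on_diff [smooth_intros]:
  assumes "open S" "smooth_on S f" "smooth_on S g"
  shows "smooth_on S (\<lambda>x. f x - g x)"
  using smooth_on_add[OF assms(1,2) smooth_on_minus[OF assms(1,3)]] by simp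

lemma smooth_on_compose:
  fixes g :: "'a::real_normed_vector \<Rightarrow> 'b::euclidean_space"
  shows "open S \<Longrightarrow> open T \<Longrightarrow> g ` S \<subseteq> T \<Longrightarrow> smooth_on T f \<Longrightarrow> smooth_on S g \<Longrightarrow> smooth_on S (\<lambda>x. f (g x))"
  by (simp add: smooth_on_def Ck_on_compose)

lemma smooth_on_imp_continuous_on: "smooth_on S f \<Longrightarrow> continuous_on S f"
  using Ck_on_imp_continuous_on smooth_on_def by blast

lemma smooth_on_differentiable: "smooth_on S f \<Longrightarrow> x \<in> S \<Longrightarrow> f differentiable (at x)"
  unfolding smooth_on_def by (metis Ck_on.simps(2))

lemma smooth_on_has_derivative:
  "smooth_on S f \<Longrightarrow> x \<in> S \<Longrightarrow> (f has_derivative frechet_derivative f (at x)) (at x)"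
  using smooth_on_differentiable frechet_derivative_works by blast

lemma smooth_on_frechet_derivative:
  "smooth_on S f \<Longrightarrow> smooth_on S (\<lambda>x. frechet_derivative f (at x) v)"
  unfolding smooth_on_def by (metis Ck_on.simps(2))

lemma smooth_on_deriv:
  fixes f :: "real \<Rightarrow> real"
  assumes "open S" "smooth_on S f"
  shows "smooth_on S (deriv f)"
proof (rule smooth_on_cong[OF assms(1)])
  show "smooth_on S (\<lambda>x. frechet_derivative f (at x) 1)"
    by (intro smooth_on_frechet_derivative assms)
  fix x assume "x \<in> S"
  then have "(f has_derivative frechet_derivative f (at x)) (at x)"
    using assms smooth_on_has_derivative by blast
  moreover have "frechet_derivative f (at x) = (*) (frechet_derivative f (at x) 1)"
    using calculation[THEN has_derivative_linear]
    by (metis (no_types, opaque_lifting) ext linear_scale mult.commute mult.right_neutral real_scaleR_def)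
  ultimately have "(f has_real_derivative frechet_derivative f (at x) 1) (at x)"
    unfolding has_field_derivative_def by metis
  then show "frechet_derivative f (at x) 1 = deriv f x"
    by (simp add: DERIV_imp_deriv)
qed

lemma smooth_on_DERIV:
  fixes f :: "real \<Rightarrow> real"
  assumes "smooth_on S f" "t \<in> S"
  shows "(f has_real_derivative deriv f t) (at t)"
  using smooth_on_differentiable[OF assms]
  by (simp add: DERIV_deriv_iff_real_differentiable)

lemma smooth_on_inverse:
  "smooth_on {0<..} (inverse :: real \<Rightarrow> real)"
proof -
  have "Ck_on k {0<..} (inverse :: real \<Rightarrow> real)" for k
  proof (induction k)
    case 0
    then show ?case by (auto intro!: continuous_intros)
  next
    case (Suc k)
    show ?case
    proof (rule Ck_on_Suc_real)
      show "(inverse has_vector_derivative - (inverse t * inverse t)) (at t)" if "t \<in> {0<..}" for t :: real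
        using that DERIV_inverse[of t UNIV]
        by (auto simp: has_real_derivative_iff_has_vector_derivative power2_eq_square numeral_2_eq_2)
      have "Ck_on k {0<..} (\<lambda>t::real. (-1) * (inverse t * inverse t))"
        by (intro bounded_bilinear.Ck_on[OF bounded_bilinear_mult] Ck_on_const Suc open_greaterThan)
      then show "Ck_on k {0<..} (\<lambda>t::real. - (inverse t * inverse t))" by simp
    qed simp
  qed
  then show ?thesis by (simp add: smooth_on_def)
qed

lemma smooth_on_exp: "smooth_on S (exp :: real \<Rightarrow> real)"
proof -
  have "Ck_on k UNIV (exp :: real \<Rightarrow> real)" for k
  proof (induction k)
    case 0
    then show ?case by (auto intro!: continuous_intros)
  next
    case (Suc k)
    show ?case
      by (rule Ck_on_Suc_real[OF open_UNIV _ Suc])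
         (auto simp: has_real_derivative_iff_has_vector_derivative[symmetric] intro: DERIV_exp)
  qed
  then show ?thesis by (metis Ck_on_subset smooth_on_def subset_UNIV)
qed

subsection \<open>Cut-off functions\<close>

text \<open>The powers of \<open>inverse t\<close> are included because derivatives of the flat
  function \<open>exp (- inverse t)\<close> produce them: the span of this family is closed under
  differentiation, so one induction over all \<open>n\<close> gives smoothness.\<close>

definition flat_exp :: "nat \<Rightarrow> real \<Rightarrow> real" where
  "flat_exp n t = (if t > 0 then inverse t ^ n * exp (- inverse t) else 0)"

lemma flat_exp_tendsto_0: "(flat_exp n \<longlongrightarrow> 0) (at_right 0)"
proof -
  have "((\<lambda>t. inverse t ^ n / exp (inverse t)) \<longlongrightarrow> 0) (at_right (0::real))"
    using filterlim_compose[OF tendsto_power_div_exp_0 filterlim_inverse_at_top_right] .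
  moreover have "\<forall>\<^sub>F t in at_right (0::real). inverse t ^ n / exp (inverse t) = flat_exp n t"
    unfolding eventually_at_filter flat_exp_def by (auto simp: exp_minus divide_inverse)
  ultimately show ?thesis
    by (rule Lim_transform_eventually)
qed

lemma flat_exp_deriv:
  "(flat_exp n has_real_derivative (flat_exp (n + 2) t - n * flat_exp (n + 1) t)) (at t)"
proof -
  consider "t > 0" | "t < 0" | "t = 0" by linarith
  then show ?thesis
  proof cases
    case 1
    have "((\<lambda>t. inverse t ^ n * exp (- inverse t)) has_real_derivative (flat_exp (n + 2) t - n * flat_exp (n + 1) t)) (at t)"
      using 1
      by (auto intro!: derivative_eq_intros simp: flat_exp_def power2_eq_square algebra_simps)
         (cases n; simp add: algebra_simps)
    then show ?thesis
      by (rule has_field_derivative_transform_within_open[where S = "{0<..}"]) (use 1 in \<open>auto simp: flat_exp_def\<close>)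
  next
    case 2
    have "((\<lambda>t. 0) has_real_derivative (flat_exp (n + 2) t - n * flat_exp (n + 1) t)) (at t)"
      using 2 by (auto simp: flat_exp_def)
    then show ?thesis
      by (rule has_field_derivative_transform_within_open[where S = "{..<0}"]) (use 2 in \<open>auto simp: flat_exp_def\<close>)
  next
    case 3
    \<comment> \<open>At \<open>0\<close> the difference quotient is zero from the left and
      \<open>flat_exp (Suc n)\<close> from the right.\<close>
    have "((\<lambda>h. flat_exp n h / h) \<longlongrightarrow> 0) (at (0::real))"
    proof (rule filterlim_split_at)
      show "((\<lambda>h. flat_exp n h / h) \<longlongrightarrow> 0) (at_left 0)"
        by (rule Lim_transform_eventually[OF tendsto_const])
           (auto simp: eventually_at_filter flat_exp_def)
      show "((\<lambda>h. flat_exp n h / h) \<longlongrightarrow> 0) (at_right 0)"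
        by (rule Lim_transform_eventually[OF flat_exp_tendsto_0[of "Suc n"]])
           (auto simp: eventually_at_filter flat_exp_def divide_inverse)
    qed
    then show ?thesis
      using 3 by (simp add: DERIV_def flat_exp_def[of _ 0])
  qed
qed

lemma smooth_on_flat_exp: "smooth_on S (flat_exp n)"
proof -
  have "Ck_on k UNIV (flat_exp n)" for k
  proof (induction k arbitrary: n)
    case 0
    have "isCont (flat_exp n) t" for t using flat_exp_deriv DERIV_isCont by blast
    then show ?case by (simp add: continuous_at_imp_continuous_on)
  next
    case (Suc k)
    show ?case
    proof (rule Ck_on_Suc_real[OF open_UNIV])
      show "(flat_exp n has_vector_derivative (flat_exp (n + 2) t + (- real n) * flat_exp (n + 1) t)) (at t)" for t
        using flat_exp_deriv[of n t]
        by (simp add: has_real_derivative_iff_has_vector_derivative[symmetric])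
      show "Ck_on k UNIV (\<lambda>t. flat_exp (n + 2) t + (- real n) * flat_exp (n + 1) t)"
        by (intro Ck_on_add bounded_bilinear.Ck_on[OF bounded_bilinear_mult] Ck_on_const open_UNIV Suc)
    qed
  qed
  then show ?thesis by (metis Ck_on_subset smooth_on_def subset_UNIV)
qed

lemma ex_smooth_step:
  "\<exists>S :: real \<Rightarrow> real. smooth_on UNIV S \<and> (\<forall>t\<le>0. S t = 0) \<and> (\<forall>t\<ge>1. S t = 1)"
proof -
  define D where "D t = flat_exp 0 t + flat_exp 0 (1 - t)" for t
  have flat_compl: "smooth_on UNIV (\<lambda>t. flat_exp 0 (1 - t))"
    by (rule smooth_on_compose[OF open_UNIV open_UNIV _ smooth_on_flat_exp])
       (auto intro!: smooth_intros)
  have pos: "D t > 0" for t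
    by (cases "t > 0") (auto simp: D_def flat_exp_def add_pos_nonneg)
  have "smooth_on UNIV D"
    unfolding D_def by (intro smooth_intros smooth_on_flat_exp flat_compl open_UNIV)
  then have "smooth_on UNIV (\<lambda>t. inverse (D t))"
    by (intro smooth_on_compose[OF open_UNIV open_greaterThan _ smooth_on_inverse])
       (auto simp: pos)
  then have "smooth_on UNIV (\<lambda>t. flat_exp 0 t * inverse (D t))"
    by (intro smooth_intros smooth_on_flat_exp open_UNIV)
  moreover have "flat_exp 0 t * inverse (D t) = 1" if "t \<ge> 1" for t
  proof -
    have "D t = flat_exp 0 t" using that by (simp add: D_def flat_exp_def)
    then show ?thesis using pos[of t] by simp
  qed
  moreover have "flat_exp 0 t * inverse (D t) = 0" if "t \<le> 0" for t
    using that by (simp add: flat_exp_def)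
  ultimately show ?thesis by (intro exI[of _ "\<lambda>t. flat_exp 0 t * inverse (D t)"]) auto
qed

lemma ex_smooth_cutoff:
  fixes x0 :: "'a::euclidean_space"
  assumes "0 < r" "r < R"
  shows "\<exists>w :: 'a \<Rightarrow> real. smooth_on UNIV w \<and> (\<forall>x\<in>cball x0 r. w x = 1) \<and> (\<forall>x. x \<notin> ball x0 R \<longrightarrow> w x = 0)"
proof -
  obtain S :: "real \<Rightarrow> real" where S: "smooth_on UNIV S" "\<And>t. t \<le> 0 \<Longrightarrow> S t = 0" "\<And>t. t \<ge> 1 \<Longrightarrow> S t = 1"
    using ex_smooth_step by blast
  \<comment> \<open>The squared distance is smooth even at the centre. The affine rescaling is at
    least \<open>1\<close> on the inner ball and at most \<open>0\<close> outside the outer one,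
    where the step function is constant.\<close>
  define q where "q x = (R\<^sup>2 - (x - x0) \<bullet> (x - x0)) * inverse (R\<^sup>2 - r\<^sup>2)" for x
  have pos: "R\<^sup>2 - r\<^sup>2 > 0" using assms by (simp add: power_strict_mono)
  have "smooth_on UNIV q"
    unfolding q_def by (intro smooth_intros open_UNIV)
  then have "smooth_on UNIV (\<lambda>x. S (q x))"
    by (intro smooth_on_compose[OF open_UNIV open_UNIV _ S(1)]) auto
  moreover have "S (q x) = 1" if "x \<in> cball x0 r" for x
  proof (rule S(3))
    have "norm (x - x0) \<le> r" using that by (simp add: dist_norm norm_minus_commute)
    then have "(x - x0) \<bullet> (x - x0) \<le> r\<^sup>2"
      using assms by (simp add: power_mono flip: power2_norm_eq_inner)
    then show "1 \<le> q x" using pos by (simp add: q_def field_simps)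
  qed
  moreover have "S (q x) = 0" if "x \<notin> ball x0 R" for x
  proof (rule S(2))
    have "norm (x - x0) \<ge> R" using that by (simp add: dist_norm norm_minus_commute)
    then have "(x - x0) \<bullet> (x - x0) \<ge> R\<^sup>2"
      using assms by (simp add: power_mono flip: power2_norm_eq_inner)
    then show "q x \<le> 0" using pos by (simp add: q_def field_simps)
  qed
  ultimately show ?thesis by blast
qed

subsection \<open>Hadamard's lemma\<close>

lemma segment_point_in_ball:
  fixes x x0 :: "'a::real_normed_vector"
  assumes "x \<in> ball x0 R" "t \<in> {0..1}"
  shows "x0 + t *\<^sub>R (x - x0) \<in> ball x0 R"
proof -
  have "norm (t *\<^sub>R (x - x0)) \<le> 1 * norm (x - x0)"
    unfolding norm_scaleR using assms by (intro mult_right_mono) auto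
  also have "\<dots> < R" using assms by (simp add: dist_norm norm_minus_commute)
  finally show ?thesis by (simp add: dist_norm)
qed

text \<open>The weight \<open>m\<close> is general because every differentiation under the integral
  brings out a factor \<open>t\<close>, so an induction for weight \<open>1\<close> alone would not
  close.\<close>

lemma Ck_on_param_integral:
  fixes u :: "'a::euclidean_space \<Rightarrow> real" and x0 :: 'a
  assumes "smooth_on (ball x0 R) u" "continuous_on {0..1} m"
  shows "Ck_on k (ball x0 R) (\<lambda>x. integral {0..1} (\<lambda>t. m t * u (x0 + t *\<^sub>R (x - x0))))"
  using assms
proof (induction k arbitrary: u m)
  case 0
  let ?U = "ball x0 R"
  have cu: "continuous_on ?U u" using 0 smooth_on_imp_continuous_on by blast
  have "continuous_on (?U \<times> cbox 0 1) (\<lambda>(x, t). m t * u (x0 + t *\<^sub>R (x - x0)))"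
    unfolding split_beta
    apply (intro continuous_intros continuous_on_compose2[OF 0(2)] continuous_on_compose2[OF cu])
    using segment_point_in_ball by fastforce+
  then have "continuous_on ?U (\<lambda>x. integral (cbox 0 1) (\<lambda>t. m t * u (x0 + t *\<^sub>R (x - x0))))"
    by (rule integral_continuous_on_param)
  then show ?case by simp
next
  case (Suc k)
  let ?U = "ball x0 R"
  have cu: "continuous_on ?U u" using Suc smooth_on_imp_continuous_on by blast
  let ?D = "\<lambda>x. frechet_derivative u (at x)"
  \<comment> \<open>\<open>leibniz_rule\<close> asks for a derivative in the space of bounded linear
    maps. In the basis expansion its joint continuity in \<open>x\<close> and \<open>t\<close>
    reduces to that of the partial derivatives.\<close>
  define b where "b = (\<lambda>x t. \<Sum>e\<in>Basis. (m t * t * ?D (x0 + t *\<^sub>R (x - x0)) e) *\<^sub>R blinfun_inner_right e)"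
  have lin: "linear (?D y)" if "y \<in> ?U" for y
    using Suc.prems smooth_on_has_derivative that has_derivative_linear by blast
  have b: "blinfun_apply (b x t) v = m t * (t * ?D (x0 + t *\<^sub>R (x - x0)) v)"
    if "x \<in> ?U" "t \<in> {0..1}" for x t v
  proof -
    have "?D (x0 + t *\<^sub>R (x - x0)) v = (\<Sum>e\<in>Basis. (v \<bullet> e) * ?D (x0 + t *\<^sub>R (x - x0)) e)"
      using linear_euclidean_expansion[OF lin[OF segment_point_in_ball[OF that]], of v] by simp
    then show ?thesis
      by (simp add: b_def blinfun.sum_left blinfun.scaleR_left sum_distrib_left algebra_simps inner_commute)
  qed
  have der: "((\<lambda>x. integral (cbox 0 1) (\<lambda>t. m t * u (x0 + t *\<^sub>R (x - x0)))) has_derivative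
     blinfun_apply (integral (cbox 0 1) (b x))) (at x)" if x: "x \<in> ?U" for x
  proof -
    have "((\<lambda>x. integral (cbox 0 1) (\<lambda>t. m t * u (x0 + t *\<^sub>R (x - x0)))) has_derivative
     blinfun_apply (integral (cbox 0 1) (b x))) (at x within ?U)"
    proof (rule leibniz_rule)
      fix x t assume xt: "x \<in> ?U" "t \<in> cbox 0 (1::real)"
      have "((\<lambda>x. x0 + t *\<^sub>R (x - x0)) has_derivative (\<lambda>v. t *\<^sub>R v)) (at x)"
        by (auto intro!: derivative_eq_intros)
      then have "((\<lambda>x. u (x0 + t *\<^sub>R (x - x0))) has_derivative (\<lambda>v. ?D (x0 + t *\<^sub>R (x - x0)) (t *\<^sub>R v))) (at x)"
        by (rule has_derivative_compose)
           (use xt Suc.prems segment_point_in_ball in \<open>auto intro!: smooth_on_has_derivative simp del: mem_ball\<close>)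
      then have "((\<lambda>x. m t * u (x0 + t *\<^sub>R (x - x0))) has_derivative (\<lambda>v. m t * ?D (x0 + t *\<^sub>R (x - x0)) (t *\<^sub>R v))) (at x)"
        by (rule has_derivative_mult_right)
      moreover have "(\<lambda>v. m t * ?D (x0 + t *\<^sub>R (x - x0)) (t *\<^sub>R v)) = blinfun_apply (b x t)"
        using b[of x t] xt lin[OF segment_point_in_ball[of x _ _ t]]
        by (intro ext) (simp add: linear_scale)
      ultimately show "((\<lambda>x. m t * u (x0 + t *\<^sub>R (x - x0))) has_derivative blinfun_apply (b x t)) (at x within ?U)"
        by (simp add: has_derivative_at_withinI)
    next
      fix x assume "x \<in> ?U"
      then show "(\<lambda>t. m t * u (x0 + t *\<^sub>R (x - x0))) integrable_on cbox 0 1"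
        apply (intro integrable_continuous continuous_intros continuous_on_compose2[OF Suc.prems(2)] continuous_on_compose2[OF cu])
        using segment_point_in_ball by fastforce+
    next
      have "continuous_on ?U (\<lambda>y. ?D y e)" for e
        using Suc.prems smooth_on_frechet_derivative smooth_on_imp_continuous_on by blast
      note c = continuous_on_compose2[OF this]
      show "continuous_on (?U \<times> cbox 0 1) (\<lambda>(x, t). b x t)"
        unfolding split_beta b_def
        apply (intro continuous_intros continuous_on_compose2[OF Suc.prems(2)] c)
        using segment_point_in_ball by fastforce+
    qed (use x in auto)
    then show ?thesis using x at_within_open[OF x open_ball] by metis
  qed
  show ?case
  proof (rule Ck_on_SucI'[OF open_ball])
    show "((\<lambda>x. integral {0..1} (\<lambda>t. m t * u (x0 + t *\<^sub>R (x - x0)))) has_derivative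
      blinfun_apply (integral (cbox 0 1) (b x))) (at x)" if "x \<in> ?U" for x
      using der[OF that] by simp
    fix v
    have eq: "integral {0..1} (\<lambda>t. (m t * t) * ?D (x0 + t *\<^sub>R (x - x0)) v)
        = blinfun_apply (integral (cbox 0 1) (b x)) v" if x: "x \<in> ?U" for x
    proof -
      have "continuous_on ?U (\<lambda>y. ?D y e)" for e
        using Suc.prems smooth_on_frechet_derivative smooth_on_imp_continuous_on by blast
      note c = continuous_on_compose2[OF this]
      have "continuous_on (cbox 0 1) (b x)"
        unfolding b_def
        apply (intro continuous_intros continuous_on_compose2[OF Suc.prems(2)] c)
        using segment_point_in_ball x by fastforce+
      then have "b x integrable_on cbox 0 1" by (rule integrable_continuous)
      then have "blinfun_apply (integral (cbox 0 1) (b x)) v = integral (cbox 0 1) (\<lambda>t. blinfun_apply (b x t) v)"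
        by (rule blinfun_apply_integral)
      then show ?thesis
        using b[OF x] by (auto simp: algebra_simps intro!: integral_cong)
    qed
    have "Ck_on k ?U (\<lambda>x. integral {0..1} (\<lambda>t. (m t * t) * ?D (x0 + t *\<^sub>R (x - x0)) v))"
      using Suc.prems by (intro Suc.IH smooth_on_frechet_derivative continuous_intros) auto
    then show "Ck_on k ?U (\<lambda>x. blinfun_apply (integral (cbox 0 1) (b x)) v)"
      by (rule Ck_on_cong[OF open_ball eq, rotated])
  qed
qed

text \<open>The fundamental theorem of calculus on the segment from \<open>x0\<close> to
  \<open>x\<close>: \<open>g e\<close> is the mean of a partial derivative along it. This is what
  turns an abstract derivation into a directional derivative in \<open>tangent_eq\<close>.\<close>

lemma Hadamard_lemma:
  fixes f :: "'a::euclidean_space \<Rightarrow> real"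
  assumes "smooth_on (ball x0 R) f" "R > 0"
  obtains g where "\<And>e. smooth_on (ball x0 R) (g e)"
    "\<And>x. x \<in> ball x0 R \<Longrightarrow> f x = f x0 + (\<Sum>e\<in>Basis. ((x - x0) \<bullet> e) * g e x)"
    "\<And>e. g e x0 = frechet_derivative f (at x0) e"
proof
  let ?D = "\<lambda>x. frechet_derivative f (at x)"
  define g where "g e x = integral {0..1} (\<lambda>t. 1 * ?D (x0 + t *\<^sub>R (x - x0)) e)" for e x
  show "smooth_on (ball x0 R) (g e)" for e
    unfolding smooth_on_def g_def
    using Ck_on_param_integral[OF smooth_on_frechet_derivative[OF assms(1)] continuous_on_const] by blast
  show "g e x0 = frechet_derivative f (at x0) e" for e
    by (simp add: g_def)
  show "f x = f x0 + (\<Sum>e\<in>Basis. ((x - x0) \<bullet> e) * g e x)" if x: "x \<in> ball x0 R" for x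
  proof -
    have der: "((\<lambda>t. f (x0 + t *\<^sub>R (x - x0))) has_vector_derivative
       (\<Sum>e\<in>Basis. ((x - x0) \<bullet> e) * ?D (x0 + t *\<^sub>R (x - x0)) e)) (at t within {0..1})" if t: "t \<in> {0..1}" for t
    proof -
      let ?y = "x0 + t *\<^sub>R (x - x0)"
      have y: "?y \<in> ball x0 R" using segment_point_in_ball x t by blast
      have fd: "(f has_derivative ?D ?y) (at ?y)"
        using assms smooth_on_has_derivative y by blast
      have "((\<lambda>t. x0 + t *\<^sub>R (x - x0)) has_derivative (\<lambda>s. s *\<^sub>R (x - x0))) (at t within {0..1})"
        by (auto intro!: derivative_eq_intros)
      then have "((\<lambda>t. f (x0 + t *\<^sub>R (x - x0))) has_derivative (\<lambda>s. ?D ?y (s *\<^sub>R (x - x0)))) (at t within {0..1})"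
        using has_derivative_compose fd by blast
      moreover have "linear (?D ?y)" using fd has_derivative_linear by blast
      moreover have "?D ?y (x - x0) = (\<Sum>e\<in>Basis. ((x - x0) \<bullet> e) * ?D ?y e)"
        using linear_euclidean_expansion[OF \<open>linear (?D ?y)\<close>, of "x - x0"] by simp
      ultimately show ?thesis
        by (simp add: has_vector_derivative_def linear_scale)
    qed
    have "((\<lambda>t. \<Sum>e\<in>Basis. ((x - x0) \<bullet> e) * ?D (x0 + t *\<^sub>R (x - x0)) e) has_integral
        (f (x0 + 1 *\<^sub>R (x - x0)) - f (x0 + 0 *\<^sub>R (x - x0)))) {0..1}"
      by (rule fundamental_theorem_of_calculus) (use der in auto)
    moreover have "((\<lambda>t. \<Sum>e\<in>Basis. ((x - x0) \<bullet> e) * ?D (x0 + t *\<^sub>R (x - x0)) e) has_integral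
        (\<Sum>e\<in>Basis. ((x - x0) \<bullet> e) * g e x)) {0..1}"
    proof (intro has_integral_sum has_integral_mult_right)
      fix e
      have "continuous_on (ball x0 R) (\<lambda>y. ?D y e)"
        using assms smooth_on_frechet_derivative smooth_on_imp_continuous_on by blast
      then have "continuous_on {0..1} (\<lambda>t. ?D (x0 + t *\<^sub>R (x - x0)) e)"
        apply (rule continuous_on_compose2)
        using segment_point_in_ball x by (fastforce intro!: continuous_intros)+
      then show "((\<lambda>t. ?D (x0 + t *\<^sub>R (x - x0)) e) has_integral g e x) {0..1}"
        unfolding g_def by (simp add: integrable_continuous_real integrable_integral)
    qed auto
    ultimately have "f (x0 + 1 *\<^sub>R (x - x0)) - f (x0 + 0 *\<^sub>R (x - x0)) = (\<Sum>e\<in>Basis. ((x - x0) \<bullet> e) * g e x)"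
      by (rule has_integral_unique)
    then show ?thesis by simp
  qed
qed

section \<open>Tangent vectors in charts\<close>

lemma smooth_on_exp_compose:
  fixes f :: "'a::real_normed_vector \<Rightarrow> real"
  shows "open S \<Longrightarrow> smooth_on S f \<Longrightarrow> smooth_on S (\<lambda>x. exp (f x))"
  by (rule smooth_on_compose[OF _ open_UNIV _ smooth_on_exp]) auto

section \<open>Charts and globally smooth functions\<close>

abbreviation cinv :: "('m, 'n::finite) chart \<Rightarrow> real ^ 'n \<Rightarrow> 'm" where
  "cinv c \<equiv> inv_into (fst c) (snd c)"

abbreviation cimg :: "('m, 'n::finite) chart \<Rightarrow> (real ^ 'n) set" where
  "cimg c \<equiv> snd c ` fst c"

definition ext_fun :: "('m, 'n::finite) chart \<Rightarrow> (real ^ 'n) set \<Rightarrow> (real ^ 'n \<Rightarrow> real) \<Rightarrow> (real ^ 'n \<Rightarrow> real) \<Rightarrow> 'm \<Rightarrow> real" where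
  "ext_fun c W w u q = (if q \<in> fst c \<and> snd c q \<in> W then w (snd c q) * u (snd c q) else 0)"

locale smooth_manifold =
  fixes A :: "('m::t2_space, 'n::finite) chart set"
  assumes atlas: "smooth_atlas A"
begin

lemma chart_open: "c \<in> A \<Longrightarrow> open (fst c)"
  and cimg_open: "c \<in> A \<Longrightarrow> open (cimg c)"
  and chart_homeo: "c \<in> A \<Longrightarrow> homeomorphism (fst c) (cimg c) (snd c) (cinv c)"
  using atlas unfolding smooth_atlas_def is_chart_def by (auto simp: split_beta)

lemma chart_ex: "\<exists>c\<in>A. p \<in> fst c"
  using atlas unfolding smooth_atlas_def by blast

lemma cinv_chart: "c \<in> A \<Longrightarrow> q \<in> fst c \<Longrightarrow> cinv c (snd c q) = q"
  using chart_homeo homeomorphism_apply1 by metis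

lemma chart_cinv: "x \<in> cimg c \<Longrightarrow> snd c (cinv c x) = x"
  by (rule f_inv_into_f)

lemma cinv_in: "x \<in> cimg c \<Longrightarrow> cinv c x \<in> fst c"
  by (rule inv_into_into)

lemma chart_continuous: "c \<in> A \<Longrightarrow> continuous_on (fst c) (snd c)"
  and cinv_continuous: "c \<in> A \<Longrightarrow> continuous_on (cimg c) (cinv c)"
  using chart_homeo by (auto simp: homeomorphism_def)

lemma chart_vimage_open:
  assumes "c \<in> A" "open W"
  shows "open {q \<in> fst c. snd c q \<in> W}"
proof -
  have "open (snd c -` W \<inter> fst c)"
    using continuous_on_open_vimage[OF chart_open[OF assms(1)]] chart_continuous assms by blast
  then show ?thesis by (simp add: vimage_def Int_def conj_commute)
qed

lemma chart_image_eq: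
  assumes "c \<in> A" "V \<subseteq> fst c"
  shows "snd c ` V = {x \<in> cimg c. cinv c x \<in> V}"
  using assms cinv_chart chart_cinv by (auto simp: subset_iff image_iff)

lemma chart_image_open:
  assumes "c \<in> A" "open V" "V \<subseteq> fst c"
  shows "open (snd c ` V)"
proof -
  have "open (cinv c -` V \<inter> cimg c)"
    using continuous_on_open_vimage[OF cimg_open[OF assms(1)]] cinv_continuous assms by blast
  moreover have "snd c ` V = cinv c -` V \<inter> cimg c"
    using chart_image_eq[OF assms(1,3)] by auto
  ultimately show ?thesis by simp
qed

lemma transition_smooth:
  "c \<in> A \<Longrightarrow> d \<in> A \<Longrightarrow> smooth_on (snd c ` (fst c \<inter> fst d)) (\<lambda>x. snd d (cinv c x))"
  using atlas unfolding smooth_atlas_def transition_def o_def by auto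

lemma smooth_fun_iff: "smooth_fun A f \<longleftrightarrow> (\<forall>c\<in>A. smooth_on (cimg c) (\<lambda>x. f (cinv c x)))"
  unfolding smooth_fun_def o_def by (auto simp: split_beta)

lemma smooth_funD: "smooth_fun A f \<Longrightarrow> c \<in> A \<Longrightarrow> smooth_on (cimg c) (\<lambda>x. f (cinv c x))"
  using smooth_fun_iff by blast

text \<open>Smooth transition maps let one chart per point suffice, although
  \<open>smooth_fun\<close> quantifies over the whole atlas.\<close>

lemma smooth_funI_local:
  assumes "\<And>p. \<exists>c\<in>A. \<exists>W. open W \<and> p \<in> fst c \<and> snd c p \<in> W \<and> W \<subseteq> cimg c \<and> smooth_on W (\<lambda>x. f (cinv c x))"
  shows "smooth_fun A f"
  unfolding smooth_fun_iff
proof (intro ballI smooth_on_local)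
  fix d y assume d: "d \<in> A" and y: "y \<in> cimg d"
  obtain c W where c: "c \<in> A" "open W" "cinv d y \<in> fst c" "snd c (cinv d y) \<in> W" "W \<subseteq> cimg c"
    "smooth_on W (\<lambda>x. f (cinv c x))"
    using assms by blast
  define V where "V = fst d \<inter> {q \<in> fst c. snd c q \<in> W}"
  have V: "open V" "V \<subseteq> fst d" "V \<subseteq> fst d \<inter> fst c"
    using chart_vimage_open[OF c(1,2)] chart_open[OF d] by (auto simp: V_def)
  have sm: "smooth_on (snd d ` V) (\<lambda>y. f (cinv c (snd c (cinv d y))))"
  proof (rule smooth_on_compose[OF chart_image_open[OF d V(1,2)] c(2) _ c(6)])
    show "(\<lambda>x. snd c (cinv d x)) ` snd d ` V \<subseteq> W"
      using cinv_chart[OF d] by (auto simp: V_def)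
    show "smooth_on (snd d ` V) (\<lambda>y. snd c (cinv d y))"
      by (rule smooth_on_subset[OF transition_smooth[OF d c(1)]]) (use V in blast)
  qed
  have "f (cinv c (snd c (cinv d y))) = f (cinv d y)" if y: "y \<in> snd d ` V" for y
  proof -
    obtain q where q: "q \<in> V" "y = snd d q" using y by blast
    then have "cinv d y = q" "cinv c (snd c q) = q"
      using V(3) cinv_chart[OF d] cinv_chart[OF c(1)] by auto
    then show ?thesis by simp
  qed
  then have "smooth_on (snd d ` V) (\<lambda>y. f (cinv d y))"
    by (rule smooth_on_cong[OF chart_image_open[OF d V(1,2)] _ sm])
  moreover have "y \<in> snd d ` V"
    using c y chart_image_eq[OF d V(2)] cinv_in[OF y] by (auto simp: V_def)
  ultimately show "\<exists>T. open T \<and> y \<in> T \<and> smooth_on T (\<lambda>x. f (cinv d x))"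
    using chart_image_open[OF d V(1,2)] by blast
qed

text \<open>The danger is the boundary of the chart domain. The support sits in the image of the
  compact \<open>K\<close>, which is closed because the manifold is Hausdorff, so every point where
  the local formula does not apply has a neighbourhood on which the function vanishes.\<close>

lemma ext_fun_smooth:
  assumes c: "c \<in> A" and W: "open W" "W \<subseteq> cimg c" and "smooth_on W w" "smooth_on W u"
    and K: "compact K" "K \<subseteq> W" "\<And>x. x \<in> W \<Longrightarrow> x \<notin> K \<Longrightarrow> w x = 0"
  shows "smooth_fun A (ext_fun c W w u)"
proof (rule smooth_funI_local)
  fix p
  show "\<exists>d\<in>A. \<exists>V. open V \<and> p \<in> fst d \<and> snd d p \<in> V \<and> V \<subseteq> cimg d \<and> smooth_on V (\<lambda>x. ext_fun c W w u (cinv d x))"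
  proof (cases "p \<in> fst c \<and> snd c p \<in> W")
    case True
    have sm: "smooth_on W (\<lambda>x. w x * u x)"
      by (intro smooth_intros assms)
    have "w x * u x = ext_fun c W w u (cinv c x)" if "x \<in> W" for x
      using that W(2) chart_cinv[of x c] cinv_in[of x c] by (auto simp: ext_fun_def)
    then have "smooth_on W (\<lambda>x. ext_fun c W w u (cinv c x))"
      by (rule smooth_on_cong[OF W(1) _ sm])
    with True c W show ?thesis by blast
  next
    case False
    let ?K = "cinv c ` K"
    have "closed ?K"
      using K(1,2) W(2) by (intro compact_imp_closed compact_continuous_image continuous_on_subset[OF cinv_continuous[OF c]]) blast+
    obtain d where d: "d \<in> A" "p \<in> fst d" using chart_ex by blast
    have pK: "p \<notin> ?K"
    proof
      assume "p \<in> ?K"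
      then obtain x where x: "x \<in> K" "p = cinv c x" by blast
      then have "x \<in> cimg c" using K W by blast
      then show False using False x K(2) cinv_in[of x c] chart_cinv[of x c] by auto
    qed
    let ?V = "fst d - ?K"
    have V: "open ?V" "?V \<subseteq> fst d" using chart_open[OF d(1)] \<open>closed ?K\<close> by auto
    have z: "ext_fun c W w u q = 0" if "q \<notin> ?K" for q
      using that K(3) cinv_chart[OF c] by (force simp: ext_fun_def image_iff)
    have "smooth_on (snd d ` ?V) (\<lambda>x. ext_fun c W w u (cinv d x))"
      by (rule smooth_on_cong[OF chart_image_open[OF d(1) V] _ smooth_on_const[of _ 0]])
         (use z cinv_chart[OF d(1)] in fastforce)
    then show ?thesis
      using d pK chart_image_open[OF d(1) V] by blast
  qed
qed

lemma smooth_fun_const: "smooth_fun A (\<lambda>q. a)"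
  by (simp add: smooth_fun_iff smooth_on_const)

lemma smooth_fun_add: "smooth_fun A f \<Longrightarrow> smooth_fun A h \<Longrightarrow> smooth_fun A (\<lambda>q. f q + h q)"
  and smooth_fun_mult: "smooth_fun A f \<Longrightarrow> smooth_fun A h \<Longrightarrow> smooth_fun A (\<lambda>q. f q * h q)"
  and smooth_fun_diff: "smooth_fun A f \<Longrightarrow> smooth_fun A h \<Longrightarrow> smooth_fun A (\<lambda>q. f q - h q)"
  and smooth_fun_exp: "smooth_fun A f \<Longrightarrow> smooth_fun A (\<lambda>q. exp (f q))"
  by (auto simp: smooth_fun_iff intro!: smooth_on_add smooth_on_mult smooth_on_diff smooth_on_exp_compose cimg_open)

lemma smooth_fun_sum: "(\<And>i. i \<in> I \<Longrightarrow> smooth_fun A (f i)) \<Longrightarrow> smooth_fun A (\<lambda>q. \<Sum>i\<in>I. f i q)"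
  by (auto simp: smooth_fun_iff intro!: smooth_on_sum cimg_open)

lemmas smooth_fun_intros = smooth_fun_const smooth_fun_add smooth_fun_mult smooth_fun_diff smooth_fun_exp smooth_fun_sum

lemma ex_cutoff:
  assumes "open N" "p \<in> N"
  obtains \<theta> V where "smooth_fun A \<theta>" "open V" "p \<in> V" "V \<subseteq> N" "\<And>q. q \<in> V \<Longrightarrow> \<theta> q = 1" "\<And>q. q \<notin> N \<Longrightarrow> \<theta> q = 0"
proof -
  obtain c where c: "c \<in> A" "p \<in> fst c" using chart_ex by blast
  define W where "W = snd c ` (fst c \<inter> N)"
  have W: "open W" "W \<subseteq> cimg c" unfolding W_def by (auto intro!: chart_image_open c assms chart_open)
  have "snd c p \<in> W" using c assms by (auto simp: W_def)
  then obtain R where R: "R > 0" "cball (snd c p) R \<subseteq> W"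
    using W(1) open_contains_cball by blast
  obtain w :: "real ^ 'n \<Rightarrow> real" where w: "smooth_on UNIV w" "\<And>x. x \<in> cball (snd c p) (R/2) \<Longrightarrow> w x = 1"
     "\<And>x. x \<notin> ball (snd c p) R \<Longrightarrow> w x = 0"
    using ex_smooth_cutoff[of "R/2" R "snd c p"] R(1) by auto
  show ?thesis
  proof (rule that)
    show "smooth_fun A (ext_fun c W w (\<lambda>x. 1))"
      using W w R
      by (intro ext_fun_smooth[OF c(1), where K = "cball (snd c p) R"] smooth_on_const) (auto intro: smooth_on_subset)
    show "open {q \<in> fst c. snd c q \<in> ball (snd c p) (R/2)}"
      using chart_vimage_open c by blast
    show "p \<in> {q \<in> fst c. snd c q \<in> ball (snd c p) (R/2)}" using c R by auto
    have sub: "q \<in> fst c \<Longrightarrow> snd c q \<in> ball (snd c p) (R/2) \<Longrightarrow> snd c q \<in> W" for q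
      using R by (auto simp: subset_iff)
    have WN: "q \<in> fst c \<Longrightarrow> snd c q \<in> W \<Longrightarrow> q \<in> N" for q
      unfolding W_def using cinv_chart[OF c(1)] by (auto simp: image_iff) (metis)
    show "{q \<in> fst c. snd c q \<in> ball (snd c p) (R/2)} \<subseteq> N"
      using sub WN by blast
    show "ext_fun c W w (\<lambda>x. 1) q = 1" if "q \<in> {q \<in> fst c. snd c q \<in> ball (snd c p) (R/2)}" for q
      using that sub w(2) by (auto simp: ext_fun_def)
    show "ext_fun c W w (\<lambda>x. 1) q = 0" if "q \<notin> N" for q
      using that WN by (auto simp: ext_fun_def)
  qed
qed

section \<open>Derivations at a point\<close>

lemma tangent_lincomb:
  "v \<in> tangent_space A p \<Longrightarrow> smooth_fun A f \<Longrightarrow> smooth_fun A h \<Longrightarrow> v (\<lambda>x. a * f x + b * h x) = a * v f + b * v h"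
  and tangent_mult: "v \<in> tangent_space A p \<Longrightarrow> smooth_fun A f \<Longrightarrow> smooth_fun A h \<Longrightarrow> v (\<lambda>x. f x * h x) = v f * h p + f p * v h"
  and tangent_nonsmooth: "v \<in> tangent_space A p \<Longrightarrow> \<not> smooth_fun A f \<Longrightarrow> v f = 0"
  unfolding tangent_space_def by blast+

lemma tangent_add: "v \<in> tangent_space A p \<Longrightarrow> smooth_fun A f \<Longrightarrow> smooth_fun A h \<Longrightarrow> v (\<lambda>x. f x + h x) = v f + v h"
  and tangent_diff: "v \<in> tangent_space A p \<Longrightarrow> smooth_fun A f \<Longrightarrow> smooth_fun A h \<Longrightarrow> v (\<lambda>x. f x - h x) = v f - v h"
  and tangent_scale: "v \<in> tangent_space A p \<Longrightarrow> smooth_fun A f \<Longrightarrow> v (\<lambda>x. a * f x) = a * v f"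
  using tangent_lincomb[of v p f h 1 1] tangent_lincomb[of v p f h 1 "-1"] tangent_lincomb[of v p f f a 0] by simp_all

lemma tangent_const:
  assumes "v \<in> tangent_space A p" shows "v (\<lambda>x. a) = 0"
proof -
  have "v (\<lambda>x. 1 * 1) = v (\<lambda>x. 1) * 1 + 1 * v (\<lambda>x. 1)"
    by (rule tangent_mult[OF assms smooth_fun_const smooth_fun_const])
  then have "v (\<lambda>x. 1) = 0" by simp
  then show ?thesis using tangent_scale[OF assms smooth_fun_const[of 1], of a] by simp
qed

lemma tangent_sum:
  assumes "v \<in> tangent_space A p" "finite I" "\<And>i. i \<in> I \<Longrightarrow> smooth_fun A (f i)"
  shows "v (\<lambda>x. \<Sum>i\<in>I. f i x) = (\<Sum>i\<in>I. v (f i))"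
  using assms(2,3)
proof (induction I rule: finite_induct)
  case empty
  then show ?case using tangent_const[OF assms(1)] by simp
next
  case (insert i I)
  then have "v (\<lambda>x. f i x + (\<Sum>i\<in>I. f i x)) = v (f i) + v (\<lambda>x. \<Sum>i\<in>I. f i x)"
    by (intro tangent_add[OF assms(1)] smooth_fun_sum) auto
  with insert show ?case by simp
qed

text \<open>Derivations take globally defined arguments, so locality has to be earned: the product
  of \<open>f - h\<close> with a cut-off vanishes identically, and by Leibniz at \<open>p\<close> it
  is mapped to \<open>v f - v h\<close>.\<close>

lemma tangent_local:
  assumes v: "v \<in> tangent_space A p" and f: "smooth_fun A f" and h: "smooth_fun A h"
    and N: "open N" "p \<in> N" "\<And>q. q \<in> N \<Longrightarrow> f q = h q"
  shows "v f = v h"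
proof -
  obtain \<theta> V where \<theta>: "smooth_fun A \<theta>" "open V" "p \<in> V" "V \<subseteq> N" "\<And>q. q \<in> V \<Longrightarrow> \<theta> q = 1" "\<And>q. q \<notin> N \<Longrightarrow> \<theta> q = 0"
    using ex_cutoff[OF N(1,2)] by metis
  have "(\<lambda>q. \<theta> q * (f q - h q)) = (\<lambda>q. 0)"
    using N(3) \<theta>(6) by (intro ext) (metis diff_self mult_eq_0_iff)
  then have "v (\<lambda>q. \<theta> q * (f q - h q)) = 0"
    using tangent_const[OF v, of 0] by simp
  moreover have "v (\<lambda>q. \<theta> q * (f q - h q)) = v \<theta> * (f p - h p) + \<theta> p * v (\<lambda>q. f q - h q)"
    by (intro tangent_mult[OF v \<theta>(1)] smooth_fun_intros f h)
  ultimately show ?thesis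
    using N \<theta> tangent_diff[OF v f h] by simp
qed

lemma tangent_zero: "(\<lambda>f. 0) \<in> tangent_space A p"
  by (simp add: tangent_space_def)

lemma tangent_space_lincomb:
  assumes "u \<in> tangent_space A p" "v \<in> tangent_space A p"
  shows "(\<lambda>f. a * u f + b * v f) \<in> tangent_space A p"
  unfolding tangent_space_def
  by (auto simp: tangent_lincomb[OF assms(1)] tangent_lincomb[OF assms(2)] tangent_mult[OF assms(1)]
      tangent_mult[OF assms(2)] tangent_nonsmooth[OF assms(1)] tangent_nonsmooth[OF assms(2)] algebra_simps)

text \<open>The image of the coordinate vector \<open>v\<close> under the differential of the
  inverse chart. The value on functions that are not smooth follows the convention of
  \<open>tangent_space\<close>.\<close>

definition tvec :: "('m, 'n) chart \<Rightarrow> 'm \<Rightarrow> real ^ 'n \<Rightarrow> 'm tangent" where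
  "tvec c q v = (\<lambda>f. if smooth_fun A f then frechet_derivative (\<lambda>x. f (cinv c x)) (at (snd c q)) v else 0)"

lemma smooth_fun_has_derivative:
  assumes "c \<in> A" "q \<in> fst c" "smooth_fun A f"
  shows "((\<lambda>x. f (cinv c x)) has_derivative (\<lambda>v. tvec c q v f)) (at (snd c q))"
  using smooth_on_has_derivative[OF smooth_funD[OF assms(3,1)], of "snd c q"] assms by (simp add: tvec_def)

lemma tvec_eqI:
  assumes "c \<in> A" "q \<in> fst c" "smooth_fun A f" "((\<lambda>x. f (cinv c x)) has_derivative D) (at (snd c q))"
  shows "tvec c q v f = D v"
  using has_derivative_unique[OF smooth_fun_has_derivative[OF assms(1-3)] assms(4)] by metis

lemma tvec_in:
  assumes c: "c \<in> A" "q \<in> fst c"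
  shows "tvec c q v \<in> tangent_space A q"
proof -
  note d = smooth_fun_has_derivative[OF c]
  have "tvec c q v (\<lambda>x. a * f x + b * h x) = a * tvec c q v f + b * tvec c q v h"
    if "smooth_fun A f" "smooth_fun A h" for f h a b
    by (rule tvec_eqI[OF c])
       (intro smooth_fun_add smooth_fun_mult smooth_fun_const that has_derivative_add has_derivative_mult_right d)+
  moreover have "tvec c q v (\<lambda>x. f x * h x) = tvec c q v f * h q + f q * tvec c q v h"
    if "smooth_fun A f" "smooth_fun A h" for f h
  proof -
    have "tvec c q v (\<lambda>x. f x * h x) = f (cinv c (snd c q)) * tvec c q v h + tvec c q v f * h (cinv c (snd c q))"
      by (rule tvec_eqI[OF c]) (intro smooth_fun_mult that has_derivative_mult d)+
    then show ?thesis by (simp add: cinv_chart[OF c])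
  qed
  moreover have "tvec c q v f = 0" if "\<not> smooth_fun A f" for f
    using that by (simp add: tvec_def)
  ultimately show ?thesis unfolding tangent_space_def by blast
qed

lemma tvec_linear:
  assumes c: "c \<in> A" "q \<in> fst c"
  shows "linear (\<lambda>v. tvec c q v f)"
proof (cases "smooth_fun A f")
  case True
  show ?thesis using smooth_fun_has_derivative[OF c True] has_derivative_linear by blast
next
  case False
  then show ?thesis by (simp add: tvec_def linear_iff)
qed

lemma tvec_lincomb:
  assumes c: "c \<in> A" "q \<in> fst c"
  shows "tvec c q (a *\<^sub>R u + b *\<^sub>R v) = (\<lambda>f. a * tvec c q u f + b * tvec c q v f)"
proof
  show "tvec c q (a *\<^sub>R u + b *\<^sub>R v) f = a * tvec c q u f + b * tvec c q v f" for f
    using linear_add[OF tvec_linear[OF c]] linear_scale[OF tvec_linear[OF c]] by simp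
qed

section \<open>Vector fields as a module over the smooth functions\<close>

lemma vf_tangent: "X \<in> vector_fields A \<Longrightarrow> X p \<in> tangent_space A p"
  and vf_smooth: "X \<in> vector_fields A \<Longrightarrow> smooth_fun A f \<Longrightarrow> smooth_fun A (\<lambda>p. X p f)"
  unfolding vector_fields_def by blast+

lemma vf_lincomb:
  assumes "X \<in> vector_fields A" "Y \<in> vector_fields A" "smooth_fun A h" "smooth_fun A k"
  shows "(\<lambda>p f. h p * X p f + k p * Y p f) \<in> vector_fields A"
  unfolding vector_fields_def
  by (intro CollectI conjI allI impI tangent_space_lincomb smooth_fun_add smooth_fun_mult
      vf_tangent[OF assms(1)] vf_tangent[OF assms(2)] vf_smooth[OF assms(1)] vf_smooth[OF assms(2)] assms(3,4))

lemma vf_add: "X \<in> vector_fields A \<Longrightarrow> Y \<in> vector_fields A \<Longrightarrow> (\<lambda>p f. X p f + Y p f) \<in> vector_fields A"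
  using vf_lincomb[of X Y "\<lambda>_. 1" "\<lambda>_. 1"] smooth_fun_const by simp

lemma vf_scale: "X \<in> vector_fields A \<Longrightarrow> smooth_fun A h \<Longrightarrow> (\<lambda>p f. h p * X p f) \<in> vector_fields A"
  using vf_lincomb[of X X h "\<lambda>_. 0"] smooth_fun_const by simp

lemma vf_zero: "(\<lambda>p f. 0) \<in> vector_fields A"
  by (auto simp: vector_fields_def tangent_zero smooth_fun_const)

lemma vf_sum:
  assumes "finite I" "\<And>i. i \<in> I \<Longrightarrow> X i \<in> vector_fields A"
  shows "(\<lambda>p f. \<Sum>i\<in>I. X i p f) \<in> vector_fields A"
  using assms by (induction I rule: finite_induct) (auto simp: vf_zero intro: vf_add)

end

subsection \<open>Chart balls with a cut-off function\<close>

locale cutoff_chart = smooth_manifold A for A :: "('m::t2_space, 'n::finite) chart set" +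
  fixes c :: "('m, 'n) chart" and x0 :: "real ^ 'n" and r :: real and w :: "real ^ 'n \<Rightarrow> real"
  assumes c: "c \<in> A" and r: "r > 0" and ball_sub: "cball x0 (2 * r) \<subseteq> cimg c"
    and w_smooth: "smooth_on UNIV w" and w_1: "\<And>x. x \<in> cball x0 r \<Longrightarrow> w x = 1"
    and w_0: "\<And>x. x \<notin> ball x0 (2 * r) \<Longrightarrow> w x = 0"
begin

text \<open>On \<open>Q\<close>, where the cut-off function is \<open>1\<close>, the smooth functions \<open>X e\<close> on the manifold are the coordinates
  of the chart, and the vector fields \<open>E v\<close> are its coordinate fields.\<close>

definition "Q = {q \<in> fst c. snd c q \<in> ball x0 r}"

definition "X e = ext_fun c (cimg c) w (\<lambda>x. x \<bullet> e)"

definition "E v q f = (if q \<in> fst c then w (snd c q) * tvec c q v f else 0)"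

text \<open>On \<open>Q\<close> this is the inverse of \<open>tvec c q\<close>; see
  \<open>coord_tvec\<close> and \<open>tangent_eq\<close>.\<close>

definition "coord u = (\<Sum>e\<in>Basis. u (X e) *\<^sub>R e)"

lemma Q_open: "open Q" and Q_sub: "q \<in> Q \<Longrightarrow> q \<in> fst c" and Q_ball: "q \<in> Q \<Longrightarrow> snd c q \<in> ball x0 r"
  unfolding Q_def using chart_vimage_open[OF c open_ball] by simp_all

lemma ball_cimg: "x \<in> ball x0 r \<Longrightarrow> x \<in> cimg c"
  using ball_sub r by (auto simp: subset_iff)

lemma cinv_Q: "x \<in> ball x0 r \<Longrightarrow> cinv c x \<in> Q"
  unfolding Q_def using ball_cimg[of x] cinv_in[of x c] chart_cinv[of x c] by auto

lemma glob_w_smooth: "smooth_on (cimg c) u \<Longrightarrow> smooth_fun A (ext_fun c (cimg c) w u)"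
  using ball_sub w_0 w_smooth
  by (intro ext_fun_smooth[OF c cimg_open[OF c], where K = "cball x0 (2 * r)"]) (auto intro: smooth_on_subset)

lemma X_smooth: "smooth_fun A (X e)"
  unfolding X_def by (intro glob_w_smooth smooth_intros cimg_open c)

lemma X_eq: "q \<in> Q \<Longrightarrow> X e q = snd c q \<bullet> e"
  using Q_sub[of q] Q_ball[of q] w_1[of "snd c q"] by (simp add: X_def ext_fun_def)

lemma tvec_cong:
  assumes q: "q \<in> Q" and fh: "\<And>q. q \<in> Q \<Longrightarrow> f (q :: 'm) = h (snd c q)" and f: "smooth_fun A f"
    and h: "(h has_derivative D) (at (snd c q))"
  shows "tvec c q v f = D v"
proof (rule tvec_eqI[OF c Q_sub[OF q] f])
  have "h x = f (cinv c x)" if "x \<in> ball x0 r" for x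
    using fh[OF cinv_Q[OF that]] chart_cinv[OF ball_cimg[OF that]] by simp
  then show "((\<lambda>x. f (cinv c x)) has_derivative D) (at (snd c q))"
    by (rule has_derivative_transform_within_open[OF h open_ball Q_ball[OF q]])
qed

lemma tvec_X: "q \<in> Q \<Longrightarrow> tvec c q v (X e) = v \<bullet> e"
  by (rule tvec_cong[where h = "\<lambda>x. x \<bullet> e"]) (auto simp: X_eq X_smooth intro!: derivative_eq_intros)

lemma coord_tvec: "q \<in> Q \<Longrightarrow> coord (tvec c q v) = v"
  by (simp add: coord_def tvec_X euclidean_representation)

lemma E_eq: "q \<in> Q \<Longrightarrow> E v q = tvec c q v"
  using Q_sub[of q] Q_ball[of q] w_1[of "snd c q"] by (auto simp: E_def)

lemma E_glob: "smooth_fun A f \<Longrightarrow> (\<lambda>q. E v q f) = ext_fun c (cimg c) w (\<lambda>x. frechet_derivative (\<lambda>x. f (cinv c x)) (at x) v)"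
  by (auto simp: E_def ext_fun_def tvec_def)

lemma E_vf: "E v \<in> vector_fields A"
proof -
  have "E v p \<in> tangent_space A p" for p
  proof (cases "p \<in> fst c")
    case True
    have "(\<lambda>f. w (snd c p) * tvec c p v f + 0 * tvec c p v f) \<in> tangent_space A p"
      by (intro tangent_space_lincomb tvec_in c True)
    then show ?thesis using True by (simp add: E_def[abs_def])
  next
    case False
    then show ?thesis by (simp add: E_def[abs_def] tangent_zero)
  qed
  moreover have "smooth_fun A (\<lambda>q. E v q f)" if "smooth_fun A f" for f
    unfolding E_glob[OF that]
    by (intro glob_w_smooth smooth_on_frechet_derivative smooth_funD that c)
  ultimately show ?thesis unfolding vector_fields_def by blast
qed

lemma E_lincomb: "E (a *\<^sub>R u + b *\<^sub>R v) = (\<lambda>q f. a * E u q f + b * E v q f)"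
  by (intro ext) (auto simp: E_def tvec_lincomb[OF c] algebra_simps)

text \<open>Hadamard's lemma writes \<open>f\<close> near \<open>q\<close> as a constant plus
  products of two factors, the first of which vanishes at \<open>q\<close>. By Leibniz only the
  values of \<open>u\<close> on the coordinates survive.\<close>

lemma tangent_eq:
  assumes q: "q \<in> Q" and u: "u \<in> tangent_space A q"
  shows "u = tvec c q (coord u)"
proof
  fix f
  show "u f = tvec c q (coord u) f"
  proof (cases "smooth_fun A f")
    case False
    then show ?thesis by (simp add: tvec_def tangent_nonsmooth[OF u])
  next
    case f: True
    let ?x = "snd c q"
    let ?f = "\<lambda>x. f (cinv c x)"
    obtain s where s: "s > 0" "ball ?x s \<subseteq> ball x0 r"
      using Q_ball[OF q] open_contains_ball open_ball by metis
    have sub: "ball ?x s \<subseteq> cimg c" using s ball_cimg by blast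
    obtain g where g: "\<And>e. smooth_on (ball ?x s) (g e)"
      "\<And>x. x \<in> ball ?x s \<Longrightarrow> ?f x = ?f ?x + (\<Sum>e\<in>Basis. ((x - ?x) \<bullet> e) * g e x)"
      "\<And>e. g e ?x = frechet_derivative ?f (at ?x) e"
      by (rule Hadamard_lemma[OF smooth_on_subset[OF smooth_funD[OF f c] sub] s(1)]) blast
    obtain w' :: "real ^ 'n \<Rightarrow> real" where w': "smooth_on UNIV w'" "\<And>x. x \<in> cball ?x (s/3) \<Longrightarrow> w' x = 1"
      "\<And>x. x \<notin> ball ?x (s/2) \<Longrightarrow> w' x = 0"
      using ex_smooth_cutoff[of "s/3" "s/2" ?x] s(1) by auto
    \<comment> \<open>A derivation accepts only functions on the whole manifold, so the Hadamard
      coefficients, defined on a ball of the chart, are cut off; \<open>F\<close> below then agrees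
      with \<open>f\<close> near \<open>q\<close>.\<close>
    define \<psi> where "\<psi> e = ext_fun c (ball ?x s) w' (g e)" for e
    have \<psi>: "smooth_fun A (\<psi> e)" for e
      unfolding \<psi>_def using sub w' s
      by (intro ext_fun_smooth[OF c open_ball _ _ g(1), where K = "cball ?x (s/2)"]) (auto intro: smooth_on_subset)
    have \<psi>_near: "\<psi> e m = g e (snd c m)" if "m \<in> fst c" "snd c m \<in> ball ?x (s/3)" for e m
      using that w'(2) s by (simp add: \<psi>_def ext_fun_def)
    define F where "F m = f q + (\<Sum>e\<in>Basis. (X e m - ?x \<bullet> e) * \<psi> e m)" for m
    have F: "smooth_fun A F"
      unfolding F_def by (intro smooth_fun_intros \<psi> X_smooth)
    have "u f = u F"
    proof (rule tangent_local[OF u f F])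
      show "open {m \<in> fst c. snd c m \<in> ball ?x (s/3)}" using chart_vimage_open c by blast
      show "q \<in> {m \<in> fst c. snd c m \<in> ball ?x (s/3)}" using Q_sub[OF q] s by simp
      fix m assume m: "m \<in> {m \<in> fst c. snd c m \<in> ball ?x (s/3)}"
      then have ms: "snd c m \<in> ball ?x s" using s by auto
      then have "m \<in> Q" using s(2) m unfolding Q_def by blast
      have "f m = ?f (snd c m)" using m c cinv_chart by auto
      also have "\<dots> = f q + (\<Sum>e\<in>Basis. ((snd c m - ?x) \<bullet> e) * g e (snd c m))"
        using g(2)[OF ms] cinv_chart[OF c Q_sub[OF q]] by simp
      also have "\<dots> = F m"
        using m \<psi>_near by (simp add: F_def X_eq[OF \<open>m \<in> Q\<close>] inner_diff_left)
      finally show "f m = F m" .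
    qed
    also have "u F = (\<Sum>e\<in>Basis. u (X e) * g e ?x)"
    proof -
      have t: "u (\<lambda>m. (X e m - ?x \<bullet> e) * \<psi> e m) = u (X e) * g e ?x" for e
      proof -
        have "u (\<lambda>m. (X e m - ?x \<bullet> e) * \<psi> e m) = u (\<lambda>m. X e m - ?x \<bullet> e) * \<psi> e q + (X e q - ?x \<bullet> e) * u (\<psi> e)"
          by (intro tangent_mult[OF u] smooth_fun_intros X_smooth \<psi>)
        then show ?thesis
          using tangent_diff[OF u X_smooth smooth_fun_const] tangent_const[OF u] X_eq[OF q] \<psi>_near[OF Q_sub[OF q]] s
          by simp
      qed
      have "u F = u (\<lambda>m. f q) + u (\<lambda>m. \<Sum>e\<in>Basis. (X e m - ?x \<bullet> e) * \<psi> e m)"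
        unfolding F_def by (intro tangent_add[OF u] smooth_fun_intros X_smooth \<psi>)
      also have "\<dots> = (\<Sum>e\<in>Basis. u (\<lambda>m. (X e m - ?x \<bullet> e) * \<psi> e m))"
        unfolding tangent_const[OF u] add_0
        by (intro tangent_sum[OF u] smooth_fun_intros X_smooth \<psi>) auto
      finally show ?thesis using t by simp
    qed
    also have "\<dots> = (\<Sum>e\<in>Basis. u (X e) * tvec c q e f)"
      using f by (simp add: g(3) tvec_def)
    also have "\<dots> = tvec c q (coord u) f"
      unfolding coord_def
      by (simp add: linear_sum[OF tvec_linear[OF c Q_sub[OF q]]] linear_scale[OF tvec_linear[OF c Q_sub[OF q]]])
    finally show ?thesis .
  qed
qed

end

context smooth_manifold
begin

lemma ex_cutoff_chart:
  assumes "c \<in> A" "p \<in> fst c"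
  obtains r w where "cutoff_chart A c (snd c p) r w"
proof -
  have "snd c p \<in> cimg c" using assms by auto
  then obtain R where R: "R > 0" "cball (snd c p) R \<subseteq> cimg c"
    using cimg_open[OF assms(1)] open_contains_cball by blast
  obtain w :: "real ^ 'n \<Rightarrow> real" where "smooth_on UNIV w" "\<forall>x\<in>cball (snd c p) (R/2). w x = 1"
     "\<forall>x. x \<notin> ball (snd c p) (2 * (R/2)) \<longrightarrow> w x = 0"
    using ex_smooth_cutoff[of "R/2" R "snd c p"] R(1) by auto
  then have "cutoff_chart A c (snd c p) (R/2) w"
    using R assms by unfold_locales auto
  then show ?thesis using that by blast
qed

end

section \<open>Connections and geodesics\<close>

context smooth_manifold
begin

definition hess_fields :: "'m connection \<Rightarrow> 'm field \<Rightarrow> 'm field \<Rightarrow> 'm \<Rightarrow> ('m \<Rightarrow> real) \<Rightarrow> real" where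
  "hess_fields N U V p f = U p (\<lambda>q. V q f) - N U V p f"

definition ext_field :: "'m \<Rightarrow> 'm tangent \<Rightarrow> 'm field" where
  "ext_field p u = (SOME U. U \<in> vector_fields A \<and> U p = u)"

text \<open>The Hessian of \<open>f\<close> with respect to \<open>N\<close>: \<open>U (V f) - (N\<^sub>U V) f\<close> is tensorial in \<open>U\<close> and \<open>V\<close>, so the choice of
  extensions does not matter. It turns the geodesic equation and the covariant derivative along a curve
  into statements about second derivatives of functions, without reference to charts.\<close>

definition hess :: "'m connection \<Rightarrow> 'm \<Rightarrow> 'm tangent \<Rightarrow> 'm tangent \<Rightarrow> ('m \<Rightarrow> real) \<Rightarrow> real" where
  "hess N p u v f = hess_fields N (ext_field p u) (ext_field p v) p f"

lemma ext_field:
  assumes "u \<in> tangent_space A p"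
  shows "ext_field p u \<in> vector_fields A" "ext_field p u p = u"
proof -
  obtain c where cp: "c \<in> A" "p \<in> fst c" using chart_ex by blast
  obtain r w where "cutoff_chart A c (snd c p) r w" using ex_cutoff_chart[OF cp] by blast
  then interpret cutoff_chart A c "snd c p" r w .
  have p: "p \<in> Q" using cp r by (simp add: Q_def)
  have "E (coord u) \<in> vector_fields A \<and> E (coord u) p = u"
    using E_vf E_eq[OF p] tangent_eq[OF p assms] by simp
  then have "ext_field p u \<in> vector_fields A \<and> ext_field p u p = u"
    unfolding ext_field_def by (rule someI[of "\<lambda>U. U \<in> vector_fields A \<and> U p = u"])
  then show "ext_field p u \<in> vector_fields A" "ext_field p u p = u" by simp_all
qed

end

section \<open>Affine connections as local operators\<close>

locale affine_manifold = smooth_manifold A for A :: "('m::t2_space, 'n::finite) chart set" +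
  fixes N :: "'m connection"
  assumes conn: "affine_connection A N"
begin

lemma N_vf: "U \<in> vector_fields A \<Longrightarrow> V \<in> vector_fields A \<Longrightarrow> N U V \<in> vector_fields A"
  and N_lincomb1: "U \<in> vector_fields A \<Longrightarrow> V \<in> vector_fields A \<Longrightarrow> Z \<in> vector_fields A \<Longrightarrow>
    smooth_fun A h \<Longrightarrow> smooth_fun A k \<Longrightarrow>
    N (\<lambda>p f. h p * U p f + k p * V p f) Z = (\<lambda>p f. h p * N U Z p f + k p * N V Z p f)"
  and N_add2: "U \<in> vector_fields A \<Longrightarrow> V \<in> vector_fields A \<Longrightarrow> Z \<in> vector_fields A \<Longrightarrow>
    N U (\<lambda>p f. V p f + Z p f) = (\<lambda>p f. N U V p f + N U Z p f)"
  and N_mult2: "U \<in> vector_fields A \<Longrightarrow> V \<in> vector_fields A \<Longrightarrow> smooth_fun A h \<Longrightarrow>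
    N U (\<lambda>p f. h p * V p f) = (\<lambda>p f. U p h * V p f + h p * N U V p f)"
  using conn unfolding affine_connection_def by (elim conjE; blast)+

lemma N_mult1: "U \<in> vector_fields A \<Longrightarrow> V \<in> vector_fields A \<Longrightarrow> smooth_fun A h \<Longrightarrow>
    N (\<lambda>p f. h p * U p f) V = (\<lambda>p f. h p * N U V p f)"
  using N_lincomb1[of U U V h "\<lambda>_. 0"] smooth_fun_const by simp

lemma N_zero1: "V \<in> vector_fields A \<Longrightarrow> N (\<lambda>p f. 0) V = (\<lambda>p f. 0)"
  using N_mult1[OF vf_zero, of V "\<lambda>_. 0"] smooth_fun_const by simp

lemma N_zero2: "U \<in> vector_fields A \<Longrightarrow> N U (\<lambda>p f. 0) = (\<lambda>p f. 0)"
  using N_mult2[OF _ vf_zero, of U "\<lambda>_. 0"] smooth_fun_const tangent_const[OF vf_tangent] by simp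

lemma N_add1: "U \<in> vector_fields A \<Longrightarrow> V \<in> vector_fields A \<Longrightarrow> Z \<in> vector_fields A \<Longrightarrow>
    N (\<lambda>p f. U p f + V p f) Z = (\<lambda>p f. N U Z p f + N V Z p f)"
  using N_lincomb1[of U V Z "\<lambda>_. 1" "\<lambda>_. 1"] smooth_fun_const by simp

lemma N_sum1:
  assumes "finite I" "\<And>i. i \<in> I \<Longrightarrow> U i \<in> vector_fields A" "V \<in> vector_fields A"
  shows "N (\<lambda>p f. \<Sum>i\<in>I. U i p f) V = (\<lambda>p f. \<Sum>i\<in>I. N (U i) V p f)"
  using assms(1,2)
proof (induction I rule: finite_induct)
  case empty
  then show ?case using N_zero1[OF assms(3)] by simp
next
  case (insert i I)
  have "N (\<lambda>p f. U i p f + (\<Sum>i\<in>I. U i p f)) V = (\<lambda>p f. N (U i) V p f + N (\<lambda>p f. \<Sum>i\<in>I. U i p f) V p f)"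
    by (rule N_add1[OF _ vf_sum assms(3)]) (use insert in auto)
  with insert show ?case by simp
qed

lemma N_sum2:
  assumes "finite I" "\<And>i. i \<in> I \<Longrightarrow> V i \<in> vector_fields A" "U \<in> vector_fields A"
  shows "N U (\<lambda>p f. \<Sum>i\<in>I. V i p f) = (\<lambda>p f. \<Sum>i\<in>I. N U (V i) p f)"
  using assms(1,2)
proof (induction I rule: finite_induct)
  case empty
  then show ?case using N_zero2[OF assms(3)] by simp
next
  case (insert i I)
  have "N U (\<lambda>p f. V i p f + (\<Sum>i\<in>I. V i p f)) = (\<lambda>p f. N U (V i) p f + N U (\<lambda>p f. \<Sum>i\<in>I. V i p f) p f)"
    by (rule N_add2[OF assms(3) _ vf_sum]) (use insert in auto)
  with insert show ?case by simp
qed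

text \<open>The axioms of a connection mention global fields only. After multiplication with a
  cut-off the two fields coincide everywhere, and linearity over functions removes the cut-off at
  \<open>p\<close>.\<close>

lemma N_local1:
  assumes U: "U \<in> vector_fields A" "U' \<in> vector_fields A" and V: "V \<in> vector_fields A"
    and W: "open W" "p \<in> W" "\<And>q. q \<in> W \<Longrightarrow> U q = U' q"
  shows "N U V p = N U' V p"
proof -
  obtain \<theta> W' where \<theta>: "smooth_fun A \<theta>" "open W'" "p \<in> W'" "W' \<subseteq> W" "\<And>q. q \<in> W' \<Longrightarrow> \<theta> q = 1" "\<And>q. q \<notin> W \<Longrightarrow> \<theta> q = 0"
    using ex_cutoff[OF W(1,2)] by blast
  have "(\<lambda>p f. \<theta> p * U p f) = (\<lambda>p f. \<theta> p * U' p f)"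
  proof (intro ext)
    fix q f show "\<theta> q * U q f = \<theta> q * U' q f"
      using W(3)[of q] \<theta>(6)[of q] by (cases "q \<in> W") auto
  qed
  then have "\<theta> p * N U V p f = \<theta> p * N U' V p f" for f
    using N_mult1[OF U(1) V \<theta>(1)] N_mult1[OF U(2) V \<theta>(1)] by metis
  then show ?thesis using \<theta>(5)[OF \<theta>(3)] by auto
qed

lemma N_local2:
  assumes U: "U \<in> vector_fields A" and V: "V \<in> vector_fields A" "V' \<in> vector_fields A"
    and W: "open W" "p \<in> W" "\<And>q. q \<in> W \<Longrightarrow> V q = V' q"
  shows "N U V p = N U V' p"
proof -
  obtain \<theta> W' where \<theta>: "smooth_fun A \<theta>" "open W'" "p \<in> W'" "W' \<subseteq> W" "\<And>q. q \<in> W' \<Longrightarrow> \<theta> q = 1" "\<And>q. q \<notin> W \<Longrightarrow> \<theta> q = 0"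
    using ex_cutoff[OF W(1,2)] by blast
  have "(\<lambda>p f. \<theta> p * V p f) = (\<lambda>p f. \<theta> p * V' p f)"
  proof (intro ext)
    fix q f show "\<theta> q * V q f = \<theta> q * V' q f"
      using W(3)[of q] \<theta>(6)[of q] by (cases "q \<in> W") auto
  qed
  \<comment> \<open>The Leibniz rule adds derivatives of the cut-off, but they multiply
    \<open>V p\<close> and \<open>V' p\<close>, which are equal.\<close>
  then have "U p \<theta> * V p f + \<theta> p * N U V p f = U p \<theta> * V' p f + \<theta> p * N U V' p f" for f
    using N_mult2[OF U V(1) \<theta>(1)] N_mult2[OF U V(2) \<theta>(1)] by metis
  then show ?thesis using \<theta>(5)[OF \<theta>(3)] W(3)[OF W(2)] by auto
qed

end

locale affine_chart = affine_manifold A N + cutoff_chart A c x0 r w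
  for A :: "('m::t2_space, 'n::finite) chart set" and N c x0 r w
begin

lemma tangent_expand:
  assumes q: "q \<in> Q" and u: "u \<in> tangent_space A q"
  shows "u f = (\<Sum>e\<in>Basis. u (X e) * E e q f)"
proof -
  have "u f = tvec c q (coord u) f" using tangent_eq[OF q u] by simp
  also have "\<dots> = (\<Sum>e\<in>Basis. (coord u \<bullet> e) *\<^sub>R tvec c q e f)"
    by (rule linear_euclidean_expansion[OF tvec_linear[OF c Q_sub[OF q]]])
  finally show ?thesis by (simp add: E_eq[OF q] coord_def)
qed

text \<open>The expansion of \<open>U\<close> in the coordinate frame, as a field on the whole
  manifold. It is compared with \<open>U\<close> only on \<open>Q\<close>, which suffices by
  locality.\<close>

definition "rep U = (\<lambda>q f. \<Sum>e\<in>Basis. U q (X e) * E e q f)"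

lemma rep_vf: "U \<in> vector_fields A \<Longrightarrow> rep U \<in> vector_fields A"
  unfolding rep_def by (intro vf_sum vf_scale E_vf vf_smooth[of U] X_smooth) auto

lemma rep_eq: "U \<in> vector_fields A \<Longrightarrow> q \<in> Q \<Longrightarrow> U q = rep U q"
  unfolding rep_def using tangent_expand[OF _ vf_tangent] by blast

lemma N_expand1:
  assumes U: "U \<in> vector_fields A" and V: "V \<in> vector_fields A" and p: "p \<in> Q"
  shows "N U V p f = (\<Sum>e\<in>Basis. U p (X e) * N (E e) V p f)"
proof -
  have "N U V p = N (rep U) V p"
    by (rule N_local1[OF U rep_vf[OF U] V Q_open p rep_eq[OF U]])
  also have "N (rep U) V = (\<lambda>p f. \<Sum>e\<in>Basis. N (\<lambda>q f. U q (X e) * E e q f) V p f)"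
    unfolding rep_def by (rule N_sum1[OF _ _ V]) (auto intro!: vf_scale E_vf vf_smooth[OF U] X_smooth)
  also have "\<dots> = (\<lambda>p f. \<Sum>e\<in>Basis. U p (X e) * N (E e) V p f)"
    by (simp add: N_mult1[OF E_vf V vf_smooth[OF U X_smooth]])
  finally show ?thesis by simp
qed

lemma N_expand2:
  assumes U: "U \<in> vector_fields A" and V: "V \<in> vector_fields A" and p: "p \<in> Q"
  shows "N U V p f = (\<Sum>e\<in>Basis. U p (\<lambda>q. V q (X e)) * E e p f + V p (X e) * N U (E e) p f)"
proof -
  have "N U V p = N U (rep V) p"
    by (rule N_local2[OF U V rep_vf[OF V] Q_open p rep_eq[OF V]])
  also have "N U (rep V) = (\<lambda>p f. \<Sum>e\<in>Basis. N U (\<lambda>q f. V q (X e) * E e q f) p f)"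
    unfolding rep_def by (rule N_sum2[OF _ _ U]) (auto intro!: vf_scale E_vf vf_smooth[OF V] X_smooth)
  also have "\<dots> = (\<lambda>p f. \<Sum>e\<in>Basis. U p (\<lambda>q. V q (X e)) * E e p f + V p (X e) * N U (E e) p f)"
    by (simp add: N_mult2[OF U E_vf vf_smooth[OF V X_smooth]])
  finally show ?thesis by simp
qed

text \<open>Both \<open>U (V f)\<close> and \<open>N U V f\<close> contain the derivatives of the
  components of \<open>V\<close>, with the same coefficients; the difference depends on the
  components at \<open>p\<close> alone. This is the tensoriality behind \<open>hess\<close>.\<close>

lemma hess_fields_formula:
  assumes U: "U \<in> vector_fields A" and V: "V \<in> vector_fields A" and p: "p \<in> Q" and f: "smooth_fun A f"
  shows "hess_fields N U V p f = (\<Sum>i\<in>Basis. \<Sum>k\<in>Basis. U p (X i) * V p (X k) * hess_fields N (E i) (E k) p f)"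
proof -
  note Up = vf_tangent[OF U, of p]
  have VX: "smooth_fun A (\<lambda>q. V q (X e))" for e by (rule vf_smooth[OF V X_smooth])
  have Ef: "smooth_fun A (\<lambda>q. E e q f)" for e by (rule vf_smooth[OF E_vf f])
  have "U p (\<lambda>q. V q f) = U p (\<lambda>q. \<Sum>e\<in>Basis. V q (X e) * E e q f)"
    by (rule tangent_local[OF Up vf_smooth[OF V f] smooth_fun_sum Q_open p])
       (auto intro!: smooth_fun_mult VX Ef tangent_expand vf_tangent[OF V])
  also have "\<dots> = (\<Sum>e\<in>Basis. U p (\<lambda>q. V q (X e) * E e q f))"
    by (rule tangent_sum[OF Up]) (auto intro!: smooth_fun_mult VX Ef)
  also have "\<dots> = (\<Sum>e\<in>Basis. U p (\<lambda>q. V q (X e)) * E e p f + V p (X e) * U p (\<lambda>q. E e q f))"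
    by (simp add: tangent_mult[OF Up VX Ef])
  finally have "hess_fields N U V p f = (\<Sum>k\<in>Basis. V p (X k) * (U p (\<lambda>q. E k q f) - N U (E k) p f))"
    unfolding hess_fields_def N_expand2[OF U V p] by (simp add: sum_subtractf[symmetric] algebra_simps)
  also have "\<dots> = (\<Sum>k\<in>Basis. V p (X k) * (\<Sum>i\<in>Basis. U p (X i) * hess_fields N (E i) (E k) p f))"
    unfolding hess_fields_def N_expand1[OF U E_vf p] tangent_expand[OF p Up, of "\<lambda>q. E _ q f"]
    by (simp add: sum_subtractf[symmetric] algebra_simps)
  also have "\<dots> = (\<Sum>k\<in>Basis. \<Sum>i\<in>Basis. U p (X i) * V p (X k) * hess_fields N (E i) (E k) p f)"
    by (simp add: sum_distrib_left algebra_simps)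
  also have "\<dots> = (\<Sum>i\<in>Basis. \<Sum>k\<in>Basis. U p (X i) * V p (X k) * hess_fields N (E i) (E k) p f)"
    by (rule sum.swap)
  finally show ?thesis .
qed

lemma hess_formula:
  assumes u: "u \<in> tangent_space A p" and v: "v \<in> tangent_space A p" and p: "p \<in> Q" and f: "smooth_fun A f"
  shows "hess N p u v f = (\<Sum>i\<in>Basis. \<Sum>k\<in>Basis. u (X i) * v (X k) * hess_fields N (E i) (E k) p f)"
  unfolding hess_def using hess_fields_formula[OF ext_field(1)[OF u] ext_field(1)[OF v] p f]
  by (simp add: ext_field[OF u] ext_field[OF v])

end

context affine_manifold
begin

lemma ex_affine_chart:
  obtains c x0 r w where "affine_chart A N c x0 r w" "p \<in> cutoff_chart.Q c x0 r"
proof -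
  obtain c where cp: "c \<in> A" "p \<in> fst c" using chart_ex by blast
  obtain r w where "cutoff_chart A c (snd c p) r w" using ex_cutoff_chart[OF cp] by blast
  then interpret cutoff_chart A c "snd c p" r w .
  have "p \<in> Q" using cp r by (simp add: Q_def)
  moreover have "affine_chart A N c (snd c p) r w" by unfold_locales
  ultimately show ?thesis using that by blast
qed

lemma hess_eq:
  assumes U: "U \<in> vector_fields A" and V: "V \<in> vector_fields A" and f: "smooth_fun A f"
  shows "hess N p (U p) (V p) f = hess_fields N U V p f"
proof -
  obtain c x0 r w where "affine_chart A N c x0 r w" and p: "p \<in> cutoff_chart.Q c x0 r" by (rule ex_affine_chart)
  then interpret affine_chart A N c x0 r w by simp
  show ?thesis
    using hess_formula[OF vf_tangent[OF U] vf_tangent[OF V] p f] hess_fields_formula[OF U V p f] by simp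
qed

lemma hess_lincomb2:
  assumes u: "u \<in> tangent_space A p" and v: "v \<in> tangent_space A p" "v' \<in> tangent_space A p" and f: "smooth_fun A f"
  shows "hess N p u (\<lambda>f. a * v f + b * v' f) f = a * hess N p u v f + b * hess N p u v' f"
proof -
  obtain c x0 r w where "affine_chart A N c x0 r w" and p: "p \<in> cutoff_chart.Q c x0 r" by (rule ex_affine_chart)
  then interpret affine_chart A N c x0 r w by simp
  show ?thesis
    unfolding hess_formula[OF u v(1) p f] hess_formula[OF u v(2) p f] hess_formula[OF u tangent_space_lincomb[OF v] p f]
    by (simp add: sum_distrib_left sum.distrib[symmetric] algebra_simps)
qed

lemma hess_scale:
  assumes u: "u \<in> tangent_space A p" and f: "smooth_fun A f"
  shows "hess N p (\<lambda>f. a * u f) (\<lambda>f. a * u f) f = a\<^sup>2 * hess N p u u f"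
proof -
  obtain c x0 r w where "affine_chart A N c x0 r w" and p: "p \<in> cutoff_chart.Q c x0 r" by (rule ex_affine_chart)
  then interpret affine_chart A N c x0 r w by simp
  have au: "(\<lambda>f. a * u f) \<in> tangent_space A p" using tangent_space_lincomb[OF u u, of a 0] by simp
  show ?thesis
    unfolding hess_formula[OF u u p f] hess_formula[OF au au p f]
    by (simp add: sum_distrib_left power2_eq_square algebra_simps)
qed

lemma hess_lincomb_fun:
  assumes u: "u \<in> tangent_space A p" and v: "v \<in> tangent_space A p" and f: "smooth_fun A f" and h: "smooth_fun A h"
  shows "hess N p u v (\<lambda>x. a * f x + b * h x) = a * hess N p u v f + b * hess N p u v h"
proof -
  let ?U = "ext_field p u" and ?V = "ext_field p v"
  note U = ext_field[OF u] and V = ext_field[OF v]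
  have "(\<lambda>q. ?V q (\<lambda>x. a * f x + b * h x)) = (\<lambda>q. a * ?V q f + b * ?V q h)"
    using tangent_lincomb[OF vf_tangent[OF V(1)] f h] by blast
  then show ?thesis
    unfolding hess_def hess_fields_def
    using tangent_lincomb[OF vf_tangent[OF U(1), of p] vf_smooth[OF V(1) f] vf_smooth[OF V(1) h]]
      tangent_lincomb[OF vf_tangent[OF N_vf[OF U(1) V(1)], of p] f h]
    by (simp add: algebra_simps)
qed

text \<open>The cross terms are those that differentiating
  \<open>V t (\<lambda>x. f x * h x)\<close> along a curve produces; they cancel in
  \<open>cov_along\<close>, whose values therefore are derivations again.\<close>

lemma hess_mult_fun:
  assumes u: "u \<in> tangent_space A p" and v: "v \<in> tangent_space A p" and f: "smooth_fun A f" and h: "smooth_fun A h"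
  shows "hess N p u v (\<lambda>x. f x * h x) = hess N p u v f * h p + f p * hess N p u v h + u f * v h + v f * u h"
proof -
  let ?U = "ext_field p u" and ?V = "ext_field p v"
  note U = ext_field[OF u] and V = ext_field[OF v]
  have eq: "(\<lambda>q. ?V q (\<lambda>x. f x * h x)) = (\<lambda>q. ?V q f * h q + f q * ?V q h)"
    using tangent_mult[OF vf_tangent[OF V(1)] f h] by blast
  note Up = vf_tangent[OF U(1), of p] and Vf = vf_smooth[OF V(1) f] and Vh = vf_smooth[OF V(1) h]
  have "?U p (\<lambda>q. ?V q (\<lambda>x. f x * h x)) = ?U p (\<lambda>q. ?V q f * h q) + ?U p (\<lambda>q. f q * ?V q h)"
    unfolding eq by (rule tangent_add[OF Up smooth_fun_mult[OF Vf h] smooth_fun_mult[OF f Vh]])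
  then show ?thesis
    unfolding hess_def hess_fields_def
    using tangent_mult[OF Up Vf h] tangent_mult[OF Up f Vh]
      tangent_mult[OF vf_tangent[OF N_vf[OF U(1) V(1)], of p] f h]
    by (simp add: U(2) V(2) algebra_simps)
qed

end

subsection \<open>Covariant derivatives along curves\<close>

context smooth_manifold
begin

lemma curve_open: "smooth_curve_on A J \<gamma> \<Longrightarrow> open J"
  and curve_continuous: "smooth_curve_on A J \<gamma> \<Longrightarrow> continuous_on J \<gamma>"
  and curve_chart: "smooth_curve_on A J \<gamma> \<Longrightarrow> c \<in> A \<Longrightarrow> smooth_on (J \<inter> \<gamma> -` fst c) (\<lambda>t. snd c (\<gamma> t))"
  unfolding smooth_curve_on_def o_def by (auto simp: split_beta)

lemma curve_vimage_open:
  assumes "smooth_curve_on A J \<gamma>" "open V" shows "open (J \<inter> \<gamma> -` V)"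
  using continuous_on_open_vimage[OF curve_open[OF assms(1)]] curve_continuous[OF assms(1)] assms(2)
  by (metis Int_commute)

lemma smooth_fun_curve:
  assumes g: "smooth_curve_on A J \<gamma>" and f: "smooth_fun A f"
  shows "smooth_on J (\<lambda>t. f (\<gamma> t))"
proof (rule smooth_on_local)
  fix t assume "t \<in> J"
  obtain c where c: "c \<in> A" "\<gamma> t \<in> fst c" using chart_ex by blast
  let ?T = "J \<inter> \<gamma> -` fst c"
  have T: "open ?T" by (rule curve_vimage_open[OF g chart_open[OF c(1)]])
  have sm: "smooth_on ?T (\<lambda>t. f (cinv c (snd c (\<gamma> t))))"
    by (rule smooth_on_compose[OF T cimg_open[OF c(1)] _ smooth_funD[OF f c(1)] curve_chart[OF g c(1)]]) auto
  have "smooth_on ?T (\<lambda>t. f (\<gamma> t))"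
    by (rule smooth_on_cong[OF T _ sm]) (simp add: cinv_chart[OF c(1)])
  then show "\<exists>T. open T \<and> t \<in> T \<and> smooth_on T (\<lambda>t. f (\<gamma> t))"
    using T c \<open>t \<in> J\<close> by blast
qed

lemma velocity_DERIV:
  assumes "smooth_curve_on A J \<gamma>" "smooth_fun A f" "t \<in> J"
  shows "((\<lambda>s. f (\<gamma> s)) has_real_derivative velocity A \<gamma> t f) (at t)"
  using smooth_on_DERIV[OF smooth_fun_curve[OF assms(1,2)] assms(3)] assms(2) by (simp add: velocity_def)

lemma velocity_tangent:
  assumes g: "smooth_curve_on A J \<gamma>" and t: "t \<in> J"
  shows "velocity A \<gamma> t \<in> tangent_space A (\<gamma> t)"
proof -
  note d = velocity_DERIV[OF g _ t]
  have "velocity A \<gamma> t (\<lambda>x. a * f x + b * h x) = a * velocity A \<gamma> t f + b * velocity A \<gamma> t h"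
    if "smooth_fun A f" "smooth_fun A h" for f h a b
    by (rule DERIV_unique[OF d DERIV_add[OF DERIV_cmult[OF d] DERIV_cmult[OF d]]])
       (intro smooth_fun_intros that)+
  moreover have "velocity A \<gamma> t (\<lambda>x. f x * h x) = velocity A \<gamma> t f * h (\<gamma> t) + f (\<gamma> t) * velocity A \<gamma> t h"
    if "smooth_fun A f" "smooth_fun A h" for f h
    using DERIV_unique[OF d[OF smooth_fun_mult[OF that]] DERIV_mult[OF d[OF that(1)] d[OF that(2)]]]
    by (simp add: algebra_simps)
  moreover have "velocity A \<gamma> t f = 0" if "\<not> smooth_fun A f" for f
    using that by (simp add: velocity_def)
  ultimately show ?thesis unfolding tangent_space_def by blast
qed

lemma velocity_fields_along:
  assumes g: "smooth_curve_on A J \<gamma>"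
  shows "velocity A \<gamma> \<in> fields_along A J \<gamma>"
  unfolding fields_along_def
proof (intro CollectI conjI ballI allI impI)
  fix f assume f: "smooth_fun A f"
  have "(\<lambda>t. velocity A \<gamma> t f) = deriv (\<lambda>s. f (\<gamma> s))" by (rule ext) (simp add: velocity_def f)
  then show "smooth_on J (\<lambda>t. velocity A \<gamma> t f)"
    using smooth_on_deriv[OF curve_open[OF g] smooth_fun_curve[OF g f]] by simp
qed (rule velocity_tangent[OF g])

text \<open>For the restriction of a field \<open>Y\<close>, the derivative of \<open>Y f\<close>
  along \<open>\<gamma>\<close> minus the Hessian leaves the covariant derivative of
  \<open>Y\<close> in the direction of the velocity, applied to \<open>f\<close>. The formula also
  makes sense for fields along \<open>\<gamma>\<close> that do not extend to the manifold.\<close>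

definition cov_along :: "'m connection \<Rightarrow> (real \<Rightarrow> 'm) \<Rightarrow> (real \<Rightarrow> 'm tangent) \<Rightarrow> real \<Rightarrow> 'm tangent" where
  "cov_along N \<gamma> V t f = (if smooth_fun A f then deriv (\<lambda>s. V s f) t - hess N (\<gamma> t) (velocity A \<gamma> t) (V t) f else 0)"

text \<open>The vanishing of the covariant derivative of the velocity, tested on functions through
  \<open>cov_along\<close>.\<close>

definition geodesic_at :: "'m connection \<Rightarrow> (real \<Rightarrow> 'm) \<Rightarrow> real \<Rightarrow> bool" where
  "geodesic_at N \<gamma> t \<longleftrightarrow> (\<forall>f. smooth_fun A f \<longrightarrow>
     deriv (deriv (\<lambda>s. f (\<gamma> s))) t = hess N (\<gamma> t) (velocity A \<gamma> t) (velocity A \<gamma> t) f)"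

text \<open>Geodesics on open sets of parameters, which can be restricted and glued;
  \<open>geodesic_onI\<close> leads back to \<open>geodesic_on\<close>.\<close>

definition gcurve :: "'m connection \<Rightarrow> real set \<Rightarrow> (real \<Rightarrow> 'm) \<Rightarrow> bool" where
  "gcurve N J \<gamma> \<longleftrightarrow> smooth_curve_on A J \<gamma> \<and> (\<forall>t\<in>J. geodesic_at N \<gamma> t)"

end

context affine_manifold
begin

lemma cov_along_fields:
  assumes g: "smooth_curve_on A J \<gamma>" and V: "V \<in> fields_along A J \<gamma>"
  shows "cov_along N \<gamma> V \<in> fields_along A J \<gamma>"
proof -
  have Vt: "V t \<in> tangent_space A (\<gamma> t)" if "t \<in> J" for t
    using V that unfolding fields_along_def by blast
  have Vf: "smooth_on J (\<lambda>t. V t f)" if "smooth_fun A f" for f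
    using V that unfolding fields_along_def by blast
  have Vd: "((\<lambda>t. V t f) has_real_derivative deriv (\<lambda>s. V s f) t) (at t)" if "smooth_fun A f" "t \<in> J" for f t
    by (rule smooth_on_DERIV[OF Vf[OF that(1)] that(2)])
  have tan: "cov_along N \<gamma> V t \<in> tangent_space A (\<gamma> t)" if t: "t \<in> J" for t
  proof -
    note vt = velocity_tangent[OF g t]
    have dV: "deriv (\<lambda>s. V s f) t = D" if "smooth_fun A f" "((\<lambda>s. V s f) has_real_derivative D) (at t)" for f D
      using that by (simp add: DERIV_imp_deriv)
    have cong: "((\<lambda>s. V s f) has_real_derivative D) (at t)" if "\<And>s. s \<in> J \<Longrightarrow> F s = V s f" "(F has_real_derivative D) (at t)" for F f D
      by (rule has_field_derivative_transform_within_open[OF that(2) curve_open[OF g] t that(1)])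
    have "cov_along N \<gamma> V t (\<lambda>x. a * f x + b * h x) = a * cov_along N \<gamma> V t f + b * cov_along N \<gamma> V t h"
      if f: "smooth_fun A f" and h: "smooth_fun A h" for f h a b
    proof -
      have sm: "smooth_fun A (\<lambda>x. a * f x + b * h x)" by (intro smooth_fun_intros f h)
      have "((\<lambda>s. a * V s f + b * V s h) has_real_derivative (a * deriv (\<lambda>s. V s f) t + b * deriv (\<lambda>s. V s h) t)) (at t)"
        by (intro DERIV_add DERIV_cmult Vd f h t)
      then have "deriv (\<lambda>s. V s (\<lambda>x. a * f x + b * h x)) t = a * deriv (\<lambda>s. V s f) t + b * deriv (\<lambda>s. V s h) t"
        by (intro dV[OF sm] cong[rotated]) (simp_all add: tangent_lincomb[OF Vt f h])
      then show ?thesis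
        using hess_lincomb_fun[OF vt Vt[OF t] f h] by (simp add: cov_along_def f h sm algebra_simps)
    qed
    moreover have "cov_along N \<gamma> V t (\<lambda>x. f x * h x) = cov_along N \<gamma> V t f * h (\<gamma> t) + f (\<gamma> t) * cov_along N \<gamma> V t h"
      if f: "smooth_fun A f" and h: "smooth_fun A h" for f h
    proof -
      have sm: "smooth_fun A (\<lambda>x. f x * h x)" by (intro smooth_fun_intros f h)
      have "((\<lambda>s. V s f * h (\<gamma> s) + f (\<gamma> s) * V s h) has_real_derivative
         ((deriv (\<lambda>s. V s f) t * h (\<gamma> t) + velocity A \<gamma> t h * V t f)
          + (velocity A \<gamma> t f * V t h + deriv (\<lambda>s. V s h) t * f (\<gamma> t)))) (at t)"
        by (intro DERIV_add DERIV_mult Vd velocity_DERIV[OF g] f h t)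
      then have "deriv (\<lambda>s. V s (\<lambda>x. f x * h x)) t = (deriv (\<lambda>s. V s f) t * h (\<gamma> t) + velocity A \<gamma> t h * V t f)
          + (velocity A \<gamma> t f * V t h + deriv (\<lambda>s. V s h) t * f (\<gamma> t))"
        by (intro dV[OF sm] cong[rotated]) (simp_all add: tangent_mult[OF Vt f h])
      then show ?thesis
        using hess_mult_fun[OF vt Vt[OF t] f h] by (simp add: cov_along_def f h sm algebra_simps)
    qed
    moreover have "cov_along N \<gamma> V t f = 0" if "\<not> smooth_fun A f" for f
      using that by (simp add: cov_along_def)
    ultimately show ?thesis unfolding tangent_space_def by blast
  qed
  have "smooth_on J (\<lambda>t. cov_along N \<gamma> V t f)" if f: "smooth_fun A f" for f
  proof (rule smooth_on_local)
    fix t assume t: "t \<in> J"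
    \<comment> \<open>\<open>hess\<close> chooses extensions anew at every point, so smoothness in
      \<open>t\<close> is invisible in its definition. In a chart it is bilinear in the components,
      with smooth coefficients.\<close>
    obtain c x0 r w where "affine_chart A N c x0 r w" and p: "\<gamma> t \<in> cutoff_chart.Q c x0 r" by (rule ex_affine_chart)
    then interpret affine_chart A N c x0 r w by simp
    let ?T = "J \<inter> \<gamma> -` Q"
    have T: "open ?T" by (rule curve_vimage_open[OF g Q_open])
    have sub: "smooth_on J F \<Longrightarrow> smooth_on ?T F" for F :: "real \<Rightarrow> real" by (rule smooth_on_subset) auto
    have B: "smooth_fun A (\<lambda>p. hess_fields N (E i) (E k) p f)" for i k
      unfolding hess_fields_def by (intro smooth_fun_diff vf_smooth[OF E_vf] vf_smooth[OF N_vf[OF E_vf E_vf]] f)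
    have vel: "smooth_on J (\<lambda>t. velocity A \<gamma> t f)" if "smooth_fun A f" for f
      using velocity_fields_along[OF g] that unfolding fields_along_def by blast
    have sm: "smooth_on ?T (\<lambda>t. deriv (\<lambda>s. V s f) t - (\<Sum>i\<in>Basis. \<Sum>k\<in>Basis. velocity A \<gamma> t (X i) * V t (X k) * hess_fields N (E i) (E k) (\<gamma> t) f))"
      by (intro smooth_on_diff smooth_on_sum smooth_on_mult T sub[OF smooth_on_deriv[OF curve_open[OF g] Vf[OF f]]]
          sub[OF vel] sub[OF Vf] X_smooth sub[OF smooth_fun_curve[OF g B]])
    have "smooth_on ?T (\<lambda>t. cov_along N \<gamma> V t f)"
      by (rule smooth_on_cong[OF T _ sm])
         (simp add: cov_along_def f hess_formula[OF velocity_tangent[OF g] Vt _ f])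
    then show "\<exists>T. open T \<and> t \<in> T \<and> smooth_on T (\<lambda>t. cov_along N \<gamma> V t f)"
      using T p t by blast
  qed
  with tan show ?thesis unfolding fields_along_def by blast
qed

text \<open>Existence of the covariant derivative along a curve. It supplies the witness
  \<open>D\<close> that \<open>geodesic_on\<close> asks for.\<close>

lemma cov_along:
  assumes g: "smooth_curve_on A J \<gamma>"
  shows "covariant_derivative_along A N J \<gamma> (cov_along N \<gamma>)"
  unfolding covariant_derivative_along_def
proof (intro conjI ballI allI impI)
  fix V assume V: "V \<in> fields_along A J \<gamma>"
  show "cov_along N \<gamma> V \<in> fields_along A J \<gamma>" by (rule cov_along_fields[OF g V])
next
  fix V W t assume V: "V \<in> fields_along A J \<gamma>" and W: "W \<in> fields_along A J \<gamma>" and t: "t \<in> J"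
  show "cov_along N \<gamma> (\<lambda>s f. V s f + W s f) t = (\<lambda>f. cov_along N \<gamma> V t f + cov_along N \<gamma> W t f)"
  proof
    fix f
    show "cov_along N \<gamma> (\<lambda>s f. V s f + W s f) t f = cov_along N \<gamma> V t f + cov_along N \<gamma> W t f"
    proof (cases "smooth_fun A f")
      case f: True
      have VW: "V t \<in> tangent_space A (\<gamma> t)" "W t \<in> tangent_space A (\<gamma> t)"
        "smooth_on J (\<lambda>t. V t f)" "smooth_on J (\<lambda>t. W t f)"
        using V W t f unfolding fields_along_def by blast+
      have "deriv (\<lambda>s. V s f + W s f) t = deriv (\<lambda>s. V s f) t + deriv (\<lambda>s. W s f) t"
        by (rule DERIV_imp_deriv) (intro DERIV_add smooth_on_DERIV[OF _ t] VW)
      then show ?thesis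
        using hess_lincomb2[OF velocity_tangent[OF g t] VW(1,2) f, of 1 1] by (simp add: cov_along_def f)
    qed (simp add: cov_along_def)
  qed
next
  fix V and h :: "real \<Rightarrow> real" and t assume V: "V \<in> fields_along A J \<gamma>" and h: "smooth_on J h" and t: "t \<in> J"
  show "cov_along N \<gamma> (\<lambda>s f. h s * V s f) t = (\<lambda>f. deriv h t * V t f + h t * cov_along N \<gamma> V t f)"
  proof
    fix f
    show "cov_along N \<gamma> (\<lambda>s f. h s * V s f) t f = deriv h t * V t f + h t * cov_along N \<gamma> V t f"
    proof (cases "smooth_fun A f")
      case f: True
      have V': "V t \<in> tangent_space A (\<gamma> t)" "smooth_on J (\<lambda>t. V t f)"
        using V t f unfolding fields_along_def by blast+
      have "deriv (\<lambda>s. h s * V s f) t = deriv h t * V t f + deriv (\<lambda>s. V s f) t * h t"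
        by (rule DERIV_imp_deriv) (intro DERIV_mult smooth_on_DERIV[OF _ t] V' h)
      then show ?thesis
        using hess_lincomb2[OF velocity_tangent[OF g t] V'(1) V'(1) f, of "h t" 0] by (simp add: cov_along_def f algebra_simps)
    next
      case False
      moreover have "V t f = 0" using tangent_nonsmooth[OF _ False] V t unfolding fields_along_def by blast
      ultimately show ?thesis by (simp add: cov_along_def)
    qed
  qed
next
  fix U V t assume U: "U \<in> vector_fields A" and V: "V \<in> vector_fields A" and t: "t \<in> J" and v: "U (\<gamma> t) = velocity A \<gamma> t"
  show "cov_along N \<gamma> (\<lambda>s. V (\<gamma> s)) t = N U V (\<gamma> t)"
  proof
    fix f show "cov_along N \<gamma> (\<lambda>s. V (\<gamma> s)) t f = N U V (\<gamma> t) f"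
    proof (cases "smooth_fun A f")
      case f: True
      have "deriv (\<lambda>s. V (\<gamma> s) f) t = U (\<gamma> t) (\<lambda>q. V q f)"
        using v vf_smooth[OF V f] by (simp add: velocity_def)
      then show ?thesis
        using hess_eq[OF U V f, of "\<gamma> t"] v by (simp add: cov_along_def f hess_fields_def)
    next
      case False
      then show ?thesis
        using tangent_nonsmooth[OF vf_tangent[OF N_vf[OF U V]] False] by (simp add: cov_along_def)
    qed
  qed
qed

lemma geodesic_onI:
  assumes "is_interval I" "interior I \<noteq> {}" "I \<subseteq> J" "gcurve N J \<eta>" "\<And>t. t \<in> I \<Longrightarrow> \<eta> t = \<gamma> t"
  shows "geodesic_on A N I \<gamma>"
proof -
  have g: "smooth_curve_on A J \<eta>" and eq: "\<And>t. t \<in> J \<Longrightarrow> geodesic_at N \<eta> t"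
    using assms(4) by (auto simp: gcurve_def)
  have "cov_along N \<eta> (velocity A \<eta>) t = (\<lambda>f. 0)" if "t \<in> I" for t
  proof
    fix f show "cov_along N \<eta> (velocity A \<eta>) t f = 0"
    proof (cases "smooth_fun A f")
      case f: True
      have "(\<lambda>s. velocity A \<eta> s f) = deriv (\<lambda>s. f (\<eta> s))" by (rule ext) (simp add: velocity_def f)
      then show ?thesis
        using eq[of t] that assms(3) f by (auto simp: cov_along_def geodesic_at_def)
    qed (simp add: cov_along_def)
  qed
  then show ?thesis
    unfolding geodesic_on_def using assms(1-3,5) g cov_along[OF g] by blast
qed

end

context smooth_manifold
begin

section \<open>Restriction and gluing of geodesics\<close>

lemma velocity_cong:
  assumes "open T" "t \<in> T" "\<And>s. s \<in> T \<Longrightarrow> \<gamma> s = \<eta> s"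
  shows "velocity A \<gamma> t = velocity A \<eta> t"
proof -
  have "\<forall>\<^sub>F s in nhds t. f (\<gamma> s) = f (\<eta> s)" for f :: "'m \<Rightarrow> real"
    using eventually_nhds_in_open[OF assms(1,2)] by eventually_elim (simp add: assms(3))
  then show ?thesis by (auto simp: velocity_def fun_eq_iff intro!: deriv_cong_ev)
qed

lemma geodesic_at_cong:
  assumes "open T" "t \<in> T" "\<And>s. s \<in> T \<Longrightarrow> \<gamma> s = \<eta> s" "geodesic_at N \<eta> t"
  shows "geodesic_at N \<gamma> t"
proof -
  have "\<forall>\<^sub>F s in nhds t. deriv (\<lambda>s. f (\<gamma> s)) s = deriv (\<lambda>s. f (\<eta> s)) s" for f :: "'m \<Rightarrow> real"
    using eventually_nhds_in_open[OF assms(1,2)]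
  proof eventually_elim
    case (elim s)
    have "\<forall>\<^sub>F s in nhds s. f (\<gamma> s) = f (\<eta> s)"
      using eventually_nhds_in_open[OF assms(1) elim] by eventually_elim (simp add: assms(3))
    then show ?case by (intro deriv_cong_ev) auto
  qed
  then have "deriv (deriv (\<lambda>s. f (\<gamma> s))) t = deriv (deriv (\<lambda>s. f (\<eta> s))) t" for f :: "'m \<Rightarrow> real"
    by (intro deriv_cong_ev) auto
  then show ?thesis
    using assms(4) velocity_cong[OF assms(1-3)] assms(3)[OF assms(2)] by (simp add: geodesic_at_def)
qed

lemma smooth_curve_local:
  assumes J: "open J" and loc: "\<And>t. t \<in> J \<Longrightarrow> \<exists>T \<eta>. open T \<and> t \<in> T \<and> smooth_curve_on A T \<eta> \<and> (\<forall>s\<in>T. \<gamma> s = \<eta> s)"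
  shows "smooth_curve_on A J \<gamma>"
proof -
  have cont: "continuous_on J \<gamma>"
  proof -
    have "isCont \<gamma> t" if t: "t \<in> J" for t
    proof -
      obtain T \<eta> where T: "open T" "t \<in> T" "smooth_curve_on A T \<eta>" "\<forall>s\<in>T. \<gamma> s = \<eta> s" using loc[OF t] by blast
      have "continuous_on T \<gamma>"
        using continuous_on_eq[OF curve_continuous[OF T(3)]] T(4) by metis
      then show ?thesis using T continuous_on_eq_continuous_at by blast
    qed
    then show ?thesis by (simp add: continuous_at_imp_continuous_on)
  qed
  have "smooth_on (J \<inter> \<gamma> -` fst c) (\<lambda>t. snd c (\<gamma> t))" if c: "c \<in> A" for c
  proof (rule smooth_on_local)
    fix t assume t: "t \<in> J \<inter> \<gamma> -` fst c"
    obtain T \<eta> where T: "open T" "t \<in> T" "smooth_curve_on A T \<eta>" "\<forall>s\<in>T. \<gamma> s = \<eta> s" using loc t by blast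
    have o: "open (T \<inter> \<eta> -` fst c)" by (rule curve_vimage_open[OF T(3) chart_open[OF c]])
    have "smooth_on (T \<inter> \<eta> -` fst c) (\<lambda>t. snd c (\<gamma> t))"
      by (rule smooth_on_cong[OF o _ curve_chart[OF T(3) c]]) (use T(4) in simp)
    moreover have "t \<in> T \<inter> \<eta> -` fst c" using t T by auto
    ultimately show "\<exists>T. open T \<and> t \<in> T \<and> smooth_on T (\<lambda>t. snd c (\<gamma> t))" using o by blast
  qed
  then show ?thesis
    unfolding smooth_curve_on_def o_def using J cont by (auto simp: split_beta)
qed

lemma gcurve_local:
  assumes J: "open J" and loc: "\<And>t. t \<in> J \<Longrightarrow> \<exists>T \<eta>. open T \<and> t \<in> T \<and> gcurve N T \<eta> \<and> (\<forall>s\<in>T. \<gamma> s = \<eta> s)"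
  shows "gcurve N J \<gamma>"
  unfolding gcurve_def
proof (intro conjI ballI)
  show "smooth_curve_on A J \<gamma>"
  proof (rule smooth_curve_local[OF J])
    fix t assume "t \<in> J"
    then obtain T \<eta> where "open T" "t \<in> T" "gcurve N T \<eta>" "\<forall>s\<in>T. \<gamma> s = \<eta> s" using loc by blast
    then show "\<exists>T \<eta>. open T \<and> t \<in> T \<and> smooth_curve_on A T \<eta> \<and> (\<forall>s\<in>T. \<gamma> s = \<eta> s)"
      unfolding gcurve_def by blast
  qed
  fix t assume "t \<in> J"
  then obtain T \<eta> where T: "open T" "t \<in> T" "gcurve N T \<eta>" "\<forall>s\<in>T. \<gamma> s = \<eta> s" using loc by blast
  then show "geodesic_at N \<gamma> t" by (intro geodesic_at_cong[of T t \<gamma> \<eta>]) (auto simp: gcurve_def)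
qed

lemma smooth_curve_chartI:
  assumes c: "c \<in> A" and J: "open J" and z: "smooth_on J z" "z ` J \<subseteq> cimg c"
  shows "smooth_curve_on A J (\<lambda>t. cinv c (z t))"
proof -
  have cont: "continuous_on J (\<lambda>t. cinv c (z t))"
    by (rule continuous_on_compose2[OF cinv_continuous[OF c] smooth_on_imp_continuous_on[OF z(1)] z(2)])
  have "smooth_on (J \<inter> (\<lambda>t. cinv c (z t)) -` fst d) (\<lambda>t. snd d (cinv c (z t)))" if d: "d \<in> A" for d
  proof (rule smooth_on_compose[OF _ _ _ transition_smooth[OF c d]])
    show "open (J \<inter> (\<lambda>t. cinv c (z t)) -` fst d)"
      using continuous_on_open_vimage[OF J, of "\<lambda>t. cinv c (z t)"] cont chart_open[OF d] by (metis Int_commute)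
    show "open (snd c ` (fst c \<inter> fst d))"
      by (rule chart_image_open[OF c]) (auto intro: chart_open c d)
    show "z ` (J \<inter> (\<lambda>t. cinv c (z t)) -` fst d) \<subseteq> snd c ` (fst c \<inter> fst d)"
    proof
      fix y assume "y \<in> z ` (J \<inter> (\<lambda>t. cinv c (z t)) -` fst d)"
      then have y: "y \<in> cimg c" "cinv c y \<in> fst d" using z(2) by auto
      then have "y = snd c (cinv c y)" "cinv c y \<in> fst c \<inter> fst d"
        using chart_cinv[of y c] cinv_in[of y c] by auto
      then show "y \<in> snd c ` (fst c \<inter> fst d)" by (rule image_eqI)
    qed
    show "smooth_on (J \<inter> (\<lambda>t. cinv c (z t)) -` fst d) z"
      by (rule smooth_on_subset[OF z(1)]) auto
  qed
  then show ?thesis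
    unfolding smooth_curve_on_def o_def using J cont by (auto simp: split_beta)
qed

end

context affine_chart
begin

text \<open>The Christoffel symbols, packed as a bilinear map for every point of the chart
  ball.\<close>

definition "\<Gamma> x u v = coord (N (E u) (E v) (cinv c x))"

lemma N_E_eq: "q \<in> Q \<Longrightarrow> N (E u) (E v) q = tvec c q (\<Gamma> (snd c q) u v)"
  unfolding \<Gamma>_def using tangent_eq[OF _ vf_tangent[OF N_vf[OF E_vf E_vf]]] cinv_chart[OF c Q_sub] by simp

text \<open>The velocity applied to \<open>f\<close> is expanded in the coordinate frame. In its
  derivative, the terms with the derivative of \<open>v\<close> give minus the covariant derivative
  of the field \<open>E (v t)\<close> along itself, and the others give its second derivative of
  \<open>f\<close>; together they are the Hessian.\<close>

lemma gcurve_chartI: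
  assumes J: "open J" and z: "smooth_on J z" "\<And>t. t \<in> J \<Longrightarrow> z t \<in> ball x0 r"
    and dz: "\<And>t. t \<in> J \<Longrightarrow> (z has_vector_derivative v t) (at t)"
    and dv: "\<And>t. t \<in> J \<Longrightarrow> (v has_vector_derivative - \<Gamma> (z t) (v t) (v t)) (at t)"
  shows "gcurve N J (\<lambda>t. cinv c (z t))"
proof -
  let ?g = "\<lambda>t. cinv c (z t)"
  have g: "smooth_curve_on A J ?g"
    by (rule smooth_curve_chartI[OF c J z(1)]) (use z(2) ball_cimg in blast)
  have gQ: "?g t \<in> Q" if "t \<in> J" for t using cinv_Q z(2) that by blast
  have sg: "snd c (?g t) = z t" if "t \<in> J" for t using chart_cinv[OF ball_cimg[OF z(2)[OF that]]] .
  have vel: "velocity A ?g t = tvec c (?g t) (v t)" if t: "t \<in> J" for t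
  proof
    fix f show "velocity A ?g t f = tvec c (?g t) (v t) f"
    proof (cases "smooth_fun A f")
      case f: True
      have "((\<lambda>x. f (cinv c x)) has_derivative (\<lambda>v. tvec c (?g t) v f)) (at (z t))"
        using smooth_fun_has_derivative[OF c Q_sub[OF gQ[OF t]] f] sg[OF t] by simp
      with dz[OF t, unfolded has_vector_derivative_def]
      have "((\<lambda>s. f (?g s)) has_derivative (\<lambda>h. tvec c (?g t) (h *\<^sub>R v t) f)) (at t)"
        by (rule has_derivative_compose)
      then have "((\<lambda>s. f (?g s)) has_real_derivative tvec c (?g t) (v t) f) (at t)"
        unfolding has_field_derivative_def
        by (rule has_derivative_eq_rhs) (simp add: fun_eq_iff linear_scale[OF tvec_linear[OF c Q_sub[OF gQ[OF t]]]] mult.commute)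
      then show ?thesis using velocity_DERIV[OF g f t] DERIV_unique by blast
    qed (simp add: velocity_def tvec_def)
  qed
  have "geodesic_at N ?g t" if t: "t \<in> J" for t
    unfolding geodesic_at_def
  proof (intro allI impI)
    fix f assume f: "smooth_fun A f"
    let ?p = "?g t" and ?E = "E (v t)"
    have p: "?p \<in> Q" using gQ t by blast
    have Ef: "smooth_fun A (\<lambda>q. E e q f)" for e by (rule vf_smooth[OF E_vf f])
    have exp1: "tvec c q u f = (\<Sum>k\<in>Basis. (u \<bullet> k) * E k q f)" if "q \<in> Q" for q u
      using tangent_expand[OF that tvec_in[OF c Q_sub[OF that]], of u f] by (simp add: tvec_X[OF that])
    have eq: "(\<Sum>k\<in>Basis. (v s \<bullet> k) * E k (?g s) f) = deriv (\<lambda>s. f (?g s)) s" if "s \<in> J" for s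
      using fun_cong[OF vel[OF that], of f] exp1[OF gQ[OF that], of "v s"] f by (simp add: velocity_def)
    have d: "((\<lambda>s. \<Sum>k\<in>Basis. (v s \<bullet> k) * E k (?g s) f) has_real_derivative
       (\<Sum>k\<in>Basis. (- \<Gamma> (z t) (v t) (v t) \<bullet> k) * E k ?p f + velocity A ?g t (\<lambda>q. E k q f) * (v t \<bullet> k))) (at t)"
    proof (intro DERIV_sum DERIV_mult velocity_DERIV[OF g Ef t])
      fix k :: "real ^ 'n"
      have "((\<lambda>s. v s \<bullet> k) has_derivative (\<lambda>h. (h *\<^sub>R (- \<Gamma> (z t) (v t) (v t))) \<bullet> k)) (at t)"
        using dv[OF t] unfolding has_vector_derivative_def by (rule has_derivative_inner_left)
      then show "((\<lambda>s. v s \<bullet> k) has_real_derivative - \<Gamma> (z t) (v t) (v t) \<bullet> k) (at t)"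
        unfolding has_field_derivative_def by (rule has_derivative_eq_rhs) (auto simp: fun_eq_iff)
    qed
    have "(deriv (\<lambda>s. f (?g s)) has_real_derivative
       (\<Sum>k\<in>Basis. (- \<Gamma> (z t) (v t) (v t) \<bullet> k) * E k ?p f + velocity A ?g t (\<lambda>q. E k q f) * (v t \<bullet> k))) (at t)"
      by (rule has_field_derivative_transform_within_open[OF d J t]) (simp add: eq)
    then have "deriv (deriv (\<lambda>s. f (?g s))) t =
       (\<Sum>k\<in>Basis. (- \<Gamma> (z t) (v t) (v t) \<bullet> k) * E k ?p f + velocity A ?g t (\<lambda>q. E k q f) * (v t \<bullet> k))"
      by (rule DERIV_imp_deriv)
    also have "\<dots> = (\<Sum>k\<in>Basis. velocity A ?g t (\<lambda>q. E k q f) * (v t \<bullet> k)) - tvec c ?p (\<Gamma> (z t) (v t) (v t)) f"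
      by (simp add: exp1[OF p] sum_subtractf)
    also have "tvec c ?p (\<Gamma> (z t) (v t) (v t)) f = N ?E ?E ?p f"
      using N_E_eq[OF p] sg[OF t] by simp
    also have "(\<Sum>k\<in>Basis. velocity A ?g t (\<lambda>q. E k q f) * (v t \<bullet> k)) = ?E ?p (\<lambda>q. ?E q f)"
    proof -
      have vE: "velocity A ?g t = ?E ?p" using vel[OF t] E_eq[OF p] by simp
      note Ep = vf_tangent[OF E_vf, of "v t" ?p]
      have eq: "?E q f = (\<Sum>k\<in>Basis. (v t \<bullet> k) * E k q f)" if "q \<in> Q" for q
        using exp1[OF that, of "v t"] fun_cong[OF E_eq[OF that, of "v t"], of f] by (simp only:)
      have "?E ?p (\<lambda>q. ?E q f) = ?E ?p (\<lambda>q. \<Sum>k\<in>Basis. (v t \<bullet> k) * E k q f)"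
        by (rule tangent_local[OF Ep Ef _ Q_open p eq]) (intro smooth_fun_intros Ef)
      also have "\<dots> = (\<Sum>k\<in>Basis. ?E ?p (\<lambda>q. (v t \<bullet> k) * E k q f))"
        by (rule tangent_sum[OF Ep]) (auto intro!: smooth_fun_intros Ef)
      also have "\<dots> = (\<Sum>k\<in>Basis. velocity A ?g t (\<lambda>q. E k q f) * (v t \<bullet> k))"
        by (simp add: tangent_scale[OF Ep Ef] vE mult.commute)
      finally show ?thesis by simp
    qed
    also have "?E ?p (\<lambda>q. ?E q f) - N ?E ?E ?p f = hess N ?p (velocity A ?g t) (velocity A ?g t) f"
      using hess_eq[OF E_vf E_vf f, of ?p "v t" "v t"] vel[OF t] E_eq[OF p, of "v t"] by (simp add: hess_fields_def)
    finally show "deriv (deriv (\<lambda>s. f (?g s))) t = hess N ?p (velocity A ?g t) (velocity A ?g t) f" .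
  qed
  with g show ?thesis by (simp add: gcurve_def)
qed

end

section \<open>Short geodesics in a chart\<close>

subsection \<open>Bounds for families of bilinear maps\<close>

lemma bilinear_expansion:
  fixes B :: "'a::euclidean_space \<Rightarrow> 'a \<Rightarrow> 'b::real_vector"
  assumes "\<And>w. linear (\<lambda>v. B v w)" "\<And>v. linear (B v)"
  shows "B v w = (\<Sum>e\<in>Basis. \<Sum>f\<in>Basis. ((v \<bullet> e) * (w \<bullet> f)) *\<^sub>R B e f)"
proof -
  have "B v w = (\<Sum>e\<in>Basis. (v \<bullet> e) *\<^sub>R B e w)" by (rule linear_euclidean_expansion[OF assms(1)])
  also have "\<dots> = (\<Sum>e\<in>Basis. (v \<bullet> e) *\<^sub>R (\<Sum>f\<in>Basis. (w \<bullet> f) *\<^sub>R B e f))"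
    using linear_euclidean_expansion[OF assms(2)] by metis
  finally show ?thesis by (simp add: scaleR_sum_right)
qed

lemma bilinear_norm_le:
  fixes B :: "'a::euclidean_space \<Rightarrow> 'a \<Rightarrow> 'b::real_normed_vector"
  assumes "\<And>w. linear (\<lambda>v. B v w)" "\<And>v. linear (B v)"
    and M: "\<And>e f. e \<in> Basis \<Longrightarrow> f \<in> Basis \<Longrightarrow> norm (B e f) \<le> M e f"
  shows "norm (B v w) \<le> (\<Sum>e\<in>Basis. \<Sum>f\<in>Basis. M e f) * norm v * norm w"
proof -
  have "norm (B v w) \<le> (\<Sum>e\<in>Basis. \<Sum>f\<in>Basis. norm (((v \<bullet> e) * (w \<bullet> f)) *\<^sub>R B e f))"
    unfolding bilinear_expansion[OF assms(1,2), of v w] by (intro order_trans[OF norm_sum] sum_mono norm_sum)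
  also have "\<dots> \<le> (\<Sum>e\<in>Basis. \<Sum>f\<in>Basis. (norm v * norm w) * M e f)"
  proof (intro sum_mono)
    fix e f :: 'a assume "e \<in> Basis" "f \<in> Basis"
    then show "norm (((v \<bullet> e) * (w \<bullet> f)) *\<^sub>R B e f) \<le> (norm v * norm w) * M e f"
      unfolding norm_scaleR real_norm_def abs_mult
      by (intro mult_mono Basis_le_norm M mult_nonneg_nonneg) auto
  qed
  also have "\<dots> = (\<Sum>e\<in>Basis. \<Sum>f\<in>Basis. M e f) * norm v * norm w"
    by (simp add: sum_distrib_left[symmetric] algebra_simps)
  finally show ?thesis .
qed

lemma smooth_on_bounded_cball:
  fixes F :: "'a::euclidean_space \<Rightarrow> 'b::real_normed_vector"
  assumes "continuous_on (cball x0 r) F"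
  obtains M where "M \<ge> 0" "\<And>x. x \<in> cball x0 r \<Longrightarrow> norm (F x) \<le> M"
proof -
  have "bounded (F ` cball x0 r)" by (intro compact_imp_bounded compact_continuous_image assms compact_cball)
  then obtain M where "\<forall>x\<in>cball x0 r. norm (F x) \<le> M" by (auto simp: bounded_iff)
  then show ?thesis using that[of "max M 0"] by fastforce
qed

lemma smooth_on_lipschitz:
  fixes F :: "'a::euclidean_space \<Rightarrow> 'b::real_normed_vector"
  assumes F: "smooth_on (ball x0 R) F" and r: "r < R"
  obtains L where "L \<ge> 0" "\<And>x y. x \<in> cball x0 r \<Longrightarrow> y \<in> cball x0 r \<Longrightarrow> norm (F x - F y) \<le> L * norm (x - y)"
proof -
  let ?D = "\<lambda>x. frechet_derivative F (at x)"
  have sub: "cball x0 r \<subseteq> ball x0 R" using r by auto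
  have "\<exists>M. \<forall>x\<in>cball x0 r. norm (?D x e) \<le> M" for e
  proof -
    obtain M where "\<And>x. x \<in> cball x0 r \<Longrightarrow> norm (?D x e) \<le> M"
      by (rule smooth_on_bounded_cball[OF continuous_on_subset[OF smooth_on_imp_continuous_on[OF smooth_on_frechet_derivative[OF F]] sub]]) blast
    then show ?thesis by blast
  qed
  then obtain M where M: "\<And>x e. x \<in> cball x0 r \<Longrightarrow> norm (?D x e) \<le> M e" by metis
  define L where "L = (\<Sum>e\<in>Basis. \<bar>M e\<bar>)"
  have "onorm (?D x) \<le> L" if x: "x \<in> cball x0 r" for x
  proof (rule onorm_bound)
    have "linear (?D x)" using smooth_on_has_derivative[OF F, of x] x sub has_derivative_linear by blast
    then show "norm (?D x v) \<le> L * norm v" for v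
    proof -
      have "norm (?D x v) \<le> (\<Sum>e\<in>Basis. norm ((v \<bullet> e) *\<^sub>R ?D x e))"
        unfolding linear_euclidean_expansion[OF \<open>linear (?D x)\<close>, of v] by (rule norm_sum)
      also have "\<dots> \<le> (\<Sum>e\<in>Basis. norm v * \<bar>M e\<bar>)"
      proof (intro sum_mono)
        fix e :: 'a assume "e \<in> Basis"
        then show "norm ((v \<bullet> e) *\<^sub>R ?D x e) \<le> norm v * \<bar>M e\<bar>"
          unfolding norm_scaleR real_norm_def using M[OF x, of e] by (intro mult_mono Basis_le_norm) auto
      qed
      also have "\<dots> = L * norm v" by (simp add: L_def sum_distrib_left mult.commute)
      finally show ?thesis .
    qed
  qed (auto simp: L_def sum_nonneg)
  note on = this
  have "norm (F x - F y) \<le> L * norm (x - y)" if "x \<in> cball x0 r" "y \<in> cball x0 r" for x y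
    by (rule differentiable_bound[OF convex_cball has_derivative_at_withinI[OF smooth_on_has_derivative[OF F]] on that])
       (use sub in auto)
  then show ?thesis by (intro that[of L]) (auto simp: L_def sum_nonneg)
qed

lemma bilinear_family_bounds:
  fixes B :: "'a::euclidean_space \<Rightarrow> 'a \<Rightarrow> 'a \<Rightarrow> 'b::real_normed_vector"
  assumes lin: "\<And>x w. x \<in> ball x0 R \<Longrightarrow> linear (\<lambda>v. B x v w)" "\<And>x v. x \<in> ball x0 R \<Longrightarrow> linear (B x v)"
    and smooth: "\<And>v w. smooth_on (ball x0 R) (\<lambda>x. B x v w)" and r: "r < R"
  obtains K where "K \<ge> 0" "\<And>x v w. x \<in> cball x0 r \<Longrightarrow> norm (B x v w) \<le> K * norm v * norm w"
    "\<And>x y v w. x \<in> cball x0 r \<Longrightarrow> y \<in> cball x0 r \<Longrightarrow> norm (B x v w - B y v w) \<le> K * norm (x - y) * norm v * norm w"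
proof -
  have sub: "cball x0 r \<subseteq> ball x0 R" using r by auto
  have "\<exists>M. M \<ge> 0 \<and> (\<forall>x\<in>cball x0 r. norm (B x v w) \<le> M)" for v w
    by (rule smooth_on_bounded_cball[OF continuous_on_subset[OF smooth_on_imp_continuous_on[OF smooth[of v w]] sub]]) blast
  then obtain M where M: "\<And>v w. M v w \<ge> 0" "\<And>x v w. x \<in> cball x0 r \<Longrightarrow> norm (B x v w) \<le> M v w" by metis
  have "\<exists>L. L \<ge> 0 \<and> (\<forall>x\<in>cball x0 r. \<forall>y\<in>cball x0 r. norm (B x v w - B y v w) \<le> L * norm (x - y))" for v w
    by (rule smooth_on_lipschitz[OF smooth r]) blast
  then obtain L where L: "\<And>v w. L v w \<ge> 0"
    "\<And>x y v w. x \<in> cball x0 r \<Longrightarrow> y \<in> cball x0 r \<Longrightarrow> norm (B x v w - B y v w) \<le> L v w * norm (x - y)" by metis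
  define KM where "KM = (\<Sum>e\<in>Basis. \<Sum>f\<in>Basis. M e f)"
  define KL where "KL = (\<Sum>e\<in>Basis. \<Sum>f\<in>Basis. L e f)"
  have pos: "KM \<ge> 0" "KL \<ge> 0" using M L by (auto simp: KM_def KL_def intro!: sum_nonneg)
  show ?thesis
  proof (rule that[of "KM + KL"])
    show "KM + KL \<ge> 0" using pos by simp
    fix x v w assume x: "x \<in> cball x0 r"
    then have xb: "x \<in> ball x0 R" using sub by blast
    have "norm (B x v w) \<le> KM * norm v * norm w"
      unfolding KM_def by (rule bilinear_norm_le[OF lin[OF xb]]) (rule M(2)[OF x])
    also have "\<dots> \<le> (KM + KL) * norm v * norm w"
      using pos by (intro mult_right_mono) auto
    finally show "norm (B x v w) \<le> (KM + KL) * norm v * norm w" .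
    fix y assume y: "y \<in> cball x0 r"
    then have yb: "y \<in> ball x0 R" using sub by blast
    have "norm (B x v w - B y v w) \<le> (\<Sum>e\<in>Basis. \<Sum>f\<in>Basis. L e f * norm (x - y)) * norm v * norm w"
      by (rule bilinear_norm_le[where B = "\<lambda>v w. B x v w - B y v w"])
         (auto intro!: linear_compose_sub lin xb yb L(2) x y)
    also have "\<dots> = KL * norm (x - y) * norm v * norm w" by (simp add: KL_def sum_distrib_right)
    also have "\<dots> \<le> (KM + KL) * norm (x - y) * norm v * norm w"
      using pos by (intro mult_right_mono) auto
    finally show "norm (B x v w - B y v w) \<le> (KM + KL) * norm (x - y) * norm v * norm w" .
  qed
qed

text \<open>The coordinate picture detached from the manifold: \<open>H\<close> holds the metric
  coefficients and \<open>\<Gamma>\<close> the Christoffel symbols. \<open>compat\<close> says that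
  the connection preserves the metric, solved for the derivative of \<open>H\<close>.\<close>

locale local_geometry =
  fixes x0 :: "'a::euclidean_space" and R :: real
    and H :: "'a \<Rightarrow> 'a \<Rightarrow> 'a \<Rightarrow> real" and \<Gamma> :: "'a \<Rightarrow> 'a \<Rightarrow> 'a \<Rightarrow> 'a"
  assumes R: "R > 0"
    and H_lin: "\<And>x v. x \<in> ball x0 R \<Longrightarrow> linear (H x v)"
    and H_sym: "\<And>x v w. x \<in> ball x0 R \<Longrightarrow> H x v w = H x w v"
    and H_pos: "\<And>x v. x \<in> ball x0 R \<Longrightarrow> v \<noteq> 0 \<Longrightarrow> H x v v > 0"
    and \<Gamma>_lin: "\<And>x v. x \<in> ball x0 R \<Longrightarrow> linear (\<Gamma> x v)"
    and \<Gamma>_sym: "\<And>x v w. x \<in> ball x0 R \<Longrightarrow> \<Gamma> x v w = \<Gamma> x w v"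
    and H_smooth: "\<And>v w. smooth_on (ball x0 R) (\<lambda>x. H x v w)"
    and \<Gamma>_smooth: "\<And>v w. smooth_on (ball x0 R) (\<lambda>x. \<Gamma> x v w)"
    and compat: "\<And>x v w. x \<in> ball x0 R \<Longrightarrow>
      ((\<lambda>x. H x v w) has_derivative (\<lambda>u. H x (\<Gamma> x u v) w + H x v (\<Gamma> x u w))) (at x)"
begin

lemma H_lin1: "x \<in> ball x0 R \<Longrightarrow> linear (\<lambda>v. H x v w)"
proof -
  assume x: "x \<in> ball x0 R"
  have "(\<lambda>v. H x v w) = H x w" using H_sym[OF x] by blast
  then show ?thesis using H_lin[OF x] by simp
qed

lemma \<Gamma>_lin1: "x \<in> ball x0 R \<Longrightarrow> linear (\<lambda>v. \<Gamma> x v w)"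
proof -
  assume x: "x \<in> ball x0 R"
  have "(\<lambda>v. \<Gamma> x v w) = \<Gamma> x w" using \<Gamma>_sym[OF x] by blast
  then show ?thesis using \<Gamma>_lin[OF x] by simp
qed

text \<open>One constant \<open>K\<close> for all upper bounds keeps the later estimates short. The
  last bound is Taylor's: by \<open>compat\<close>, the linear term of \<open>H y v v\<close> at
  \<open>x\<close> is \<open>2 * H x (\<Gamma> x (y - x) v) v\<close>.\<close>

lemma ex_bounds:
  assumes r: "0 < r" "r < R"
  obtains K l where "K \<ge> 1" "l > 0"
    "\<And>x v. x \<in> cball x0 r \<Longrightarrow> l * (norm v)\<^sup>2 \<le> H x v v"
    "\<And>x v w. x \<in> cball x0 r \<Longrightarrow> \<bar>H x v w\<bar> \<le> K * norm v * norm w"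
    "\<And>x v w. x \<in> cball x0 r \<Longrightarrow> norm (\<Gamma> x v w) \<le> K * norm v * norm w"
    "\<And>x y v w. x \<in> cball x0 r \<Longrightarrow> y \<in> cball x0 r \<Longrightarrow> norm (\<Gamma> x v w - \<Gamma> y v w) \<le> K * norm (x - y) * norm v * norm w"
    "\<And>x y v w. x \<in> cball x0 r \<Longrightarrow> y \<in> cball x0 r \<Longrightarrow> \<bar>H x v w - H y v w\<bar> \<le> K * norm (x - y) * norm v * norm w"
    "\<And>x y v. x \<in> cball x0 r \<Longrightarrow> y \<in> cball x0 r \<Longrightarrow>
       \<bar>H y v v - H x v v - 2 * H x (\<Gamma> x (y - x) v) v\<bar> \<le> K * (norm (y - x))\<^sup>2 * (norm v)\<^sup>2"
proof -
  have sub: "cball x0 r \<subseteq> ball x0 R" using r by auto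
  obtain KH where KH: "KH \<ge> 0" "\<And>x v w. x \<in> cball x0 r \<Longrightarrow> norm (H x v w) \<le> KH * norm v * norm w"
    "\<And>x y v w. x \<in> cball x0 r \<Longrightarrow> y \<in> cball x0 r \<Longrightarrow> norm (H x v w - H y v w) \<le> KH * norm (x - y) * norm v * norm w"
    by (rule bilinear_family_bounds[of x0 R H r, OF H_lin1 H_lin H_smooth r(2)]) blast+
  obtain KG where KG: "KG \<ge> 0" "\<And>x v w. x \<in> cball x0 r \<Longrightarrow> norm (\<Gamma> x v w) \<le> KG * norm v * norm w"
    "\<And>x y v w. x \<in> cball x0 r \<Longrightarrow> y \<in> cball x0 r \<Longrightarrow> norm (\<Gamma> x v w - \<Gamma> y v w) \<le> KG * norm (x - y) * norm v * norm w"
    by (rule bilinear_family_bounds[of x0 R \<Gamma> r, OF \<Gamma>_lin1 \<Gamma>_lin \<Gamma>_smooth r(2)]) blast+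
  define C where "C = max KH KG"
  have C: "C \<ge> 0" "KH \<le> C" "KG \<le> C" using KH by (auto simp: C_def)
  have H_le: "\<bar>H x v w\<bar> \<le> C * norm v * norm w" if "x \<in> cball x0 r" for x v w
  proof -
    have "\<bar>H x v w\<bar> \<le> KH * norm v * norm w" using KH(2)[OF that] by simp
    also have "\<dots> \<le> C * norm v * norm w" using C by (intro mult_right_mono) auto
    finally show ?thesis .
  qed
  have G_le: "norm (\<Gamma> x v w) \<le> C * norm v * norm w" if "x \<in> cball x0 r" for x v w
  proof -
    have "norm (\<Gamma> x v w) \<le> KG * norm v * norm w" using KG(2)[OF that] by simp
    also have "\<dots> \<le> C * norm v * norm w" using C by (intro mult_right_mono) auto
    finally show ?thesis .
  qed
  have H_lip: "\<bar>H x v w - H y v w\<bar> \<le> C * norm (x - y) * norm v * norm w" if "x \<in> cball x0 r" "y \<in> cball x0 r" for x y v w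
  proof -
    have "\<bar>H x v w - H y v w\<bar> \<le> KH * norm (x - y) * norm v * norm w" using KH(3)[OF that] by simp
    also have "\<dots> \<le> C * norm (x - y) * norm v * norm w" using C by (intro mult_right_mono) auto
    finally show ?thesis .
  qed
  have G_lip: "norm (\<Gamma> x v w - \<Gamma> y v w) \<le> C * norm (x - y) * norm v * norm w" if "x \<in> cball x0 r" "y \<in> cball x0 r" for x y v w
  proof -
    have "norm (\<Gamma> x v w - \<Gamma> y v w) \<le> KG * norm (x - y) * norm v * norm w" using KG(3)[OF that] by simp
    also have "\<dots> \<le> C * norm (x - y) * norm v * norm w" using C by (intro mult_right_mono) auto
    finally show ?thesis .
  qed
  \<comment> \<open>The derivative is twice a composition of \<open>H\<close> and
    \<open>\<Gamma>\<close>, both bounded and Lipschitz with constant \<open>C\<close>; its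
    variation splits into two terms, hence \<open>4 * C\<^sup>2\<close>.\<close>
  have taylor: "\<bar>H y v v - H x v v - 2 * H x (\<Gamma> x (y - x) v) v\<bar> \<le> (4 * C\<^sup>2) * (norm (y - x))\<^sup>2 * (norm v)\<^sup>2"
    if x: "x \<in> cball x0 r" and y: "y \<in> cball x0 r" for x y v
  proof -
    let ?f' = "\<lambda>z u. 2 * H z (\<Gamma> z u v) v"
    let ?S = "closed_segment x y"
    have S: "?S \<subseteq> cball x0 r" using x y closed_segment_subset convex_cball by blast
    have "norm (H y v v - H x v v - ?f' x (y - x)) \<le> norm (y - x) * (4 * C\<^sup>2 * norm (y - x) * (norm v)\<^sup>2)"
    proof (rule differentiable_bound_linearization[where S = ?S and f' = ?f' and ?x0.0 = x])
      show "x + t *\<^sub>R (y - x) \<in> ?S" if "t \<in> {0..1}" for t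
        using that by (auto simp: closed_segment_def algebra_simps intro!: exI[of _ t])
      show "((\<lambda>x. H x v v) has_derivative ?f' z) (at z within ?S)" if "z \<in> ?S" for z
      proof -
        have z: "z \<in> ball x0 R" using that S sub by blast
        have "(\<lambda>u. H z (\<Gamma> z u v) v + H z v (\<Gamma> z u v)) = ?f' z"
          using H_sym[OF z, of v] by auto
        then show ?thesis using compat[OF z, of v v] has_derivative_at_withinI by metis
      qed
      show "onorm (?f' z - ?f' x) \<le> 4 * C\<^sup>2 * norm (y - x) * (norm v)\<^sup>2" if "z \<in> ?S" for z
      proof (rule onorm_bound)
        show "0 \<le> 4 * C\<^sup>2 * norm (y - x) * (norm v)\<^sup>2" by simp
        have z: "z \<in> cball x0 r" "z \<in> ball x0 R" using that S sub by auto
        have zx: "norm (z - x) \<le> norm (y - x)" using segment_bound1[OF that] .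
        fix u
        have "H z (\<Gamma> z u v) v - H x (\<Gamma> x u v) v = H z (\<Gamma> z u v - \<Gamma> x u v) v + (H z (\<Gamma> x u v) v - H x (\<Gamma> x u v) v)"
          using linear_diff[OF H_lin1[OF z(2)]] by simp
        then have "\<bar>H z (\<Gamma> z u v) v - H x (\<Gamma> x u v) v\<bar> \<le> \<bar>H z (\<Gamma> z u v - \<Gamma> x u v) v\<bar> + \<bar>H z (\<Gamma> x u v) v - H x (\<Gamma> x u v) v\<bar>"
          by (simp add: abs_triangle_ineq)
        also have "\<dots> \<le> C * norm (\<Gamma> z u v - \<Gamma> x u v) * norm v + C * norm (z - x) * norm (\<Gamma> x u v) * norm v"
          by (intro add_mono H_le H_lip z x)
        also have "\<dots> \<le> C * (C * norm (z - x) * norm u * norm v) * norm v + C * norm (z - x) * (C * norm u * norm v) * norm v"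
          using C by (intro add_mono mult_right_mono mult_left_mono G_lip G_le z x) auto
        also have "\<dots> = (2 * C\<^sup>2 * norm u * (norm v)\<^sup>2) * norm (z - x)" by (simp add: power2_eq_square algebra_simps)
        also have "\<dots> \<le> (2 * C\<^sup>2 * norm u * (norm v)\<^sup>2) * norm (y - x)" by (intro mult_left_mono zx) auto
        finally show "norm ((?f' z - ?f' x) u) \<le> 4 * C\<^sup>2 * norm (y - x) * (norm v)\<^sup>2 * norm u"
          by (simp add: algebra_simps)
      qed
      show "x \<in> ?S" by simp
    qed
    then show ?thesis by (simp add: power2_eq_square algebra_simps)
  qed
  obtain l where l: "l > 0" "\<And>x v. x \<in> cball x0 r \<Longrightarrow> l * (norm v)\<^sup>2 \<le> H x v v"
  proof (cases "(\<exists>v::'a. v \<noteq> 0)")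
    case False
    then show ?thesis using H_lin R r sub by (intro that[of 1]) (auto simp: linear_0)
  next
    case True
    \<comment> \<open>By homogeneity \<open>l\<close> may be taken as the minimum over unit vectors,
      which is positive by compactness.\<close>
    let ?D = "cball x0 r \<times> sphere (0::'a) 1"
    have "continuous_on ?D (\<lambda>p. \<Sum>e\<in>Basis. \<Sum>f\<in>Basis. ((snd p \<bullet> e) * (snd p \<bullet> f)) *\<^sub>R H (fst p) e f)"
      by (intro continuous_intros continuous_on_compose2[OF smooth_on_imp_continuous_on[OF H_smooth]]) (use sub in auto)
    moreover have "(\<Sum>e\<in>Basis. \<Sum>f\<in>Basis. ((snd p \<bullet> e) * (snd p \<bullet> f)) *\<^sub>R H (fst p) e f) = H (fst p) (snd p) (snd p)" if "p \<in> ?D" for p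
      using bilinear_expansion[OF H_lin1 H_lin, of "fst p" "snd p" "snd p"] that sub by auto
    ultimately have cont: "continuous_on ?D (\<lambda>p. H (fst p) (snd p) (snd p))"
      using continuous_on_cong by (metis (no_types, lifting))
    obtain v :: 'a where v: "v \<noteq> 0" using True by blast
    then have "(x0, v /\<^sub>R norm v) \<in> ?D" using r by simp
    then obtain p where p: "p \<in> ?D" "\<forall>q\<in>?D. H (fst p) (snd p) (snd p) \<le> H (fst q) (snd q) (snd q)"
      using continuous_attains_inf[OF compact_Times[OF compact_cball compact_sphere] _ cont] by blast
    define l where "l = H (fst p) (snd p) (snd p)"
    have "snd p \<noteq> 0" using p(1) by auto
    then have "l > 0" unfolding l_def using p(1) sub by (intro H_pos) auto
    moreover have "l * (norm v)\<^sup>2 \<le> H x v v" if x: "x \<in> cball x0 r" for x v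
    proof (cases "v = 0")
      case True
      then show ?thesis using linear_0[OF H_lin[of x 0]] x sub by auto
    next
      case False
      let ?u = "v /\<^sub>R norm v"
      have xb: "x \<in> ball x0 R" using x sub by blast
      have "(x, ?u) \<in> ?D" using x False by simp
      then have "l \<le> H x ?u ?u" using p(2) by (auto simp: l_def)
      also have "H x ?u ?u = H x v v / (norm v)\<^sup>2"
        by (simp add: linear_scale[OF H_lin[OF xb]] linear_scale[OF H_lin1[OF xb]] power2_eq_square divide_inverse)
      finally show ?thesis using False by (simp add: field_simps)
    qed
    ultimately show ?thesis using that by blast
  qed
  define K where "K = 1 + C + 4 * C\<^sup>2"
  have K: "K \<ge> 1" "C \<le> K" "4 * C\<^sup>2 \<le> K" using C by (auto simp: K_def)
  show ?thesis
  proof (rule that)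
    show "K \<ge> 1" "l > 0" by (fact K l)+
    show "l * (norm v)\<^sup>2 \<le> H x v v" if "x \<in> cball x0 r" for x v by (rule l(2)[OF that])
  next
    fix x y v w :: 'a assume x: "x \<in> cball x0 r"
    have up: "C * norm v * norm w \<le> K * norm v * norm w" using K by (intro mult_right_mono) auto
    show "\<bar>H x v w\<bar> \<le> K * norm v * norm w" using H_le[OF x] up by (rule order_trans)
    show "norm (\<Gamma> x v w) \<le> K * norm v * norm w" using G_le[OF x] up by (rule order_trans)
    assume y: "y \<in> cball x0 r"
    have up2: "C * norm (x - y) * norm v * norm w \<le> K * norm (x - y) * norm v * norm w" using K by (intro mult_right_mono) auto
    show "norm (\<Gamma> x v w - \<Gamma> y v w) \<le> K * norm (x - y) * norm v * norm w" using G_lip[OF x y] up2 by (rule order_trans)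
    show "\<bar>H x v w - H y v w\<bar> \<le> K * norm (x - y) * norm v * norm w" using H_lip[OF x y] up2 by (rule order_trans)
    have "(4 * C\<^sup>2) * (norm (y - x))\<^sup>2 * (norm v)\<^sup>2 \<le> K * (norm (y - x))\<^sup>2 * (norm v)\<^sup>2" using K by (intro mult_right_mono) auto
    with taylor[OF x y] show "\<bar>H y v v - H x v v - 2 * H x (\<Gamma> x (y - x) v) v\<bar> \<le> K * (norm (y - x))\<^sup>2 * (norm v)\<^sup>2" by (rule order_trans)
  qed
qed

lemma H_has_derivative:
  assumes x: "(x has_vector_derivative v) (at t within S)" and p: "(p has_vector_derivative p') (at t within S)"
    and q: "(q has_vector_derivative q') (at t within S)" and xt: "x t \<in> ball x0 R" and tS: "t \<in> S"
  shows "((\<lambda>t. H (x t) (p t) (q t)) has_real_derivative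
    (H (x t) (\<Gamma> (x t) v (p t)) (q t) + H (x t) (p t) (\<Gamma> (x t) v (q t)) + H (x t) p' (q t) + H (x t) (p t) q')) (at t within S)"
proof -
  let ?x = "x t"
  note lin = H_lin1[OF xt] H_lin[OF xt]
  have ip: "((\<lambda>t. p t \<bullet> e) has_real_derivative p' \<bullet> e) (at t within S)" for e
    using bounded_linear.has_vector_derivative[OF bounded_linear_inner_left p]
    by (simp add: has_real_derivative_iff_has_vector_derivative)
  have iq: "((\<lambda>t. q t \<bullet> e) has_real_derivative q' \<bullet> e) (at t within S)" for e
    using bounded_linear.has_vector_derivative[OF bounded_linear_inner_left q]
    by (simp add: has_real_derivative_iff_has_vector_derivative)
  have iH: "((\<lambda>t. H (x t) e f) has_real_derivative (H ?x (\<Gamma> ?x v e) f + H ?x e (\<Gamma> ?x v f))) (at t within S)" for e f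
  proof -
    have lin': "linear (\<lambda>u. H ?x (\<Gamma> ?x u e) f + H ?x e (\<Gamma> ?x u f))"
      using compat[OF xt] has_derivative_linear by blast
    have "((\<lambda>t. H (x t) e f) has_derivative (\<lambda>h. H ?x (\<Gamma> ?x (h *\<^sub>R v) e) f + H ?x e (\<Gamma> ?x (h *\<^sub>R v) f))) (at t within S)"
      using has_derivative_compose[OF x[unfolded has_vector_derivative_def] compat[OF xt, of e f]] .
    then show ?thesis
      unfolding has_field_derivative_def
      by (rule has_derivative_eq_rhs) (use linear_scale[OF lin'] in \<open>auto simp: fun_eq_iff algebra_simps\<close>)
  qed
  \<comment> \<open>\<open>compat\<close> differentiates \<open>H\<close> only for fixed arguments,
    so the moving arguments are expanded in the basis and reassembled afterwards.\<close>
  let ?E = "\<lambda>t. \<Sum>e\<in>Basis. \<Sum>f\<in>Basis. (p t \<bullet> e) * (q t \<bullet> f) * H (x t) e f"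
  have d: "(?E has_real_derivative (\<Sum>e\<in>Basis. \<Sum>f\<in>Basis.
      ((p' \<bullet> e) * (q t \<bullet> f) + (q' \<bullet> f) * (p t \<bullet> e)) * H ?x e f
       + (H ?x (\<Gamma> ?x v e) f + H ?x e (\<Gamma> ?x v f)) * ((p t \<bullet> e) * (q t \<bullet> f)))) (at t within S)"
    by (intro DERIV_sum DERIV_mult ip iq iH)
  have e0: "H ?x a b = (\<Sum>e\<in>Basis. \<Sum>f\<in>Basis. (a \<bullet> e) * (b \<bullet> f) * H ?x e f)" for a b
    using bilinear_expansion[OF lin, of a b] by simp
  have e1: "H ?x (\<Gamma> ?x v a) b = (\<Sum>e\<in>Basis. \<Sum>f\<in>Basis. (a \<bullet> e) * (b \<bullet> f) * H ?x (\<Gamma> ?x v e) f)" for a b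
    using bilinear_expansion[of "\<lambda>a b. H ?x (\<Gamma> ?x v a) b" a b] lin linear_compose[OF \<Gamma>_lin[OF xt] lin(1)]
    by (simp add: o_def)
  have e2: "H ?x a (\<Gamma> ?x v b) = (\<Sum>e\<in>Basis. \<Sum>f\<in>Basis. (a \<bullet> e) * (b \<bullet> f) * H ?x e (\<Gamma> ?x v f))" for a b
    using bilinear_expansion[of "\<lambda>a b. H ?x a (\<Gamma> ?x v b)" a b] lin linear_compose[OF \<Gamma>_lin[OF xt] lin(2)]
    by (simp add: o_def)
  have D: "(\<Sum>e\<in>Basis. \<Sum>f\<in>Basis.
      ((p' \<bullet> e) * (q t \<bullet> f) + (q' \<bullet> f) * (p t \<bullet> e)) * H ?x e f
       + (H ?x (\<Gamma> ?x v e) f + H ?x e (\<Gamma> ?x v f)) * ((p t \<bullet> e) * (q t \<bullet> f)))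
     = H ?x (\<Gamma> ?x v (p t)) (q t) + H ?x (p t) (\<Gamma> ?x v (q t)) + H ?x p' (q t) + H ?x (p t) q'"
    unfolding e1[of "p t" "q t"] e2[of "p t" "q t"] e0[of p' "q t"] e0[of "p t" q']
    unfolding sum.distrib[symmetric] by (intro sum.cong refl) (simp add: algebra_simps)
  have nh: "\<forall>\<^sub>F s in at t within S. ?E s = H (x s) (p s) (q s)"
  proof -
    have "((\<lambda>s. x s) \<longlongrightarrow> x t) (at t within S)"
      using has_vector_derivative_continuous[OF x] by (simp add: continuous_within)
    then have "\<forall>\<^sub>F s in at t within S. x s \<in> ball x0 R"
      using xt topological_tendstoD open_ball by blast
    then show ?thesis
    proof eventually_elim
      case (elim s)
      show ?case using bilinear_expansion[OF H_lin1[OF elim] H_lin[OF elim], of "p s" "q s"] by simp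
    qed
  qed
  have "((\<lambda>t. H (x t) (p t) (q t)) has_derivative (*) (\<Sum>e\<in>Basis. \<Sum>f\<in>Basis.
      ((p' \<bullet> e) * (q t \<bullet> f) + (q' \<bullet> f) * (p t \<bullet> e)) * H ?x e f
       + (H ?x (\<Gamma> ?x v e) f + H ?x e (\<Gamma> ?x v f)) * ((p t \<bullet> e) * (q t \<bullet> f)))) (at t within S)"
    by (rule has_derivative_transform_eventually[OF d[unfolded has_field_derivative_def] nh _ tS])
       (simp only: e0[of "p t" "q t"])
  then show ?thesis unfolding D has_field_derivative_def .
qed

lemma H_Cauchy_Schwarz:
  assumes x: "x \<in> ball x0 R"
  shows "H x v w \<le> sqrt (H x v v) * sqrt (H x w w)"
proof (cases "w = 0")
  case True
  then show ?thesis using linear_0[OF H_lin[OF x]] by simp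
next
  case False
  note lin = linear_diff[OF H_lin[OF x]] linear_diff[OF H_lin1[OF x]] linear_scale[OF H_lin[OF x]] linear_scale[OF H_lin1[OF x]]
  have nonneg: "H x u u \<ge> 0" for u
    using H_pos[OF x, of u] linear_0[OF H_lin[OF x]] by (cases "u = 0") auto
  have W: "H x w w > 0" using H_pos[OF x False] .
  define s where "s = H x v w / H x w w"
  have "0 \<le> H x (v - s *\<^sub>R w) (v - s *\<^sub>R w)" by (rule nonneg)
  also have "\<dots> = H x v v - (H x v w)\<^sup>2 / H x w w"
    using W H_sym[OF x, of w v] by (simp add: lin s_def power2_eq_square field_simps)
  finally have "(H x v w)\<^sup>2 \<le> H x v v * H x w w" using W by (simp add: field_simps)
  then have "\<bar>H x v w\<bar> \<le> sqrt (H x v v * H x w w)" using real_le_rsqrt by (metis real_sqrt_abs real_sqrt_le_iff)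
  then show ?thesis by (simp add: real_sqrt_mult)
qed

end

subsection \<open>The boundary value problem\<close>

lemma has_vector_derivative_bound:
  fixes f :: "real \<Rightarrow> 'a::real_normed_vector"
  assumes d: "\<And>t. t \<in> {A..B} \<Longrightarrow> (f has_vector_derivative f' t) (at t within {A..B})"
    and M: "\<And>t. t \<in> {A..B} \<Longrightarrow> norm (f' t) \<le> M" and st: "s \<in> {A..B}" "t \<in> {A..B}"
  shows "norm (f s - f t) \<le> M * \<bar>s - t\<bar>"
proof -
  have "norm (f s - f t) \<le> M * norm (s - t)"
  proof (rule differentiable_bound[OF _ d[unfolded has_vector_derivative_def] _ st])
    show "onorm (\<lambda>h. h *\<^sub>R f' u) \<le> M" if "u \<in> {A..B}" for u
    proof (rule onorm_bound)
      show "0 \<le> M" using M[OF that] norm_ge_zero order_trans by blast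
      show "norm (h *\<^sub>R f' u) \<le> M * norm h" for h
        using mult_right_mono[OF M[OF that], of "\<bar>h\<bar>"] by (simp add: mult.commute)
    qed
  qed auto
  then show ?thesis by simp
qed

lemma mean_value_le:
  fixes f :: "real \<Rightarrow> real"
  assumes "a \<le> b" and d: "\<And>t. t \<in> {a..b} \<Longrightarrow> (f has_real_derivative f' t) (at t within {a..b})"
    and c: "\<And>t. t \<in> {a..b} \<Longrightarrow> f' t \<le> c"
  shows "f b - f a \<le> c * (b - a)"
proof -
  obtain t where t: "t \<in> {a..b}" "f b - f a = f' t * (b - a)"
    using mvt_very_simple[OF \<open>a \<le> b\<close>, of f "\<lambda>t. (*) (f' t)"] d unfolding has_field_derivative_def by auto
  then show ?thesis using c[OF t(1)] \<open>a \<le> b\<close> by (simp add: mult_right_mono)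
qed

text \<open>All estimates hold on the closed ball of radius \<open>R1\<close>. The conditions on
  \<open>\<rho>\<close> have separate purposes: \<open>200 * K * \<rho> \<le> 1\<close> makes the
  map of \<open>ex_geo\<close> a contraction and keeps velocities below \<open>1\<close>,
  \<open>64 * K * \<rho> \<le> l\<close> lets the positive term of the energy beat the error terms
  in \<open>Phi_convexity\<close>, and \<open>20 * \<rho> \<le> R1\<close> leaves room for curves
  that stray up to \<open>11 * \<rho>\<close> from the centre.\<close>

locale short_geodesics = local_geometry +
  fixes R1 K l \<rho> :: real
  assumes R1: "0 < R1" "R1 < R" and K: "K \<ge> 1" and l: "l > 0" and \<rho>: "\<rho> > 0" "200 * K * \<rho> \<le> 1" "64 * K * \<rho> \<le> l" "20 * \<rho> \<le> R1"
    and H_lower: "\<And>x v. x \<in> cball x0 R1 \<Longrightarrow> l * (norm v)\<^sup>2 \<le> H x v v"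
    and H_upper: "\<And>x v w. x \<in> cball x0 R1 \<Longrightarrow> \<bar>H x v w\<bar> \<le> K * norm v * norm w"
    and \<Gamma>_upper: "\<And>x v w. x \<in> cball x0 R1 \<Longrightarrow> norm (\<Gamma> x v w) \<le> K * norm v * norm w"
    and \<Gamma>_lipschitz: "\<And>x y v w. x \<in> cball x0 R1 \<Longrightarrow> y \<in> cball x0 R1 \<Longrightarrow> norm (\<Gamma> x v w - \<Gamma> y v w) \<le> K * norm (x - y) * norm v * norm w"
    and H_lipschitz: "\<And>x y v w. x \<in> cball x0 R1 \<Longrightarrow> y \<in> cball x0 R1 \<Longrightarrow> \<bar>H x v w - H y v w\<bar> \<le> K * norm (x - y) * norm v * norm w"
    and H_taylor: "\<And>x y v. x \<in> cball x0 R1 \<Longrightarrow> y \<in> cball x0 R1 \<Longrightarrow>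
       \<bar>H y v v - H x v v - 2 * H x (\<Gamma> x (y - x) v) v\<bar> \<le> K * (norm (y - x))\<^sup>2 * (norm v)\<^sup>2"
begin

lemma R1_sub: "x \<in> cball x0 R1 \<Longrightarrow> x \<in> ball x0 R"
  using R1 by auto

lemma \<rho>_sub: "x \<in> cball x0 (10 * \<rho>) \<Longrightarrow> x \<in> cball x0 R1"
  and \<rho>_sub': "x \<in> ball x0 \<rho> \<Longrightarrow> x \<in> cball x0 R1"
  using \<rho> by auto

lemma \<rho>_small: "\<rho> \<le> 1 / 200"
proof -
  have "1 * \<rho> \<le> K * \<rho>" using K \<rho> by (intro mult_right_mono) auto
  then show ?thesis using \<rho>(2) by simp
qed

text \<open>\<open>geo a b x v\<close>: the curve \<open>x\<close> with velocity \<open>v\<close> is a short geodesic with \<open>x 0 = a\<close> and \<open>x 1 = b\<close>. It is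
  defined beyond \<open>[0, 1]\<close>, so that geodesic segments have smooth extensions at their end points.\<close>

definition geo :: "'a \<Rightarrow> 'a \<Rightarrow> (real \<Rightarrow> 'a) \<Rightarrow> (real \<Rightarrow> 'a) \<Rightarrow> bool" where
  "geo a b x v \<longleftrightarrow> (\<forall>t\<in>{-1..2}. x t \<in> cball x0 (9 * \<rho>) \<and> norm (v t) \<le> 2 * norm (b - a) \<and>
      (x has_vector_derivative v t) (at t within {-1..2}) \<and>
      (v has_vector_derivative - \<Gamma> (x t) (v t) (v t)) (at t within {-1..2})) \<and> x 0 = a \<and> x 1 = b"

text \<open>A fixed point problem for the velocity \<open>v\<close>: integrate it to the position
  \<open>X\<close> with \<open>X v 0 = a\<close>, insert both into the geodesic equation, and
  integrate again. The constant of the second integration is chosen so that the velocity has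
  integral \<open>b - a\<close> over \<open>{0..1}\<close>, which is the end condition
  \<open>X v 1 = b\<close>.\<close>

lemma ex_geo:
  assumes a: "a \<in> ball x0 \<rho>" and b: "b \<in> ball x0 \<rho>"
  shows "\<exists>x v. geo a b x v"
proof -
  define e where "e = norm (b - a)"
  have e0: "e \<ge> 0" and e\<rho>: "e \<le> 2 * \<rho>"
    using a b norm_triangle_ineq4[of "b - x0" "a - x0"] by (auto simp: e_def dist_norm norm_minus_commute)
  have "K * e \<le> K * (2 * \<rho>)" using e\<rho> K by (intro mult_left_mono) auto
  then have Ke: "K * e \<le> 1 / 100" using \<rho>(2) by simp
  have e1: "e \<le> 1 / 100" using e\<rho> \<rho>_small by simp
  have "K * e * e \<le> (1 / 100) * e" using Ke e0 by (rule mult_right_mono)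
  then have Kee: "K * e * e \<le> e / 100" by simp
  \<comment> \<open>Bounded continuous functions live on all of \<open>real\<close>;
    \<open>cl\<close> extends the velocity constantly outside \<open>{-1..2}\<close>.\<close>
  define cl :: "real \<Rightarrow> real" where "cl t = max (-1) (min 2 t)" for t
  have cl: "cl t \<in> {-1..2}" "t \<in> {-1..2} \<Longrightarrow> cl t = t" for t by (auto simp: cl_def)
  define I where "I v t = integral {-1..t} (apply_bcontfun v)" for v :: "real \<Rightarrow>\<^sub>C 'a" and t
  define X where "X v t = a + (I v t - I v 0)" for v t
  define G where "G v t = \<Gamma> (X v t) (apply_bcontfun v t) (apply_bcontfun v t)" for v t
  define n where "n v t = integral {-1..t} (G v)" for v t
  \<comment> \<open>Since \<open>n\<close> integrates \<open>G\<close>, the derivative of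
    \<open>F v\<close> is \<open>- G v\<close>; the last term makes its mean over
    \<open>{0..1}\<close> equal to \<open>b - a\<close>.\<close>
  define F where "F v t = (b - a) - n v t + integral {0..1} (n v)" for v t
  define \<Phi> where "\<Phi> v = Bcontfun (\<lambda>t. F v (cl t))" for v
  define S where "S = {v :: real \<Rightarrow>\<^sub>C 'a. \<forall>t. norm (apply_bcontfun v t) \<le> 2 * e}"
  have Ider: "(I v has_vector_derivative apply_bcontfun v t) (at t within {-1..2})" if "t \<in> {-1..2}" for v t
    unfolding I_def by (rule integral_has_vector_derivative[OF continuous_on_apply_bcontfun that])
  have Xder: "(X v has_vector_derivative apply_bcontfun v t) (at t within {-1..2})" if "t \<in> {-1..2}" for v t
    unfolding X_def by (auto intro!: derivative_eq_intros Ider[OF that])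
  have X0: "X v 0 = a" for v by (simp add: X_def)
  have Xcont: "continuous_on {-1..2} (X v)" for v
    by (rule continuous_on_vector_derivative[OF Xder])
  have Xa: "norm (X v t - a) \<le> 4 * e" if "v \<in> S" "t \<in> {-1..2}" for v t
  proof -
    have "norm (X v t - X v 0) \<le> (2 * e) * \<bar>t - 0\<bar>"
      by (rule has_vector_derivative_bound[OF Xder]) (use that in \<open>auto simp: S_def\<close>)
    also have "\<dots> \<le> (2 * e) * 2" using that e0 by (intro mult_left_mono) auto
    finally show ?thesis by (simp add: X0)
  qed
  have X9: "X v t \<in> cball x0 (9 * \<rho>)" if "v \<in> S" "t \<in> {-1..2}" for v t
  proof -
    have "norm (x0 - X v t) \<le> norm (x0 - a) + norm (X v t - a)"
      using norm_triangle_ineq[of "x0 - a" "a - X v t"] by (simp add: norm_minus_commute)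
    also have "\<dots> \<le> 9 * \<rho>" using Xa[OF that] a e\<rho> by (simp add: dist_norm)
    finally show ?thesis by (simp add: dist_norm)
  qed
  have XR: "X v t \<in> cball x0 R1" "X v t \<in> ball x0 R" if "v \<in> S" "t \<in> {-1..2}" for v t
    using X9[OF that] \<rho> R1 by auto
  have Gcont: "continuous_on {-1..2} (G v)" if v: "v \<in> S" for v
  proof -
    have "continuous_on {-1..2} (\<lambda>t. \<Sum>e\<in>Basis. \<Sum>f\<in>Basis. ((apply_bcontfun v t \<bullet> e) * (apply_bcontfun v t \<bullet> f)) *\<^sub>R \<Gamma> (X v t) e f)"
      by (intro continuous_intros continuous_on_compose2[OF smooth_on_imp_continuous_on[OF \<Gamma>_smooth] Xcont])
         (use XR[OF v] in auto)
    then show ?thesis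
      by (rule continuous_on_eq)
         (use bilinear_expansion[OF \<Gamma>_lin1[OF XR(2)[OF v]] \<Gamma>_lin[OF XR(2)[OF v]]] in \<open>simp add: G_def\<close>)
  qed
  have Gle: "norm (G v t) \<le> 4 * (K * e * e)" if "v \<in> S" "t \<in> {-1..2}" for v t
  proof -
    have "norm (G v t) \<le> K * norm (apply_bcontfun v t) * norm (apply_bcontfun v t)"
      unfolding G_def by (rule \<Gamma>_upper[OF XR(1)[OF that]])
    also have "\<dots> \<le> K * (2 * e) * (2 * e)"
      using that K e0 by (intro mult_mono) (auto simp: S_def)
    finally show ?thesis by simp
  qed
  have nder: "(n v has_vector_derivative G v t) (at t within {-1..2})" if "v \<in> S" "t \<in> {-1..2}" for v t
    unfolding n_def by (rule integral_has_vector_derivative[OF Gcont[OF that(1)] that(2)])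
  have n0: "n v (-1) = 0" for v by (simp add: n_def)
  have ncont: "continuous_on {-1..2} (n v)" if "v \<in> S" for v
    by (rule continuous_on_vector_derivative[OF nder[OF that]])
  have nle: "norm (n v t) \<le> 12 * (K * e * e)" if v: "v \<in> S" and t: "t \<in> {-1..2}" for v t
  proof -
    have "norm (n v t - n v (-1)) \<le> (4 * (K * e * e)) * \<bar>t - (-1)\<bar>"
      by (rule has_vector_derivative_bound[OF nder[OF v] Gle[OF v] t]) auto
    also have "\<dots> \<le> (4 * (K * e * e)) * 3" using t K e0 by (intro mult_left_mono) auto
    finally show ?thesis by (simp add: n0)
  qed
  have n01: "continuous_on {0..1} (n v)" if "v \<in> S" for v
    by (rule continuous_on_subset[OF ncont[OF that]]) auto
  have Fle: "norm (F v t) \<le> 2 * e" if v: "v \<in> S" and t: "t \<in> {-1..2}" for v t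
  proof -
    have "norm (integral {0..1} (n v)) \<le> 12 * (K * e * e) * (1 - 0)"
      by (rule integral_bound[OF _ n01[OF v]]) (use nle[OF v] in auto)
    then have "norm (integral {0..1} (n v)) \<le> 12 * (K * e * e)" by simp
    then have "norm (F v t) \<le> e + 12 * (K * e * e) + 12 * (K * e * e)"
      using norm_triangle_ineq[of "(b - a) - n v t" "integral {0..1} (n v)"] norm_triangle_ineq4[of "b - a" "n v t"] nle[OF v t]
      unfolding F_def e_def by linarith
    then show ?thesis using Kee e0 by simp
  qed
  have Fder: "(F v has_vector_derivative - G v t) (at t within {-1..2})" if "v \<in> S" "t \<in> {-1..2}" for v t
    unfolding F_def by (auto intro!: derivative_eq_intros nder[OF that])
  have Fcont: "continuous_on {-1..2} (F v)" if "v \<in> S" for v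
    by (rule continuous_on_vector_derivative[OF Fder[OF that]])
  have app: "apply_bcontfun (\<Phi> v) t = F v (cl t)" if v: "v \<in> S" for v t
  proof -
    have "(\<lambda>t. F v (cl t)) \<in> bcontfun"
    proof (rule bcontfun_normI)
      have "continuous_on UNIV cl" unfolding cl_def by (intro continuous_intros)
      then show "continuous_on UNIV (\<lambda>t. F v (cl t))"
        by (rule continuous_on_compose2[OF Fcont[OF v]]) (use cl in auto)
      show "norm (F v (cl t)) \<le> 2 * e" for t by (rule Fle[OF v cl(1)])
    qed
    then show ?thesis by (simp add: \<Phi>_def Bcontfun_inverse)
  qed
  have "\<exists>!v. v \<in> S \<and> \<Phi> v = v"
  proof (rule Banach_fix[where c = "1/2"])
    have "S = PiC UNIV (\<lambda>_. cball 0 (2 * e))" by (auto simp: S_def mem_PiC_iff Pi_iff)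
    then show "complete S" using closed_PiC[of UNIV "\<lambda>_. cball 0 (2 * e) :: 'a set"] by (simp add: complete_eq_closed)
    have "const_bcontfun 0 \<in> S" using e0 by (simp add: S_def)
    then show "S \<noteq> {}" by blast
    show "\<Phi> ` S \<subseteq> S" using app Fle[OF _ cl(1)] by (auto simp: S_def)
    fix v w assume v: "v \<in> S" and w: "w \<in> S"
    let ?D = "dist v w"
    have vw: "norm (apply_bcontfun v t - apply_bcontfun w t) \<le> ?D" for t
      using dist_bounded[of v t w] by (simp add: dist_norm)
    have Xd: "norm (X v t - X w t) \<le> 2 * ?D" if t: "t \<in> {-1..2}" for t
    proof -
      have "norm ((X v t - X w t) - (X v 0 - X w 0)) \<le> ?D * \<bar>t - 0\<bar>"
        by (rule has_vector_derivative_bound[OF has_vector_derivative_diff[OF Xder Xder] vw t]) auto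
      also have "\<dots> \<le> ?D * 2" using t by (intro mult_left_mono) auto
      finally show ?thesis by (simp add: X0)
    qed
    have Gd: "norm (G v t - G w t) \<le> (8 * (K * e * e) + 4 * (K * e)) * ?D" if t: "t \<in> {-1..2}" for t
    proof -
      let ?v = "apply_bcontfun v t" and ?w = "apply_bcontfun w t"
      note Xv = XR[OF v t] and Xw = XR[OF w t]
      have nv: "norm ?v \<le> 2 * e" "norm ?w \<le> 2 * e" using v w by (auto simp: S_def)
      have "G v t - G w t = (\<Gamma> (X v t) ?v ?v - \<Gamma> (X w t) ?v ?v) + (\<Gamma> (X w t) ?v (?v - ?w) + \<Gamma> (X w t) (?v - ?w) ?w)"
        using linear_diff[OF \<Gamma>_lin[OF Xw(2)]] linear_diff[OF \<Gamma>_lin1[OF Xw(2)]] by (simp add: G_def)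
      then have "norm (G v t - G w t) \<le> norm (\<Gamma> (X v t) ?v ?v - \<Gamma> (X w t) ?v ?v) + (norm (\<Gamma> (X w t) ?v (?v - ?w)) + norm (\<Gamma> (X w t) (?v - ?w) ?w))"
        by (metis (no_types, lifting) add_left_mono norm_triangle_ineq order_trans)
      also have "\<dots> \<le> K * norm (X v t - X w t) * norm ?v * norm ?v + (K * norm ?v * norm (?v - ?w) + K * norm (?v - ?w) * norm ?w)"
        by (intro add_mono \<Gamma>_lipschitz \<Gamma>_upper Xv Xw)
      also have "\<dots> \<le> K * (2 * ?D) * (2 * e) * (2 * e) + (K * (2 * e) * ?D + K * ?D * (2 * e))"
        using K e0 by (intro add_mono mult_mono mult_nonneg_nonneg Xd t vw nv) auto
      finally show ?thesis by (simp add: algebra_simps)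
    qed
    \<comment> \<open>\<open>G\<close> varies by at most \<open>q\<close>. Integration over a time
      at most \<open>3\<close> gives \<open>3 * q\<close> for \<open>n\<close>, and \<open>n\<close>
      enters \<open>F\<close> twice, so \<open>6 * q \<le> 1 / 2 * ?D\<close> is what the
      contraction factor \<open>1 / 2\<close> requires.\<close>
    define q where "q = (8 * (K * e * e) + 4 * (K * e)) * ?D"
    have q0: "0 \<le> q" unfolding q_def using K e0 by (intro mult_nonneg_nonneg add_nonneg_nonneg) auto
    have "8 * (K * e * e) + 4 * (K * e) \<le> 1 / 12" using Kee Ke e1 by simp
    then have "q \<le> (1 / 12) * ?D" unfolding q_def by (rule mult_right_mono) simp
    then have q: "6 * q \<le> 1 / 2 * ?D" by simp
    have nd: "norm (n v t - n w t) \<le> 3 * q" if t: "t \<in> {-1..2}" for t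
    proof -
      have "norm ((n v t - n w t) - (n v (-1) - n w (-1))) \<le> q * \<bar>t - (-1)\<bar>"
        by (rule has_vector_derivative_bound[OF has_vector_derivative_diff[OF nder[OF v] nder[OF w]] Gd[folded q_def] t]) auto
      also have "\<dots> \<le> q * 3" using t q0 by (intro mult_left_mono) auto
      finally show ?thesis by (simp add: n0)
    qed
    have "norm (integral {0..1} (\<lambda>t. n v t - n w t)) \<le> 3 * q * (1 - 0)"
      by (rule integral_bound[OF _ continuous_on_diff[OF n01[OF v] n01[OF w]]]) (use nd in auto)
    then have id: "norm (integral {0..1} (n v) - integral {0..1} (n w)) \<le> 3 * q"
      using integral_diff[OF integrable_continuous_real[OF n01[OF v]] integrable_continuous_real[OF n01[OF w]]] by simp
    show "dist (\<Phi> v) (\<Phi> w) \<le> 1 / 2 * ?D"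
    proof (rule dist_bound)
      fix t
      have "F v (cl t) - F w (cl t) = (integral {0..1} (n v) - integral {0..1} (n w)) - (n v (cl t) - n w (cl t))"
        by (simp add: F_def)
      then have "norm (F v (cl t) - F w (cl t)) \<le> 3 * q + 3 * q"
        using norm_triangle_ineq4[of "integral {0..1} (n v) - integral {0..1} (n w)" "n v (cl t) - n w (cl t)"] id nd[OF cl(1), of t]
        by simp
      then show "dist (apply_bcontfun (\<Phi> v) t) (apply_bcontfun (\<Phi> w) t) \<le> 1 / 2 * ?D"
        using q by (simp add: app v w dist_norm)
    qed
  qed auto
  then obtain v where v: "v \<in> S" "\<Phi> v = v" by blast
  have vF: "apply_bcontfun v t = F v t" if "t \<in> {-1..2}" for t
    using app[OF v(1), of t] v(2) cl(2)[OF that] by simp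
  have "(apply_bcontfun v has_vector_derivative - G v t) (at t within {-1..2})" if "t \<in> {-1..2}" for t
    by (rule has_vector_derivative_transform[OF that vF Fder[OF v(1) that]])
  moreover have "X v 1 = b"
  proof -
    have cv: "continuous_on T (apply_bcontfun v)" for T by simp
    have "I v 0 + integral {0..1} (apply_bcontfun v) = I v 1"
      unfolding I_def by (rule Henstock_Kurzweil_Integration.integral_combine) (auto intro: integrable_continuous_real cv)
    moreover have "integral {0..1} (apply_bcontfun v) = integral {0..1} (F v)"
      by (rule integral_cong) (use vF in auto)
    moreover have "integral {0..1} (F v) = (b - a) - integral {0..1} (n v) + integral {0..1} (n v)"
    proof -
      have ni: "(n v has_integral integral {0..1} (n v)) {0..1}"
        by (rule integrable_integral[OF integrable_continuous_real[OF n01[OF v(1)]]])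
      have ci: "((\<lambda>_. u) has_integral u) {0..1::real}" for u :: 'a
        using has_integral_const_real[of u 0 1] by simp
      have "(F v has_integral ((b - a) - integral {0..1} (n v) + integral {0..1} (n v))) {0..1}"
        unfolding F_def by (intro has_integral_add has_integral_diff ni ci)
      then show ?thesis by (rule integral_unique)
    qed
    ultimately have "I v 1 = I v 0 + (b - a)" by simp
    then show ?thesis by (simp add: X_def)
  qed
  ultimately have "geo a b (X v) (apply_bcontfun v)"
    unfolding geo_def using X9[OF v(1)] Xder X0 v(1) by (auto simp: G_def S_def e_def)
  then show ?thesis by blast
qed

end

subsection \<open>Convexity of the energy\<close>

context local_geometry
begin

lemma H_nonneg: "x \<in> ball x0 R \<Longrightarrow> H x v v \<ge> 0"
  using H_pos[of x v] linear_0[OF H_lin[of x 0]] by (cases "v = 0") auto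

lemma H_scale_sq: "x \<in> ball x0 R \<Longrightarrow> H x (a *\<^sub>R v) (a *\<^sub>R v) = a\<^sup>2 * H x v v"
  by (simp only: linear_scale[OF H_lin] linear_scale[OF H_lin1] real_scaleR_def power2_eq_square mult.assoc)

end

context short_geodesics
begin

text \<open>A choice for every pair of end points, with no claim of regularity in them;
  \<open>spd_sq_variation\<close> makes up for this.\<close>

definition "sol a b = (SOME p. geo a b (fst p) (snd p))"
definition "sx a b = fst (sol a b)"
definition "sv a b = snd (sol a b)"
text \<open>The speed is constant and the parameter runs from \<open>0\<close> to \<open>1\<close>,
  so this is the length of the chosen geodesic. Below \<open>cap\<close>, and near the centre, it
  turns out to be the Riemannian distance.\<close>

definition "spd a b = sqrt (H (sx a b 0) (sv a b 0) (sv a b 0))"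

lemma geo_sol: "a \<in> ball x0 \<rho> \<Longrightarrow> b \<in> ball x0 \<rho> \<Longrightarrow> geo a b (sx a b) (sv a b)"
  unfolding sx_def sv_def sol_def using ex_geo[of a b] by (metis (mono_tags, lifting) fst_conv snd_conv someI_ex)

lemma
  assumes "geo a b x v" "t \<in> {-1..2}"
  shows geo_in9: "x t \<in> cball x0 (9 * \<rho>)" and geo_in: "x t \<in> cball x0 R1" and geo_inR: "x t \<in> ball x0 R"
    and geo_v: "norm (v t) \<le> 2 * norm (b - a)"
    and geo_dx: "S \<subseteq> {-1..2} \<Longrightarrow> (x has_vector_derivative v t) (at t within S)"
    and geo_dv: "S \<subseteq> {-1..2} \<Longrightarrow> (v has_vector_derivative - \<Gamma> (x t) (v t) (v t)) (at t within S)"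
proof -
  show "x t \<in> cball x0 (9 * \<rho>)" "norm (v t) \<le> 2 * norm (b - a)"
    using assms unfolding geo_def by blast+
  then show "x t \<in> cball x0 R1" "x t \<in> ball x0 R"
    using \<rho> R1 by auto
  show "(x has_vector_derivative v t) (at t within S)" "(v has_vector_derivative - \<Gamma> (x t) (v t) (v t)) (at t within S)"
    if "S \<subseteq> {-1..2}"
    using assms has_vector_derivative_within_subset[OF _ that] unfolding geo_def by blast+
qed

lemma geo_0: "geo a b x v \<Longrightarrow> x 0 = a" and geo_1: "geo a b x v \<Longrightarrow> x 1 = b"
  by (auto simp: geo_def)

lemma norm_diff_\<rho>: "a \<in> ball x0 \<rho> \<Longrightarrow> b \<in> ball x0 \<rho> \<Longrightarrow> norm (b - a) \<le> 2 * \<rho>"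
  using norm_triangle_ineq4[of "b - x0" "a - x0"] by (auto simp: dist_norm norm_minus_commute)

lemma geo_const_speed:
  assumes g: "geo a b x v" and t: "t \<in> {-1..2}"
  shows "H (x t) (v t) (v t) = H (x 0) (v 0) (v 0)"
proof -
  have "((\<lambda>t. H (x t) (v t) (v t)) has_vector_derivative 0) (at t within {-1..2})" if t: "t \<in> {-1..2}" for t
    using H_has_derivative[OF geo_dx[OF g t] geo_dv[OF g t] geo_dv[OF g t] geo_inR[OF g t] t]
    by (simp add: has_real_derivative_iff_has_vector_derivative linear_neg[OF H_lin[OF geo_inR[OF g t]]] linear_neg[OF H_lin1[OF geo_inR[OF g t]]])
  then have "norm (H (x t) (v t) (v t) - H (x 0) (v 0) (v 0)) \<le> 0 * \<bar>t - 0\<bar>"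
    by (rule has_vector_derivative_bound) (use t in auto)
  then show ?thesis by simp
qed

lemma spd_nonneg: "a \<in> ball x0 \<rho> \<Longrightarrow> b \<in> ball x0 \<rho> \<Longrightarrow> spd a b \<ge> 0"
  unfolding spd_def using H_nonneg geo_inR[OF geo_sol] by auto

lemma spd_sq:
  assumes "a \<in> ball x0 \<rho>" "b \<in> ball x0 \<rho>" "t \<in> {-1..2}"
  shows "H (sx a b t) (sv a b t) (sv a b t) = (spd a b)\<^sup>2"
  unfolding spd_def using geo_const_speed[OF geo_sol[OF assms(1,2)] assms(3)] H_nonneg[OF geo_inR[OF geo_sol[OF assms(1,2)], of 0]]
  by simp

lemma spd_lower:
  assumes ab: "a \<in> ball x0 \<rho>" "b \<in> ball x0 \<rho>"
  shows "sqrt l * norm (b - a) \<le> spd a b"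
proof -
  note g = geo_sol[OF ab]
  have "norm (sv a b t) \<le> spd a b / sqrt l" if t: "t \<in> {0..1}" for t
  proof -
    have t': "t \<in> {-1..2}" using t by auto
    have "l * (norm (sv a b t))\<^sup>2 \<le> (spd a b)\<^sup>2"
      using H_lower[OF geo_in[OF g t'], of "sv a b t"] spd_sq[OF ab t'] by simp
    then have "(sqrt l * norm (sv a b t))\<^sup>2 \<le> (spd a b)\<^sup>2"
      using l by (simp add: power_mult_distrib)
    then have "sqrt l * norm (sv a b t) \<le> spd a b"
      using spd_nonneg[OF ab] by (rule power2_le_imp_le)
    then show ?thesis using l by (simp add: field_simps)
  qed
  moreover have "(sx a b has_vector_derivative sv a b t) (at t within {0..1})" if "t \<in> {0..1}" for t
    using that by (intro geo_dx[OF g]) auto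
  ultimately have "norm (sx a b 1 - sx a b 0) \<le> (spd a b / sqrt l) * \<bar>1 - 0\<bar>"
    by (intro has_vector_derivative_bound[of 0 1 "sx a b" "sv a b"]) auto
  then show ?thesis using geo_0[OF g] geo_1[OF g] l by (simp add: field_simps)
qed

lemma spd_upper:
  assumes ab: "a \<in> ball x0 \<rho>" "b \<in> ball x0 \<rho>"
  shows "spd a b \<le> 2 * K * norm (b - a)"
proof (rule power2_le_imp_le)
  note g = geo_sol[OF ab]
  have "(spd a b)\<^sup>2 \<le> K * norm (sv a b 0) * norm (sv a b 0)"
    using spd_sq[OF ab, of 0] H_upper[OF geo_in[OF g, of 0], of "sv a b 0" "sv a b 0"] by simp
  also have "\<dots> \<le> K * (2 * norm (b - a)) * (2 * norm (b - a))"
    using K geo_v[OF g, of 0] by (intro mult_mono) auto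
  also have "\<dots> = K * 1 * (2 * norm (b - a))\<^sup>2" by (simp add: power2_eq_square)
  also have "\<dots> \<le> K * K * (2 * norm (b - a))\<^sup>2" using K by (intro mult_right_mono mult_left_mono) auto
  finally show "(spd a b)\<^sup>2 \<le> (2 * K * norm (b - a))\<^sup>2" by (simp add: power2_eq_square algebra_simps)
  show "0 \<le> 2 * K * norm (b - a)" using K by simp
qed

text \<open>A second order expansion of the energy density. The linear part is the one that
  \<open>var_derivative\<close> integrates exactly, and the square of \<open>w - v\<close> is kept,
  not estimated, because its sign is favourable.\<close>

lemma H_variation:
  assumes x: "x \<in> cball x0 R1" and y: "y \<in> cball x0 R1"
  shows "\<bar>H y w w - H x v v - 2 * (H x v (\<Gamma> x v (y - x)) + H x v (w - v)) - H y (w - v) (w - v)\<bar>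
    \<le> K * (norm (y - x))\<^sup>2 * (norm v)\<^sup>2 + 2 * K * norm (y - x) * norm v * norm (w - v)"
proof -
  let ?z = "w - v" and ?e = "y - x"
  note xb = R1_sub[OF x] and yb = R1_sub[OF y]
  have "H y w w = H y (v + ?z) (v + ?z)" by simp
  also have "\<dots> = H y v v + 2 * H y v ?z + H y ?z ?z"
    unfolding linear_add[OF H_lin[OF yb]] linear_add[OF H_lin1[OF yb]] using H_sym[OF yb, of ?z v] by simp
  finally have e1: "H y w w = H y v v + 2 * H y v ?z + H y ?z ?z" .
  have e2: "H x v (\<Gamma> x v ?e) = H x (\<Gamma> x ?e v) v"
    using H_sym[OF xb, of v "\<Gamma> x v ?e"] \<Gamma>_sym[OF xb, of v ?e] by simp
  have "\<bar>H y v ?z - H x v ?z\<bar> \<le> K * norm ?e * norm v * norm ?z"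
    by (rule H_lipschitz[OF y x])
  with H_taylor[OF x y, of v] show ?thesis unfolding e1 e2 by simp
qed

text \<open>The first variation formula: by the geodesic equation, the linear part of the energy is
  a total derivative.\<close>

lemma var_derivative:
  assumes g: "geo a b x v" and t: "t \<in> {-1..2}" "t \<in> S" "S \<subseteq> {-1..2}" and y: "(y has_vector_derivative w) (at t within S)"
  shows "((\<lambda>t. H (x t) (v t) (y t - x t)) has_real_derivative
    (H (x t) (v t) (\<Gamma> (x t) (v t) (y t - x t)) + H (x t) (v t) (w - v t))) (at t within S)"
  using H_has_derivative[OF geo_dx[OF g t(1,3)] geo_dv[OF g t(1,3)] has_vector_derivative_diff[OF y geo_dx[OF g t(1,3)]] geo_inR[OF g t(1)] t(2)]
  by (simp add: linear_neg[OF H_lin1[OF geo_inR[OF g t(1)]]])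

text \<open>The second term of \<open>Phi\<close> is a null Lagrangian. It replaces the Poincare inequality in the proof that a
  short geodesic is a strict minimum of the energy.\<close>

definition "Phi x v y t = 2 * H (x t) (v t) (y t - x t) - l * ((t - 1 / 2) / 2) * (norm (y t - x t))\<^sup>2"

text \<open>By \<open>H_variation\<close> the gain is \<open>l * z\<^sup>2\<close> with
  \<open>z = norm (w - v t)\<close>, but the errors also involve
  \<open>n = norm (y t - x t)\<close>, for which the energy offers nothing. The null Lagrangian
  makes room for \<open>l / 2 * n\<^sup>2\<close> in exchange for a cross term of size at most
  \<open>l / 2 * n * z\<close>, as its weight \<open>t - 1 / 2\<close> is at most
  \<open>1 / 2\<close> in absolute value on \<open>{0..1}\<close>.\<close>

lemma Phi_convexity:
  assumes ab: "a \<in> ball x0 \<rho>" "b \<in> ball x0 \<rho>" and g: "geo a b x v" and t: "t \<in> {0..1}" "t \<in> S" "S \<subseteq> {-1..2}"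
    and y: "(y has_vector_derivative w) (at t within S)" and yt: "y t \<in> cball x0 R1"
  shows "\<exists>D. (Phi x v y has_real_derivative D) (at t within S) \<and>
    D + l / 4 * (norm (y t - x t))\<^sup>2 \<le> H (y t) w w - H (x t) (v t) (v t)"
proof -
  have t': "t \<in> {-1..2}" using t by auto
  let ?e = "y t - x t" and ?z = "w - v t"
  define \<psi> where "\<psi> = H (x t) (v t) (\<Gamma> (x t) (v t) ?e) + H (x t) (v t) ?z"
  define D where "D = 2 * \<psi> - l * ((norm ?e)\<^sup>2 / 2 + (t - 1 / 2) * (?e \<bullet> ?z))"
  have dn: "((\<lambda>t. (y t - x t) \<bullet> (y t - x t)) has_real_derivative 2 * (?e \<bullet> ?z)) (at t within S)"
  proof -
    have "((\<lambda>t. y t - x t) has_derivative (\<lambda>h. h *\<^sub>R ?z)) (at t within S)"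
      using has_vector_derivative_diff[OF y geo_dx[OF g t' t(3)]] by (simp add: has_vector_derivative_def)
    from has_derivative_inner[OF this this] show ?thesis
      unfolding has_field_derivative_def
      by (rule has_derivative_eq_rhs) (auto simp: fun_eq_iff inner_commute algebra_simps)
  qed
  have dl: "((\<lambda>t. l * ((t - 1 / 2) / 2)) has_real_derivative l / 2) (at t within S)"
    by (auto intro!: derivative_eq_intros)
  have d0: "((\<lambda>t. 2 * H (x t) (v t) (y t - x t) - l * ((t - 1 / 2) / 2) * ((y t - x t) \<bullet> (y t - x t))) has_real_derivative
     (2 * \<psi> - (l / 2 * (?e \<bullet> ?e) + 2 * (?e \<bullet> ?z) * (l * ((t - 1 / 2) / 2))))) (at t within S)"
    unfolding \<psi>_def by (intro DERIV_diff DERIV_cmult DERIV_mult var_derivative[OF g t' t(2,3) y] dl dn)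
  have gen: "2 * p - (l / 2 * A + 2 * B * (l * ((t - 1 / 2) / 2))) = 2 * p - l * (A / 2 + (t - 1 / 2) * B)" for p A B
    by (simp add: field_simps)
  have eq: "2 * \<psi> - (l / 2 * (?e \<bullet> ?e) + 2 * (?e \<bullet> ?z) * (l * ((t - 1 / 2) / 2))) = D"
    unfolding D_def power2_norm_eq_inner by (rule gen)
  have dP: "(Phi x v y has_real_derivative D) (at t within S)"
    using DERIV_cong[OF d0 eq] unfolding Phi_def[abs_def] power2_norm_eq_inner .
  define n z m where "n = norm ?e" and "z = norm ?z" and "m = norm (v t)"
  have pos: "n \<ge> 0" "z \<ge> 0" "m \<ge> 0" by (auto simp: n_def z_def m_def)
  have m4: "m \<le> 4 * \<rho>" unfolding m_def using geo_v[OF g t'] norm_diff_\<rho>[OF ab] by simp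
  have "K * m \<le> K * (4 * \<rho>)" using m4 K by (intro mult_left_mono) auto
  then have Km: "K * m \<le> l / 16" using \<rho>(3) by simp
  have m1: "m \<le> 1" using m4 \<rho>_small by simp
  have var: "2 * \<psi> + H (y t) ?z ?z - (K * n\<^sup>2 * m\<^sup>2 + 2 * K * n * m * z) \<le> H (y t) w w - H (x t) (v t) (v t)"
    using H_variation[OF geo_in[OF g t'] yt, of w "v t"] unfolding \<psi>_def n_def z_def m_def by linarith
  have low: "l * z\<^sup>2 \<le> H (y t) ?z ?z" unfolding z_def by (rule H_lower[OF yt])
  have b1: "K * n\<^sup>2 * m\<^sup>2 \<le> (l / 16) * n\<^sup>2"
  proof -
    have "m\<^sup>2 \<le> m" using m1 pos by (simp add: power2_eq_square mult_left_le_one_le)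
    then have "K * n\<^sup>2 * m\<^sup>2 \<le> K * n\<^sup>2 * m" using K by (intro mult_left_mono) auto
    also have "\<dots> = (K * m) * n\<^sup>2" by (simp add: algebra_simps)
    also have "\<dots> \<le> (l / 16) * n\<^sup>2" using Km by (intro mult_right_mono) auto
    finally show ?thesis .
  qed
  have b2: "2 * K * n * m * z \<le> (l / 16) * (n\<^sup>2 + z\<^sup>2)"
  proof -
    have "2 * K * n * m * z = (K * m) * (2 * n * z)" by (simp add: algebra_simps)
    also have "\<dots> \<le> (l / 16) * (2 * n * z)" using Km pos by (intro mult_right_mono) auto
    also have "\<dots> \<le> (l / 16) * (n\<^sup>2 + z\<^sup>2)" using l sum_squares_bound[of n z] by (intro mult_left_mono) auto
    finally show ?thesis .
  qed
  have b3: "- ((t - 1 / 2) * (?e \<bullet> ?z)) \<le> 1 / 2 * (n * z)"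
  proof -
    have "\<bar>t - 1 / 2\<bar> \<le> 1 / 2" using t(1) by (auto simp: abs_if)
    then have "\<bar>(t - 1 / 2) * (?e \<bullet> ?z)\<bar> \<le> (1 / 2) * (n * z)"
      unfolding abs_mult n_def z_def using Cauchy_Schwarz_ineq2[of ?e ?z] by (intro mult_mono) auto
    then show ?thesis by linarith
  qed
  \<comment> \<open>This absorbs the cross term. A sixteenth of \<open>l * z\<^sup>2\<close> is
    reserved for \<open>b2\<close>, and the balance \<open>- n\<^sup>2 / 8\<close> in
    \<open>q'\<close> pays for the \<open>n\<close>-parts of \<open>b1\<close> and
    \<open>b2\<close>.\<close>
  have "0 \<le> (z - n / 2)\<^sup>2 / 2" by simp
  also have "\<dots> = z\<^sup>2 / 2 + n\<^sup>2 / 8 - n * z / 2" by (simp add: power2_eq_square field_simps)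
  also have "\<dots> \<le> 15 / 16 * z\<^sup>2 + n\<^sup>2 / 8 - n * z / 2" by simp
  finally have q: "n * z / 2 \<le> 15 / 16 * z\<^sup>2 + n\<^sup>2 / 8" by simp
  have q': "- ((t - 1 / 2) * (?e \<bullet> ?z)) - n\<^sup>2 / 4 \<le> 15 / 16 * z\<^sup>2 + n\<^sup>2 / 8 - n\<^sup>2 / 4"
    using b3 q by linarith
  have "p - l * (N / 2 + s) + l / 4 * N = p + l * (- s - N / 4)" for p N s
    by (simp add: field_simps)
  then have "D + l / 4 * n\<^sup>2 = 2 * \<psi> + l * (- ((t - 1 / 2) * (?e \<bullet> ?z)) - n\<^sup>2 / 4)"
    unfolding D_def n_def .
  also have "\<dots> \<le> 2 * \<psi> + l * (15 / 16 * z\<^sup>2 + n\<^sup>2 / 8 - n\<^sup>2 / 4)"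
    using l by (intro add_left_mono mult_left_mono q') simp
  also have "\<dots> = 2 * \<psi> + l * z\<^sup>2 - ((l / 16) * n\<^sup>2 + (l / 16) * (n\<^sup>2 + z\<^sup>2))" by (simp add: algebra_simps)
  also have "\<dots> \<le> H (y t) w w - H (x t) (v t) (v t)" using var low b1 b2 by linarith
  finally show ?thesis using dP unfolding n_def by blast
qed

lemma Phi_zero: "y t = x t \<Longrightarrow> x t \<in> ball x0 R \<Longrightarrow> Phi x v y t = 0"
  using linear_0[OF H_lin] by (simp add: Phi_def)

text \<open>The substitute for the Gauss lemma: to first order, \<open>spd a\<close> grows at most
  like arc length when its second argument moves. The competitor \<open>y\<close> from
  \<open>a\<close> to \<open>b'\<close> adds a linear correction to the geodesic to
  \<open>b\<close>. Its energy is bounded below by that of the geodesic to \<open>b'\<close> through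
  \<open>Phi\<close>, and above through the first variation of the geodesic to
  \<open>b\<close>.\<close>

lemma spd_sq_variation:
  assumes a: "a \<in> ball x0 \<rho>" and b: "b \<in> ball x0 \<rho>" and b': "b' \<in> ball x0 \<rho>"
  shows "(spd a b')\<^sup>2 \<le> (spd a b)\<^sup>2 + 2 * spd a b * sqrt (H b (b' - b) (b' - b)) + 4 * K * (norm (b' - b))\<^sup>2"
proof -
  let ?x = "sx a b" and ?v = "sv a b" and ?X = "sx a b'" and ?V = "sv a b'"
  note g = geo_sol[OF a b] and g' = geo_sol[OF a b']
  define w where "w = b' - b"
  define y where "y t = ?x t + t *\<^sub>R w" for t
  have w2: "norm w \<le> 2 * \<rho>" unfolding w_def by (rule norm_diff_\<rho>[OF b b'])
  have in01: "t \<in> {-1..2}" if "t \<in> {0..1}" for t :: real using that by auto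
  have sub: "{0..1} \<subseteq> {-1..2::real}" by auto
  have yin: "y t \<in> cball x0 R1" if t: "t \<in> {0..1}" for t
  proof -
    have "norm (t *\<^sub>R w) \<le> 1 * (2 * \<rho>)" unfolding norm_scaleR using t w2 by (intro mult_mono) auto
    then have "norm (x0 - y t) \<le> 9 * \<rho> + 2 * \<rho>"
      using geo_in9[OF g in01[OF t]] norm_triangle_ineq4[of "x0 - ?x t" "t *\<^sub>R w"] by (simp add: y_def dist_norm algebra_simps)
    then show ?thesis using \<rho> by (simp add: dist_norm)
  qed
  have yd: "(y has_vector_derivative (?v t + w)) (at t within {0..1})" if t: "t \<in> {0..1}" for t
    unfolding y_def by (auto intro!: derivative_eq_intros geo_dx[OF g in01[OF t] sub])
  have "\<exists>D. (Phi ?X ?V y has_real_derivative D) (at t within {0..1}) \<and>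
      D + l / 4 * (norm (y t - ?X t))\<^sup>2 \<le> H (y t) (?v t + w) (?v t + w) - H (?X t) (?V t) (?V t)" if t: "t \<in> {0..1}" for t
    by (rule Phi_convexity[OF a b' g' t t sub yd[OF t] yin[OF t]])
  then obtain D where D: "\<And>t. t \<in> {0..1} \<Longrightarrow> (Phi ?X ?V y has_real_derivative D t) (at t within {0..1})"
      "\<And>t. t \<in> {0..1} \<Longrightarrow> D t + l / 4 * (norm (y t - ?X t))\<^sup>2 \<le> H (y t) (?v t + w) (?v t + w) - H (?X t) (?V t) (?V t)"
    by metis
  define P where "P t = H (?x t) (?v t) (\<Gamma> (?x t) (?v t) (y t - ?x t)) + H (?x t) (?v t) w" for t
  have dP: "((\<lambda>t. H (?x t) (?v t) (y t - ?x t)) has_real_derivative P t) (at t within {0..1})" if t: "t \<in> {0..1}" for t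
    using var_derivative[OF g in01[OF t] t sub yd[OF t]] by (simp add: P_def)
  \<comment> \<open>The first variation along the old geodesic is subtracted from \<open>Phi\<close>
    of the new one. The value at \<open>1\<close> is then the boundary term of the first variation,
    estimated by Cauchy-Schwarz.\<close>
  define f where "f t = Phi ?X ?V y t - 2 * H (?x t) (?v t) (y t - ?x t)" for t
  have fd: "(f has_real_derivative (D t - 2 * P t)) (at t within {0..1})" if t: "t \<in> {0..1}" for t
    unfolding f_def by (intro DERIV_diff DERIV_cmult D(1) dP t)
  \<comment> \<open>Of the \<open>4 * K\<close>, three come from the remainder of
    \<open>H_variation\<close>, with velocities at most \<open>1\<close>, and one from the square of
    \<open>w\<close>.\<close>
  have fle: "D t - 2 * P t \<le> (spd a b)\<^sup>2 - (spd a b')\<^sup>2 + 4 * K * (norm w)\<^sup>2" if t: "t \<in> {0..1}" for t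
  proof -
    let ?e = "y t - ?x t"
    have e: "norm ?e \<le> norm w" using t by (simp add: y_def mult_left_le_one_le)
    have v1: "norm (?v t) \<le> 1" using geo_v[OF g in01[OF t]] norm_diff_\<rho>[OF a b] \<rho>_small by simp
    have "H (y t) (?v t + w) (?v t + w) - H (?x t) (?v t) (?v t) - 2 * P t - H (y t) w w \<le> K * (norm ?e)\<^sup>2 * (norm (?v t))\<^sup>2 + 2 * K * norm ?e * norm (?v t) * norm w"
      using H_variation[OF geo_in[OF g in01[OF t]] yin[OF t], of "?v t + w" "?v t"] by (simp add: P_def)
    also have "\<dots> \<le> K * (norm w)\<^sup>2 * 1\<^sup>2 + 2 * K * norm w * 1 * norm w"
      using K e v1 by (intro add_mono mult_mono power_mono mult_nonneg_nonneg) auto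
    also have "\<dots> = 3 * K * (norm w)\<^sup>2" by (simp add: power2_eq_square)
    finally have "H (y t) (?v t + w) (?v t + w) - (spd a b)\<^sup>2 - 2 * P t \<le> H (y t) w w + 3 * K * (norm w)\<^sup>2"
      using spd_sq[OF a b in01[OF t]] by simp
    moreover have "H (y t) w w \<le> K * (norm w)\<^sup>2"
      using H_upper[OF yin[OF t], of w w] by (simp add: power2_eq_square algebra_simps)
    moreover have "D t \<le> H (y t) (?v t + w) (?v t + w) - (spd a b')\<^sup>2"
    proof -
      have "0 \<le> l / 4 * (norm (y t - ?X t))\<^sup>2" using l by simp
      then show ?thesis using D(2)[OF t] spd_sq[OF a b' in01[OF t]] by linarith
    qed
    ultimately show ?thesis by linarith
  qed
  have "f 1 - f 0 \<le> ((spd a b)\<^sup>2 - (spd a b')\<^sup>2 + 4 * K * (norm w)\<^sup>2) * (1 - 0)"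
    by (rule mean_value_le[OF _ fd fle]) auto
  moreover have "f 0 = 0"
    using geo_0[OF g] geo_0[OF g'] geo_inR[OF g', of 0] geo_inR[OF g, of 0] linear_0[OF H_lin, of a]
    by (simp add: f_def Phi_zero y_def)
  moreover have "f 1 = - 2 * H b (?v 1) w"
    using geo_1[OF g] geo_1[OF g'] geo_inR[OF g', of 1] by (simp add: f_def Phi_zero y_def w_def)
  moreover have "H b (?v 1) w \<le> spd a b * sqrt (H b w w)"
    using H_Cauchy_Schwarz[of b "?v 1" w] geo_inR[OF g, of 1] geo_1[OF g] spd_sq[OF a b, of 1] spd_nonneg[OF a b] by simp
  ultimately show ?thesis unfolding w_def by simp
qed

text \<open>The broken geodesic through \<open>m\<close>, run at the speed of the direct one, has
  the same energy density. Then \<open>Phi\<close> cannot increase on either piece, and it is zero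
  at both ends, so it stays zero, and the strict term in \<open>Phi_convexity\<close> forces the two
  curves to meet at \<open>\<tau>\<close>. This pins a metric segment to the geodesic without a
  uniqueness theorem for the equation.\<close>

lemma division_point_unique:
  assumes a: "a \<in> ball x0 \<rho>" and b: "b \<in> ball x0 \<rho>" and m: "m \<in> ball x0 \<rho>" and \<tau>: "0 < \<tau>" "\<tau> < 1"
    and am: "spd a m = \<tau> * spd a b" and mb: "spd m b = (1 - \<tau>) * spd a b"
  shows "m = sx a b \<tau>"
proof -
  let ?x = "sx a b" and ?v = "sv a b"
  note g = geo_sol[OF a b]
  define y1 where "y1 t = sx a m (t / \<tau>)" for t
  define y2 where "y2 t = sx m b ((t - \<tau>) / (1 - \<tau>))" for t
  have in1: "t / \<tau> \<in> {0..1}" "t / \<tau> \<in> {-1..2}" "t \<in> {0..1}" if "t \<in> {0..\<tau>}" for t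
  proof -
    have "0 \<le> t / \<tau>" "t / \<tau> \<le> 1" using that \<tau> by (simp_all add: divide_le_eq_1)
    then show "t / \<tau> \<in> {0..1}" "t / \<tau> \<in> {-1..2}" "t \<in> {0..1}"
      using that \<tau> unfolding atLeastAtMost_iff by linarith+
  qed
  have in2: "(t - \<tau>) / (1 - \<tau>) \<in> {0..1}" "(t - \<tau>) / (1 - \<tau>) \<in> {-1..2}" "t \<in> {0..1}" if "t \<in> {\<tau>..1}" for t
  proof -
    have "0 \<le> (t - \<tau>) / (1 - \<tau>)" "(t - \<tau>) / (1 - \<tau>) \<le> 1" using that \<tau> by (simp_all add: divide_le_eq_1)
    then show "(t - \<tau>) / (1 - \<tau>) \<in> {0..1}" "(t - \<tau>) / (1 - \<tau>) \<in> {-1..2}" "t \<in> {0..1}"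
      using that \<tau> unfolding atLeastAtMost_iff by linarith+
  qed
  have d1: "(y1 has_vector_derivative ((1 / \<tau>) *\<^sub>R sv a m (t / \<tau>))) (at t within {0..\<tau>})" if t: "t \<in> {0..\<tau>}" for t
  proof -
    have "(sx a m has_vector_derivative sv a m (t / \<tau>)) (at (t / \<tau>) within (\<lambda>t. t / \<tau>) ` {0..\<tau>})"
      by (rule geo_dx[OF geo_sol[OF a m] in1(2)[OF t]]) (use in1(2) in blast)
    moreover have "((\<lambda>t. t / \<tau>) has_vector_derivative (1 / \<tau>)) (at t within {0..\<tau>})"
      unfolding has_real_derivative_iff_has_vector_derivative[symmetric] by (rule DERIV_cdivide[OF DERIV_ident])
    ultimately show ?thesis
      unfolding y1_def using vector_diff_chain_within[of "\<lambda>t. t / \<tau>" "1 / \<tau>" t "{0..\<tau>}" "sx a m" "sv a m (t / \<tau>)"] by (simp add: o_def)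
  qed
  have d2: "(y2 has_vector_derivative ((1 / (1 - \<tau>)) *\<^sub>R sv m b ((t - \<tau>) / (1 - \<tau>)))) (at t within {\<tau>..1})" if t: "t \<in> {\<tau>..1}" for t
  proof -
    have "(sx m b has_vector_derivative sv m b ((t - \<tau>) / (1 - \<tau>))) (at ((t - \<tau>) / (1 - \<tau>)) within (\<lambda>t. (t - \<tau>) / (1 - \<tau>)) ` {\<tau>..1})"
      by (rule geo_dx[OF geo_sol[OF m b] in2(2)[OF t]]) (use in2(2) in blast)
    moreover have "((\<lambda>t. (t - \<tau>) / (1 - \<tau>)) has_vector_derivative (1 / (1 - \<tau>))) (at t within {\<tau>..1})"
      unfolding has_real_derivative_iff_has_vector_derivative[symmetric]
      by (rule DERIV_cong[OF DERIV_cdivide[OF DERIV_diff[OF DERIV_ident DERIV_const]]]) simp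
    ultimately show ?thesis
      unfolding y2_def using vector_diff_chain_within[of "\<lambda>t. (t - \<tau>) / (1 - \<tau>)" "1 / (1 - \<tau>)" t "{\<tau>..1}" "sx m b" "sv m b ((t - \<tau>) / (1 - \<tau>))"] by (simp add: o_def)
  qed
  have e1: "H (y1 t) ((1 / \<tau>) *\<^sub>R sv a m (t / \<tau>)) ((1 / \<tau>) *\<^sub>R sv a m (t / \<tau>)) = (spd a b)\<^sup>2" if t: "t \<in> {0..\<tau>}" for t
    unfolding y1_def H_scale_sq[OF geo_inR[OF geo_sol[OF a m] in1(2)[OF t]]] spd_sq[OF a m in1(2)[OF t]] am
    using \<tau> by (simp add: power_mult_distrib power_divide)
  have e2: "H (y2 t) ((1 / (1 - \<tau>)) *\<^sub>R sv m b ((t - \<tau>) / (1 - \<tau>))) ((1 / (1 - \<tau>)) *\<^sub>R sv m b ((t - \<tau>) / (1 - \<tau>))) = (spd a b)\<^sup>2" if t: "t \<in> {\<tau>..1}" for t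
    unfolding y2_def H_scale_sq[OF geo_inR[OF geo_sol[OF m b] in2(2)[OF t]]] spd_sq[OF m b in2(2)[OF t]] mb
    using \<tau> by (simp add: power_mult_distrib power_divide)
  have s1: "{0..\<tau>} \<subseteq> {-1..2}" and s2: "{\<tau>..1} \<subseteq> {-1..2}" using \<tau> by auto
  have in3: "t \<in> {-1..2}" if "t \<in> {0..1}" for t :: real using that by auto
  have "\<exists>D. (Phi ?x ?v y1 has_real_derivative D) (at t within {0..\<tau>}) \<and> D + l / 4 * (norm (y1 t - ?x t))\<^sup>2 \<le> 0" if t: "t \<in> {0..\<tau>}" for t
    using Phi_convexity[OF a b g in1(3)[OF t] t s1 d1[OF t] geo_in[OF geo_sol[OF a m] in1(2)[OF t], folded y1_def]]
    unfolding e1[OF t] spd_sq[OF a b in3[OF in1(3)[OF t]]] by simp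
  then obtain D1 where D1: "\<And>t. t \<in> {0..\<tau>} \<Longrightarrow> (Phi ?x ?v y1 has_real_derivative D1 t) (at t within {0..\<tau>})"
    "\<And>t. t \<in> {0..\<tau>} \<Longrightarrow> D1 t + l / 4 * (norm (y1 t - ?x t))\<^sup>2 \<le> 0" by metis
  have "\<exists>D. (Phi ?x ?v y2 has_real_derivative D) (at t within {\<tau>..1}) \<and> D + l / 4 * (norm (y2 t - ?x t))\<^sup>2 \<le> 0" if t: "t \<in> {\<tau>..1}" for t
    using Phi_convexity[OF a b g in2(3)[OF t] t s2 d2[OF t] geo_in[OF geo_sol[OF m b] in2(2)[OF t], folded y2_def]]
    unfolding e2[OF t] spd_sq[OF a b in3[OF in2(3)[OF t]]] by simp
  then obtain D2 where D2: "\<And>t. t \<in> {\<tau>..1} \<Longrightarrow> (Phi ?x ?v y2 has_real_derivative D2 t) (at t within {\<tau>..1})"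
    "\<And>t. t \<in> {\<tau>..1} \<Longrightarrow> D2 t + l / 4 * (norm (y2 t - ?x t))\<^sup>2 \<le> 0" by metis
  have n1: "D1 t \<le> 0" if t: "t \<in> {0..\<tau>}" for t
  proof -
    have "0 \<le> l / 4 * (norm (y1 t - ?x t))\<^sup>2" using l by simp
    then show ?thesis using D1(2)[OF t] by linarith
  qed
  have n2: "D2 t \<le> 0" if t: "t \<in> {\<tau>..1}" for t
  proof -
    have "0 \<le> l / 4 * (norm (y2 t - ?x t))\<^sup>2" using l by simp
    then show ?thesis using D2(2)[OF t] by linarith
  qed
  have y1_\<tau>: "y1 \<tau> = m" and y2_\<tau>: "y2 \<tau> = m" and y1_0: "y1 0 = a" and y2_1: "y2 1 = b"
    using \<tau> geo_0[OF geo_sol[OF a m]] geo_1[OF geo_sol[OF a m]] geo_0[OF geo_sol[OF m b]] geo_1[OF geo_sol[OF m b]]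
    by (simp_all add: y1_def y2_def)
  have P0: "Phi ?x ?v y1 0 = 0" and P1: "Phi ?x ?v y2 1 = 0"
    using geo_0[OF g] geo_1[OF g] geo_inR[OF g, of 0] geo_inR[OF g, of 1] by (auto intro!: Phi_zero simp: y1_0 y2_1)
  have P\<tau>: "Phi ?x ?v y1 \<tau> = Phi ?x ?v y2 \<tau>" by (simp add: Phi_def y1_\<tau> y2_\<tau>)
  have "Phi ?x ?v y2 1 - Phi ?x ?v y2 \<tau> \<le> 0 * (1 - \<tau>)"
    by (rule mean_value_le[OF _ D2(1) n2]) (use \<tau> in auto)
  then have Pge: "Phi ?x ?v y1 \<tau> \<ge> 0" using P1 P\<tau> by simp
  have mono: "Phi ?x ?v y1 t - Phi ?x ?v y1 s \<le> 0 * (t - s)" if "s \<in> {0..\<tau>}" "t \<in> {0..\<tau>}" "s \<le> t" for s t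
  proof (rule mean_value_le[OF that(3)])
    fix u assume u: "u \<in> {s..t}"
    then have u': "u \<in> {0..\<tau>}" using that by auto
    show "(Phi ?x ?v y1 has_real_derivative D1 u) (at u within {s..t})"
      by (rule DERIV_subset[OF D1(1)[OF u']]) (use that in auto)
    show "D1 u \<le> 0" by (rule n1[OF u'])
  qed
  have Pz: "Phi ?x ?v y1 t = 0" if t: "t \<in> {0..\<tau>}" for t
    using mono[of 0 t] mono[of t \<tau>] t \<tau> P0 Pge by simp
  \<comment> \<open>The broken curve may have a corner at \<open>\<tau>\<close>, so the derivative
    is taken from the left; it vanishes because \<open>Phi\<close> is zero on all of
    \<open>{0..\<tau>}\<close>.\<close>
  have "D1 \<tau> = 0"
  proof (rule vector_derivative_unique_within_closed_interval[of 0 \<tau> \<tau> "Phi ?x ?v y1"])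
    show "(Phi ?x ?v y1 has_vector_derivative D1 \<tau>) (at \<tau> within cbox 0 \<tau>)"
      using D1(1)[of \<tau>] \<tau> by (simp add: has_real_derivative_iff_has_vector_derivative)
    show "(Phi ?x ?v y1 has_vector_derivative 0) (at \<tau> within cbox 0 \<tau>)"
      by (rule has_vector_derivative_transform[OF _ Pz has_vector_derivative_const]) (use \<tau> in auto)
  qed (use \<tau> in auto)
  then have "l / 4 * (norm (m - ?x \<tau>))\<^sup>2 \<le> 0" using D1(2)[of \<tau>] \<tau> by (simp add: y1_\<tau>)
  then show ?thesis using l by (simp add: mult_le_0_iff)
qed

lemma geo_smooth:
  assumes g: "geo a b x v"
  shows "smooth_on {-1<..<2} x" "smooth_on {-1<..<2} v"
proof -
  let ?J = "{-1<..<2::real}"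
  have dx: "(x has_vector_derivative v t) (at t)" if t: "t \<in> ?J" for t
  proof -
    have "(x has_vector_derivative v t) (at t within ?J)" using t by (intro geo_dx[OF g]) auto
    then show ?thesis using t by (simp add: at_within_open[OF t])
  qed
  have dv: "(v has_vector_derivative - \<Gamma> (x t) (v t) (v t)) (at t)" if t: "t \<in> ?J" for t
  proof -
    have "(v has_vector_derivative - \<Gamma> (x t) (v t) (v t)) (at t within ?J)" using t by (intro geo_dv[OF g]) auto
    then show ?thesis using t by (simp add: at_within_open[OF t])
  qed
  have xb: "x t \<in> ball x0 R" if "t \<in> ?J" for t using that by (intro geo_inR[OF g]) auto
  have "Ck_on k ?J x \<and> Ck_on k ?J v" for k
  proof (induction k)
    case 0
    have "isCont x t" "isCont v t" if t: "t \<in> ?J" for t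
      using dx[OF t] dv[OF t] has_vector_derivative_continuous by blast+
    then show ?case by (simp add: continuous_at_imp_continuous_on)
  next
    case (Suc k)
    have cG: "Ck_on k ?J (\<lambda>t. \<Gamma> (x t) e f)" for e f
      by (rule Ck_on_compose[OF open_greaterThanLessThan open_ball])
         (use xb Suc \<Gamma>_smooth in \<open>auto simp: smooth_on_def\<close>)
    have cv: "Ck_on k ?J (\<lambda>t. v t \<bullet> e)" for e
      using Suc by (intro bounded_bilinear.Ck_on[OF bounded_bilinear_inner] Ck_on_const) auto
    have "Ck_on k ?J (\<lambda>t. \<Sum>e\<in>Basis. \<Sum>f\<in>Basis. ((v t \<bullet> e) * (v t \<bullet> f)) *\<^sub>R \<Gamma> (x t) e f)"
      by (intro Ck_on_sum bounded_bilinear.Ck_on[OF bounded_bilinear_scaleR] bounded_bilinear.Ck_on[OF bounded_bilinear_mult]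
          cG cv open_greaterThanLessThan)
    then have "Ck_on k ?J (\<lambda>t. (-1::real) *\<^sub>R (\<Sum>e\<in>Basis. \<Sum>f\<in>Basis. ((v t \<bullet> e) * (v t \<bullet> f)) *\<^sub>R \<Gamma> (x t) e f))"
      by (intro bounded_bilinear.Ck_on[OF bounded_bilinear_scaleR] Ck_on_const) auto
    then have "Ck_on k ?J (\<lambda>t. - \<Gamma> (x t) (v t) (v t))"
      by (rule Ck_on_cong[OF open_greaterThanLessThan, rotated])
         (simp add: bilinear_expansion[OF \<Gamma>_lin1[OF xb] \<Gamma>_lin[OF xb], symmetric])
    then have "Ck_on (Suc k) ?J v" by (intro Ck_on_Suc_real[OF _ dv]) auto
    moreover have "Ck_on (Suc k) ?J x" using Suc by (intro Ck_on_Suc_real[OF _ dx]) auto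
    ultimately show ?case by blast
  qed
  then show "smooth_on ?J x" "smooth_on ?J v" by (auto simp: smooth_on_def)
qed

end

section \<open>Riemannian metrics\<close>

locale riemannian_manifold = affine_manifold A N
  for A :: "('m::{t2_space, second_countable_topology}, 'n::finite) chart set" and N :: "'m connection" +
  fixes h :: "'m metric"
  assumes metric: "riemannian_metric A h" and lc: "levi_civita A h N"
begin

lemma
  assumes u: "u \<in> tangent_space A p" and w: "w \<in> tangent_space A p"
  shows h_lincomb: "v \<in> tangent_space A p \<Longrightarrow> h p (\<lambda>f. a * u f + b * v f) w = a * h p u w + b * h p v w"
    and h_sym: "h p u w = h p w u"
    and h_pos: "u \<noteq> (\<lambda>f. 0) \<Longrightarrow> h p u u > 0"
  using metric u w unfolding riemannian_metric_def by blast+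

lemma h_smooth: "U \<in> vector_fields A \<Longrightarrow> V \<in> vector_fields A \<Longrightarrow> smooth_fun A (\<lambda>p. h p (U p) (V p))"
  using metric unfolding riemannian_metric_def by blast

lemma N_torsion_free:
  assumes "U \<in> vector_fields A" "V \<in> vector_fields A"
  shows "N U V p f - N V U p f = U p (\<lambda>q. V q f) - V p (\<lambda>q. U q f)"
proof -
  have "(\<lambda>p f. N U V p f - N V U p f) = lie_bracket U V"
    using lc assms unfolding levi_civita_def torsion_free_def by blast
  then show ?thesis unfolding lie_bracket_def by meson
qed

lemma N_metric:
  assumes "U \<in> vector_fields A" "V \<in> vector_fields A" "W \<in> vector_fields A"
  shows "U p (\<lambda>q. h q (V q) (W q)) = h p (N U V p) (W p) + h p (V p) (N U W p)"
proof -
  have "cubic_form h N U V W p = 0"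
    using lc assms unfolding levi_civita_def by blast
  then show ?thesis unfolding cubic_form_def by simp
qed

end

locale riemannian_chart = riemannian_manifold A N h + affine_chart A N c x0 r w
  for A :: "('m::{t2_space, second_countable_topology}, 'n::finite) chart set" and N h c x0 r w
begin

definition "H x u v = h (cinv c x) (tvec c (cinv c x) u) (tvec c (cinv c x) v)"

lemma tvec_tangent: "x \<in> ball x0 r \<Longrightarrow> tvec c (cinv c x) v \<in> tangent_space A (cinv c x)"
  by (rule tvec_in[OF c cinv_in[OF ball_cimg]])

lemma H_E: "x \<in> ball x0 r \<Longrightarrow> H x u v = h (cinv c x) (E u (cinv c x)) (E v (cinv c x))"
  unfolding H_def by (simp only: E_eq[OF cinv_Q])

lemma coord_lincomb: "coord (\<lambda>f. a * u f + b * v f) = a *\<^sub>R coord u + b *\<^sub>R coord v"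
  by (simp add: coord_def scaleR_add_left scaleR_sum_right sum.distrib)

lemma N_E_lincomb: "N (E u) (E (a *\<^sub>R v + b *\<^sub>R y)) = (\<lambda>p f. a * N (E u) (E v) p f + b * N (E u) (E y) p f)"
proof -
  have m: "N (E u) (\<lambda>p f. a * E v p f) = (\<lambda>p f. a * N (E u) (E v) p f)" for a v
    using N_mult2[OF E_vf E_vf smooth_fun_const] tangent_const[OF vf_tangent[OF E_vf]] by simp
  have "N (E u) (\<lambda>p f. a * E v p f + b * E y p f) = (\<lambda>p f. N (E u) (\<lambda>p f. a * E v p f) p f + N (E u) (\<lambda>p f. b * E y p f) p f)"
    by (intro N_add2 E_vf vf_scale smooth_fun_const)
  then show ?thesis unfolding E_lincomb m .
qed

lemma local_geometry: "local_geometry x0 r H \<Gamma>"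
proof (rule local_geometry.intro)
  show "0 < r" by (rule r)
next
  fix x v assume x: "x \<in> ball x0 r"
  note t = tvec_tangent[OF x]
  have lin: "tvec c (cinv c x) (a *\<^sub>R u + b *\<^sub>R w) = (\<lambda>f. a * tvec c (cinv c x) u f + b * tvec c (cinv c x) w f)" for a b u w
    by (rule tvec_lincomb[OF c cinv_in[OF ball_cimg[OF x]]])
  have l: "H x v (a *\<^sub>R u + b *\<^sub>R w) = a * H x v u + b * H x v w" for a b u w
  proof -
    have "H x v (a *\<^sub>R u + b *\<^sub>R w) = h (cinv c x) (tvec c (cinv c x) (a *\<^sub>R u + b *\<^sub>R w)) (tvec c (cinv c x) v)"
      unfolding H_def by (rule h_sym[OF t t])
    also have "\<dots> = a * h (cinv c x) (tvec c (cinv c x) u) (tvec c (cinv c x) v) + b * h (cinv c x) (tvec c (cinv c x) w) (tvec c (cinv c x) v)"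
      unfolding lin by (rule h_lincomb[OF t t t])
    finally show ?thesis unfolding H_def by (simp only: h_sym[OF t t, of _ v])
  qed
  show "linear (H x v)"
    using l[of 1 _ 1] l[of _ _ 0] by (intro linearI) auto
  show "linear (\<Gamma> x v)"
    unfolding \<Gamma>_def using N_E_lincomb[of v 1 _ 1] N_E_lincomb[of v _ _ 0 0] coord_lincomb[of 1 _ 1] coord_lincomb[of _ _ 0]
    by (intro linearI) auto
next
  fix x v w assume x: "x \<in> ball x0 r"
  show "H x v w = H x w v" unfolding H_def by (rule h_sym[OF tvec_tangent[OF x] tvec_tangent[OF x]])
  have q: "cinv c x \<in> Q" by (rule cinv_Q[OF x])
  \<comment> \<open>Coordinate fields have constant components on \<open>Q\<close>, so they commute
    there; absence of torsion then makes \<open>\<Gamma>\<close> symmetric.\<close>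
  have z: "E u (cinv c x) (\<lambda>q. E v q (X e)) = 0" for u v e
  proof -
    have "E u (cinv c x) (\<lambda>q. E v q (X e)) = E u (cinv c x) (\<lambda>q. v \<bullet> e)"
      by (rule tangent_local[OF vf_tangent[OF E_vf] vf_smooth[OF E_vf X_smooth] smooth_fun_const Q_open q])
         (simp add: E_eq tvec_X)
    then show ?thesis by (simp add: tangent_const[OF vf_tangent[OF E_vf]])
  qed
  have "N (E v) (E w) (cinv c x) (X e) = N (E w) (E v) (cinv c x) (X e)" for e
    using N_torsion_free[OF E_vf[of v] E_vf[of w], of "cinv c x" "X e"] z by simp
  then show "\<Gamma> x v w = \<Gamma> x w v" by (simp add: \<Gamma>_def coord_def)
next
  fix x and v :: "real ^ 'n" assume x: "x \<in> ball x0 r" and v: "v \<noteq> 0"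
  have "coord (tvec c (cinv c x) v) = v" by (rule coord_tvec[OF cinv_Q[OF x]])
  moreover have "coord (\<lambda>f. 0) = 0" by (simp add: coord_def)
  ultimately have "tvec c (cinv c x) v \<noteq> (\<lambda>f. 0)" using v by metis
  then show "0 < H x v v" unfolding H_def by (rule h_pos[OF tvec_tangent[OF x] tvec_tangent[OF x]])
next
  fix v w
  let ?F = "\<lambda>q. h q (E v q) (E w q)"
  have F: "smooth_fun A ?F" by (rule h_smooth[OF E_vf E_vf])
  have sF: "smooth_on (ball x0 r) (\<lambda>x. ?F (cinv c x))"
    by (rule smooth_on_subset[OF smooth_funD[OF F c]]) (use ball_cimg in blast)
  show "smooth_on (ball x0 r) (\<lambda>x. H x v w)"
    by (rule smooth_on_cong[OF open_ball _ sF]) (simp add: H_E)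
  have "smooth_on (ball x0 r) (\<lambda>x. N (E v) (E w) (cinv c x) (X e))" for e
    by (rule smooth_on_subset[OF smooth_funD[OF vf_smooth[OF N_vf[OF E_vf E_vf] X_smooth] c]]) (use ball_cimg in blast)
  then show "smooth_on (ball x0 r) (\<lambda>x. \<Gamma> x v w)"
    unfolding \<Gamma>_def coord_def by (intro smooth_intros open_ball)
  fix x assume x: "x \<in> ball x0 r"
  let ?q = "cinv c x"
  have q: "?q \<in> Q" by (rule cinv_Q[OF x])
  have sx: "snd c ?q = x" by (rule chart_cinv[OF ball_cimg[OF x]])
  have "((\<lambda>x. ?F (cinv c x)) has_derivative (\<lambda>u. tvec c ?q u ?F)) (at x)"
    using smooth_fun_has_derivative[OF c Q_sub[OF q] F] sx by simp
  then have "((\<lambda>x. H x v w) has_derivative (\<lambda>u. tvec c ?q u ?F)) (at x)"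
    by (rule has_derivative_transform_within_open[OF _ open_ball x]) (simp add: H_E)
  moreover have "tvec c ?q u ?F = H x (\<Gamma> x u v) w + H x v (\<Gamma> x u w)" for u
    using N_metric[OF E_vf[of u] E_vf[of v] E_vf[of w], of ?q]
    unfolding E_eq[OF q] N_E_eq[OF q] sx H_def .
  ultimately show "((\<lambda>x. H x v w) has_derivative (\<lambda>u. H x (\<Gamma> x u v) w + H x v (\<Gamma> x u w))) (at x)"
    by (simp only:)
qed

end

locale riemannian_ball = riemannian_chart A N h c x0 r w + short_geodesics x0 r H \<Gamma> R1 K l \<rho>
  for A :: "('m::{t2_space, second_countable_topology}, 'n::finite) chart set" and N h c x0 r w R1 K l \<rho>

context riemannian_manifold
begin

lemma ex_riemannian_ball:
  obtains c r w R1 K l \<rho> where "riemannian_ball A N h c (snd c p) r w R1 K l \<rho>" "p \<in> fst c"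
proof -
  obtain c where cp: "c \<in> A" "p \<in> fst c" using chart_ex by blast
  obtain r w where "cutoff_chart A c (snd c p) r w" using ex_cutoff_chart[OF cp] by blast
  then interpret cutoff_chart A c "snd c p" r w .
  interpret riemannian_chart A N h c "snd c p" r w by unfold_locales
  interpret local_geometry "snd c p" r H \<Gamma> by (rule local_geometry)
  have r2: "0 < r / 2" "r / 2 < r" using r by auto
  obtain K l where K: "K \<ge> 1" "l > 0"
    and bounds:
    "\<And>x v. x \<in> cball (snd c p) (r / 2) \<Longrightarrow> l * (norm v)\<^sup>2 \<le> H x v v"
    "\<And>x v w. x \<in> cball (snd c p) (r / 2) \<Longrightarrow> \<bar>H x v w\<bar> \<le> K * norm v * norm w"
    "\<And>x v w. x \<in> cball (snd c p) (r / 2) \<Longrightarrow> norm (\<Gamma> x v w) \<le> K * norm v * norm w"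
    "\<And>x y v w. x \<in> cball (snd c p) (r / 2) \<Longrightarrow> y \<in> cball (snd c p) (r / 2) \<Longrightarrow> norm (\<Gamma> x v w - \<Gamma> y v w) \<le> K * norm (x - y) * norm v * norm w"
    "\<And>x y v w. x \<in> cball (snd c p) (r / 2) \<Longrightarrow> y \<in> cball (snd c p) (r / 2) \<Longrightarrow> \<bar>H x v w - H y v w\<bar> \<le> K * norm (x - y) * norm v * norm w"
    "\<And>x y v. x \<in> cball (snd c p) (r / 2) \<Longrightarrow> y \<in> cball (snd c p) (r / 2) \<Longrightarrow>
       \<bar>H y v v - H x v v - 2 * H x (\<Gamma> x (y - x) v) v\<bar> \<le> K * (norm (y - x))\<^sup>2 * (norm v)\<^sup>2"
    by (rule ex_bounds[OF r2]) (rule that, assumption+)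
  \<comment> \<open>The entries match the three smallness conditions of
    \<open>short_geodesics\<close>; the last one is \<open>R1 / 20\<close> for
    \<open>R1 = r / 2\<close>.\<close>
  define \<rho> where "\<rho> = Min {1 / (200 * K), l / (64 * K), r / 40}"
  have Min: "\<rho> \<le> 1 / (200 * K)" "\<rho> \<le> l / (64 * K)" "\<rho> \<le> r / 40" "\<rho> > 0"
    using K r by (auto simp: \<rho>_def)
  have "riemannian_ball A N h c (snd c p) r w (r / 2) K l \<rho>"
  proof unfold_locales
    show "200 * K * \<rho> \<le> 1" "64 * K * \<rho> \<le> l" "20 * \<rho> \<le> r / 2" "\<rho> > 0"
      using Min K by (auto simp: field_simps)
  qed (fact r2 K bounds)+
  then show ?thesis using that cp by blast
qed

end

subsection \<open>The Riemannian distance\<close>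

context smooth_manifold
begin

definition speed2 :: "'m metric \<Rightarrow> ('m, 'n) chart \<Rightarrow> 'm \<Rightarrow> real ^ 'n \<Rightarrow> real" where
  "speed2 h c q v = h q (tvec c q v) (tvec c q v)"

text \<open>An arc stays in a single chart, so its velocity is a derivative of a curve in Euclidean
  space; \<open>reach\<close> joins arcs from different charts. The derivative may be discontinuous,
  which decides the form of \<open>arc_local\<close>.\<close>

definition is_arc :: "'m metric \<Rightarrow> ('m, 'n) chart \<Rightarrow> (real \<Rightarrow> real ^ 'n) \<Rightarrow> (real \<Rightarrow> real ^ 'n) \<Rightarrow> real \<Rightarrow> real \<Rightarrow> bool" where
  "is_arc h c z z' \<alpha> \<omega> \<longleftrightarrow> \<alpha> \<le> \<omega> \<and> (\<forall>t\<in>{\<alpha>..\<omega>}. z t \<in> cimg c \<and>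
     (z has_vector_derivative z' t) (at t within {\<alpha>..\<omega>}) \<and> speed2 h c (cinv c (z t)) (z' t) \<le> 1)"

definition arc :: "'m metric \<Rightarrow> 'm \<Rightarrow> 'm \<Rightarrow> real \<Rightarrow> bool" where
  "arc h p q \<tau> \<longleftrightarrow> (\<exists>c\<in>A. \<exists>z z' \<alpha> \<omega>. is_arc h c z z' \<alpha> \<omega> \<and> \<tau> = \<omega> - \<alpha> \<and> p = cinv c (z \<alpha>) \<and> q = cinv c (z \<omega>))"

text \<open>Arcs have speed at most \<open>1\<close>. The Riemannian distance is then the infimum of travel times, and the
  speed need not be integrated.\<close>

inductive reach :: "'m metric \<Rightarrow> 'm \<Rightarrow> 'm \<Rightarrow> real \<Rightarrow> bool" for h where
  reach_refl: "reach h p p 0"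
| reach_step: "reach h p q s \<Longrightarrow> arc h q r t \<Longrightarrow> reach h p r (s + t)"

definition riem_dist :: "'m metric \<Rightarrow> 'm \<Rightarrow> 'm \<Rightarrow> real" where
  "riem_dist h p q = Inf {\<tau>. reach h p q \<tau>}"

lemma is_arc_sub:
  assumes "is_arc h c z z' \<alpha> \<omega>" "\<alpha> \<le> s" "s \<le> t" "t \<le> \<omega>"
  shows "is_arc h c z z' s t"
proof -
  have sub: "{s..t} \<subseteq> {\<alpha>..\<omega>}" using assms by auto
  show ?thesis
    using assms has_vector_derivative_within_subset[OF _ sub] sub unfolding is_arc_def by blast
qed

lemma is_arc_arc: "c \<in> A \<Longrightarrow> is_arc h c z z' \<alpha> \<omega> \<Longrightarrow> arc h (cinv c (z \<alpha>)) (cinv c (z \<omega>)) (\<omega> - \<alpha>)"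
  unfolding arc_def by blast

lemma arc_reach: "arc h p q \<tau> \<Longrightarrow> reach h p q \<tau>"
  using reach_step[OF reach_refl] by force

lemma reach_nonneg: "reach h p q \<tau> \<Longrightarrow> \<tau> \<ge> 0"
  by (induction rule: reach.induct) (auto simp: arc_def is_arc_def)

lemma reach_trans: "reach h q r t \<Longrightarrow> reach h p q s \<Longrightarrow> reach h p r (s + t)"
proof (induction rule: reach.induct)
  case (reach_step p' q' s' r' t')
  then have "reach h p r' ((s + s') + t')" using reach.reach_step by blast
  then show ?case by (simp add: add.assoc)
qed simp

lemma tvec_change:
  assumes c: "c \<in> A" and d: "d \<in> A" and q: "q \<in> fst c" "q \<in> fst d"
  shows "tvec c q (frechet_derivative (\<lambda>y. snd c (cinv d y)) (at (snd d q)) v) = tvec d q v"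
proof
  fix f
  let ?T = "\<lambda>y. snd c (cinv d y)"
  let ?W = "snd d ` (fst d \<inter> fst c)"
  have W: "open ?W" by (rule chart_image_open[OF d]) (auto intro: chart_open c d)
  have qW: "snd d q \<in> ?W" using q by blast
  show "tvec c q (frechet_derivative ?T (at (snd d q)) v) f = tvec d q v f"
  proof (cases "smooth_fun A f")
    case f: True
    have dT: "(?T has_derivative frechet_derivative ?T (at (snd d q))) (at (snd d q))"
      by (rule smooth_on_has_derivative[OF transition_smooth[OF d c] qW])
    have "((\<lambda>x. f (cinv c x)) has_derivative (\<lambda>v. tvec c q v f)) (at (?T (snd d q)))"
      using smooth_fun_has_derivative[OF c q(1) f] by (simp add: cinv_chart[OF d q(2)])
    with dT have comp: "((\<lambda>y. f (cinv c (?T y))) has_derivative (\<lambda>v. tvec c q (frechet_derivative ?T (at (snd d q)) v) f)) (at (snd d q))"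
      by (rule has_derivative_compose)
    have eq: "f (cinv c (?T y)) = f (cinv d y)" if y: "y \<in> ?W" for y
    proof -
      obtain p where p: "p \<in> fst d \<inter> fst c" "y = snd d p" using y by blast
      then show ?thesis using cinv_chart[OF d, of p] cinv_chart[OF c, of p] by simp
    qed
    have "((\<lambda>y. f (cinv d y)) has_derivative (\<lambda>v. tvec c q (frechet_derivative ?T (at (snd d q)) v) f)) (at (snd d q))"
      by (rule has_derivative_transform_within_open[OF comp W qW eq])
    then show ?thesis using tvec_eqI[OF d q(2) f] by metis
  qed (simp add: tvec_def)
qed

lemma arc_continuous:
  assumes "c \<in> A" "is_arc h c z z' \<alpha> \<omega>"
  shows "continuous_on {\<alpha>..\<omega>} (\<lambda>t. cinv c (z t))"
proof (rule continuous_on_compose2[OF cinv_continuous[OF assms(1)]])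
  show "continuous_on {\<alpha>..\<omega>} z"
    using assms(2) by (intro continuous_on_vector_derivative[where f' = z']) (auto simp: is_arc_def)
  show "z ` {\<alpha>..\<omega>} \<subseteq> cimg c" using assms(2) by (auto simp: is_arc_def)
qed

lemma continuous_within_open:
  assumes "continuous_on {\<alpha>..\<omega>::real} \<beta>" "x \<in> {\<alpha>..\<omega>}" "open O'" "\<beta> x \<in> O'"
  shows "\<exists>\<delta>>0. \<forall>t\<in>{\<alpha>..\<omega>}. \<bar>t - x\<bar> < \<delta> \<longrightarrow> \<beta> t \<in> O'"
proof -
  have "(\<beta> \<longlongrightarrow> \<beta> x) (at x within {\<alpha>..\<omega>})"
    using assms(1,2) unfolding continuous_on_def by blast
  then have "\<forall>\<^sub>F t in at x within {\<alpha>..\<omega>}. \<beta> t \<in> O'" using assms(3,4) topological_tendstoD by blast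
  then obtain \<delta> where "\<delta> > 0" "\<forall>t\<in>{\<alpha>..\<omega>}. t \<noteq> x \<and> dist t x < \<delta> \<longrightarrow> \<beta> t \<in> O'"
    unfolding eventually_at by blast
  then show ?thesis using assms(4) by (intro exI[of _ \<delta>]) (metis dist_real_def)
qed

end

context riemannian_manifold
begin

lemma speed2_scale:
  assumes "c \<in> A" "q \<in> fst c"
  shows "speed2 h c q (a *\<^sub>R v) = a\<^sup>2 * speed2 h c q v"
proof -
  note t = tvec_in[OF assms]
  have "tvec c q (a *\<^sub>R v) = (\<lambda>f. a * tvec c q v f + 0 * tvec c q v f)"
    using tvec_lincomb[OF assms, of a v 0 v] by simp
  moreover have "h q (\<lambda>f. a * tvec c q v f + 0 * tvec c q v f) u = a * h q (tvec c q v) u" if "u \<in> tangent_space A q" for u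
    using h_lincomb[OF t that t, of a v 0 v] by simp
  ultimately show ?thesis
    unfolding speed2_def using h_sym[OF t t] t by (metis (no_types, lifting) mult.assoc power2_eq_square)
qed

text \<open>Speed is traded for time: stretching the parameter by \<open>k\<close> turns a speed
  bound \<open>k\<close> into the bound \<open>1\<close>.\<close>

lemma arc_rescale:
  assumes c: "c \<in> A" and z: "\<alpha> \<le> \<omega>" "\<And>t. t \<in> {\<alpha>..\<omega>} \<Longrightarrow> z t \<in> cimg c \<and>
     (z has_vector_derivative z' t) (at t within {\<alpha>..\<omega>}) \<and> speed2 h c (cinv c (z t)) (z' t) \<le> k\<^sup>2" and k: "k > 0"
  shows "arc h (cinv c (z \<alpha>)) (cinv c (z \<omega>)) (k * (\<omega> - \<alpha>))"
proof -
  have "is_arc h c (\<lambda>t. z (t / k)) (\<lambda>t. (1 / k) *\<^sub>R z' (t / k)) (k * \<alpha>) (k * \<omega>)"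
    unfolding is_arc_def
  proof (intro conjI ballI)
    show "k * \<alpha> \<le> k * \<omega>" using z k by simp
    fix t assume t: "t \<in> {k * \<alpha>..k * \<omega>}"
    then have tk: "t / k \<in> {\<alpha>..\<omega>}" using k by (simp add: pos_le_divide_eq pos_divide_le_eq mult.commute)
    have img: "(\<lambda>t. t / k) ` {k * \<alpha>..k * \<omega>} \<subseteq> {\<alpha>..\<omega>}"
      using k by (auto simp: pos_le_divide_eq pos_divide_le_eq mult.commute)
    show "z (t / k) \<in> cimg c" using z(2)[OF tk] by blast
    have "((\<lambda>t. t / k) has_vector_derivative (1 / k)) (at t within {k * \<alpha>..k * \<omega>})"
      unfolding has_real_derivative_iff_has_vector_derivative[symmetric] by (rule DERIV_cdivide[OF DERIV_ident])
    moreover have "(z has_vector_derivative z' (t / k)) (at (t / k) within (\<lambda>t. t / k) ` {k * \<alpha>..k * \<omega>})"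
      by (rule has_vector_derivative_within_subset[OF _ img]) (use z(2)[OF tk] in blast)
    ultimately show "((\<lambda>t. z (t / k)) has_vector_derivative ((1 / k) *\<^sub>R z' (t / k))) (at t within {k * \<alpha>..k * \<omega>})"
      using vector_diff_chain_within[of "\<lambda>t. t / k" "1 / k" t _ z "z' (t / k)"] by (simp add: o_def)
    have "speed2 h c (cinv c (z (t / k))) ((1 / k) *\<^sub>R z' (t / k)) = (1 / k)\<^sup>2 * speed2 h c (cinv c (z (t / k))) (z' (t / k))"
      by (rule speed2_scale[OF c cinv_in]) (use z(2)[OF tk] in blast)
    also have "\<dots> \<le> (1 / k)\<^sup>2 * k\<^sup>2" using z(2)[OF tk] by (intro mult_left_mono) auto
    finally show "speed2 h c (cinv c (z (t / k))) ((1 / k) *\<^sub>R z' (t / k)) \<le> 1" using k by (simp add: power_divide)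
  qed
  from is_arc_arc[OF c this] k show ?thesis by (simp add: algebra_simps)
qed

lemma arc_sym:
  assumes "arc h p q \<tau>" shows "arc h q p \<tau>"
proof -
  obtain c z z' \<alpha> \<omega> where c: "c \<in> A" and z: "is_arc h c z z' \<alpha> \<omega>" and eq: "\<tau> = \<omega> - \<alpha>" "p = cinv c (z \<alpha>)" "q = cinv c (z \<omega>)"
    using assms unfolding arc_def by blast
  have "is_arc h c (\<lambda>t. z (- t)) (\<lambda>t. (- 1) *\<^sub>R z' (- t)) (- \<omega>) (- \<alpha>)"
    unfolding is_arc_def
  proof (intro conjI ballI)
    show "- \<omega> \<le> - \<alpha>" using z by (simp add: is_arc_def)
    fix t assume "t \<in> {- \<omega>..- \<alpha>}"
    then have t: "- t \<in> {\<alpha>..\<omega>}" by auto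
    then have zt: "z (- t) \<in> cimg c" "(z has_vector_derivative z' (- t)) (at (- t) within {\<alpha>..\<omega>})" "speed2 h c (cinv c (z (- t))) (z' (- t)) \<le> 1"
      using z unfolding is_arc_def by blast+
    show "z (- t) \<in> cimg c" by (rule zt(1))
    have "(uminus has_vector_derivative (- 1 :: real)) (at t within {- \<omega>..- \<alpha>})"
      by (auto intro!: derivative_eq_intros)
    moreover have "(z has_vector_derivative z' (- t)) (at (- t) within uminus ` {- \<omega>..- \<alpha>})"
      using zt(2) by simp
    ultimately show "((\<lambda>t. z (- t)) has_vector_derivative (- 1) *\<^sub>R z' (- t)) (at t within {- \<omega>..- \<alpha>})"
      using vector_diff_chain_within[of uminus "- 1 :: real" t _ z "z' (- t)"] by (simp add: o_def)
    show "speed2 h c (cinv c (z (- t))) ((- 1) *\<^sub>R z' (- t)) \<le> 1"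
      using zt(3) by (simp only: speed2_scale[OF c cinv_in[OF zt(1)]]) simp
  qed
  from is_arc_arc[OF c this] show ?thesis by (simp add: eq)
qed

lemma reach_sym: "reach h p q \<tau> \<Longrightarrow> reach h q p \<tau>"
proof (induction rule: reach.induct)
  case (reach_step p q s r t)
  then show ?case using reach_trans[OF reach_step.IH arc_reach[OF arc_sym[OF reach_step.hyps(2)]]] by (simp add: add.commute)
qed (rule reach_refl)

text \<open>A bound between two metrics becomes a bound between travel times. The distance of
  \<open>g\<close> is compared in this way with that of its conformal metric.\<close>

lemma reach_compare:
  assumes "reach k p q \<tau>" and cmp: "\<And>c q v. c \<in> A \<Longrightarrow> q \<in> fst c \<Longrightarrow> speed2 h c q v \<le> \<kappa>\<^sup>2 * speed2 k c q v" and \<kappa>: "\<kappa> > 0"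
  shows "reach h p q (\<kappa> * \<tau>)"
  using assms(1)
proof (induction rule: reach.induct)
  case (reach_step p q s r t)
  obtain c z z' \<alpha> \<omega> where c: "c \<in> A" and z: "is_arc k c z z' \<alpha> \<omega>" and eq: "t = \<omega> - \<alpha>" "q = cinv c (z \<alpha>)" "r = cinv c (z \<omega>)"
    using reach_step.hyps(2) unfolding arc_def by blast
  have "arc h (cinv c (z \<alpha>)) (cinv c (z \<omega>)) (\<kappa> * (\<omega> - \<alpha>))"
  proof (rule arc_rescale[OF c _ _ \<kappa>])
    show "\<alpha> \<le> \<omega>" using z by (simp add: is_arc_def)
    fix t assume t: "t \<in> {\<alpha>..\<omega>}"
    then have zt: "z t \<in> cimg c" "speed2 k c (cinv c (z t)) (z' t) \<le> 1" using z by (auto simp: is_arc_def)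
    have "speed2 h c (cinv c (z t)) (z' t) \<le> \<kappa>\<^sup>2 * speed2 k c (cinv c (z t)) (z' t)" by (rule cmp[OF c cinv_in[OF zt(1)]])
    also have "\<dots> \<le> \<kappa>\<^sup>2 * 1" using zt by (intro mult_left_mono) auto
    finally show "z t \<in> cimg c \<and> (z has_vector_derivative z' t) (at t within {\<alpha>..\<omega>}) \<and> speed2 h c (cinv c (z t)) (z' t) \<le> \<kappa>\<^sup>2"
      using z t by (simp add: is_arc_def)
  qed
  from reach.reach_step[OF reach_step.IH this[folded eq]] show ?case by (simp add: distrib_left)
qed (simp add: reach_refl)

end

section \<open>Lower bounds for travel times near a point\<close>

context riemannian_ball
begin

lemma H_speed2: "H x v v = speed2 h c (cinv c x) v"
  by (simp add: H_def speed2_def)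

lemma \<rho>_r: "x \<in> ball x0 \<rho> \<Longrightarrow> x \<in> ball x0 r"
  using R1_sub \<rho>_sub' by blast

lemma geo_arc:
  assumes ab: "a \<in> ball x0 \<rho>" "b \<in> ball x0 \<rho>" and S: "spd a b > 0" and st: "0 \<le> s" "s \<le> t" "t \<le> 1"
  shows "reach h (cinv c (sx a b s)) (cinv c (sx a b t)) (spd a b * (t - s))"
proof (rule arc_reach, rule arc_rescale[OF c st(2) _ S, of "sx a b" "sv a b"])
  note g = geo_sol[OF ab]
  fix u assume "u \<in> {s..t}"
  then have u: "u \<in> {-1..2}" using st by auto
  show "sx a b u \<in> cimg c \<and> (sx a b has_vector_derivative sv a b u) (at u within {s..t}) \<and>
      speed2 h c (cinv c (sx a b u)) (sv a b u) \<le> (spd a b)\<^sup>2"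
    using ball_cimg[OF geo_inR[OF g u]] geo_dx[OF g u, of "{s..t}"] spd_sq[OF ab u] st by (auto simp: H_speed2)
qed

lemma spd_eq_0: "a \<in> ball x0 \<rho> \<Longrightarrow> spd a a = 0"
  using spd_upper[of a a] spd_nonneg[of a a] by simp

lemma spd_0_eq:
  assumes "a \<in> ball x0 \<rho>" "b \<in> ball x0 \<rho>" "spd a b = 0" shows "a = b"
proof -
  have "sqrt l * norm (b - a) \<le> 0" using spd_lower[OF assms(1,2)] assms(3) by simp
  then show ?thesis using l by (simp add: mult_le_0_iff)
qed

lemma reach_ball:
  assumes ab: "a \<in> ball x0 \<rho>" "b \<in> ball x0 \<rho>"
  shows "reach h (cinv c a) (cinv c b) (spd a b)"
proof (cases "spd a b = 0")
  case True
  then show ?thesis using spd_0_eq[OF ab] reach_refl by simp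
next
  case False
  then have "spd a b > 0" using spd_nonneg[OF ab] by simp
  then show ?thesis
    using geo_arc[OF ab, of 0 1] geo_0[OF geo_sol[OF ab]] geo_1[OF geo_sol[OF ab]] by simp
qed

text \<open>An arc is merely differentiable at \<open>x\<close>, so its increments are controlled
  only between parameters \<open>s \<le> x \<le> t\<close>, which is what the bisection in
  \<open>arc_dist_minorant\<close> asks for. Of the excess rate \<open>2 * e\<close>, one
  \<open>e\<close> pays for replacing the arc by its tangent and one for the quadratic remainder of
  \<open>spd_sq_variation\<close>.\<close>

lemma arc_local:
  assumes a: "a \<in> ball x0 \<rho>" and d: "d \<in> A" and z: "is_arc h d z z' \<alpha> \<omega>" and x: "x \<in> {\<alpha>..\<omega>}"
    and e: "e > 0" and \<epsilon>: "\<epsilon> > 0" and q: "cinv d (z x) \<in> fst c" "snd c (cinv d (z x)) \<in> ball x0 \<rho>"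
  defines "W \<equiv> \<lambda>t. snd c (cinv d (z t))"
  shows "\<exists>\<delta>>0. \<forall>s t. \<alpha> \<le> s \<and> s \<le> x \<and> x \<le> t \<and> t \<le> \<omega> \<and> t - s < \<delta> \<longrightarrow>
     (cinv d (z s) \<in> fst c \<and> W s \<in> ball x0 \<rho>) \<and> (cinv d (z t) \<in> fst c \<and> W t \<in> ball x0 \<rho>) \<and>
     sqrt ((spd a (W t))\<^sup>2 + \<epsilon>\<^sup>2) \<le> sqrt ((spd a (W s))\<^sup>2 + \<epsilon>\<^sup>2) + (1 + 2 * e) * (t - s)"
proof -
  let ?T = "\<lambda>y. snd c (cinv d y)"
  let ?q = "cinv d (z x)"
  have zx: "z x \<in> cimg d" "(z has_vector_derivative z' x) (at x within {\<alpha>..\<omega>})" "speed2 h d ?q (z' x) \<le> 1"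
    using z x by (auto simp: is_arc_def)
  have sq: "snd d ?q = z x" by (rule chart_cinv[OF zx(1)])
  have qd: "?q \<in> fst d" by (rule cinv_in[OF zx(1)])
  define W' where "W' = frechet_derivative ?T (at (z x)) (z' x)"
  have zW: "z x \<in> snd d ` (fst d \<inter> fst c)" using q(1) qd sq by (metis IntI image_eqI)
  note dT = smooth_on_has_derivative[OF transition_smooth[OF d c] zW]
  have linT: "linear (frechet_derivative ?T (at (z x)))" using dT has_derivative_linear by blast
  have dW: "(W has_derivative (\<lambda>u. u *\<^sub>R W')) (at x within {\<alpha>..\<omega>})"
    using has_derivative_compose[OF zx(2)[unfolded has_vector_derivative_def] dT]
    by (simp add: W_def W'_def linear_scale[OF linT])
  have HW: "H (W x) W' W' \<le> 1"
  proof -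
    have "cinv c (W x) = ?q" unfolding W_def by (rule cinv_chart[OF c q(1)])
    then show ?thesis
      using zx(3) tvec_change[OF c d q(1) qd, of "z' x"] by (simp add: H_speed2 speed2_def W'_def sq)
  qed
  define M where "M = norm W'"
  have M: "M \<ge> 0" by (simp add: M_def)
  \<comment> \<open>One constant for both quadratic errors: replacing the arc by its tangent in
    \<open>H\<close>, and the remainder of \<open>spd_sq_variation\<close>, where
    \<open>norm \<Delta> \<le> (M + 1) * u\<close>.\<close>
  define C where "C = K * (M + 1)\<^sup>2"
  have C: "C > 0" using K M unfolding C_def by (intro mult_pos_pos) auto
  define \<eta> where "\<eta> = min 1 (e / C)"
  have \<eta>: "\<eta> > 0" "\<eta> \<le> 1" "C * \<eta> \<le> e"
  proof -
    show "\<eta> > 0" "\<eta> \<le> 1" using e C by (auto simp: \<eta>_def)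
    have "\<eta> \<le> e / C" by (simp add: \<eta>_def)
    then show "C * \<eta> \<le> e" using C by (simp add: pos_le_divide_eq mult.commute)
  qed
  obtain \<delta>1 where \<delta>1: "\<delta>1 > 0" "\<And>t. t \<in> {\<alpha>..\<omega>} \<Longrightarrow> \<bar>t - x\<bar> < \<delta>1 \<Longrightarrow> norm (W t - W x - (t - x) *\<^sub>R W') \<le> \<eta> * \<bar>t - x\<bar>"
    using dW \<eta>(1) unfolding has_derivative_within_alt real_norm_def by blast
  have Wc: "continuous (at x within {\<alpha>..\<omega>}) W" using dW has_derivative_continuous by blast
  obtain \<delta>2 where \<delta>2: "\<delta>2 > 0" "\<And>t. t \<in> {\<alpha>..\<omega>} \<Longrightarrow> \<bar>t - x\<bar> < \<delta>2 \<Longrightarrow> norm (W t - W x) < \<eta>"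
    using Wc \<eta>(1) unfolding continuous_within_eps_delta dist_norm real_norm_def by blast
  obtain \<delta>3 where \<delta>3: "\<delta>3 > 0" "\<And>t. t \<in> {\<alpha>..\<omega>} \<Longrightarrow> \<bar>t - x\<bar> < \<delta>3 \<Longrightarrow> cinv d (z t) \<in> {q \<in> fst c. snd c q \<in> ball x0 \<rho>}"
    using continuous_within_open[OF arc_continuous[OF d z] x chart_vimage_open[OF c open_ball]] q by blast
  \<comment> \<open>The last entry makes the remainder \<open>4 * C * u * u\<close> at most
    \<open>2 * G * e * u\<close>. This rests on \<open>G \<ge> \<epsilon>\<close>, since
    \<open>spd a (W s)\<close> itself may vanish.\<close>
  define \<delta> where "\<delta> = Min {\<delta>1, \<delta>2, \<delta>3, \<epsilon> * e / (2 * C)}"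
  have \<delta>: "\<delta> > 0" "\<delta> \<le> \<delta>1" "\<delta> \<le> \<delta>2" "\<delta> \<le> \<delta>3" "\<delta> \<le> \<epsilon> * e / (2 * C)"
    using \<delta>1(1) \<delta>2(1) \<delta>3(1) \<epsilon> e C by (auto simp: \<delta>_def)
  show ?thesis
  proof (intro exI[of _ \<delta>] conjI allI impI)
    show "\<delta> > 0" by (rule \<delta>)
    fix s t assume "\<alpha> \<le> s \<and> s \<le> x \<and> x \<le> t \<and> t \<le> \<omega> \<and> t - s < \<delta>"
    then have st: "\<alpha> \<le> s" "s \<le> x" "x \<le> t" "t \<le> \<omega>" "t - s < \<delta>" by auto
    have s: "s \<in> {\<alpha>..\<omega>}" "\<bar>s - x\<bar> < \<delta>" and t: "t \<in> {\<alpha>..\<omega>}" "\<bar>t - x\<bar> < \<delta>" using st x by auto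
    show si: "cinv d (z s) \<in> fst c" "W s \<in> ball x0 \<rho>" using \<delta>3(2)[OF s(1)] s(2) \<delta> by (auto simp: W_def)
    show ti: "cinv d (z t) \<in> fst c" "W t \<in> ball x0 \<rho>" using \<delta>3(2)[OF t(1)] t(2) \<delta> by (auto simp: W_def)
    define u where "u = t - s"
    have u: "u \<ge> 0" using st by (simp add: u_def)
    define \<Delta> where "\<Delta> = W t - W s"
    define k where "k = \<Delta> - u *\<^sub>R W'"
    have k: "norm k \<le> \<eta> * u"
    proof -
      have "k = (W t - W x - (t - x) *\<^sub>R W') - (W s - W x - (s - x) *\<^sub>R W')"
        by (simp add: k_def \<Delta>_def u_def algebra_simps)
      then have "norm k \<le> \<eta> * \<bar>t - x\<bar> + \<eta> * \<bar>s - x\<bar>"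
        using norm_triangle_ineq4[of "W t - W x - (t - x) *\<^sub>R W'" "W s - W x - (s - x) *\<^sub>R W'"]
          \<delta>1(2)[OF t(1)] \<delta>1(2)[OF s(1)] t(2) s(2) \<delta> by simp
      then show ?thesis using st by (simp add: u_def algebra_simps)
    qed
    have nD: "norm \<Delta> \<le> (M + 1) * u"
    proof -
      have "norm \<Delta> \<le> norm (u *\<^sub>R W') + norm k" using norm_triangle_ineq[of "u *\<^sub>R W'" k] by (simp add: k_def)
      also have "\<dots> \<le> u * M + \<eta> * u" using k u by (simp add: M_def)
      also have "\<dots> \<le> u * M + 1 * u" using \<eta> u by (intro add_left_mono mult_right_mono) auto
      finally show ?thesis by (simp add: algebra_simps)
    qed
    have R: "W s \<in> cball x0 R1" "W x \<in> cball x0 R1" "W s \<in> ball x0 r"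
      using \<rho>_sub'[OF si(2)] \<rho>_sub'[OF q(2)] \<rho>_r[OF si(2)] by (auto simp: W_def)
    have "H (W s) \<Delta> \<Delta> \<le> ((1 + e) * u)\<^sup>2"
    proof -
      have lin: "H (W s) \<Delta> \<Delta> = u\<^sup>2 * H (W s) W' W' + 2 * (u * H (W s) W' k) + H (W s) k k"
      proof -
        have "H (W s) \<Delta> \<Delta> = H (W s) (u *\<^sub>R W' + k) (u *\<^sub>R W' + k)" by (simp add: k_def)
        also have "\<dots> = u\<^sup>2 * H (W s) W' W' + 2 * (u * H (W s) W' k) + H (W s) k k"
          unfolding linear_add[OF H_lin[OF R(3)]] linear_add[OF H_lin1[OF R(3)]] linear_scale[OF H_lin[OF R(3)]] linear_scale[OF H_lin1[OF R(3)]]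
          using H_sym[OF R(3), of k W'] by (simp add: power2_eq_square algebra_simps)
        finally show ?thesis .
      qed
      have "H (W s) W' W' \<le> H (W x) W' W' + K * norm (W s - W x) * norm W' * norm W'"
        using H_lipschitz[OF R(1,2), of W' W'] by linarith
      also have "\<dots> \<le> 1 + K * \<eta> * M * M"
        unfolding M_def[symmetric] using \<delta>2(2)[OF s(1)] s(2) \<delta> K M HW by (intro add_mono mult_right_mono mult_left_mono) auto
      finally have h1: "u\<^sup>2 * H (W s) W' W' \<le> u\<^sup>2 * (1 + K * \<eta> * M * M)" by (intro mult_left_mono) auto
      have "H (W s) W' k \<le> K * M * norm k" using H_upper[OF R(1), of W' k] by (simp add: M_def)
      also have "\<dots> \<le> K * M * (\<eta> * u)" using k K M by (intro mult_left_mono) auto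
      finally have h2: "2 * (u * H (W s) W' k) \<le> 2 * (u * (K * M * (\<eta> * u)))" using u by (intro mult_left_mono) auto
      have "H (W s) k k \<le> K * norm k * norm k" using H_upper[OF R(1), of k k] by simp
      also have "\<dots> \<le> K * (\<eta> * u) * (1 * u)"
      proof (intro mult_mono)
        show "norm k \<le> 1 * u" using k mult_right_mono[OF \<eta>(2) u] by linarith
      qed (use k K u \<eta> in auto)
      finally have h3: "H (W s) k k \<le> K * (\<eta> * u) * (1 * u)" .
      have "H (W s) \<Delta> \<Delta> \<le> u\<^sup>2 * (1 + C * \<eta>)"
        unfolding lin using h1 h2 h3 by (simp add: C_def power2_eq_square algebra_simps)
      also have "\<dots> \<le> u\<^sup>2 * (1 + e)\<^sup>2"
      proof (rule mult_left_mono)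
        have "1 + C * \<eta> \<le> 1 + e" using \<eta> by simp
        also have "\<dots> \<le> (1 + e)\<^sup>2" using e by (simp add: power2_eq_square algebra_simps)
        finally show "1 + C * \<eta> \<le> (1 + e)\<^sup>2" .
      qed simp
      finally show ?thesis by (simp add: power_mult_distrib mult.commute)
    qed
    then have sH: "sqrt (H (W s) \<Delta> \<Delta>) \<le> (1 + e) * u"
      using e u by (intro real_le_lsqrt) auto
    define g where "g = spd a (W s)"
    define G where "G = sqrt (g\<^sup>2 + \<epsilon>\<^sup>2)"
    have g: "g \<ge> 0" unfolding g_def by (rule spd_nonneg[OF a si(2)])
    have gG: "g \<le> G" "\<epsilon> \<le> G" "G\<^sup>2 = g\<^sup>2 + \<epsilon>\<^sup>2" "G \<ge> 0"
      using \<epsilon> unfolding G_def by (auto intro!: real_le_rsqrt)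
    have "(spd a (W t))\<^sup>2 \<le> g\<^sup>2 + 2 * g * sqrt (H (W s) \<Delta> \<Delta>) + 4 * K * (norm \<Delta>)\<^sup>2"
      unfolding g_def \<Delta>_def by (rule spd_sq_variation[OF a si(2) ti(2)])
    also have "\<dots> \<le> g\<^sup>2 + 2 * G * ((1 + e) * u) + 4 * K * ((M + 1) * u)\<^sup>2"
      using gG g sH nD K u e H_nonneg[OF R(3), of \<Delta>] by (intro add_mono mult_mono power_mono) auto
    finally have "(spd a (W t))\<^sup>2 + \<epsilon>\<^sup>2 \<le> G\<^sup>2 + 2 * G * ((1 + e) * u) + 4 * K * ((M + 1) * u)\<^sup>2"
      unfolding gG(3) by simp
    also have "4 * K * ((M + 1) * u)\<^sup>2 = 4 * C * u * u"
      by (simp add: C_def power2_eq_square algebra_simps)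
    finally have b1: "(spd a (W t))\<^sup>2 + \<epsilon>\<^sup>2 \<le> G\<^sup>2 + 2 * G * ((1 + e) * u) + 4 * C * u * u" .
    have b2: "4 * C * u * u \<le> 2 * G * e * u"
    proof (rule mult_right_mono[OF _ u])
      have "u \<le> \<epsilon> * e / (2 * C)" using st \<delta> by (simp add: u_def)
      then have "2 * C * u \<le> \<epsilon> * e" using C by (simp add: field_simps)
      also have "\<dots> \<le> G * e" using gG e by (intro mult_right_mono) auto
      finally show "4 * C * u \<le> 2 * G * e" by simp
    qed
    have "G\<^sup>2 + 2 * G * ((1 + e) * u) + 2 * G * e * u \<le> (G + (1 + 2 * e) * u)\<^sup>2"
    proof -
      have "(G + (1 + 2 * e) * u)\<^sup>2 = G\<^sup>2 + 2 * G * ((1 + e) * u) + 2 * G * e * u + ((1 + 2 * e) * u)\<^sup>2"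
        by (simp add: power2_eq_square algebra_simps)
      then show ?thesis by simp
    qed
    with b1 b2 have "(spd a (W t))\<^sup>2 + \<epsilon>\<^sup>2 \<le> (G + (1 + 2 * e) * u)\<^sup>2" by linarith
    then show "sqrt ((spd a (W t))\<^sup>2 + \<epsilon>\<^sup>2) \<le> sqrt ((spd a (W s))\<^sup>2 + \<epsilon>\<^sup>2) + (1 + 2 * e) * (t - s)"
      unfolding G_def[symmetric] g_def[symmetric] u_def[symmetric] using gG e u by (intro real_le_lsqrt) auto
  qed
qed

text \<open>A lower bound, by \<open>spd_lower\<close>, for the length of a short geodesic from the
  quarter ball to a point outside the half ball.\<close>

definition "cap = sqrt l * \<rho> / 4"

text \<open>A function that bounds the distance to \<open>cinv c a\<close> from below. The regularisation by \<open>\<epsilon>\<close> avoids the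
  singularity of the distance at this point.\<close>

definition "dist_minorant a \<epsilon> q = (if q \<in> fst c \<and> snd c q \<in> ball x0 \<rho> then min (sqrt ((spd a (snd c q))\<^sup>2 + \<epsilon>\<^sup>2)) cap else cap)"

lemma cap_pos: "cap > 0"
  using l \<rho> by (simp add: cap_def)

lemma \<rho>4: "a \<in> ball x0 (\<rho> / 4) \<Longrightarrow> a \<in> ball x0 \<rho>"
  using \<rho> by auto

text \<open>By the choice of \<open>cap\<close> the truncation already takes effect outside the half
  ball. The two branches of \<open>dist_minorant\<close> thus agree on a collar, and the edge of the
  chart ball causes no jump.\<close>

lemma dist_minorant_far:
  assumes a: "a \<in> ball x0 (\<rho> / 4)" and q: "q \<notin> cinv c ` cball x0 (\<rho> / 2)"
  shows "dist_minorant a \<epsilon> q = cap"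
proof (cases "q \<in> fst c \<and> snd c q \<in> ball x0 \<rho>")
  case True
  let ?b = "snd c q"
  have "?b \<notin> cball x0 (\<rho> / 2)" using q True cinv_chart[OF c, of q] by (metis image_eqI)
  then have "\<rho> / 4 \<le> norm (?b - a)"
    using a norm_triangle_ineq[of "?b - a" "a - x0"] by (simp add: dist_norm norm_minus_commute)
  then have "cap \<le> sqrt l * norm (?b - a)" using l by (simp add: cap_def)
  also have "\<dots> \<le> spd a ?b" using True by (intro spd_lower \<rho>4[OF a]) auto
  also have "\<dots> \<le> sqrt ((spd a ?b)\<^sup>2 + \<epsilon>\<^sup>2)" by (rule real_le_rsqrt) simp
  finally show ?thesis using True by (simp add: dist_minorant_def)
qed (auto simp: dist_minorant_def)

text \<open>Bisection, in the form of \<open>Bolzano\<close>, extends the estimate of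
  \<open>arc_local\<close> from short intervals around a point to the whole arc; away from the ball
  the minorant is constant. The slack \<open>e\<close> is removed at the end.\<close>

lemma arc_dist_minorant:
  assumes a: "a \<in> ball x0 (\<rho> / 4)" and \<epsilon>: "\<epsilon> > 0" and arc: "arc h p q \<tau>"
  shows "dist_minorant a \<epsilon> q \<le> dist_minorant a \<epsilon> p + \<tau>"
proof -
  obtain d z z' \<alpha> \<omega> where d: "d \<in> A" and z: "is_arc h d z z' \<alpha> \<omega>" and eq: "\<tau> = \<omega> - \<alpha>" "p = cinv d (z \<alpha>)" "q = cinv d (z \<omega>)"
    using arc unfolding arc_def by blast
  have \<alpha>\<omega>: "\<alpha> \<le> \<omega>" using z by (simp add: is_arc_def)
  let ?\<beta> = "\<lambda>t. cinv d (z t)"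
  have main: "dist_minorant a \<epsilon> q \<le> dist_minorant a \<epsilon> p + (1 + 2 * e) * \<tau>" if e: "e > 0" for e
  proof -
    define P where "P s t \<longleftrightarrow> (\<alpha> \<le> s \<and> t \<le> \<omega> \<longrightarrow> dist_minorant a \<epsilon> (?\<beta> t) \<le> dist_minorant a \<epsilon> (?\<beta> s) + (1 + 2 * e) * (t - s))" for s t
    have "P \<alpha> \<omega>"
      using \<alpha>\<omega>
    proof (induction rule: Bolzano)
      case (trans s t u)
      then show ?case unfolding P_def by (auto simp: algebra_simps)
    next
      case (local x)
      then have x: "x \<in> {\<alpha>..\<omega>}" by simp
      show ?case
      proof (cases "?\<beta> x \<in> fst c \<and> snd c (?\<beta> x) \<in> ball x0 \<rho>")
        case True
        then obtain \<delta> where \<delta>: "\<delta> > 0" "\<forall>s t. \<alpha> \<le> s \<and> s \<le> x \<and> x \<le> t \<and> t \<le> \<omega> \<and> t - s < \<delta> \<longrightarrow>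
           (?\<beta> s \<in> fst c \<and> snd c (?\<beta> s) \<in> ball x0 \<rho>) \<and> (?\<beta> t \<in> fst c \<and> snd c (?\<beta> t) \<in> ball x0 \<rho>) \<and>
           sqrt ((spd a (snd c (?\<beta> t)))\<^sup>2 + \<epsilon>\<^sup>2) \<le> sqrt ((spd a (snd c (?\<beta> s)))\<^sup>2 + \<epsilon>\<^sup>2) + (1 + 2 * e) * (t - s)"
          using arc_local[OF \<rho>4[OF a] d z x e \<epsilon>] by blast
        have "P s t" if st: "s \<le> x" "x \<le> t" "t - s < \<delta>" for s t
          unfolding P_def
        proof
          assume "\<alpha> \<le> s \<and> t \<le> \<omega>"
          then have *: "(?\<beta> s \<in> fst c \<and> snd c (?\<beta> s) \<in> ball x0 \<rho>) \<and> (?\<beta> t \<in> fst c \<and> snd c (?\<beta> t) \<in> ball x0 \<rho>) \<and>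
           sqrt ((spd a (snd c (?\<beta> t)))\<^sup>2 + \<epsilon>\<^sup>2) \<le> sqrt ((spd a (snd c (?\<beta> s)))\<^sup>2 + \<epsilon>\<^sup>2) + (1 + 2 * e) * (t - s)"
            using \<delta>(2) st by blast
          moreover have "0 \<le> (1 + 2 * e) * (t - s)" using e st by simp
          ultimately show "dist_minorant a \<epsilon> (?\<beta> t) \<le> dist_minorant a \<epsilon> (?\<beta> s) + (1 + 2 * e) * (t - s)"
            by (auto simp: dist_minorant_def min_def)
        qed
        then show ?thesis using \<delta>(1) by blast
      next
        \<comment> \<open>A point outside the chart ball lies in the open complement of the compact
          half ball, where \<open>dist_minorant_far\<close> applies.\<close>
        case False
        let ?O = "- cinv c ` cball x0 (\<rho> / 2)"
        have sub: "cball x0 (\<rho> / 2) \<subseteq> ball x0 \<rho>" using \<rho> by auto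
        have sub': "cball x0 (\<rho> / 2) \<subseteq> cimg c" using sub ball_cimg \<rho>_r by blast
        have "compact (cinv c ` cball x0 (\<rho> / 2))"
          by (intro compact_continuous_image continuous_on_subset[OF cinv_continuous[OF c] sub'] compact_cball)
        then have O: "open ?O" using compact_imp_closed by blast
        have "?\<beta> x \<in> ?O"
        proof
          assume "?\<beta> x \<in> cinv c ` cball x0 (\<rho> / 2)"
          then obtain y where y: "y \<in> cball x0 (\<rho> / 2)" "?\<beta> x = cinv c y" by blast
          then have "y \<in> cimg c" "y \<in> ball x0 \<rho>" using sub sub' by blast+
          then show False using False y(2) cinv_in[of y c] chart_cinv[of y c] by simp
        qed
        then obtain \<delta> where \<delta>: "\<delta> > 0" "\<forall>t\<in>{\<alpha>..\<omega>}. \<bar>t - x\<bar> < \<delta> \<longrightarrow> ?\<beta> t \<in> ?O"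
          using continuous_within_open[OF arc_continuous[OF d z] x O] by blast
        have "P s t" if st: "s \<le> x" "x \<le> t" "t - s < \<delta>" for s t
          unfolding P_def
        proof
          assume "\<alpha> \<le> s \<and> t \<le> \<omega>"
          then have "?\<beta> s \<in> ?O" "?\<beta> t \<in> ?O" using \<delta>(2) st x by auto
          then show "dist_minorant a \<epsilon> (?\<beta> t) \<le> dist_minorant a \<epsilon> (?\<beta> s) + (1 + 2 * e) * (t - s)"
            using dist_minorant_far[OF a] e st by simp
        qed
        then show ?thesis using \<delta>(1) by blast
      qed
    qed
    then show ?thesis using \<alpha>\<omega> by (simp add: P_def eq)
  qed
  have \<tau>: "\<tau> \<ge> 0" using \<alpha>\<omega> eq by simp
  show ?thesis
  proof (rule field_le_epsilon)
    fix e :: real assume e: "e > 0"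
    define e' where "e' = e / (2 * (\<tau> + 1))"
    have e': "e' > 0" using e \<tau> by (simp add: e'_def)
    have "2 * e' * \<tau> = e * (\<tau> / (\<tau> + 1))" using \<tau> by (simp add: e'_def field_simps)
    also have "\<dots> \<le> e * 1" using e \<tau> by (intro mult_left_mono) auto
    finally show "dist_minorant a \<epsilon> q \<le> dist_minorant a \<epsilon> p + \<tau> + e" using main[OF e'] by (simp add: algebra_simps)
  qed
qed

lemma reach_dist_minorant:
  assumes "reach h p q \<tau>" and a: "a \<in> ball x0 (\<rho> / 4)" and \<epsilon>: "\<epsilon> > 0"
  shows "dist_minorant a \<epsilon> q \<le> dist_minorant a \<epsilon> p + \<tau>"
  using assms(1)
proof (induction rule: reach.induct)
  case (reach_step p q s r t)
  then show ?case using arc_dist_minorant[OF a \<epsilon> reach_step.hyps(2)] by simp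
qed simp

lemma reach_lower:
  assumes a: "a \<in> ball x0 (\<rho> / 4)" and r: "reach h (cinv c a) q \<tau>"
  shows "(if q \<in> fst c \<and> snd c q \<in> ball x0 \<rho> then min (spd a (snd c q)) cap else cap) \<le> \<tau>"
proof (rule field_le_epsilon)
  fix \<epsilon> :: real assume \<epsilon>: "\<epsilon> > 0"
  have a': "a \<in> ball x0 \<rho>" by (rule \<rho>4[OF a])
  have ac: "a \<in> cimg c" using ball_cimg \<rho>_r a' by blast
  have "dist_minorant a \<epsilon> (cinv c a) \<le> \<epsilon>"
    using a' cinv_in[OF ac] chart_cinv[OF ac] \<epsilon> by (simp add: dist_minorant_def spd_eq_0)
  then have "dist_minorant a \<epsilon> q \<le> \<tau> + \<epsilon>" using reach_dist_minorant[OF r a \<epsilon>] by simp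
  moreover have "(if q \<in> fst c \<and> snd c q \<in> ball x0 \<rho> then min (spd a (snd c q)) cap else cap) \<le> dist_minorant a \<epsilon> q"
  proof -
    have "spd a (snd c q) \<le> sqrt ((spd a (snd c q))\<^sup>2 + \<epsilon>\<^sup>2)" by (rule real_le_rsqrt) simp
    then show ?thesis by (auto simp: dist_minorant_def intro: min.coboundedI1)
  qed
  ultimately show "(if q \<in> fst c \<and> snd c q \<in> ball x0 \<rho> then min (spd a (snd c q)) cap else cap) \<le> \<tau> + \<epsilon>" by linarith
qed

end

section \<open>Length metrics\<close>

text \<open>The distance is a locale parameter and not a type class: it has to induce the given
  topology of the manifold, and it is instantiated for more than one metric on the same type.
  \<open>d_split\<close> is the length property in approximate form, which holds before any
  compactness of large balls is known.\<close>

locale length_metric =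
  fixes d :: "'m::{t2_space, second_countable_topology} \<Rightarrow> 'm \<Rightarrow> real"
  assumes d_eq_0: "d x y = 0 \<longleftrightarrow> x = y" and d_sym: "d x y = d y x" and d_tri: "d x z \<le> d x y + d y z"
    and d_top: "open S \<longleftrightarrow> (\<forall>x\<in>S. \<exists>e>0. \<forall>y. d x y < e \<longrightarrow> y \<in> S)"
    and d_loc: "\<exists>e>0. compact {y. d x y \<le> e}"
    and d_split: "0 \<le> s \<Longrightarrow> s \<le> d x y \<Longrightarrow> 0 < e \<Longrightarrow> \<exists>m. d x m = s \<and> d m y \<le> d x y - s + e"
begin

lemma d_self [simp]: "d x x = 0"
  by (simp add: d_eq_0)

lemma d_nonneg: "0 \<le> d x y"
  using d_tri[of x x y] d_sym[of x y] d_eq_0[of x x] by simp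

lemma d_abs: "\<bar>d x y - d x z\<bar> \<le> d y z"
  using d_tri[of x y z] d_tri[of x z y] d_sym[of y z] by simp

lemma open_d_ball: "open {y. d x y < e}"
  unfolding d_top
proof
  fix y assume "y \<in> {y. d x y < e}"
  then have y: "d x y < e" by simp
  then have "\<forall>z. d y z < e - d x y \<longrightarrow> z \<in> {y. d x y < e}"
    using d_tri[of x _ y] by (smt (verit) mem_Collect_eq)
  then show "\<exists>e'>0. \<forall>z. d y z < e' \<longrightarrow> z \<in> {y. d x y < e}"
    using y by (intro exI[of _ "e - d x y"]) auto
qed

lemma d_continuous: "continuous_on UNIV (\<lambda>p. d (fst p) (snd p))"
proof -
  have "isCont (\<lambda>p. d (fst p) (snd p)) p" for p :: "'m \<times> 'm"
    unfolding isCont_def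
  proof (rule tendstoI)
    fix e :: real assume e: "e > 0"
    let ?O = "{y. d (fst p) y < e / 2} \<times> {y. d (snd p) y < e / 2}"
    have "open ?O" by (intro open_Times open_d_ball)
    moreover have "p \<in> ?O" using e by (simp add: mem_Times_iff)
    ultimately have "\<forall>\<^sub>F q in at p. q \<in> ?O" using eventually_at_topological by blast
    then show "\<forall>\<^sub>F q in at p. dist (d (fst q) (snd q)) (d (fst p) (snd p)) < e"
    proof eventually_elim
      case (elim q)
      then have q: "d (fst p) (fst q) < e / 2" "d (snd p) (snd q) < e / 2" by (auto simp: mem_Times_iff)
      have "\<bar>d (fst q) (snd q) - d (fst p) (snd p)\<bar> \<le> d (fst p) (fst q) + d (snd p) (snd q)"
        using d_abs[of "fst q" "snd q" "snd p"] d_abs[of "snd p" "fst q" "fst p"] d_sym[of "fst q" "snd p"]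
          d_sym[of "fst p" "snd p"] d_sym[of "fst p" "fst q"] d_sym[of "snd p" "snd q"] by simp
      then show ?case using q by (simp add: dist_real_def)
    qed
  qed
  then show ?thesis by (simp add: continuous_at_imp_continuous_on)
qed

lemma continuous_on_d:
  assumes "continuous_on S f" "continuous_on S g"
  shows "continuous_on S (\<lambda>x. d (f x) (g x))"
  using continuous_on_compose2[OF d_continuous continuous_on_Pair[OF assms]] by simp

lemma closed_d_ball: "closed {y. d x y \<le> r}"
  using closed_Collect_le[OF continuous_on_d[OF continuous_on_const continuous_on_id] continuous_on_const] by simp

lemma d_limit:
  assumes "((\<lambda>n. d (f n) z) \<longlongrightarrow> 0) F" shows "(f \<longlongrightarrow> z) F"
proof (rule topological_tendstoI)
  fix S assume S: "open S" "z \<in> S"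
  then obtain e where e: "e > 0" "\<forall>y. d z y < e \<longrightarrow> y \<in> S" using d_top by blast
  have "\<forall>\<^sub>F n in F. d (f n) z < e" using order_tendstoD(2)[OF assms e(1)] .
  then show "\<forall>\<^sub>F n in F. f n \<in> S" by eventually_elim (use e(2) d_sym in metis)
qed

lemma limit_d:
  assumes "(f \<longlongrightarrow> z) F" "e > 0" shows "\<forall>\<^sub>F n in F. d (f n) z < e"
proof -
  have "\<forall>\<^sub>F n in F. f n \<in> {y. d z y < e}"
    by (rule topological_tendstoD[OF assms(1) open_d_ball]) (use assms(2) in auto)
  then show ?thesis by eventually_elim (simp add: d_sym)
qed

lemma compact_d_ball_mono:
  assumes "compact {y. d p y \<le> r}" "s \<le> r" shows "compact {y. d p y \<le> s}"
proof -
  have "{y. d p y \<le> s} = {y. d p y \<le> r} \<inter> {y. d p y \<le> s}" using assms(2) by auto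
  then show ?thesis using compact_Int_closed[OF assms(1) closed_d_ball] by metis
qed

text \<open>Compactness turns approximate intermediate points into exact ones: take a point of the
  sphere around \<open>x\<close> that is closest to \<open>y\<close>.\<close>

lemma d_between:
  assumes K: "compact {y. d p y \<le> r}" and s: "0 \<le> s" "s \<le> d x y" "d p x + s \<le> r"
  shows "\<exists>m. d x m = s \<and> d m y = d x y - s"
proof -
  let ?S = "{m. d x m = s}"
  have "closed ?S"
    using closed_Collect_eq[OF continuous_on_d[OF continuous_on_const continuous_on_id] continuous_on_const] by simp
  moreover have "?S = {y. d p y \<le> r} \<inter> ?S"
  proof -
    have "d p m \<le> r" if "d x m = s" for m using d_tri[of p m x] that s(3) by simp
    then show ?thesis by auto
  qed
  ultimately have S: "compact ?S" using compact_Int_closed[OF K] by metis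
  obtain m0 where "d x m0 = s" using d_split[OF s(1,2), of 1] by auto
  then have "?S \<noteq> {}" by auto
  moreover have "continuous_on ?S (\<lambda>m. d m y)" by (intro continuous_on_d continuous_on_const continuous_on_id)
  ultimately obtain m where m: "d x m = s" "\<forall>m'\<in>?S. d m y \<le> d m' y"
    using continuous_attains_inf[OF S] by blast
  have "d m y \<le> d x y - s"
  proof (rule field_le_epsilon)
    fix e :: real assume "e > 0"
    then obtain m' where "d x m' = s" "d m' y \<le> d x y - s + e" using d_split[OF s(1,2)] by blast
    then show "d m y \<le> d x y - s + e" using m(2) by fastforce
  qed
  moreover have "d x y - s \<le> d m y" using d_tri[of x y m] m(1) by simp
  ultimately show ?thesis using m(1) by auto
qed

text \<open>Points are added in increasing order of their parameters. The new one is taken between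
  the last point and \<open>q\<close>; since distances along the chain up to \<open>q\<close> are
  additive, the triangle inequality forces the right distances to all earlier points.\<close>

lemma finite_chain:
  assumes K: "compact {y. d p y \<le> d p q}" and F: "finite F" "F \<subseteq> {0..d p q}"
  shows "\<exists>c. \<forall>s\<in>F. d p (c s) = s \<and> d (c s) q = d p q - s \<and> (\<forall>t\<in>F. d (c s) (c t) = \<bar>s - t\<bar>)"
  using F
proof (induction F rule: finite_linorder_max_induct)
  case (insert b F)
  then obtain c where c: "\<And>s. s \<in> F \<Longrightarrow> d p (c s) = s" "\<And>s. s \<in> F \<Longrightarrow> d (c s) q = d p q - s"
      "\<And>s t. s \<in> F \<Longrightarrow> t \<in> F \<Longrightarrow> d (c s) (c t) = \<bar>s - t\<bar>" by auto
  have b: "0 \<le> b" "b \<le> d p q" using insert by auto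
  obtain m where m: "d p m = b" "d m q = d p q - b" "\<And>s. s \<in> F \<Longrightarrow> d (c s) m = b - s"
  proof (cases "F = {}")
    case True
    then show ?thesis using d_between[OF K b] b that by force
  next
    case False
    define s where "s = Max F"
    have s: "s \<in> F" "\<And>u. u \<in> F \<Longrightarrow> u \<le> s" using False insert.hyps by (auto simp: s_def)
    have sb: "s \<le> b" "0 \<le> s" using insert s by auto
    obtain m where m: "d (c s) m = b - s" "d m q = d (c s) q - (b - s)"
      using d_between[OF K, of "b - s" "c s" q] c(1,2)[OF s(1)] sb b by auto
    then have mq: "d m q = d p q - b" using c(2)[OF s(1)] by simp
    have "d (c u) m = b - u" if u: "u \<in> F" for u
    proof (rule antisym)
      show "d (c u) m \<le> b - u" using d_tri[of "c u" m "c s"] c(3)[OF u s(1)] m(1) s(2)[OF u] by simp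
      show "b - u \<le> d (c u) m" using d_tri[of "c u" q m] c(2)[OF u] mq by simp
    qed
    moreover have "d p m = b"
    proof (rule antisym)
      show "d p m \<le> b" using d_tri[of p m "c s"] c(1)[OF s(1)] m(1) by simp
      show "b \<le> d p m" using d_tri[of p q m] mq by simp
    qed
    ultimately show ?thesis using that mq by blast
  qed
  have lt: "s < b" if "s \<in> F" for s using insert that by auto
  let ?c = "c(b := m)"
  have eq: "?c s = c s" if "s \<in> F" for s using lt[OF that] by auto
  have mb: "d (c s) m = \<bar>s - b\<bar>" "d m (c s) = \<bar>b - s\<bar>" if "s \<in> F" for s
    using m(3)[OF that] d_sym[of m "c s"] lt[OF that] by simp_all
  show ?case
  proof (intro exI[of _ ?c] ballI)
    fix s assume s: "s \<in> insert b F"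
    show "d p (?c s) = s \<and> d (?c s) q = d p q - s \<and> (\<forall>t\<in>insert b F. d (?c s) (?c t) = \<bar>s - t\<bar>)"
    proof (cases "s = b")
      case True
      then show ?thesis using m(1,2) mb(2) eq by simp
    next
      case False
      then have "s \<in> F" using s by simp
      then show ?thesis using c mb(1) eq by simp
    qed
  qed
qed auto

text \<open>Tychonoff's theorem. Curves are treated as arbitrary functions, so no equicontinuity
  enters.\<close>

lemma compact_functions:
  fixes K :: "real \<Rightarrow> 'm set"
  assumes "\<And>t. compact (K t)"
  shows "compact {c. \<forall>t. c t \<in> K t}"
proof -
  have "compactin (product_topology (\<lambda>_. euclidean) UNIV) (PiE UNIV K)"
    unfolding compactin_PiE using assms by simp
  moreover have "PiE UNIV K = {c. \<forall>t. c t \<in> K t}" by (auto simp: PiE_UNIV_domain)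
  ultimately show ?thesis by (simp add: euclidean_product_topology)
qed

definition "segment c D \<longleftrightarrow> (\<forall>s\<in>{0..D}. \<forall>t\<in>{0..D}. d (c s) (c t) = \<bar>s - t\<bar>)"

lemma continuous_on_eval: "continuous_on S (\<lambda>c :: real \<Rightarrow> 'm. c t)"
  by (rule continuous_on_subset[OF continuous_on_product_coordinates]) auto

text \<open>Each pair of parameters imposes a closed condition on functions, and
  \<open>finite_chain\<close> satisfies finitely many of them at a time. By compactness of the
  product and the finite intersection property, all hold for one function.\<close>

lemma ex_segment:
  assumes K: "compact {y. d p y \<le> d p q}"
  shows "\<exists>c. c 0 = p \<and> c (d p q) = q \<and> segment c (d p q)"
proof -
  let ?D = "d p q" and ?K = "{y. d p y \<le> d p q}"
  define C where "C = (\<lambda>(s, t). {c :: real \<Rightarrow> 'm. d p (c s) = s} \<inter> {c. d (c s) q = ?D - s} \<inter> {c. d (c s) (c t) = \<bar>s - t\<bar>})"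
  have closed: "closed (C st)" for st
  proof -
    obtain s t where "st = (s, t)" by fastforce
    then show ?thesis
      unfolding C_def by (auto intro!: closed_Int closed_Collect_eq continuous_on_d continuous_on_const continuous_on_eval)
  qed
  have "{c. \<forall>t. c t \<in> ?K} \<inter> \<Inter> (C ` ({0..?D} \<times> {0..?D})) \<noteq> {}"
  proof (rule compact_imp_fip[OF compact_functions[OF K]])
    show "closed T" if "T \<in> C ` ({0..?D} \<times> {0..?D})" for T using that closed by blast
    fix F' assume "finite F'" "F' \<subseteq> C ` ({0..?D} \<times> {0..?D})"
    then obtain G where G: "G \<subseteq> {0..?D} \<times> {0..?D}" "finite G" "F' = C ` G" using finite_subset_image by metis
    let ?F = "fst ` G \<union> snd ` G"
    obtain c where c: "\<forall>s\<in>?F. d p (c s) = s \<and> d (c s) q = ?D - s \<and> (\<forall>t\<in>?F. d (c s) (c t) = \<bar>s - t\<bar>)"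
    proof -
      have "finite ?F" "?F \<subseteq> {0..?D}" using G(1,2) by auto
      then show ?thesis using finite_chain[OF K] that by meson
    qed
    \<comment> \<open>Outside the finite set \<open>c\<close> is uncontrolled; the value
      \<open>p\<close> keeps the function inside the compact product.\<close>
    let ?c = "\<lambda>t. if t \<in> ?F then c t else p"
    have "?c t \<in> ?K" for t
    proof (cases "t \<in> ?F")
      case True
      then have "t \<le> ?D" using G(1) by auto
      then show ?thesis using c True by simp
    qed (simp add: d_nonneg)
    moreover have "?c \<in> C st" if st: "st \<in> G" for st
    proof -
      have "fst st \<in> ?F" "snd st \<in> ?F" using st by auto
      then show ?thesis using c by (auto simp: C_def split_beta)
    qed
    ultimately have "?c \<in> {c. \<forall>t. c t \<in> ?K} \<inter> \<Inter> F'" unfolding G(3) by blast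
    then show "{c. \<forall>t. c t \<in> ?K} \<inter> \<Inter> F' \<noteq> {}" by (metis empty_iff)
  qed
  then obtain c where "c \<in> \<Inter> (C ` ({0..?D} \<times> {0..?D}))" by (metis Int_iff ex_in_conv)
  then have c: "c \<in> C (s, t)" if "s \<in> {0..?D}" "t \<in> {0..?D}" for s t using that by blast
  have D: "0 \<le> ?D" by (rule d_nonneg)
  have "d p (c 0) = 0" "d (c ?D) q = ?D - ?D" using c[of 0 0] c[of ?D ?D] D by (auto simp: C_def)
  then have "c 0 = p" "c ?D = q" using d_eq_0[of p "c 0"] d_eq_0[of "c ?D" q] by auto
  moreover have "segment c ?D" using c by (auto simp: segment_def C_def)
  ultimately show ?thesis by blast
qed

text \<open>Finitely many compact local balls cover the given ball even with halved radii. A point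
  slightly farther out is within \<open>\<delta>\<close> of a point of the ball, by
  \<open>d_split\<close>, and so lies in one of the local balls of full radius.\<close>

lemma compact_d_ball_extend:
  assumes K: "compact {y. d p y \<le> r}" and r: "r \<ge> 0"
  shows "\<exists>e>0. compact {y. d p y \<le> r + e}"
proof -
  obtain \<epsilon> where \<epsilon>: "\<And>z. \<epsilon> z > 0" "\<And>z. compact {y. d z y \<le> \<epsilon> z}" using d_loc by metis
  have "{y. d p y \<le> r} \<subseteq> (\<Union>z\<in>{y. d p y \<le> r}. {y. d z y < \<epsilon> z / 2})"
    using \<epsilon>(1) d_eq_0 by (fastforce)
  then obtain Z where Z: "Z \<subseteq> {y. d p y \<le> r}" "finite Z" "{y. d p y \<le> r} \<subseteq> (\<Union>z\<in>Z. {y. d z y < \<epsilon> z / 2})"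
    using compactE_image[OF K, of "{y. d p y \<le> r}" "\<lambda>z. {y. d z y < \<epsilon> z / 2}"] open_d_ball by blast
  define \<delta> where "\<delta> = Min (insert 1 ((\<lambda>z. \<epsilon> z / 2) ` Z))"
  have \<delta>1: "\<delta> > 0" using Z(2) \<epsilon>(1) by (simp add: \<delta>_def)
  have \<delta>2: "\<delta> \<le> \<epsilon> z / 2" if "z \<in> Z" for z
    unfolding \<delta>_def by (rule Min_le) (use Z(2) that in auto)
  note \<delta> = \<delta>1 \<delta>2
  have "{y. d p y \<le> r + \<delta> / 2} \<subseteq> (\<Union>z\<in>Z. {y. d z y \<le> \<epsilon> z})"
  proof
    fix w assume "w \<in> {y. d p y \<le> r + \<delta> / 2}"
    then have w: "d p w \<le> r + \<delta> / 2" by simp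
    obtain m where m: "d p m \<le> r" "d m w \<le> \<delta>"
    proof (cases "d p w \<le> r")
      case True
      then show ?thesis using that[of w] d_eq_0[of w w] \<delta>(1) by simp
    next
      case False
      then obtain m where "d p m = r" "d m w \<le> d p w - r + \<delta> / 2" using d_split[of r p w "\<delta> / 2"] r \<delta>(1) by auto
      then show ?thesis using that[of m] w by simp
    qed
    then obtain z where z: "z \<in> Z" "d z m < \<epsilon> z / 2" using Z(3) by blast
    have "d z w \<le> \<epsilon> z" using d_tri[of z w m] z(2) m(2) \<delta>(2)[OF z(1)] by simp
    then show "w \<in> (\<Union>z\<in>Z. {y. d z y \<le> \<epsilon> z})" using z(1) by blast
  qed
  then have eq: "{y. d p y \<le> r + \<delta> / 2} = (\<Union>z\<in>Z. {y. d z y \<le> \<epsilon> z}) \<inter> {y. d p y \<le> r + \<delta> / 2}" by blast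
  have "compact (\<Union>z\<in>Z. {y. d z y \<le> \<epsilon> z})" using Z(2) \<epsilon>(2) by (intro compact_UN) auto
  from compact_Int_closed[OF this closed_d_ball, of p "r + \<delta> / 2"]
  have "compact {y. d p y \<le> r + \<delta> / 2}" by (simp only: eq[symmetric])
  then show ?thesis using \<delta>(1) by (intro exI[of _ "\<delta> / 2"]) auto
qed

lemma frequently_subseq:
  assumes "\<And>e. e > 0 \<Longrightarrow> \<exists>\<^sub>F n in sequentially. d (x n) z < e"
  shows "\<exists>\<phi>. strict_mono \<phi> \<and> (x \<circ> \<phi>) \<longlonglongrightarrow> z"
proof -
  have "\<exists>\<phi>. \<forall>n. d (x (\<phi> n)) z < inverse (real (Suc n)) \<and> \<phi> n < \<phi> (Suc n)"
  proof (rule dependent_nat_choice)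
    show "\<exists>n. d (x n) z < inverse (real (Suc 0))"
      using assms[of "inverse (real (Suc 0))"] frequently_ex by fastforce
    show "\<exists>m. d (x m) z < inverse (real (Suc (Suc k))) \<and> n < m" for n k
    proof -
      have "\<exists>\<^sub>F m in sequentially. d (x m) z < inverse (real (Suc (Suc k))) \<and> n < m"
        using frequently_eventually_frequently[OF assms eventually_gt_at_top] by simp
      then show ?thesis using frequently_ex by blast
    qed
  qed
  then obtain \<phi> where \<phi>: "\<And>n. d (x (\<phi> n)) z < inverse (real (Suc n))" "\<And>n. \<phi> n < \<phi> (Suc n)" by blast
  have "(\<lambda>n. d (x (\<phi> n)) z) \<longlonglongrightarrow> 0"
    by (rule tendsto_sandwich[OF _ _ tendsto_const LIMSEQ_inverse_real_of_nat])
       (intro always_eventually allI d_nonneg less_imp_le[OF \<phi>(1)])+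
  then have "(x \<circ> \<phi>) \<longlonglongrightarrow> z" unfolding o_def by (rule d_limit)
  then show ?thesis using \<phi>(2) strict_mono_Suc_iff by blast
qed

text \<open>The key step of the theorem of Hopf, Rinow and Cohn-Vossen: segments from \<open>p\<close> to points that approach
  the sphere of radius \<open>r\<close> cluster at a ray, and the end point of this ray is a cluster point.\<close>

lemma compact_d_ball_limit:
  assumes ray: "\<And>b c. b > 0 \<Longrightarrow> (\<forall>s\<in>{0..<b}. \<forall>t\<in>{0..<b}. d (c s) (c t) = \<bar>s - t\<bar>) \<Longrightarrow> \<exists>z. (c \<longlongrightarrow> z) (at_left b)"
    and K: "\<And>r'. r' < r \<Longrightarrow> compact {y. d p y \<le> r'}" and r: "r > 0"
  shows "compact {y. d p y \<le> r}"
proof -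
  have "seq_compact {y. d p y \<le> r}"
  proof (rule seq_compactI)
    fix x :: "nat \<Rightarrow> 'm" assume "\<forall>n. x n \<in> {y. d p y \<le> r}"
    then have x: "d p (x n) \<le> r" for n by simp
    let ?i = "\<lambda>n. inverse (real (Suc n))"
    \<comment> \<open>Each \<open>x n\<close> is approximated by a point at distance strictly below
      \<open>r\<close> from \<open>p\<close>, since only the smaller balls are known to be compact
      and thus to admit segments.\<close>
    have "\<exists>s y. 0 \<le> s \<and> s < r \<and> d p y = s \<and> d y (x n) \<le> 2 * ?i n" for n
    proof -
      define i where "i = ?i n"
      have i: "i > 0" by (simp add: i_def)
      define s where "s = max 0 (d p (x n) - i)"
      have s: "0 \<le> s" "s < r" "s \<le> d p (x n)" "d p (x n) - s \<le> i"
        using x[of n] r d_nonneg[of p "x n"] i unfolding s_def by linarith+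
      obtain y where "d p y = s" "d y (x n) \<le> d p (x n) - s + i" using d_split[OF s(1,3) i] by blast
      then have "0 \<le> s \<and> s < r \<and> d p y = s \<and> d y (x n) \<le> 2 * i" using s by linarith
      then show ?thesis unfolding i_def by blast
    qed
    then obtain s y where s: "\<And>n. 0 \<le> s n" "\<And>n. s n < r" and y: "\<And>n. d p (y n) = s n" "\<And>n. d (y n) (x n) \<le> 2 * ?i n"
      by metis
    have "\<exists>c. c 0 = p \<and> c (s n) = y n \<and> segment c (s n)" for n
      using ex_segment[of p "y n"] K[OF s(2)] y(1) by simp
    then obtain c0 where c0: "\<And>n. c0 n 0 = p" "\<And>n. c0 n (s n) = y n" "\<And>n. segment (c0 n) (s n)" by metis
    \<comment> \<open>Parameters are clamped to \<open>{0..s n}\<close>, and from \<open>r\<close>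
      on the value is \<open>p\<close>, so that all \<open>c n\<close> lie in one product of compact
      sets: balls of radius below \<open>r\<close>, and the single point \<open>p\<close>.\<close>
    define c where "c n t = (if t < r then c0 n (max 0 (min t (s n))) else p)" for n t
    have c_p: "d p (c n t) \<le> max 0 t" for n t
    proof (cases "t < r")
      case True
      have "d (c0 n 0) (c0 n (max 0 (min t (s n)))) = \<bar>0 - max 0 (min t (s n))\<bar>"
        using c0(3)[of n] s(1)[of n] unfolding segment_def by (auto simp: max_def min_def)
      then show ?thesis using True s(1)[of n] by (simp add: c_def c0(1))
    qed (simp add: c_def)
    have c_d: "d (c n t) (c n u) = \<bar>t - u\<bar>" if "0 \<le> t" "t \<le> s n" "0 \<le> u" "u \<le> s n" for n t u
      using c0(3)[of n] that s(2)[of n] by (auto simp: segment_def c_def)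
    have c_s: "c n (s n) = y n" for n using s by (simp add: c_def c0(2))
    obtain s0 \<phi> where \<phi>: "strict_mono \<phi>" "(s \<circ> \<phi>) \<longlonglongrightarrow> s0" and s0: "s0 \<in> {0..r}"
    proof -
      have "seq_compact {0..r}" by (simp add: compact_imp_seq_compact)
      moreover have "\<forall>n. s n \<in> {0..r}" using s less_imp_le by auto
      ultimately show ?thesis using that unfolding seq_compact_def by blast
    qed
    have i0: "(\<lambda>n. 2 * ?i (\<phi> n)) \<longlonglongrightarrow> 0"
    proof -
      have "(\<lambda>n. 2 * ?i n) \<longlonglongrightarrow> 2 * 0" by (intro tendsto_mult_left LIMSEQ_inverse_real_of_nat)
      then show ?thesis using LIMSEQ_subseq_LIMSEQ[OF _ \<phi>(1), of "\<lambda>n. 2 * ?i n" 0] by (simp add: o_def)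
    qed
    \<comment> \<open>If the radii of the \<open>y n\<close> tend to a limit below \<open>r\<close>,
      these points eventually lie in one compact ball; otherwise their segments cluster at a ray of
      length \<open>r\<close>.\<close>
    have "\<exists>z. \<forall>e>0. \<exists>\<^sub>F n in sequentially. d (y (\<phi> n)) z < e"
    proof (cases "s0 < r")
      case True
      define r' where "r' = (s0 + r) / 2"
      have r': "s0 < r'" "r' < r" using True by (auto simp: r'_def)
      let ?F = "filtermap (\<lambda>n. y (\<phi> n)) sequentially"
      have "\<forall>\<^sub>F n in sequentially. (s \<circ> \<phi>) n < r'" using order_tendstoD(2)[OF \<phi>(2) r'(1)] .
      then have "\<forall>\<^sub>F z in ?F. z \<in> {y. d p y \<le> r'}"
        unfolding eventually_filtermap by eventually_elim (simp add: y(1))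
      moreover have "?F \<noteq> bot" by (simp add: filtermap_bot_iff)
      ultimately obtain z where z: "inf (nhds z) ?F \<noteq> bot"
        using K[OF r'(2)] unfolding compact_filter by blast
      have "\<exists>\<^sub>F n in sequentially. d (y (\<phi> n)) z < e" if e: "e > 0" for e
      proof (rule ccontr)
        assume "\<not> ?thesis"
        then have "\<forall>\<^sub>F w in ?F. \<not> d w z < e" by (simp add: eventually_filtermap not_frequently)
        moreover have "\<forall>\<^sub>F w in nhds z. d w z < e"
          using eventually_nhds_in_open[OF open_d_ball[of z e], of z] e d_eq_0[of z z]
          by (simp add: d_sym[of z] eventually_mono)
        ultimately have "eventually (\<lambda>_. False) (inf (nhds z) ?F)"
          unfolding eventually_inf by blast
        then show False using z by (simp add: eventually_False)
      qed
      then show ?thesis by blast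
    next
      case False
      then have s0r: "s0 = r" using s0 by simp
      let ?K = "\<lambda>t. if t < r then {y. d p y \<le> max 0 t} else {p}"
      let ?F = "filtermap (\<lambda>n. c (\<phi> n)) sequentially"
      have "compact {c. \<forall>t. c t \<in> ?K t}"
        by (rule compact_functions) (use K r in auto)
      moreover have "c n t \<in> ?K t" for n t
        using c_p[of n t] by (cases "t < r") (auto simp: c_def)
      then have "\<forall>\<^sub>F f in ?F. f \<in> {c. \<forall>t. c t \<in> ?K t}"
        unfolding eventually_filtermap by simp
      moreover have "?F \<noteq> bot" by (simp add: filtermap_bot_iff)
      ultimately obtain f where f: "inf (nhds f) ?F \<noteq> bot"
        unfolding compact_filter by blast
      \<comment> \<open>A cluster point in a product of uncountably many factors need not be the
        limit of a subsequence, so the argument runs with \<open>frequently\<close>.\<close>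
      have freq: "\<exists>\<^sub>F n in sequentially. c (\<phi> n) \<in> O'" if O: "open O'" "f \<in> O'" for O'
      proof (rule ccontr)
        assume "\<not> ?thesis"
        then have "\<forall>\<^sub>F w in ?F. w \<notin> O'" by (simp add: eventually_filtermap not_frequently)
        moreover have "\<forall>\<^sub>F w in nhds f. w \<in> O'" using eventually_nhds_in_open[OF O] .
        ultimately have "eventually (\<lambda>_. False) (inf (nhds f) ?F)"
          unfolding eventually_inf by blast
        then show False using f by (simp add: eventually_False)
      qed
      have iso: "d (f t) (f u) = \<bar>t - u\<bar>" if tu: "t \<in> {0..<r}" "u \<in> {0..<r}" for t u
      proof (rule ccontr)
        assume neq: "\<not> ?thesis"
        let ?O = "{g. d (g t) (g u) \<noteq> \<bar>t - u\<bar>}"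
        have "closed {g. d (g t) (g u) = \<bar>t - u\<bar>}"
          by (intro closed_Collect_eq continuous_on_d continuous_on_eval continuous_on_const)
        then have "open ?O" by (simp add: closed_def Collect_neg_eq)
        then have "\<exists>\<^sub>F n in sequentially. c (\<phi> n) \<in> ?O" using freq neq by blast
        moreover have "\<forall>\<^sub>F n in sequentially. max t u < (s \<circ> \<phi>) n"
          by (rule order_tendstoD(1)[OF \<phi>(2)]) (use tu s0r in auto)
        ultimately have "\<exists>\<^sub>F n in sequentially. c (\<phi> n) \<in> ?O \<and> max t u < (s \<circ> \<phi>) n"
          by (rule frequently_eventually_frequently)
        then obtain n where "c (\<phi> n) \<in> ?O" "max t u < s (\<phi> n)" using frequently_ex by fastforce
        then show False using c_d[of t "\<phi> n" u] tu by auto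
      qed
      then obtain z where z: "(f \<longlongrightarrow> z) (at_left r)" using ray[OF r, of f] by blast
      \<comment> \<open>Three steps of length \<open>e / 3\<close>: from \<open>y (\<phi> n)\<close>
        back along its segment to the parameter \<open>t\<close>, across to the ray, and along the
        ray to its end point.\<close>
      have "\<exists>\<^sub>F n in sequentially. d (y (\<phi> n)) z < e" if e: "e > 0" for e
      proof -
        have "\<forall>\<^sub>F t in at_left r. d (f t) z < e / 3" by (rule limit_d[OF z]) (use e in simp)
        moreover have "\<forall>\<^sub>F t in at_left r. t \<in> {max 0 (r - e / 3)<..<r}"
          by (rule eventually_at_left_real) (use r e in auto)
        ultimately have "\<forall>\<^sub>F t in at_left r. d (f t) z < e / 3 \<and> t \<in> {max 0 (r - e / 3)<..<r}" by (rule eventually_conj)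
        then obtain t where "d (f t) z < e / 3 \<and> t \<in> {max 0 (r - e / 3)<..<r}"
          using eventually_happens'[OF trivial_limit_at_left_real] by blast
        then have t: "d (f t) z < e / 3" "0 < t" "r - e / 3 < t" "t < r" by auto
        have "open {g. d (g t) (f t) < e / 3}"
          by (intro open_Collect_less continuous_on_d continuous_on_eval continuous_on_const)
        then have "\<exists>\<^sub>F n in sequentially. c (\<phi> n) \<in> {g. d (g t) (f t) < e / 3}"
          by (rule freq) (use e d_eq_0[of "f t" "f t"] in simp)
        moreover have "\<forall>\<^sub>F n in sequentially. t < (s \<circ> \<phi>) n"
          by (rule order_tendstoD(1)[OF \<phi>(2)]) (use t s0r in auto)
        ultimately have "\<exists>\<^sub>F n in sequentially. c (\<phi> n) \<in> {g. d (g t) (f t) < e / 3} \<and> t < (s \<circ> \<phi>) n"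
          by (rule frequently_eventually_frequently)
        then show ?thesis
        proof (rule frequently_elim1)
          fix n assume n: "c (\<phi> n) \<in> {g. d (g t) (f t) < e / 3} \<and> t < (s \<circ> \<phi>) n"
          have "d (y (\<phi> n)) (c (\<phi> n) t) = \<bar>s (\<phi> n) - t\<bar>"
            using c_d[of "s (\<phi> n)" "\<phi> n" t] n t(2) s(1)[of "\<phi> n"] by (simp add: c_s)
          then have "d (y (\<phi> n)) (c (\<phi> n) t) < e / 3" using n t s(2)[of "\<phi> n"] by simp
          then show "d (y (\<phi> n)) z < e"
            using d_tri[of "y (\<phi> n)" z "c (\<phi> n) t"] d_tri[of "c (\<phi> n) t" z "f t"] n t(1) by simp
        qed
      qed
      then show ?thesis by blast
    qed
    then obtain z where z: "\<And>e. e > 0 \<Longrightarrow> \<exists>\<^sub>F n in sequentially. d (y (\<phi> n)) z < e" by blast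
    have "\<exists>\<^sub>F n in sequentially. d ((x \<circ> \<phi>) n) z < e" if e: "e > 0" for e
    proof -
      have "\<forall>\<^sub>F n in sequentially. 2 * ?i (\<phi> n) < e / 2" by (rule order_tendstoD(2)[OF i0]) (use e in simp)
      with z[of "e / 2"] e have "\<exists>\<^sub>F n in sequentially. d (y (\<phi> n)) z < e / 2 \<and> 2 * ?i (\<phi> n) < e / 2"
        by (intro frequently_eventually_frequently) auto
      then show ?thesis
      proof (rule frequently_elim1)
        fix n assume n: "d (y (\<phi> n)) z < e / 2 \<and> 2 * ?i (\<phi> n) < e / 2"
        have "d (x (\<phi> n)) z \<le> d (x (\<phi> n)) (y (\<phi> n)) + d (y (\<phi> n)) z" by (rule d_tri)
        then show "d ((x \<circ> \<phi>) n) z < e"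
          using n y(2)[of "\<phi> n"] d_sym[of "x (\<phi> n)" "y (\<phi> n)"] unfolding o_def by linarith
      qed
    qed
    then obtain \<psi> where \<psi>: "strict_mono \<psi>" "((x \<circ> \<phi>) \<circ> \<psi>) \<longlonglongrightarrow> z" using frequently_subseq by blast
    have "z \<in> {y. d p y \<le> r}"
      by (rule closed_sequentially[OF closed_d_ball[of p r] _ \<psi>(2)]) (use x in simp)
    moreover have "strict_mono (\<phi> \<circ> \<psi>)" using \<phi>(1) \<psi>(1) by (rule strict_mono_o)
    ultimately show "\<exists>l\<in>{y. d p y \<le> r}. \<exists>\<phi>. strict_mono \<phi> \<and> (x \<circ> \<phi>) \<longlonglongrightarrow> l"
      using \<psi>(2) by (metis comp_assoc)
  qed
  then show ?thesis
    using seq_compact_imp_countably_compact countably_compact_imp_compact_second_countable by blast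
qed

text \<open>The radii with compact balls form an interval starting at \<open>0\<close>. It contains
  its supremum by \<open>compact_d_ball_limit\<close> and can be enlarged by
  \<open>compact_d_ball_extend\<close>, so the supremum cannot be finite.\<close>

theorem proper_if_rays_converge:
  assumes ray: "\<And>b c. b > 0 \<Longrightarrow> (\<forall>s\<in>{0..<b}. \<forall>t\<in>{0..<b}. d (c s) (c t) = \<bar>s - t\<bar>) \<Longrightarrow> \<exists>z. (c \<longlongrightarrow> z) (at_left b)"
  shows "compact {y. d p y \<le> r}"
proof (rule ccontr)
  assume nc: "\<not> compact {y. d p y \<le> r}"
  let ?S = "{s. 0 \<le> s \<and> compact {y. d p y \<le> s}}"
  have ub: "s \<le> r" if "s \<in> ?S" for s
    using that nc compact_d_ball_mono[of p s r] by force
  have "d p y \<le> 0 \<longleftrightarrow> y = p" for y using d_eq_0[of p y] d_nonneg[of p y] by auto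
  then have "{y. d p y \<le> 0} = {p}" by auto
  then have S0: "0 \<in> ?S" by simp
  have bdd: "bdd_above ?S" using ub by (auto simp: bdd_above_def)
  define R where "R = Sup ?S"
  have R0: "0 \<le> R" unfolding R_def by (rule cSup_upper[OF S0 bdd])
  have less: "compact {y. d p y \<le> r'}" if r': "r' < R" for r'
  proof -
    obtain s where "s \<in> ?S" "r' < s" using less_cSupD[of ?S r'] S0 r' unfolding R_def by blast
    then show ?thesis using compact_d_ball_mono[of p s r'] by simp
  qed
  have "compact {y. d p y \<le> R}"
  proof (cases "R = 0")
    case True
    then show ?thesis using S0 by simp
  next
    case False
    then show ?thesis using R0 by (intro compact_d_ball_limit[OF ray less]) auto
  qed
  then obtain e where "e > 0" "compact {y. d p y \<le> R + e}" using compact_d_ball_extend R0 by blast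
  then have "R + e \<in> ?S" using R0 by simp
  then have "R + e \<le> R" unfolding R_def by (intro cSup_upper bdd)
  then show False using \<open>e > 0\<close> by simp
qed

end

subsection \<open>Metric segments are geodesics\<close>

context smooth_manifold
begin

lemma smooth_curve_subset: "smooth_curve_on A J \<gamma> \<Longrightarrow> open T \<Longrightarrow> T \<subseteq> J \<Longrightarrow> smooth_curve_on A T \<gamma>"
  by (rule smooth_curve_local) (use curve_open in blast)+

lemma gcurve_subset: "gcurve N J \<gamma> \<Longrightarrow> open T \<Longrightarrow> T \<subseteq> J \<Longrightarrow> gcurve N T \<gamma>"
  unfolding gcurve_def using smooth_curve_subset by blast

end

locale connected_riemannian = riemannian_manifold A N h
  for A :: "('m::{t2_space, second_countable_topology}, 'n::finite) chart set" and N h +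
  assumes connected: "connected (UNIV :: 'm set)"

locale connected_ball = connected_riemannian A N h + riemannian_ball A N h c x0 r w R1 K l \<rho>
  for A :: "('m::{t2_space, second_countable_topology}, 'n::finite) chart set" and N h c x0 r w R1 K l \<rho>

context riemannian_ball
begin

lemma reach_points:
  assumes "q \<in> fst c" "snd c q \<in> ball x0 \<rho>" "q' \<in> fst c" "snd c q' \<in> ball x0 \<rho>"
  shows "reach h q q' (spd (snd c q) (snd c q'))"
  using reach_ball[OF assms(2,4)] cinv_chart[OF c assms(1)] cinv_chart[OF c assms(3)] by simp

end

section \<open>The Riemannian distance as a length metric\<close>

context connected_riemannian
begin

lemma ex_connected_ball:
  obtains c r w R1 K l \<rho> where "connected_ball A N h c (snd c p) r w R1 K l \<rho>" "p \<in> fst c"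
proof -
  obtain c r w R1 K l \<rho> where "riemannian_ball A N h c (snd c p) r w R1 K l \<rho>" "p \<in> fst c" by (rule ex_riemannian_ball)
  then show ?thesis using that connected_ball.intro connected_riemannian_axioms by blast
qed

lemma ex_reach: "\<exists>\<tau>. reach h p q \<tau>"
proof -
  let ?S = "{q. \<exists>\<tau>. reach h p q \<tau>}"
  have loc: "\<exists>O'. open O' \<and> q \<in> O' \<and> (\<forall>q'\<in>O'. \<exists>\<tau>. reach h q q' \<tau>)" for q
  proof -
    obtain c r w R1 K l \<rho> where b: "riemannian_ball A N h c (snd c q) r w R1 K l \<rho>" "q \<in> fst c" by (rule ex_riemannian_ball)
    interpret riemannian_ball A N h c "snd c q" r w R1 K l \<rho> by (rule b(1))
    let ?O = "{q' \<in> fst c. snd c q' \<in> ball (snd c q) \<rho>}"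
    have "open ?O" by (rule chart_vimage_open[OF c open_ball])
    moreover have "q \<in> ?O" using b(2) \<rho>(1) by simp
    moreover have "\<exists>\<tau>. reach h q q' \<tau>" if "q' \<in> ?O" for q'
      using reach_points[of q q'] that b(2) \<rho>(1) by auto
    ultimately show ?thesis by blast
  qed
  have "open ?S"
  proof (subst open_subopen, intro ballI)
    fix q assume "q \<in> ?S"
    then obtain \<tau> where \<tau>: "reach h p q \<tau>" by blast
    obtain O' where O': "open O'" "q \<in> O'" "\<forall>q'\<in>O'. \<exists>\<tau>. reach h q q' \<tau>" using loc by blast
    then have "O' \<subseteq> ?S" using reach_trans[OF _ \<tau>] by blast
    then show "\<exists>T. open T \<and> q \<in> T \<and> T \<subseteq> ?S" using O' by blast
  qed
  moreover have "open (- ?S)"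
  proof (subst open_subopen, intro ballI)
    fix q assume q: "q \<in> - ?S"
    obtain O' where O': "open O'" "q \<in> O'" "\<forall>q'\<in>O'. \<exists>\<tau>. reach h q q' \<tau>" using loc by blast
    have "q' \<in> - ?S" if "q' \<in> O'" for q'
    proof
      assume "q' \<in> ?S"
      then obtain \<tau> where "reach h p q' \<tau>" by blast
      moreover obtain \<tau>' where "reach h q q' \<tau>'" using O'(3) \<open>q' \<in> O'\<close> by blast
      ultimately show False using q reach_trans reach_sym by blast
    qed
    then show "\<exists>T. open T \<and> q \<in> T \<and> T \<subseteq> - ?S" using O' by blast
  qed
  moreover have "p \<in> ?S" using reach_refl by blast
  ultimately have "?S = UNIV"
    using connected_clopen[of "UNIV :: 'm set"] connected by (auto simp: closed_def)
  then show ?thesis by blast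
qed

lemma riem_dist_bdd: "bdd_below {\<tau>. reach h p q \<tau>}"
  by (rule bdd_belowI[of _ 0]) (auto dest: reach_nonneg)

lemma riem_dist_le: "reach h p q \<tau> \<Longrightarrow> riem_dist h p q \<le> \<tau>"
  unfolding riem_dist_def by (rule cInf_lower[OF _ riem_dist_bdd]) simp

lemma riem_dist_greatest: "(\<And>\<tau>. reach h p q \<tau> \<Longrightarrow> b \<le> \<tau>) \<Longrightarrow> b \<le> riem_dist h p q"
  unfolding riem_dist_def using ex_reach[of p q] by (intro cInf_greatest) auto

lemma riem_dist_approx:
  assumes "e > 0" obtains \<tau> where "reach h p q \<tau>" "\<tau> < riem_dist h p q + e"
proof -
  have "\<exists>\<tau>\<in>{\<tau>. reach h p q \<tau>}. \<tau> < riem_dist h p q + e"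
    using ex_reach[of p q] assms unfolding riem_dist_def by (intro cInf_lessD) auto
  then show ?thesis using that by blast
qed

lemma riem_dist_nonneg: "0 \<le> riem_dist h p q"
  by (rule riem_dist_greatest) (rule reach_nonneg)

lemma riem_dist_self: "riem_dist h p p = 0"
  using riem_dist_le[OF reach_refl] riem_dist_nonneg by (rule antisym)

lemma riem_dist_sym: "riem_dist h p q = riem_dist h q p"
proof -
  have "{\<tau>. reach h p q \<tau>} = {\<tau>. reach h q p \<tau>}" using reach_sym by blast
  then show ?thesis by (simp add: riem_dist_def)
qed

lemma riem_dist_tri: "riem_dist h p r \<le> riem_dist h p q + riem_dist h q r"
proof (rule field_le_epsilon)
  fix e :: real assume "e > 0"
  then have e: "e / 2 > 0" by simp
  obtain s t where "reach h p q s" "s < riem_dist h p q + e / 2" "reach h q r t" "t < riem_dist h q r + e / 2"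
    using riem_dist_approx[OF e] by metis
  then show "riem_dist h p r \<le> riem_dist h p q + riem_dist h q r + e"
    using riem_dist_le[OF reach_trans, of q r t p s] by simp
qed

lemma riem_dist_arc_lipschitz:
  assumes c: "c \<in> A" and z: "is_arc h c z z' \<alpha> \<omega>" and st: "s \<in> {\<alpha>..\<omega>}" "t \<in> {\<alpha>..\<omega>}"
  shows "riem_dist h (cinv c (z s)) (cinv c (z t)) \<le> \<bar>t - s\<bar>"
proof -
  have *: "riem_dist h (cinv c (z s)) (cinv c (z t)) \<le> t - s" if "s \<in> {\<alpha>..\<omega>}" "t \<in> {\<alpha>..\<omega>}" "s \<le> t" for s t
    using is_arc_sub[OF z, of s t] that by (intro riem_dist_le arc_reach is_arc_arc[OF c]) auto
  show ?thesis
    using *[OF st] *[OF st(2,1)] riem_dist_sym[of "cinv c (z s)" "cinv c (z t)"] by (cases "s \<le> t") auto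
qed

text \<open>Along the path, the distance from the start attains \<open>s\<close> by the intermediate
  value theorem. The time spent up to that point is at least \<open>s\<close>, so at most
  \<open>L - s\<close> remains.\<close>

lemma reach_split:
  "reach h x q L \<Longrightarrow> 0 \<le> s \<Longrightarrow> s \<le> riem_dist h x q \<Longrightarrow> \<exists>m \<tau>. riem_dist h x m = s \<and> reach h m q \<tau> \<and> \<tau> \<le> L - s"
proof (induction rule: reach.induct)
  case (reach_refl p)
  then show ?case using riem_dist_self reach.reach_refl by fastforce
next
  case (reach_step p q s' r t)
  show ?case
  proof (cases "s \<le> riem_dist h p q")
    case True
    then obtain m \<tau> where "riem_dist h p m = s" "reach h m q \<tau>" "\<tau> \<le> s' - s" using reach_step by blast
    then show ?thesis using reach.reach_step[OF _ reach_step.hyps(2)] by force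
  next
    case False
    obtain c z z' \<alpha> \<omega> where c: "c \<in> A" and z: "is_arc h c z z' \<alpha> \<omega>" and eq: "t = \<omega> - \<alpha>" "q = cinv c (z \<alpha>)" "r = cinv c (z \<omega>)"
      using reach_step.hyps(2) unfolding arc_def by blast
    have \<alpha>\<omega>: "\<alpha> \<le> \<omega>" using z by (simp add: is_arc_def)
    let ?f = "\<lambda>u. riem_dist h p (cinv c (z u))"
    have lip: "\<bar>?f u - ?f v\<bar> \<le> \<bar>u - v\<bar>" if "u \<in> {\<alpha>..\<omega>}" "v \<in> {\<alpha>..\<omega>}" for u v
    proof -
      have "\<bar>?f u - ?f v\<bar> \<le> riem_dist h (cinv c (z u)) (cinv c (z v))"
        using riem_dist_tri[of p "cinv c (z u)" "cinv c (z v)"] riem_dist_tri[of p "cinv c (z v)" "cinv c (z u)"] riem_dist_sym[of "cinv c (z u)" "cinv c (z v)"] by simp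
      also have "\<dots> \<le> \<bar>u - v\<bar>" using riem_dist_arc_lipschitz[OF c z that] by (simp add: abs_minus_commute)
      finally show ?thesis .
    qed
    have "continuous_on {\<alpha>..\<omega>} ?f"
      unfolding continuous_on_iff dist_real_def using lip by (meson order_le_less_trans)
    then obtain u where u: "u \<in> {\<alpha>..\<omega>}" "?f u = s"
      using IVT'[of ?f \<alpha> s \<omega>] False reach_step.prems \<alpha>\<omega> eq by auto
    have "reach h (cinv c (z u)) r (\<omega> - u)"
      unfolding eq using is_arc_sub[OF z, of u \<omega>] u(1) by (intro arc_reach is_arc_arc[OF c]) auto
    moreover have "s \<le> s' + (u - \<alpha>)"
      using riem_dist_le[OF reach_step.hyps(1)] lip[OF u(1), of \<alpha>] u \<alpha>\<omega> by (simp add: eq)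
    then have "\<omega> - u \<le> s' + t - s" by (simp add: eq)
    ultimately show ?thesis using u(2) by blast
  qed
qed

lemma riem_dist_split:
  assumes "0 \<le> s" "s \<le> riem_dist h x y" "0 < e"
  shows "\<exists>m. riem_dist h x m = s \<and> riem_dist h m y \<le> riem_dist h x y - s + e"
proof -
  obtain L where L: "reach h x y L" "L < riem_dist h x y + e" using riem_dist_approx[OF assms(3)] by blast
  obtain m \<tau> where "riem_dist h x m = s" "reach h m y \<tau>" "\<tau> \<le> L - s" using reach_split[OF L(1) assms(1,2)] by blast
  then show ?thesis using riem_dist_le[of m y \<tau>] L(2) by (intro exI[of _ m]) simp
qed

end

context connected_ball
begin

lemma riem_dist_upper: "a \<in> ball x0 \<rho> \<Longrightarrow> b \<in> ball x0 \<rho> \<Longrightarrow> riem_dist h (cinv c a) (cinv c b) \<le> spd a b"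
  by (rule riem_dist_le[OF reach_ball])

text \<open>\<open>reach_lower\<close> and \<open>riem_dist_upper\<close> squeeze the distance:
  below \<open>cap\<close> it equals \<open>spd\<close>, so local questions about it become
  questions in the chart.\<close>

lemma riem_dist_close:
  assumes q: "q \<in> fst c" "snd c q \<in> ball x0 (\<rho> / 4)" and less: "riem_dist h q q' < cap"
  shows "q' \<in> fst c" "snd c q' \<in> ball x0 \<rho>" "spd (snd c q) (snd c q') = riem_dist h q q'"
    "sqrt l * norm (snd c q' - snd c q) \<le> riem_dist h q q'"
proof -
  let ?a = "snd c q"
  have qa: "cinv c ?a = q" by (rule cinv_chart[OF c q(1)])
  have low: "(if q' \<in> fst c \<and> snd c q' \<in> ball x0 \<rho> then min (spd ?a (snd c q')) cap else cap) \<le> riem_dist h q q'"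
    by (rule riem_dist_greatest) (rule reach_lower[OF q(2), unfolded qa])
  then have in': "q' \<in> fst c \<and> snd c q' \<in> ball x0 \<rho>" using less by (auto split: if_splits)
  then show "q' \<in> fst c" "snd c q' \<in> ball x0 \<rho>" by auto
  have "spd ?a (snd c q') \<le> riem_dist h q q'" using low less in' by (auto simp: min_def split: if_splits)
  moreover have "riem_dist h q q' \<le> spd ?a (snd c q')"
    using riem_dist_upper[OF \<rho>4[OF q(2)], of "snd c q'"] in' qa cinv_chart[OF c, of q'] by simp
  ultimately show "spd (snd c q) (snd c q') = riem_dist h q q'" by simp
  then show "sqrt l * norm (snd c q' - snd c q) \<le> riem_dist h q q'"
    using spd_lower[OF \<rho>4[OF q(2)], of "snd c q'"] in' by simp
qed

end

context connected_riemannian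
begin

lemma riem_dist_open: "open S \<longleftrightarrow> (\<forall>x\<in>S. \<exists>e>0. \<forall>y. riem_dist h x y < e \<longrightarrow> y \<in> S)"
proof
  assume S: "open S"
  show "\<forall>x\<in>S. \<exists>e>0. \<forall>y. riem_dist h x y < e \<longrightarrow> y \<in> S"
  proof
    fix p assume p: "p \<in> S"
    obtain c r w R1 K l \<rho> where b: "connected_ball A N h c (snd c p) r w R1 K l \<rho>" "p \<in> fst c" by (rule ex_connected_ball)
    interpret connected_ball A N h c "snd c p" r w R1 K l \<rho> by (rule b(1))
    have "open (snd c ` (fst c \<inter> S))" by (rule chart_image_open[OF c]) (auto intro: chart_open c S)
    moreover have "snd c p \<in> snd c ` (fst c \<inter> S)" using b(2) p by blast
    ultimately obtain \<delta> where \<delta>: "\<delta> > 0" "ball (snd c p) \<delta> \<subseteq> snd c ` (fst c \<inter> S)" using open_contains_ball by blast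
    define e where "e = min cap (sqrt l * \<delta>)"
    have "e > 0" using cap_pos l \<delta>(1) by (simp add: e_def)
    moreover have "y \<in> S" if y: "riem_dist h p y < e" for y
    proof -
      have p4: "snd c p \<in> ball (snd c p) (\<rho> / 4)" using \<rho>(1) by simp
      have cap: "riem_dist h p y < cap" using y by (simp add: e_def)
      note cl = riem_dist_close[OF b(2) p4 cap]
      have "sqrt l * norm (snd c y - snd c p) < sqrt l * \<delta>" using cl(4) y by (simp add: e_def)
      then have "snd c y \<in> ball (snd c p) \<delta>" using l by (simp add: dist_norm norm_minus_commute)
      then obtain q where "q \<in> fst c \<inter> S" "snd c y = snd c q" using \<delta>(2) by blast
      then show ?thesis using cinv_chart[OF c, of q] cinv_chart[OF c cl(1)] by simp
    qed
    ultimately show "\<exists>e>0. \<forall>y. riem_dist h p y < e \<longrightarrow> y \<in> S" by blast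
  qed
next
  assume S: "\<forall>x\<in>S. \<exists>e>0. \<forall>y. riem_dist h x y < e \<longrightarrow> y \<in> S"
  show "open S"
  proof (subst open_subopen, intro ballI)
    fix p assume "p \<in> S"
    then obtain e where e: "e > 0" "\<And>y. riem_dist h p y < e \<Longrightarrow> y \<in> S" using S by blast
    obtain c r w R1 K l \<rho> where b: "connected_ball A N h c (snd c p) r w R1 K l \<rho>" "p \<in> fst c" by (rule ex_connected_ball)
    interpret connected_ball A N h c "snd c p" r w R1 K l \<rho> by (rule b(1))
    define \<delta> where "\<delta> = min \<rho> (e / (2 * K))"
    have \<delta>: "\<delta> > 0" using \<rho>(1) e(1) K by (simp add: \<delta>_def)
    let ?O = "{q \<in> fst c. snd c q \<in> ball (snd c p) \<delta>}"
    have "open ?O" by (rule chart_vimage_open[OF c open_ball])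
    moreover have "p \<in> ?O" using b(2) \<delta> by simp
    moreover have "q \<in> S" if q: "q \<in> ?O" for q
    proof (rule e(2))
      have q': "q \<in> fst c" "snd c q \<in> ball (snd c p) \<rho>" "norm (snd c q - snd c p) < e / (2 * K)"
        using q by (auto simp: \<delta>_def dist_norm norm_minus_commute)
      have p\<rho>: "snd c p \<in> ball (snd c p) \<rho>" using \<rho>(1) by simp
      have "riem_dist h p q \<le> spd (snd c p) (snd c q)"
        using riem_dist_upper[OF p\<rho> q'(2)] cinv_chart[OF c b(2)] cinv_chart[OF c q'(1)] by simp
      also have "\<dots> \<le> 2 * K * norm (snd c q - snd c p)" by (rule spd_upper[OF p\<rho> q'(2)])
      also have "\<dots> < 2 * K * (e / (2 * K))" using q'(3) K by (intro mult_strict_left_mono) auto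
      also have "\<dots> = e" using K by simp
      finally show "riem_dist h p q < e" .
    qed
    ultimately show "\<exists>T. open T \<and> p \<in> T \<and> T \<subseteq> S" by blast
  qed
qed

lemma riem_dist_eq_0: "riem_dist h p q = 0 \<longleftrightarrow> p = q"
proof
  assume 0: "riem_dist h p q = 0"
  obtain c r w R1 K l \<rho> where b: "connected_ball A N h c (snd c p) r w R1 K l \<rho>" "p \<in> fst c" by (rule ex_connected_ball)
  interpret connected_ball A N h c "snd c p" r w R1 K l \<rho> by (rule b(1))
  have p4: "snd c p \<in> ball (snd c p) (\<rho> / 4)" using \<rho>(1) by simp
  have "riem_dist h p q < cap" using 0 cap_pos by simp
  note cl = riem_dist_close[OF b(2) p4 this]
  have "sqrt l * norm (snd c q - snd c p) \<le> 0" using cl(4) 0 by simp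
  then have "snd c q = snd c p" using l by (simp add: mult_le_0_iff)
  then show "p = q" using cinv_chart[OF c b(2)] cinv_chart[OF c cl(1)] by metis
qed (simp add: riem_dist_self)

lemma riem_dist_compact: "\<exists>e>0. compact {y. riem_dist h p y \<le> e}"
proof -
  obtain c r w R1 K l \<rho> where b: "connected_ball A N h c (snd c p) r w R1 K l \<rho>" "p \<in> fst c" by (rule ex_connected_ball)
  interpret connected_ball A N h c "snd c p" r w R1 K l \<rho> by (rule b(1))
  let ?B = "{y. riem_dist h p y \<le> cap / 2}" and ?C = "cinv c ` cball (snd c p) (\<rho> / 2)"
  have "cball (snd c p) (\<rho> / 2) \<subseteq> cimg c" using ball_cimg \<rho>_r \<rho>(1) by (force simp: subset_iff)
  then have C: "compact ?C"
    by (intro compact_continuous_image continuous_on_subset[OF cinv_continuous[OF c]] compact_cball)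
  have p4: "snd c p \<in> ball (snd c p) (\<rho> / 4)" using \<rho>(1) by simp
  have "y \<in> ?C" if "y \<in> ?B" for y
  proof -
    have "riem_dist h p y < cap" using that cap_pos by simp
    note cl = riem_dist_close[OF b(2) p4 this]
    have "sqrt l * norm (snd c y - snd c p) \<le> sqrt l * (\<rho> / 8)" using cl(4) that by (simp add: cap_def)
    then have "norm (snd c y - snd c p) \<le> \<rho> / 8" using l by simp
    then have "snd c y \<in> cball (snd c p) (\<rho> / 2)" using \<rho>(1) by (simp add: dist_norm norm_minus_commute)
    then show ?thesis using cinv_chart[OF c cl(1)] by (metis image_eqI)
  qed
  then have "?B = ?C \<inter> ?B" by blast
  moreover have "closed ?B"
    unfolding closed_def riem_dist_open
  proof
    fix y assume "y \<in> - ?B"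
    then have y: "riem_dist h p y > cap / 2" by simp
    have "z \<in> - ?B" if "riem_dist h y z < riem_dist h p y - cap / 2" for z
      using that riem_dist_tri[of p y z] riem_dist_sym[of y z] by simp
    then show "\<exists>e>0. \<forall>z. riem_dist h y z < e \<longrightarrow> z \<in> - ?B"
      using y by (intro exI[of _ "riem_dist h p y - cap / 2"]) auto
  qed
  ultimately have "compact ?B" using compact_Int_closed[OF C] by metis
  then show ?thesis using cap_pos by (intro exI[of _ "cap / 2"]) auto
qed

sublocale length_metric "riem_dist h"
  by unfold_locales (rule riem_dist_eq_0 riem_dist_sym riem_dist_tri riem_dist_open riem_dist_compact riem_dist_split; assumption?)+

end

context connected_ball
begin

lemma geo_gcurve:
  assumes ab: "a \<in> ball x0 \<rho>" "b \<in> ball x0 \<rho>" and L: "L > 0" and J: "open J" "\<And>t. t \<in> J \<Longrightarrow> (t - s0) / L \<in> {-1<..<2}"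
  shows "gcurve N J (\<lambda>t. cinv c (sx a b ((t - s0) / L)))"
proof (rule gcurve_chartI[OF J(1)])
  note g = geo_sol[OF ab]
  show "smooth_on J (\<lambda>t. sx a b ((t - s0) / L))"
  proof (rule smooth_on_compose[OF J(1) open_greaterThanLessThan _ geo_smooth(1)[OF g]])
    show "(\<lambda>t. (t - s0) / L) ` J \<subseteq> {-1<..<2}" using J(2) by blast
    show "smooth_on J (\<lambda>t. (t - s0) / L)" unfolding divide_inverse by (intro smooth_intros J(1))
  qed
  fix t assume t: "t \<in> J"
  let ?u = "(t - s0) / L"
  have u: "?u \<in> {-1..2}" "?u \<in> {-1<..<2}" using J(2)[OF t] by auto
  have d: "((\<lambda>t. (t - s0) / L) has_vector_derivative (1 / L)) (at t)"
    unfolding has_real_derivative_iff_has_vector_derivative[symmetric]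
    by (rule DERIV_cong[OF DERIV_cdivide[OF DERIV_diff[OF DERIV_ident DERIV_const]]]) simp
  have at: "(f has_vector_derivative f') (at ?u)" if "(f has_vector_derivative f') (at ?u within {-1<..<2})" for f f'
    using that by (simp add: at_within_open[OF u(2)])
  show "sx a b ?u \<in> ball x0 r" by (rule geo_inR[OF g u(1)])
  have dx: "(sx a b has_vector_derivative sv a b ?u) (at ?u)" by (rule at, rule geo_dx[OF g u(1)]) auto
  have dv: "(sv a b has_vector_derivative - \<Gamma> (sx a b ?u) (sv a b ?u) (sv a b ?u)) (at ?u)" by (rule at, rule geo_dv[OF g u(1)]) auto
  show "((\<lambda>t. sx a b ((t - s0) / L)) has_vector_derivative (1 / L) *\<^sub>R sv a b ?u) (at t)"
    using vector_diff_chain_at[OF d dx] by (simp add: o_def)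
  have "((\<lambda>t. sv a b ((t - s0) / L)) has_vector_derivative (1 / L) *\<^sub>R (- \<Gamma> (sx a b ?u) (sv a b ?u) (sv a b ?u))) (at t)"
    using vector_diff_chain_at[OF d dv] by (simp add: o_def)
  then have "((\<lambda>t. (1 / L) *\<^sub>R sv a b ((t - s0) / L)) has_vector_derivative (1 / L) *\<^sub>R ((1 / L) *\<^sub>R (- \<Gamma> (sx a b ?u) (sv a b ?u) (sv a b ?u)))) (at t)"
    by (rule bounded_linear.has_vector_derivative[OF bounded_linear_scaleR_right])
  moreover note linear_scale[OF \<Gamma>_lin[OF geo_inR[OF g u(1)]]] linear_scale[OF \<Gamma>_lin1[OF geo_inR[OF g u(1)]]]
  ultimately show "((\<lambda>t. (1 / L) *\<^sub>R sv a b ((t - s0) / L)) has_vector_derivative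
      - \<Gamma> (sx a b ?u) ((1 / L) *\<^sub>R sv a b ?u) ((1 / L) *\<^sub>R sv a b ?u)) (at t)"
    by simp
qed

text \<open>Near \<open>t0\<close>, the piece of the segment over \<open>{s0..s1}\<close> has the
  end points and the length of a short geodesic, and each of its points divides that length as the
  geodesic does. \<open>division_point_unique\<close> identifies the two curves point by
  point.\<close>

lemma segment_at_centre_geodesic:
  assumes seg: "\<And>s t. s \<in> {\<alpha>..\<omega>} \<Longrightarrow> t \<in> {\<alpha>..\<omega>} \<Longrightarrow> riem_dist h (\<gamma> s) (\<gamma> t) = \<bar>s - t\<bar>" and \<alpha>\<omega>: "\<alpha> < \<omega>"
    and t0: "t0 \<in> {\<alpha>..\<omega>}" "\<gamma> t0 \<in> fst c" "snd c (\<gamma> t0) = x0"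
  shows "\<exists>\<epsilon>>0. \<exists>\<eta>. gcurve N {t0-\<epsilon><..<t0+\<epsilon>} \<eta> \<and> (\<forall>t\<in>{\<alpha>..\<omega>}. \<bar>t - t0\<bar> < \<epsilon> \<longrightarrow> \<eta> t = \<gamma> t)"
proof -
  \<comment> \<open>So small that all points with parameters in \<open>{s0..s1}\<close> stay in the
    quarter ball and their mutual distances, at most \<open>2 * e\<close>, stay below
    \<open>cap\<close>.\<close>
  define e where "e = cap / 16"
  have e: "e > 0" "e < cap" "2 * e < cap" using cap_pos by (auto simp: e_def)
  define s0 s1 where "s0 = max \<alpha> (t0 - e)" and "s1 = min \<omega> (t0 + e)"
  have s: "s0 < s1" "s0 \<le> t0" "t0 \<le> s1" "\<alpha> \<le> s0" "s1 \<le> \<omega>" "t0 - e \<le> s0" "s1 \<le> t0 + e"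
    using \<alpha>\<omega> e t0 by (auto simp: s0_def s1_def)
  define L where "L = s1 - s0"
  have L: "L > 0" "L \<le> 2 * e" using s by (auto simp: L_def)
  have x04: "snd c (\<gamma> t0) \<in> ball x0 (\<rho> / 4)" using t0(3) \<rho>(1) by simp
  have near: "\<gamma> u \<in> fst c" "snd c (\<gamma> u) \<in> ball x0 (\<rho> / 4)" if u: "u \<in> {s0..s1}" for u
  proof -
    have "riem_dist h (\<gamma> t0) (\<gamma> u) \<le> e" using seg[OF t0(1), of u] u s by auto
    then have cap: "riem_dist h (\<gamma> t0) (\<gamma> u) < cap" using e by simp
    note cl = riem_dist_close[OF t0(2) x04 cap]
    show "\<gamma> u \<in> fst c" by (rule cl(1))
    have "sqrt l * norm (snd c (\<gamma> u) - x0) \<le> sqrt l * (\<rho> / 64)"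
      using cl(4) \<open>riem_dist h (\<gamma> t0) (\<gamma> u) \<le> e\<close> t0(3) by (simp add: e_def cap_def)
    then have "norm (snd c (\<gamma> u) - x0) \<le> \<rho> / 64" using l by simp
    then show "snd c (\<gamma> u) \<in> ball x0 (\<rho> / 4)" using \<rho>(1) by (simp add: dist_norm norm_minus_commute)
  qed
  have sp: "spd (snd c (\<gamma> u)) (snd c (\<gamma> v)) = v - u" if uv: "u \<in> {s0..s1}" "v \<in> {s0..s1}" "u \<le> v" for u v
  proof -
    have d: "riem_dist h (\<gamma> u) (\<gamma> v) = v - u" using seg[of u v] uv s by auto
    moreover have "v - u < cap" using uv s e by auto
    ultimately show ?thesis using riem_dist_close(3)[OF near[OF uv(1)], of "\<gamma> v"] by simp
  qed
  define a b where "a = snd c (\<gamma> s0)" and "b = snd c (\<gamma> s1)"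
  have i01: "s0 \<in> {s0..s1}" "s1 \<in> {s0..s1}" using s by auto
  have ab: "a \<in> ball x0 \<rho>" "b \<in> ball x0 \<rho>" unfolding a_def b_def by (rule \<rho>4[OF near(2)[OF i01(1)]], rule \<rho>4[OF near(2)[OF i01(2)]])
  have spL: "spd a b = L" using sp[OF i01] s by (simp add: a_def b_def L_def)
  have on: "cinv c (sx a b ((u - s0) / L)) = \<gamma> u" if u: "u \<in> {s0..s1}" for u
  proof -
    let ?m = "snd c (\<gamma> u)"
    have "?m = sx a b ((u - s0) / L)"
    proof -
      consider "u = s0" | "u = s1" | "s0 < u" "u < s1" using u by fastforce
      then show ?thesis
      proof cases
        case 1
        then show ?thesis using geo_0[OF geo_sol[OF ab]] by (simp add: a_def)
      next
        case 2
        then show ?thesis using geo_1[OF geo_sol[OF ab]] L(1) by (simp add: b_def L_def)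
      next
        case 3
        show ?thesis
        proof (rule division_point_unique[OF ab \<rho>4[OF near(2)[OF u]]])
          show "0 < (u - s0) / L" "(u - s0) / L < 1" using 3 L(1) by (auto simp: L_def field_simps)
          show "spd a ?m = (u - s0) / L * spd a b" using sp[OF i01(1) u] 3 L(1) by (simp add: a_def[symmetric] spL)
          have "(1 - (u - s0) / L) * L = s1 - u" using L(1) by (simp add: L_def field_simps)
          then show "spd ?m b = (1 - (u - s0) / L) * spd a b" using sp[OF u i01(2)] 3 by (simp add: b_def[symmetric] spL)
        qed
      qed
    qed
    then show ?thesis using cinv_chart[OF c near(1)[OF u]] by simp
  qed
  \<comment> \<open>Short geodesics are defined over \<open>{-1..2}\<close>, a full length
    \<open>L\<close> beyond either end. Hence \<open>\<eta>\<close> exists on both sides of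
    \<open>t0\<close> even if \<open>t0\<close> is an end point of the segment.\<close>
  define \<epsilon> where "\<epsilon> = min e L"
  have \<epsilon>: "\<epsilon> > 0" "\<epsilon> \<le> e" "\<epsilon> \<le> L" using e L by (auto simp: \<epsilon>_def)
  have "gcurve N {t0-\<epsilon><..<t0+\<epsilon>} (\<lambda>t. cinv c (sx a b ((t - s0) / L)))"
  proof (rule geo_gcurve[OF ab L(1) open_greaterThanLessThan])
    fix t assume "t \<in> {t0-\<epsilon><..<t0+\<epsilon>}"
    then have "- L < t - s0" "t - s0 < 2 * L" using s \<epsilon> unfolding L_def by auto
    then show "(t - s0) / L \<in> {-1<..<2}" using L(1) by (simp add: field_simps)
  qed
  moreover have "cinv c (sx a b ((t - s0) / L)) = \<gamma> t" if "t \<in> {\<alpha>..\<omega>}" "\<bar>t - t0\<bar> < \<epsilon>" for t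
    using that \<epsilon> by (intro on) (auto simp: s0_def s1_def)
  ultimately show ?thesis using \<epsilon>(1) by blast
qed

end

context connected_riemannian
begin

lemma segment_locally_geodesic:
  assumes seg: "\<And>s t. s \<in> {\<alpha>..\<omega>} \<Longrightarrow> t \<in> {\<alpha>..\<omega>} \<Longrightarrow> riem_dist h (\<gamma> s) (\<gamma> t) = \<bar>s - t\<bar>" and \<alpha>\<omega>: "\<alpha> < \<omega>" and t0: "t0 \<in> {\<alpha>..\<omega>}"
  shows "\<exists>\<epsilon>>0. \<exists>\<eta>. gcurve N {t0-\<epsilon><..<t0+\<epsilon>} \<eta> \<and> (\<forall>t\<in>{\<alpha>..\<omega>}. \<bar>t - t0\<bar> < \<epsilon> \<longrightarrow> \<eta> t = \<gamma> t)"
proof -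
  obtain c r w R1 K l \<rho> where b: "connected_ball A N h c (snd c (\<gamma> t0)) r w R1 K l \<rho>" "\<gamma> t0 \<in> fst c" by (rule ex_connected_ball)
  interpret connected_ball A N h c "snd c (\<gamma> t0)" r w R1 K l \<rho> by (rule b(1))
  show ?thesis by (rule segment_at_centre_geodesic[OF seg \<alpha>\<omega> t0 b(2) refl])
qed

lemma segment_gcurve:
  assumes seg: "\<And>s t. s \<in> {\<alpha>..\<omega>} \<Longrightarrow> t \<in> {\<alpha>..\<omega>} \<Longrightarrow> riem_dist h (\<gamma> s) (\<gamma> t) = \<bar>s - t\<bar>" and \<alpha>\<omega>: "\<alpha> < \<omega>"
  shows "\<exists>\<epsilon>>0. \<exists>\<eta>. gcurve N {\<alpha>-\<epsilon><..<\<omega>+\<epsilon>} \<eta> \<and> (\<forall>t\<in>{\<alpha>..\<omega>}. \<eta> t = \<gamma> t)"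
proof -
  note loc = segment_locally_geodesic[OF seg \<alpha>\<omega>]
  obtain \<epsilon>0 \<eta>0 where 0: "\<epsilon>0 > 0" "gcurve N {\<alpha>-\<epsilon>0<..<\<alpha>+\<epsilon>0} \<eta>0" "\<And>t. t \<in> {\<alpha>..\<omega>} \<Longrightarrow> \<bar>t - \<alpha>\<bar> < \<epsilon>0 \<Longrightarrow> \<eta>0 t = \<gamma> t"
    using loc[of \<alpha>] \<alpha>\<omega> by force
  obtain \<epsilon>1 \<eta>1 where 1: "\<epsilon>1 > 0" "gcurve N {\<omega>-\<epsilon>1<..<\<omega>+\<epsilon>1} \<eta>1" "\<And>t. t \<in> {\<alpha>..\<omega>} \<Longrightarrow> \<bar>t - \<omega>\<bar> < \<epsilon>1 \<Longrightarrow> \<eta>1 t = \<gamma> t"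
    using loc[of \<omega>] \<alpha>\<omega> by force
  define \<epsilon> where "\<epsilon> = Min {\<epsilon>0, \<epsilon>1, \<omega> - \<alpha>}"
  have \<epsilon>: "\<epsilon> > 0" "\<epsilon> \<le> \<epsilon>0" "\<epsilon> \<le> \<epsilon>1" "\<epsilon> \<le> \<omega> - \<alpha>" using 0(1) 1(1) \<alpha>\<omega> by (auto simp: \<epsilon>_def)
  \<comment> \<open>The local geodesics at the two ends prolong the segment; in between it is
    geodesic by the same local statement.\<close>
  define \<eta> where "\<eta> t = (if t < \<alpha> then \<eta>0 t else if t > \<omega> then \<eta>1 t else \<gamma> t)" for t
  have "gcurve N {\<alpha>-\<epsilon><..<\<omega>+\<epsilon>} \<eta>"
  proof (rule gcurve_local[OF open_greaterThanLessThan])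
    fix t assume t: "t \<in> {\<alpha>-\<epsilon><..<\<omega>+\<epsilon>}"
    consider "t \<le> \<alpha>" | "t \<ge> \<omega>" | "\<alpha> < t" "t < \<omega>" by linarith
    then show "\<exists>T \<eta>'. open T \<and> t \<in> T \<and> gcurve N T \<eta>' \<and> (\<forall>s\<in>T. \<eta> s = \<eta>' s)"
    proof cases
      case 1
      have "gcurve N {\<alpha>-\<epsilon><..<\<alpha>+\<epsilon>} \<eta>0" by (rule gcurve_subset[OF 0(2)]) (use \<epsilon> in auto)
      moreover have "\<eta> s = \<eta>0 s" if "s \<in> {\<alpha>-\<epsilon><..<\<alpha>+\<epsilon>}" for s
        using that 0(3)[of s] \<epsilon> by (auto simp: \<eta>_def)
      moreover have "t \<in> {\<alpha>-\<epsilon><..<\<alpha>+\<epsilon>}" using t 1 \<epsilon> by auto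
      ultimately show ?thesis using open_greaterThanLessThan by blast
    next
      case 2
      have "gcurve N {\<omega>-\<epsilon><..<\<omega>+\<epsilon>} \<eta>1" by (rule gcurve_subset[OF 1(2)]) (use \<epsilon> in auto)
      moreover have "\<eta> s = \<eta>1 s" if "s \<in> {\<omega>-\<epsilon><..<\<omega>+\<epsilon>}" for s
        using that 1(3)[of s] \<epsilon> by (auto simp: \<eta>_def)
      moreover have "t \<in> {\<omega>-\<epsilon><..<\<omega>+\<epsilon>}" using t 2 \<epsilon> by auto
      ultimately show ?thesis using open_greaterThanLessThan by blast
    next
      case 3
      then obtain \<delta> \<eta>2 where 2: "\<delta> > 0" "gcurve N {t-\<delta><..<t+\<delta>} \<eta>2" "\<And>s. s \<in> {\<alpha>..\<omega>} \<Longrightarrow> \<bar>s - t\<bar> < \<delta> \<Longrightarrow> \<eta>2 s = \<gamma> s"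
        using loc[of t] by force
      let ?T = "{t-\<delta><..<t+\<delta>} \<inter> {\<alpha><..<\<omega>}"
      have "gcurve N ?T \<eta>2" by (rule gcurve_subset[OF 2(2)]) auto
      moreover have "\<eta> s = \<eta>2 s" if "s \<in> ?T" for s using that 2(3)[of s] by (auto simp: \<eta>_def)
      moreover have "t \<in> ?T" "open ?T" using 3 2(1) by auto
      ultimately show ?thesis by blast
    qed
  qed
  then show ?thesis using \<epsilon>(1) by (intro exI[of _ \<epsilon>] conjI exI[of _ \<eta>]) (auto simp: \<eta>_def)
qed

lemma ray_gcurve:
  assumes ray: "\<And>s t. s \<in> {0..<b} \<Longrightarrow> t \<in> {0..<b} \<Longrightarrow> riem_dist h (\<gamma> s) (\<gamma> t) = \<bar>s - t\<bar>"
  shows "gcurve N {0<..<b} \<gamma>"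
proof (rule gcurve_local[OF open_greaterThanLessThan])
  fix t assume t: "t \<in> {0<..<b}"
  define b' where "b' = (t + b) / 2"
  have b': "t < b'" "b' < b" "0 < b'" using t by (auto simp: b'_def)
  obtain \<delta> \<eta> where 2: "\<delta> > 0" "gcurve N {t-\<delta><..<t+\<delta>} \<eta>" "\<And>s. s \<in> {0..b'} \<Longrightarrow> \<bar>s - t\<bar> < \<delta> \<Longrightarrow> \<eta> s = \<gamma> s"
    using segment_locally_geodesic[of 0 b' \<gamma> t] ray b' t by force
  let ?T = "{t-\<delta><..<t+\<delta>} \<inter> {0<..<b'}"
  have "gcurve N ?T \<eta>" by (rule gcurve_subset[OF 2(2)]) auto
  moreover have "\<gamma> s = \<eta> s" if "s \<in> ?T" for s using that 2(3)[of s] by auto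
  moreover have "t \<in> ?T" "open ?T" using t b' 2(1) by auto
  ultimately show "\<exists>T \<eta>. open T \<and> t \<in> T \<and> gcurve N T \<eta> \<and> (\<forall>s\<in>T. \<gamma> s = \<eta> s)" by blast
qed

end

section \<open>Reparametrisation\<close>

context smooth_manifold
begin

lemma smooth_curve_compose:
  assumes c: "smooth_curve_on A J c" and I: "open I" "\<tau> ` I \<subseteq> J" "smooth_on I \<tau>"
  shows "smooth_curve_on A I (\<lambda>t. c (\<tau> t))"
proof -
  have cont: "continuous_on I (\<lambda>t. c (\<tau> t))"
    by (rule continuous_on_compose2[OF curve_continuous[OF c] smooth_on_imp_continuous_on[OF I(3)] I(2)])
  have "smooth_on (I \<inter> (\<lambda>t. c (\<tau> t)) -` fst d) (\<lambda>t. snd d (c (\<tau> t)))" if d: "d \<in> A" for d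
  proof (rule smooth_on_compose[OF _ curve_vimage_open[OF c chart_open[OF d]] _ curve_chart[OF c d]])
    show "open (I \<inter> (\<lambda>t. c (\<tau> t)) -` fst d)"
      using continuous_on_open_vimage[OF I(1), of "\<lambda>t. c (\<tau> t)"] cont chart_open[OF d] by (metis Int_commute)
    show "\<tau> ` (I \<inter> (\<lambda>t. c (\<tau> t)) -` fst d) \<subseteq> J \<inter> c -` fst d" using I(2) by auto
    show "smooth_on (I \<inter> (\<lambda>t. c (\<tau> t)) -` fst d) \<tau>" by (rule smooth_on_subset[OF I(3)]) auto
  qed
  then show ?thesis
    unfolding smooth_curve_on_def o_def using I(1) cont by (auto simp: split_beta)
qed

text \<open>For \<open>\<theta> = ds/dt\<close>, a multiple of \<open>exp (2 * \<sigma>)\<close>,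
  the derivative along the curve is \<open>2 * v \<sigma> * \<theta>\<close>. The second derivative
  of \<open>f\<close> along the new curve is therefore \<open>\<theta>\<^sup>2\<close> times the sum
  of the Hessian of \<open>N\<close> and \<open>2 * v \<sigma> * v f\<close>, and by
  \<open>rel\<close> this sum is the Hessian of \<open>M\<close>.\<close>

lemma gcurve_reparametrise:
  assumes M: "affine_manifold A M" and \<sigma>: "smooth_fun A \<sigma>"
    and rel: "\<And>p u f. u \<in> tangent_space A p \<Longrightarrow> smooth_fun A f \<Longrightarrow> hess N p u u f = hess M p u u f - 2 * u \<sigma> * u f"
    and c: "gcurve N J c" and J: "is_interval J" and k: "k > 0"
    and T: "\<And>s. s \<in> J \<Longrightarrow> (T has_real_derivative k * exp (- 2 * \<sigma> (c s))) (at s)"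
  shows "\<exists>\<beta>. gcurve M (T ` J) \<beta> \<and> open (T ` J) \<and> is_interval (T ` J) \<and> (\<forall>s\<in>J. \<beta> (T s) = c s)"
proof -
  interpret M: affine_manifold A M by (rule M)
  have sc: "smooth_curve_on A J c" and geo: "\<And>s. s \<in> J \<Longrightarrow> geodesic_at N c s" using c by (auto simp: gcurve_def)
  have oJ: "open J" by (rule curve_open[OF sc])
  have contT: "continuous_on J T"
    using T DERIV_isCont continuous_at_imp_continuous_on by blast
  have less: "T s < T t" if "s \<in> J" "t \<in> J" "s < t" for s t
  proof (rule DERIV_pos_imp_increasing[OF that(3)])
    fix u assume "s \<le> u" "u \<le> t"
    then have "u \<in> J" using J that unfolding is_interval_1 by blast
    then show "\<exists>y. (T has_real_derivative y) (at u) \<and> 0 < y" using T[of u] k by (intro exI[of _ "k * exp (- 2 * \<sigma> (c u))"]) auto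
  qed
  have inj: "inj_on T J" by (rule linorder_inj_onI') (use less in fastforce)
  have oI: "open (T ` J)" by (rule invariance_of_domain[OF contT oJ inj])
  have iI: "is_interval (T ` J)"
    using connected_continuous_image[OF contT] J by (simp add: is_interval_connected_1)
  obtain \<tau> where hom: "homeomorphism J (T ` J) T \<tau>"
    using invariance_of_domain_homeomorphism[OF oJ contT _ inj] by auto
  have \<tau>J: "\<tau> y \<in> J" and T\<tau>: "T (\<tau> y) = y" if "y \<in> T ` J" for y
    using hom that by (auto simp: homeomorphism_def)
  have \<tau>T: "\<tau> (T s) = s" if "s \<in> J" for s using hom that by (auto simp: homeomorphism_def)
  have c\<tau>: "continuous_on (T ` J) \<tau>" using hom by (auto simp: homeomorphism_def)
  define \<theta> where "\<theta> s = (1 / k) * exp (2 * \<sigma> (c s))" for s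
  have d\<tau>: "(\<tau> has_real_derivative \<theta> (\<tau> y)) (at y)" if y: "y \<in> T ` J" for y
  proof -
    obtain e where e: "e > 0" "ball y e \<subseteq> T ` J" using oI y open_contains_ball by blast
    have "(\<tau> has_real_derivative inverse (k * exp (- 2 * \<sigma> (c (\<tau> y))))) (at y)"
    proof (rule DERIV_inverse_function[where f = T and a = "y - e" and b = "y + e"])
      show "(T has_real_derivative k * exp (- 2 * \<sigma> (c (\<tau> y)))) (at (\<tau> y))" by (rule T[OF \<tau>J[OF y]])
      show "T (\<tau> z) = z" if "y - e < z" "z < y + e" for z
        using e(2) that by (intro T\<tau>) (auto simp: dist_real_def subset_iff)
      show "isCont \<tau> y" using c\<tau> oI y continuous_on_eq_continuous_at by blast
    qed (use e k in auto)
    moreover have "inverse (k * exp (- 2 * \<sigma> (c (\<tau> y)))) = \<theta> (\<tau> y)"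
      by (simp add: \<theta>_def exp_minus divide_inverse)
    ultimately show ?thesis by simp
  qed
  have s\<theta>: "smooth_on J \<theta>"
    unfolding \<theta>_def
    by (intro smooth_on_mult smooth_on_const smooth_on_exp_compose smooth_fun_curve[OF sc] \<sigma> oJ)
  \<comment> \<open>The inverse parameter has the derivative \<open>\<theta> (\<tau> y)\<close> with
    smooth \<open>\<theta>\<close>, so its regularity bootstraps.\<close>
  have "Ck_on n (T ` J) \<tau>" for n
  proof (induction n)
    case 0
    then show ?case using c\<tau> by simp
  next
    case (Suc n)
    show ?case
    proof (rule Ck_on_Suc_real[OF oI])
      show "(\<tau> has_vector_derivative \<theta> (\<tau> y)) (at y)" if "y \<in> T ` J" for y
        using d\<tau>[OF that] by (simp add: has_real_derivative_iff_has_vector_derivative)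
      show "Ck_on n (T ` J) (\<lambda>y. \<theta> (\<tau> y))"
        by (rule Ck_on_compose[OF oI oJ _ _ Suc]) (use \<tau>J s\<theta> in \<open>auto simp: smooth_on_def\<close>)
    qed
  qed
  then have s\<tau>: "smooth_on (T ` J) \<tau>" by (simp add: smooth_on_def)
  define \<beta> where "\<beta> y = c (\<tau> y)" for y
  have s\<beta>: "smooth_curve_on A (T ` J) \<beta>"
    unfolding \<beta>_def by (rule smooth_curve_compose[OF sc oI _ s\<tau>]) (use \<tau>J in blast)
  have d\<beta>: "((\<lambda>y. f (\<beta> y)) has_real_derivative velocity A c (\<tau> y) f * \<theta> (\<tau> y)) (at y)"
    if y: "y \<in> T ` J" and f: "smooth_fun A f" for y f
    unfolding \<beta>_def by (rule DERIV_chain2[OF velocity_DERIV[OF sc f \<tau>J[OF y]] d\<tau>[OF y]])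
  have vel: "velocity A \<beta> y = (\<lambda>f. \<theta> (\<tau> y) * velocity A c (\<tau> y) f)" if y: "y \<in> T ` J" for y
  proof
    fix f show "velocity A \<beta> y f = \<theta> (\<tau> y) * velocity A c (\<tau> y) f"
    proof (cases "smooth_fun A f")
      case True
      then show ?thesis using DERIV_unique[OF velocity_DERIV[OF s\<beta> True y] d\<beta>[OF y True]] by (simp add: mult.commute)
    qed (simp add: velocity_def)
  qed
  have "geodesic_at M \<beta> y" if y: "y \<in> T ` J" for y
    unfolding geodesic_at_def
  proof (intro allI impI)
    fix f assume f: "smooth_fun A f"
    let ?s = "\<tau> y"
    let ?v = "velocity A c ?s"
    note sJ = \<tau>J[OF y]
    note vt = velocity_tangent[OF sc sJ]
    have "(\<lambda>t. velocity A c t f) = deriv (\<lambda>s. f (c s))" by (rule ext) (simp add: velocity_def f)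
    moreover have "(deriv (\<lambda>s. f (c s)) has_real_derivative deriv (deriv (\<lambda>s. f (c s))) ?s) (at ?s)"
      by (rule smooth_on_DERIV[OF smooth_on_deriv[OF oJ smooth_fun_curve[OF sc f]] sJ])
    ultimately have dv: "((\<lambda>t. velocity A c t f) has_real_derivative hess N (c ?s) ?v ?v f) (at ?s)"
      using geo[OF sJ] f unfolding geodesic_at_def by simp
    have d\<theta>: "(\<theta> has_real_derivative (1 / k) * (exp (2 * \<sigma> (c ?s)) * (2 * ?v \<sigma>))) (at ?s)"
      unfolding \<theta>_def by (intro DERIV_cmult DERIV_fun_exp velocity_DERIV[OF sc \<sigma> sJ])
    have "((\<lambda>t. velocity A c (\<tau> t) f * \<theta> (\<tau> t)) has_real_derivative
        ((hess N (c ?s) ?v ?v f * \<theta> ?s + (1 / k) * (exp (2 * \<sigma> (c ?s)) * (2 * ?v \<sigma>)) * ?v f) * \<theta> ?s)) (at y)"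
      by (rule DERIV_chain2[OF DERIV_mult[OF dv d\<theta>] d\<tau>[OF y]])
    moreover have "velocity A c (\<tau> t) f * \<theta> (\<tau> t) = deriv (\<lambda>y. f (\<beta> y)) t" if "t \<in> T ` J" for t
      using d\<beta>[OF that f] by (simp add: DERIV_imp_deriv)
    ultimately have "(deriv (\<lambda>y. f (\<beta> y)) has_real_derivative
        ((hess N (c ?s) ?v ?v f * \<theta> ?s + (1 / k) * (exp (2 * \<sigma> (c ?s)) * (2 * ?v \<sigma>)) * ?v f) * \<theta> ?s)) (at y)"
      by (rule has_field_derivative_transform_within_open[OF _ oI y])
    then have "deriv (deriv (\<lambda>y. f (\<beta> y))) y =
        (hess N (c ?s) ?v ?v f * \<theta> ?s + (1 / k) * (exp (2 * \<sigma> (c ?s)) * (2 * ?v \<sigma>)) * ?v f) * \<theta> ?s"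
      by (rule DERIV_imp_deriv)
    also have "\<dots> = (\<theta> ?s)\<^sup>2 * hess M (c ?s) ?v ?v f"
      unfolding rel[OF vt f] by (simp add: \<theta>_def power2_eq_square algebra_simps)
    also have "\<dots> = hess M (\<beta> y) (velocity A \<beta> y) (velocity A \<beta> y) f"
      unfolding vel[OF y] \<beta>_def by (rule M.hess_scale[OF vt f, symmetric])
    finally show "deriv (deriv (\<lambda>y. f (\<beta> y))) y = hess M (\<beta> y) (velocity A \<beta> y) (velocity A \<beta> y) f" .
  qed
  with s\<beta> have "gcurve M (T ` J) \<beta>" by (simp add: gcurve_def)
  moreover have "\<forall>s\<in>J. \<beta> (T s) = c s" by (simp add: \<beta>_def \<tau>T)
  ultimately show ?thesis using oI iI by blast
qed

end

lemma integral_has_real_derivative_open: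
  fixes f :: "real \<Rightarrow> real"
  assumes f: "continuous_on {a<..<b} f" and m: "a < m" and s: "m < s" "s < b"
  shows "((\<lambda>s. integral {m..s} f) has_real_derivative f s) (at s)"
proof -
  define b' where "b' = (s + b) / 2"
  have b': "s < b'" "b' < b" using s by (auto simp: b'_def)
  have "continuous_on {m..b'} f" by (rule continuous_on_subset[OF f]) (use m b' in auto)
  then have "((\<lambda>s. integral {m..s} f) has_vector_derivative f s) (at s within {m..b'})"
    by (rule integral_has_vector_derivative) (use s b' in auto)
  then show ?thesis
    using at_within_Icc_at[OF s(1) b'(1)] by (simp add: has_real_derivative_iff_has_vector_derivative)
qed

lemma tendsto_at_left_mono_bounded:
  fixes T :: "real \<Rightarrow> real"
  assumes "m < b" and mono: "\<And>s t. m < s \<Longrightarrow> s \<le> t \<Longrightarrow> t < b \<Longrightarrow> T s \<le> T t" and bdd: "\<And>s. m < s \<Longrightarrow> s < b \<Longrightarrow> T s \<le> C"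
  shows "\<exists>B. (T \<longlongrightarrow> B) (at_left b)"
proof -
  let ?J = "{m<..<b}"
  have J: "(m + b) / 2 \<in> ?J" using assms(1) by auto
  have bd: "bdd_above (T ` ?J)" by (rule bdd_aboveI[of _ C]) (use bdd in auto)
  have "(T \<longlongrightarrow> Sup (T ` ?J)) (at_left b)"
  proof (rule order_tendstoI)
    fix a assume "a < Sup (T ` ?J)"
    then obtain s where s: "s \<in> ?J" "a < T s" using less_cSupD[of "T ` ?J" a] J by blast
    have "\<forall>\<^sub>F t in at_left b. t \<in> {s<..<b}" by (rule eventually_at_left_real) (use s in auto)
    then show "\<forall>\<^sub>F t in at_left b. a < T t"
    proof eventually_elim
      case (elim t)
      then show ?case using s mono[of s t] by auto
    qed
  next
    fix a assume a: "Sup (T ` ?J) < a"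
    have "\<forall>\<^sub>F t in at_left b. t \<in> ?J" by (rule eventually_at_left_real) (use assms(1) in auto)
    then show "\<forall>\<^sub>F t in at_left b. T t < a"
      by eventually_elim (use a cSup_upper[OF _ bd] in fastforce)
  qed
  then show ?thesis by blast
qed

context smooth_manifold
begin

text \<open>This is what a geodesic supplied by completeness is used for: its points have a limit at
  every parameter.\<close>

lemma geodesic_on_continuous:
  assumes "geodesic_on A N UNIV \<eta>" shows "isCont \<eta> t"
proof -
  obtain J \<gamma> where "UNIV \<subseteq> J" "smooth_curve_on A J \<gamma>" "\<forall>t. \<gamma> t = \<eta> t"
    using assms unfolding geodesic_on_def by blast
  then have "J = UNIV" "\<gamma> = \<eta>" by auto
  then have "continuous_on UNIV \<eta>" using curve_continuous[OF \<open>smooth_curve_on A J \<gamma>\<close>] by simp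
  then show ?thesis using continuous_on_eq_continuous_at[OF open_UNIV] by blast
qed

end

section \<open>Conformal metrics and projective changes of the connection\<close>

context smooth_manifold
begin

text \<open>The axioms of a derivation cover products but not composition with \<open>exp\<close>,
  hence the detour through charts.\<close>

lemma tangent_exp:
  assumes u: "u \<in> tangent_space A p" and f: "smooth_fun A f"
  shows "u (\<lambda>q. exp (f q)) = exp (f p) * u f"
proof -
  obtain c where cp: "c \<in> A" "p \<in> fst c" using chart_ex by blast
  obtain r w where "cutoff_chart A c (snd c p) r w" using ex_cutoff_chart[OF cp] by blast
  then interpret cutoff_chart A c "snd c p" r w .
  have p: "p \<in> Q" using cp r by (simp add: Q_def)
  have "((\<lambda>x. exp (f (cinv c x))) has_derivative (\<lambda>v. exp (f (cinv c (snd c p))) * tvec c p v f)) (at (snd c p))"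
    using has_derivative_exp[OF smooth_fun_has_derivative[OF cp f]] by (simp add: mult.commute)
  then have "tvec c p v (\<lambda>q. exp (f q)) = exp (f p) * tvec c p v f" for v
    using tvec_eqI[OF cp smooth_fun_exp[OF f]] cinv_chart[OF cp] by simp
  then show ?thesis using tangent_eq[OF p u] by metis
qed

end

definition conformal_metric :: "('m \<Rightarrow> real) \<Rightarrow> 'm metric \<Rightarrow> 'm metric" where
  "conformal_metric \<sigma> g p u v = exp (\<sigma> p) * g p u v"

text \<open>The added terms are symmetric in \<open>U\<close> and \<open>V\<close>, so the torsion
  is unchanged, and for \<open>U = V\<close> they are a multiple of \<open>U\<close>, so geodesics
  change only their parameter.\<close>

definition projective_connection :: "('m \<Rightarrow> real) \<Rightarrow> 'm connection \<Rightarrow> 'm connection" where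
  "projective_connection \<sigma> N U V p f = N U V p f + U p \<sigma> * V p f + V p \<sigma> * U p f"

context affine_manifold
begin

lemma projective_affine:
  assumes \<sigma>: "smooth_fun A \<sigma>"
  shows "affine_connection A (projective_connection \<sigma> N)"
  unfolding affine_connection_def
proof (intro conjI ballI allI impI)
  fix U V assume U: "U \<in> vector_fields A" and V: "V \<in> vector_fields A"
  have "(\<lambda>p f. (\<lambda>p f. N U V p f + U p \<sigma> * V p f) p f + V p \<sigma> * U p f) \<in> vector_fields A"
    by (intro vf_add N_vf U V vf_scale vf_smooth[OF U] vf_smooth[OF V] \<sigma>)
  then show "projective_connection \<sigma> N U V \<in> vector_fields A"
    by (simp add: projective_connection_def[abs_def])
next
  fix U V Z h k assume U: "U \<in> vector_fields A" and V: "V \<in> vector_fields A" and Z: "Z \<in> vector_fields A"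
    and h: "smooth_fun A h" and k: "smooth_fun A k"
  show "projective_connection \<sigma> N (\<lambda>p f. h p * U p f + k p * V p f) Z =
      (\<lambda>p f. h p * projective_connection \<sigma> N U Z p f + k p * projective_connection \<sigma> N V Z p f)"
    unfolding projective_connection_def N_lincomb1[OF U V Z h k] by (simp add: algebra_simps)
next
  fix U V Z assume U: "U \<in> vector_fields A" and V: "V \<in> vector_fields A" and Z: "Z \<in> vector_fields A"
  show "projective_connection \<sigma> N U (\<lambda>p f. V p f + Z p f) =
      (\<lambda>p f. projective_connection \<sigma> N U V p f + projective_connection \<sigma> N U Z p f)"
    by (rule ext, rule ext) (simp add: projective_connection_def N_add2[OF U V Z] algebra_simps)
next
  fix U V h assume U: "U \<in> vector_fields A" and V: "V \<in> vector_fields A" and h: "smooth_fun A h"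
  show "projective_connection \<sigma> N U (\<lambda>p f. h p * V p f) =
      (\<lambda>p f. U p h * V p f + h p * projective_connection \<sigma> N U V p f)"
    by (rule ext, rule ext) (simp add: projective_connection_def N_mult2[OF U V h] algebra_simps)
qed

lemma projective_hess:
  assumes u: "u \<in> tangent_space A p"
  shows "hess (projective_connection \<sigma> N) p u u f = hess N p u u f - 2 * u \<sigma> * u f"
  unfolding hess_def hess_fields_def projective_connection_def by (simp add: ext_field(2)[OF u])

lemma conformal_riemannian:
  assumes g: "riemannian_metric A g" and \<sigma>: "smooth_fun A \<sigma>"
  shows "riemannian_metric A (conformal_metric \<sigma> g)"
  unfolding riemannian_metric_def
proof (intro conjI ballI allI impI)
  fix p u v w a b assume uvw: "u \<in> tangent_space A p" "v \<in> tangent_space A p" "w \<in> tangent_space A p"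
  then have "g p (\<lambda>f. a * u f + b * v f) w = a * g p u w + b * g p v w"
    using g unfolding riemannian_metric_def by blast
  then show "conformal_metric \<sigma> g p (\<lambda>f. a * u f + b * v f) w = a * conformal_metric \<sigma> g p u w + b * conformal_metric \<sigma> g p v w"
    by (simp add: conformal_metric_def algebra_simps)
next
  fix p u v assume "u \<in> tangent_space A p" "v \<in> tangent_space A p"
  then have "g p u v = g p v u" using g unfolding riemannian_metric_def by blast
  then show "conformal_metric \<sigma> g p u v = conformal_metric \<sigma> g p v u" by (simp add: conformal_metric_def)
next
  fix p u assume "u \<in> tangent_space A p" "u \<noteq> (\<lambda>f. 0)"
  then have "g p u u > 0" using g unfolding riemannian_metric_def by blast
  then show "conformal_metric \<sigma> g p u u > 0" by (simp add: conformal_metric_def)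
next
  fix U V assume "U \<in> vector_fields A" "V \<in> vector_fields A"
  then have "smooth_fun A (\<lambda>p. g p (U p) (V p))" using g unfolding riemannian_metric_def by blast
  then show "smooth_fun A (\<lambda>p. conformal_metric \<sigma> g p (U p) (V p))"
    unfolding conformal_metric_def by (intro smooth_fun_mult smooth_fun_exp \<sigma>)
qed

text \<open>This is where divisibility of the cubic form enters.\<close>

lemma conformal_levi_civita:
  assumes g: "riemannian_metric A g" and \<sigma>: "smooth_fun A \<sigma>" and tf: "torsion_free A N"
    and C: "\<And>X Y Z. X \<in> vector_fields A \<Longrightarrow> Y \<in> vector_fields A \<Longrightarrow> Z \<in> vector_fields A \<Longrightarrow>
      cubic_form g N X Y Z = sym_dtensor \<sigma> g X Y Z"
  shows "levi_civita A (conformal_metric \<sigma> g) (projective_connection \<sigma> N)"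
  unfolding levi_civita_def
proof (intro conjI ballI allI projective_affine[OF \<sigma>])
  have "(\<lambda>p f. projective_connection \<sigma> N U V p f - projective_connection \<sigma> N V U p f) = (\<lambda>p f. N U V p f - N V U p f)" for U V
    by (simp add: projective_connection_def)
  then show "torsion_free A (projective_connection \<sigma> N)"
    using tf unfolding torsion_free_def by simp
next
  fix U V W p assume U: "U \<in> vector_fields A" and V: "V \<in> vector_fields A" and W: "W \<in> vector_fields A"
  have lin: "g p (\<lambda>f. a * u f + b * v f) w = a * g p u w + b * g p v w"
    if "u \<in> tangent_space A p" "v \<in> tangent_space A p" "w \<in> tangent_space A p" for u v w a b
    using g that unfolding riemannian_metric_def by blast
  have sym: "g p u v = g p v u" if "u \<in> tangent_space A p" "v \<in> tangent_space A p" for u v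
    using g that unfolding riemannian_metric_def by blast
  have gVW: "smooth_fun A (\<lambda>q. g q (V q) (W q))" using g V W unfolding riemannian_metric_def by blast
  note Up = vf_tangent[OF U, of p] and Vp = vf_tangent[OF V, of p] and Wp = vf_tangent[OF W, of p]
  have pc: "g p (projective_connection \<sigma> N U V p) w = g p (N U V p) w + U p \<sigma> * g p (V p) w + V p \<sigma> * g p (U p) w"
    if V: "V \<in> vector_fields A" and w: "w \<in> tangent_space A p" for V w
  proof -
    note Vp = vf_tangent[OF V, of p] and Np = vf_tangent[OF N_vf[OF U V], of p]
    have "projective_connection \<sigma> N U V p = (\<lambda>f. 1 * N U V p f + 1 * (\<lambda>f. U p \<sigma> * V p f + V p \<sigma> * U p f) f)"
      by (rule ext) (simp add: projective_connection_def)
    then show ?thesis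
      using lin[OF Np tangent_space_lincomb[OF Vp Up] w, of 1 1] lin[OF Vp Up w] by simp
  qed
  have tN: "projective_connection \<sigma> N U W p \<in> tangent_space A p"
    by (rule vf_tangent) (use projective_affine[OF \<sigma>] U W in \<open>unfold affine_connection_def, blast\<close>)
  have "U p (\<lambda>q. exp (\<sigma> q) * g q (V q) (W q)) = exp (\<sigma> p) * (U p \<sigma> * g p (V p) (W p) + U p (\<lambda>q. g q (V q) (W q)))"
    using tangent_mult[OF Up smooth_fun_exp[OF \<sigma>] gVW] tangent_exp[OF Up \<sigma>] by (simp add: algebra_simps)
  moreover have "U p (\<lambda>q. g q (V q) (W q)) - g p (N U V p) (W p) - g p (V p) (N U W p)
      = U p \<sigma> * g p (V p) (W p) + V p \<sigma> * g p (W p) (U p) + W p \<sigma> * g p (U p) (V p)"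
    using fun_cong[OF C[OF U V W], of p] by (simp add: cubic_form_def sym_dtensor_def)
  \<comment> \<open>Differentiating \<open>exp (\<sigma> q)\<close> gives one term with
    \<open>U p \<sigma>\<close>, and the cubic form of \<open>g\<close> gives one for each of the
    three fields. The projective change in the two slots of the metric subtracts the term with
    \<open>U p \<sigma>\<close> twice and the other two once, so everything cancels.\<close>
  ultimately show "cubic_form (conformal_metric \<sigma> g) (projective_connection \<sigma> N) U V W p = 0"
    unfolding cubic_form_def conformal_metric_def pc[OF V Wp] sym[OF Vp tN] pc[OF W Vp]
      sym[OF vf_tangent[OF N_vf[OF U W], of p] Vp] sym[OF Wp Vp] sym[OF Up Wp] sym[OF Up Vp]
    by (simp add: algebra_simps)
qed

end

section \<open>Geodesic connectedness\<close>

context connected_riemannian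
begin

lemma geodesically_connected_if_proper:
  assumes proper: "\<And>p r. compact {y. riem_dist h p y \<le> r}" and M: "affine_manifold A M" and \<sigma>: "smooth_fun A \<sigma>"
    and rel: "\<And>p u f. u \<in> tangent_space A p \<Longrightarrow> smooth_fun A f \<Longrightarrow> hess N p u u f = hess M p u u f - 2 * u \<sigma> * u f"
  shows "geodesically_connected A M"
  unfolding geodesically_connected_def
proof (intro allI)
  interpret M: affine_manifold A M by (rule M)
  fix p q :: 'm
  have int01: "is_interval {0..1::real}" "interior {0..1::real} \<noteq> {}" by auto
  show "\<exists>\<gamma>. geodesic_on A M {0..1} \<gamma> \<and> \<gamma> 0 = p \<and> \<gamma> 1 = q"
  proof (cases "p = q")
    case True
    \<comment> \<open>A segment of length zero cannot be stretched to the parameter interval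
      \<open>{0..1}\<close>; the constant curve takes its place.\<close>
    let ?\<gamma> = "\<lambda>t :: real. p"
    have vel: "velocity A ?\<gamma> t = (\<lambda>f. 0)" for t by (auto simp: velocity_def)
    have "smooth_curve_on A UNIV ?\<gamma>"
      unfolding smooth_curve_on_def by (auto simp: o_def smooth_on_const split_beta)
    moreover have "geodesic_at M ?\<gamma> t" for t
      using M.hess_scale[OF tangent_zero, of _ p 0] unfolding geodesic_at_def vel by simp
    ultimately have "gcurve M UNIV ?\<gamma>" by (simp add: gcurve_def)
    then have "geodesic_on A M {0..1} ?\<gamma>" by (intro M.geodesic_onI[OF int01]) auto
    then show ?thesis using True by blast
  next
    case False
    define D where "D = riem_dist h p q"
    have D: "D > 0" using False riem_dist_eq_0[of p q] riem_dist_nonneg[of p q] by (simp add: D_def)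
    obtain c where c: "c 0 = p" "c D = q" "segment c D" using ex_segment[OF proper] unfolding D_def by blast
    obtain \<epsilon> \<eta> where \<epsilon>: "\<epsilon> > 0" "gcurve N {0-\<epsilon><..<D+\<epsilon>} \<eta>" "\<forall>t\<in>{0..D}. \<eta> t = c t"
      using segment_gcurve[of 0 D c] c(3) D unfolding segment_def by blast
    \<comment> \<open>The geodesic is kept on an open interval around \<open>{0..D}\<close>, so that
      its image under \<open>T\<close> is a neighbourhood of \<open>{0..1}\<close>. The base point
      \<open>- \<epsilon> / 2\<close> of the integral lies strictly inside the domain of
      \<open>\<eta>\<close>.\<close>
    define J where "J = {- \<epsilon> / 2<..<D + \<epsilon>}"
    have \<eta>: "gcurve N J \<eta>" unfolding J_def by (rule gcurve_subset[OF \<epsilon>(2)]) (use \<epsilon>(1) in auto)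
    have JJ: "0 \<in> J" "D \<in> J" "is_interval J" "{0..D} \<subseteq> J" using \<epsilon>(1) D by (auto simp: J_def is_interval_1)
    let ?f = "\<lambda>s. exp (- 2 * \<sigma> (\<eta> s))"
    have "smooth_on {0-\<epsilon><..<D+\<epsilon>} (\<lambda>s. \<sigma> (\<eta> s))"
      using smooth_fun_curve[OF _ \<sigma>] \<epsilon>(2) by (simp add: gcurve_def)
    then have cf: "continuous_on {0-\<epsilon><..<D+\<epsilon>} ?f"
      by (intro continuous_intros smooth_on_imp_continuous_on)
    define G where "G s = integral {- \<epsilon> / 2..s} ?f" for s
    have G: "(G has_real_derivative ?f s) (at s)" if "s \<in> J" for s
      unfolding G_def by (rule integral_has_real_derivative_open[OF cf]) (use that \<epsilon>(1) in \<open>auto simp: J_def\<close>)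
    have "G 0 < G D"
    proof (rule DERIV_pos_imp_increasing[OF D])
      fix s assume "0 \<le> s" "s \<le> D"
      then have "s \<in> J" using JJ by auto
      then show "\<exists>y. (G has_real_derivative y) (at s) \<and> 0 < y" using G[of s] by (intro exI[of _ "?f s"]) auto
    qed
    \<comment> \<open>A constant factor in the parameter preserves geodesics; this one achieves
      \<open>T 0 = 0\<close> and \<open>T D = 1\<close>.\<close>
    define k where "k = 1 / (G D - G 0)"
    have k: "k > 0" using \<open>G 0 < G D\<close> by (simp add: k_def)
    define T where "T s = k * (G s - G 0)" for s
    have "(T has_real_derivative k * ?f s) (at s)" if "s \<in> J" for s
      unfolding T_def by (auto intro!: derivative_eq_intros G[OF that])
    then obtain \<beta> where \<beta>: "gcurve M (T ` J) \<beta>" "is_interval (T ` J)" "\<forall>s\<in>J. \<beta> (T s) = \<eta> s"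
      using gcurve_reparametrise[OF M \<sigma> rel \<eta> JJ(3) k] by blast
    have T01: "T 0 = 0" "T D = 1" using \<open>G 0 < G D\<close> by (auto simp: T_def k_def)
    then have "0 \<in> T ` J" "1 \<in> T ` J" using JJ by (metis imageI)+
    then have "{0..1} \<subseteq> T ` J" using \<beta>(2) unfolding is_interval_1 by fastforce
    then have "geodesic_on A M {0..1} \<beta>" using \<beta>(1) by (intro M.geodesic_onI[OF int01]) auto
    moreover have "\<beta> 0 = p" "\<beta> 1 = q" using \<beta>(3) JJ T01 \<epsilon>(3) D c by (metis atLeastAtMost_iff order_refl less_imp_le)+
    ultimately show ?thesis by blast
  qed
qed

text \<open>A ray of finite length is a geodesic, and completeness continues it past its open end,
  which provides the limit. This is applied to \<open>g\<close> with its own Levi-Civita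
  connection.\<close>

lemma proper_if_complete:
  assumes "complete_connection A N"
  shows "compact {y. riem_dist h p y \<le> r}"
proof (rule proper_if_rays_converge)
  fix b c assume b: "b > 0" and ray: "\<forall>s\<in>{0..<b}. \<forall>t\<in>{0..<b}. riem_dist h (c s) (c t) = \<bar>s - t\<bar>"
  have "geodesic_on A N {0<..<b} c"
    by (rule geodesic_onI[OF _ _ subset_refl ray_gcurve]) (use b ray in \<open>auto simp: is_interval_1\<close>)
  then obtain \<eta> where \<eta>: "geodesic_on A N UNIV \<eta>" "\<forall>t\<in>{0<..<b}. \<eta> t = c t"
    using assms unfolding complete_connection_def by blast
  have "(\<eta> \<longlongrightarrow> \<eta> b) (at_left b)"
    using geodesic_on_continuous[OF \<eta>(1), of b] by (simp add: isCont_def filterlim_at_split)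
  moreover have "\<forall>\<^sub>F t in at_left b. t \<in> {0<..<b}" by (rule eventually_at_left_real[OF b])
  then have "\<forall>\<^sub>F t in at_left b. \<eta> t = c t" by eventually_elim (use \<eta>(2) in blast)
  ultimately have "(c \<longlongrightarrow> \<eta> b) (at_left b)" by (rule Lim_transform_eventually)
  then show "\<exists>z. (c \<longlongrightarrow> z) (at_left b)" by blast
qed

text \<open>The parameter of an \<open>M\<close>-geodesic has speed \<open>exp (- 2 * \<sigma>)\<close> with respect to arc length. This is
  bounded if \<open>\<sigma>\<close> is bounded below, so a ray of finite length has a finite \<open>M\<close>-parameter interval.\<close>

lemma proper_if_projectively_complete:
  assumes compl: "complete_connection A M" and M: "affine_manifold A M" and \<sigma>: "smooth_fun A \<sigma>"
    and rel: "\<And>p u f. u \<in> tangent_space A p \<Longrightarrow> smooth_fun A f \<Longrightarrow> hess N p u u f = hess M p u u f - 2 * u \<sigma> * u f"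
    and bdd: "\<And>p. \<sigma> p \<ge> \<sigma>0"
  shows "compact {y. riem_dist h p y \<le> r}"
proof (rule proper_if_rays_converge)
  interpret M: affine_manifold A M by (rule M)
  fix b c assume b: "b > 0" and ray: "\<forall>s\<in>{0..<b}. \<forall>t\<in>{0..<b}. riem_dist h (c s) (c t) = \<bar>s - t\<bar>"
  have c0: "gcurve N {0<..<b} c" by (rule ray_gcurve) (use ray in blast)
  \<comment> \<open>The integral that defines \<open>T\<close> has to start inside the interval on
    which the integrand is known to be continuous; the second half of the ray determines the
    limit.\<close>
  define m where "m = b / 2"
  have m: "0 < m" "m < b" using b by (auto simp: m_def)
  define J where "J = {m<..<b}"
  have c: "gcurve N J c" unfolding J_def by (rule gcurve_subset[OF c0]) (use m in auto)
  let ?f = "\<lambda>s. exp (- 2 * \<sigma> (c s))"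
  have "smooth_on {0<..<b} (\<lambda>s. \<sigma> (c s))" using smooth_fun_curve[OF _ \<sigma>] c0 by (simp add: gcurve_def)
  then have cf: "continuous_on {0<..<b} ?f" by (intro continuous_intros smooth_on_imp_continuous_on)
  define T where "T s = integral {m..s} ?f" for s
  have T: "(T has_real_derivative ?f s) (at s)" if "s \<in> J" for s
    unfolding T_def by (rule integral_has_real_derivative_open[OF cf]) (use that m in \<open>auto simp: J_def\<close>)
  have int: "?f integrable_on {m..s}" if "s < b" for s
    by (rule integrable_continuous_real, rule continuous_on_subset[OF cf]) (use m that in auto)
  define C where "C = exp (- 2 * \<sigma>0)"
  have fC: "?f s \<le> C" for s using bdd[of "c s"] by (simp add: C_def)
  have mono: "T s \<le> T t" if "m < s" "s \<le> t" "t < b" for s t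
    unfolding T_def by (rule integral_subset_le) (use that int in auto)
  have bound: "T s \<le> C * b" if "m < s" "s < b" for s
  proof -
    have "T s \<le> integral {m..s} (\<lambda>_. C)" unfolding T_def by (rule integral_le) (use int that fC in auto)
    also have "\<dots> = C * (s - m)" using that by simp
    also have "\<dots> \<le> C * b" using that m by (intro mult_left_mono) (auto simp: C_def)
    finally show ?thesis .
  qed
  obtain B where B: "(T \<longlongrightarrow> B) (at_left b)"
    using tendsto_at_left_mono_bounded[where T = T, OF m(2) mono bound] by blast
  have iJ: "is_interval J" by (simp add: J_def is_interval_1)
  obtain \<beta> where \<beta>: "gcurve M (T ` J) \<beta>" "open (T ` J)" "is_interval (T ` J)" "\<forall>s\<in>J. \<beta> (T s) = c s"
    using gcurve_reparametrise[OF M \<sigma> rel c iJ, of 1 T] T by auto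
  have "J \<noteq> {}" using m by (simp add: J_def)
  then have "interior (T ` J) \<noteq> {}" using \<beta>(2) by (simp add: interior_open)
  then have "geodesic_on A M (T ` J) \<beta>" by (intro M.geodesic_onI[OF \<beta>(3) _ subset_refl \<beta>(1)]) auto
  then obtain \<eta> where \<eta>: "geodesic_on A M UNIV \<eta>" "\<forall>t\<in>T ` J. \<eta> t = \<beta> t"
    using compl unfolding complete_connection_def by blast
  \<comment> \<open>At the finite limit \<open>B\<close> of the new parameter, the continued
    geodesic provides the end point of the ray.\<close>
  have "((\<lambda>s. \<eta> (T s)) \<longlongrightarrow> \<eta> B) (at_left b)"
    by (rule isCont_tendsto_compose[OF geodesic_on_continuous[OF \<eta>(1)] B])
  moreover have "\<forall>\<^sub>F t in at_left b. t \<in> {m<..<b}" by (rule eventually_at_left_real[OF m(2)])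
  then have "\<forall>\<^sub>F t in at_left b. \<eta> (T t) = c t" by eventually_elim (use \<eta>(2) \<beta>(4) in \<open>simp add: J_def\<close>)
  ultimately have "(c \<longlongrightarrow> \<eta> B) (at_left b)" by (rule Lim_transform_eventually)
  then show "\<exists>z. (c \<longlongrightarrow> z) (at_left b)" by blast
qed

end

theorem theorem4p4:
  fixes A :: "('m::{t2_space, second_countable_topology}, 'n::finite) chart set"
    and g :: "'m metric"
    and nabla :: "'m connection"
    and \<sigma> :: "'m \<Rightarrow> real"
  assumes "smooth_atlas A"
    and "connected (UNIV :: 'm set)"
    and "orientable A"
    and "CARD('n) \<ge> 2"
    and "statistical_manifold A g nabla"
    and "smooth_fun A \<sigma>"
    and "\<forall>X\<in>vector_fields A. \<forall>Y\<in>vector_fields A. \<forall>Z\<in>vector_fields A.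
           cubic_form g nabla X Y Z = sym_dtensor \<sigma> g X Y Z"
    and "bdd_below (range \<sigma>)"
  shows "(complete_connection A nabla \<longrightarrow> geodesically_connected A nabla) \<and>
         (\<forall>nabla_g. levi_civita A g nabla_g \<longrightarrow> complete_connection A nabla_g \<longrightarrow>
            geodesically_connected A nabla)"
proof -
  note \<sigma> = \<open>smooth_fun A \<sigma>\<close>
  have stat: "riemannian_metric A g" "affine_connection A nabla" "torsion_free A nabla"
    using assms(5) unfolding statistical_manifold_def by blast+
  interpret affine_manifold A nabla using assms(1) stat(2) by unfold_locales
  let ?h = "conformal_metric \<sigma> g" and ?N = "projective_connection \<sigma> nabla"
  have lc: "levi_civita A ?h ?N"
    by (rule conformal_levi_civita[OF stat(1) \<sigma> stat(3)]) (use assms(7) in blast)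
  interpret h: connected_riemannian A ?N ?h
    using projective_affine[OF \<sigma>] conformal_riemannian[OF stat(1) \<sigma>] lc assms(2) by unfold_locales
  obtain \<sigma>0 where \<sigma>0: "\<And>p. \<sigma>0 \<le> \<sigma> p" using assms(8) unfolding bdd_below_def by blast
  have conn: "geodesically_connected A nabla" if "\<And>p r. compact {y. riem_dist ?h p y \<le> r}"
    by (rule h.geodesically_connected_if_proper[OF that affine_manifold_axioms \<sigma>]) (rule projective_hess)
  have "geodesically_connected A nabla" if "complete_connection A nabla"
    by (rule conn, rule h.proper_if_projectively_complete[OF that affine_manifold_axioms \<sigma> _ \<sigma>0]) (rule projective_hess)
  moreover have "geodesically_connected A nabla" if lcg: "levi_civita A g nabla_g" and compl: "complete_connection A nabla_g" for nabla_g
  proof (rule conn)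
    fix p r
    have "affine_connection A nabla_g" using lcg unfolding levi_civita_def by blast
    then interpret g: connected_riemannian A nabla_g g
      using stat(1) lcg assms(2) by unfold_locales
    \<comment> \<open>As the conformal metric is at least \<open>exp \<sigma>0\<close> times
      \<open>g\<close>, speeds for \<open>g\<close> are at most \<open>exp (- \<sigma>0 / 2)\<close>
      times those for the conformal metric.\<close>
    define \<kappa> where "\<kappa> = exp (- \<sigma>0 / 2)"
    have \<kappa>: "\<kappa> > 0" "\<kappa>\<^sup>2 = exp (- \<sigma>0)" by (simp_all add: \<kappa>_def power2_eq_square flip: exp_add)
    have cmp: "speed2 g c q v \<le> \<kappa>\<^sup>2 * speed2 ?h c q v" if "c \<in> A" "q \<in> fst c" for c q v
    proof -
      have "speed2 g c q v \<ge> 0"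
        using g.speed2_scale[OF that, of 0 v] g.h_pos[OF tvec_in[OF that, of v] tvec_in[OF that, of v]]
          g.h_lincomb[where a=0 and b=0 and p=q, OF tangent_zero tangent_zero tangent_zero]
        by (cases "tvec c q v = (\<lambda>f. 0)") (auto simp: speed2_def)
      moreover have "1 \<le> exp (\<sigma> q - \<sigma>0)" using \<sigma>0[of q] by simp
      ultimately have "1 * speed2 g c q v \<le> exp (\<sigma> q - \<sigma>0) * speed2 g c q v" by (intro mult_right_mono)
      then show ?thesis by (simp add: \<kappa>(2) speed2_def conformal_metric_def exp_diff exp_minus field_simps)
    qed
    have le: "riem_dist g p y \<le> \<kappa> * riem_dist ?h p y" for y
    proof -
      have "riem_dist g p y / \<kappa> \<le> riem_dist ?h p y"
      proof (rule h.riem_dist_greatest)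
        fix \<tau> assume "reach ?h p y \<tau>"
        then have "riem_dist g p y \<le> \<kappa> * \<tau>" using g.riem_dist_le[OF g.reach_compare[OF _ cmp \<kappa>(1)]] by blast
        then show "riem_dist g p y / \<kappa> \<le> \<tau>" using \<kappa>(1) by (simp add: pos_divide_le_eq mult.commute)
      qed
      then show ?thesis using \<kappa>(1) by (simp add: pos_divide_le_eq mult.commute)
    qed
    have "{y. riem_dist ?h p y \<le> r} \<subseteq> {y. riem_dist g p y \<le> \<kappa> * r}"
    proof
      fix y assume "y \<in> {y. riem_dist ?h p y \<le> r}"
      then have "\<kappa> * riem_dist ?h p y \<le> \<kappa> * r" using \<kappa>(1) by simp
      then show "y \<in> {y. riem_dist g p y \<le> \<kappa> * r}" using le[of y] by simp
    qed
    \<comment> \<open>A closed ball of the conformal metric is a closed subset of a ball of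
      \<open>g\<close>, which is compact by completeness.\<close>
    then have "{y. riem_dist ?h p y \<le> r} = {y. riem_dist g p y \<le> \<kappa> * r} \<inter> {y. riem_dist ?h p y \<le> r}" by blast
    then show "compact {y. riem_dist ?h p y \<le> r}"
      using compact_Int_closed[OF g.proper_if_complete[OF compl] h.closed_d_ball] by metis
  qed
  ultimately show ?thesis by blast
qed

end
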